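(* Let $n\geq3$ be an odd integer, $p=\frac{n-3}2$, and let $Y_n$ be the one-vertex H-triangulation of $(S^3,K_n)$ described in the context, with distinguished edge $\overrightarrow{K_n}$. Then for every $\hbar>0$ (of the form $\hbar=(\mathsf b+\mathsf b^{-1})^{-2}$, $\mathsf b>0$) and for every $\tau\in\mathcal S_{Y_n\setminus Z}\times\overline{\mathcal S_Z}$ such that $\omega_{Y_n,\tau}$ vanishes on $\overrightarrow{K_n}$ and is equal to $2\pi$ on every other edge of $Y_n$, the limit $$\lim_{\alpha\to\tau,\ \alpha\in\mathcal S_{Y_n}}\Phi_{\mathsf b}\left(\frac{\pi-\omega_{Y_n,\alpha}(\overrightarrow{K_n})}{2\pi i\sqrt\hbar}\right)\mathcal Z_\hbar(Y_n,\alpha)$$ exists and its modulus is equal to $|J_{X_n}(\hbar,0)|$.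
   Context: Triangulations: a tetrahedron $T$ has totally ordered vertices $0,1,2,3$ and a sign $\varepsilon(T)=\pm1$ (recording whether the vertex order agrees with the orientation); $x_k(T)$ is its face opposite to vertex $k$. A triangulation $X$ consists of finitely many tetrahedra whose faces are all glued in pairs by the unique affine isomorphisms preserving vertex order; faces with the same name are glued. $X^k$ is the set of $k$-cells after gluing. $K_n$ is the twist knot with $n$ half-twists. For $n\geq3$ odd, $p=\frac{n-3}2$, $f_0:=e_1$; write $T:(x_0,x_1,x_2,x_3)$. - $Y_n$ has tetrahedra $T_1,\dots,T_p,U,V,W,Z$ and faces $e_1,\dots,e_{p+1},f_1,\dots,f_p,v,r,s,s',g,u,m$: $T_k:(e_k,e_{k+1},f_k,f_{k-1})$ ($1\le k\le p$) and $Z:(m,m,s,s')$ of sign $+1$; $U:(r,v,s,g)$, $V:(g,s',f_p,u)$, $W:(u,r,v,e_{p+1})$ of sign $-1$. The edge $\overrightarrow{K_n}\in Y_n^1$ is the class of the edge $23$ of $Z$ and represents $K_n$ in $S^3$. - $X_n$ (an ideal triangulation of $S^3\setminus K_n$) has tetrahedra $T_1,\dots,T_p,U,V,W$: $T_k:(e_k,e_{k+1},f_k,f_{k-1})$ of sign $+1$; $U:(r,v,s,g)$, $V:(g,s,f_p,u)$, $W:(u,r,v,e_{p+1})$ of sign $-1$. Angles: the set $\mathcal S_X$ of shape structures is the set of $\alpha=(a_T,b_T,c_T)_{T\in X^3}$ with $a_T,b_T,c_T\in(0,\pi)$, $a_T+b_T+c_T=\pi$ ($a_T$ at edges $01,23$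 of $T$, $b_T$ at $02,13$, $c_T$ at $03,12$). For $e\in X^1$, $\omega_{X,\alpha}(e)$ is the sum of the angles at all tetrahedral edges identified to $e$; $\mathcal A_X=\{\alpha\in\mathcal S_X:\omega_{X,\alpha}(e)=2\pi\ \forall e\in X^1\}$. $\mathcal S_{Y_n\setminus Z}$ denotes shape structures on all tetrahedra of $Y_n$ except $Z$; $\overline{\mathcal S_Z}$ the triples $(a_Z,b_Z,c_Z)\in[0,\pi]^3$ with sum $\pi$. Indices $k,U,V,W,Z$ refer to $T_k,U,V,W,Z$. Quantum dilogarithm: $\mathsf b>0$, $\hbar=(\mathsf b+\mathsf b^{-1})^{-2}$, $$\Phi_{\mathsf b}(z)=\exp\Big(\tfrac14\int_{\mathbb R+i0^+}\frac{e^{-2izw}\,dw}{\sinh(\mathsf bw)\sinh(\mathsf b^{-1}w)w}\Big)\quad\text{for }|\mathrm{Im}\,z|<\tfrac1{2\sqrt\hbar}$$ (contour: real line avoiding $0$ from above), extended meromorphically to $\mathbb C$. Partition function (for a shape structure $\alpha$): attach real variables $t_T$ to tetrahedra and variables to faces. The kinematical kernel is the tempered distribution on $\mathbb R^{X^3}$ $$\mathcal K_X(\mathbf t)=\int_{\mathbb R^{X^2}}d\mathbf x\prod_{T\in X^3}e^{2i\pi\varepsilon(T)x_0(T)t_T}\,\delta\big(x_0(T)-x_1(T)+x_2(T)\big)\,\delta\big(x_2(T)-x_3(T)+t_T\big),$$ where $x_i(T)$ denotes the component of $\mathbf x\in\mathbb R^{X^2}$ indexed by that face, and the expression is understood as the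 tempered distribution obtained by writing each delta as $\delta(x)=\int_{\mathbb R}e^{-2\pi ixw}dw$ and using Fourier inversion. The dynamical content is the Schwartz function of $\mathbf t$ $$\mathcal D_{\hbar,X}(\mathbf t,\alpha)=\prod_{T\in X^3}\frac{\exp(\hbar^{-1/2}c_Tt_T)}{\Phi_{\mathsf b}\big(t_T-\frac{i}{2\pi\sqrt\hbar}\varepsilon(T)(\pi-a_T)\big)^{\varepsilon(T)}},$$ and $\mathcal Z_\hbar(X,\alpha)=\int_{\mathbb R^{X^3}}\mathcal K_X(\mathbf t)\mathcal D_{\hbar,X}(\mathbf t,\alpha)d\mathbf t$ (pairing of a distribution with a Schwartz function). The value $J_{X_n}(\hbar,0)$: $$J_{X_n}(\hbar,0)=\int_{\mathcal Y'_{\hbar,\beta}}d\mathbf y'\,e^{2i\pi\mathbf y'^\top Q_n\mathbf y'+\frac1{\sqrt\hbar}\mathbf y'^\top\mathcal W_n}\frac{\Phi_{\mathsf b}(y'_U)^2\Phi_{\mathsf b}(y'_W)}{\Phi_{\mathsf b}(y'_1)\cdots\Phi_{\mathsf b}(y'_p)},$$ $\mathbf y'=(y'_1,\dots,y'_p,y'_U,y'_W)^\top$; $Q_n$ is symmetric with $(Q_n)_{jk}=\min(j,k)$, $(Q_n)_{jU}=-j$ ($1\le j,k\le p$), $(Q_n)_{UU}=p$, $(Q_n)_{UW}=\frac12$, other entries $0$; $\mathcal W_n$ has entries $-2\pi(kp-\frac{k(k-1)}2)$ ($1\le k\le p$), $(p^2+p+1)\pi$ (index $U$), $\pi$ (index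 $W$); and $$\mathcal Y'_{\hbar,\beta}=\prod_{k=1}^p\Big(\mathbb R-\tfrac{i(\pi-a_k)}{2\pi\sqrt\hbar}\Big)\times\prod_{l=U,W}\Big(\mathbb R+\tfrac{i(\pi-a_l)}{2\pi\sqrt\hbar}\Big),$$ where the $a$'s are those of any angle structure $\beta\in\mathcal A_{X_n}$ with $a_U=a_V$; the value does not depend on the choice, by contour deformation. *)

theory Defs
  imports "HOL-Complex_Analysis.Complex_Analysis"
begin

section \<open>Triangulations and angles\<close>

text \<open>
  A tetrahedron has the ordered vertices \<open>0 < 1 < 2 < 3\<close>, and \<open>face X T k\<close> (for \<open>k \<le> 3\<close>) is the
  name of its face opposite to the vertex \<open>k\<close>. Faces with the same name are glued by the
  order-preserving affine isomorphism.
\<close>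

record ('t, 'f) triangulation =
  tets :: "'t set"
  face :: "'t \<Rightarrow> nat \<Rightarrow> 'f"
  sign :: "'t \<Rightarrow> int"

definition faces :: "('t, 'f) triangulation \<Rightarrow> 'f set" where
  "faces X = (\<Union>T\<in>tets X. face X T ` {..3})"

text \<open>\<open>(T, i, j)\<close> with \<open>i < j\<close> is the edge of \<open>T\<close> from the vertex \<open>i\<close> to the vertex \<open>j\<close>.\<close>

definition tet_edges :: "('t, 'f) triangulation \<Rightarrow> ('t \<times> nat \<times> nat) set" where
  "tet_edges X = {(T, i, j). T \<in> tets X \<and> i < j \<and> j \<le> 3}"

text \<open>The increasing enumeration, by \<open>0, 1, 2\<close>, of the vertices of the face opposite to \<open>k\<close>.\<close>

definition face_vertex :: "nat \<Rightarrow> nat \<Rightarrow> nat" where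
  "face_vertex k i = (if i < k then i else Suc i)"

definition edge_gluing :: "('t, 'f) triangulation \<Rightarrow> ('t \<times> nat \<times> nat) rel" where
  "edge_gluing X =
     {((T, face_vertex k i, face_vertex k j), (T', face_vertex l i, face_vertex l j)) | T T' k l i j.
        T \<in> tets X \<and> T' \<in> tets X \<and> k \<le> 3 \<and> l \<le> 3 \<and> face X T k = face X T' l \<and> i < j \<and> j \<le> 2}"

text \<open>\<^const>\<open>edge_gluing\<close> is symmetric, so its reflexive transitive closure is an equivalence.\<close>

definition edge_class :: "('t, 'f) triangulation \<Rightarrow> 't \<times> nat \<times> nat \<Rightarrow> ('t \<times> nat \<times> nat) set" where
  "edge_class X x = (edge_gluing X)\<^sup>* `` {x}"

definition edges :: "('t, 'f) triangulation \<Rightarrow> ('t \<times> nat \<times> nat) set set" where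
  "edges X = edge_class X ` tet_edges X"

type_synonym 't angles = "'t \<Rightarrow> real \<times> real \<times> real"

definition ang_a :: "'t angles \<Rightarrow> 't \<Rightarrow> real" where "ang_a \<alpha> T = fst (\<alpha> T)"
definition ang_b :: "'t angles \<Rightarrow> 't \<Rightarrow> real" where "ang_b \<alpha> T = fst (snd (\<alpha> T))"
definition ang_c :: "'t angles \<Rightarrow> 't \<Rightarrow> real" where "ang_c \<alpha> T = snd (snd (\<alpha> T))"

definition open_triples :: "(real \<times> real \<times> real) set" where
  "open_triples = {(a, b, c). a \<in> {0<..<pi} \<and> b \<in> {0<..<pi} \<and> c \<in> {0<..<pi} \<and> a + b + c = pi}"

definition closed_triples :: "(real \<times> real \<times> real) set" where
  "closed_triples = {(a, b, c). a \<in> {0..pi} \<and> b \<in> {0..pi} \<and> c \<in> {0..pi} \<and> a + b + c = pi}"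

text \<open>
  Angle assignments are extensional functions on the set of tetrahedra, so that the product topology
  on the function type induces the Euclidean topology on them.
\<close>

definition shape_structures :: "('t, 'f) triangulation \<Rightarrow> 't angles set" where
  "shape_structures X = (\<Pi>\<^sub>E T\<in>tets X. open_triples)"

definition dihedral :: "'t angles \<Rightarrow> 't \<times> nat \<times> nat \<Rightarrow> real" where
  "dihedral \<alpha> = (\<lambda>(T, i, j).
     if (i, j) \<in> {(0, 1), (2, 3)} then ang_a \<alpha> T
     else if (i, j) \<in> {(0, 2), (1, 3)} then ang_b \<alpha> T
     else ang_c \<alpha> T)"

definition weight :: "'t angles \<Rightarrow> ('t \<times> nat \<times> nat) set \<Rightarrow> real" where
  "weight \<alpha> e = (\<Sum>x\<in>e. dihedral \<alpha> x)"

definition angle_structures :: "('t, 'f) triangulation \<Rightarrow> 't angles set" where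
  "angle_structures X = {\<alpha> \<in> shape_structures X. \<forall>e\<in>edges X. weight \<alpha> e = 2 * pi}"


section \<open>Quantum dilogarithm\<close>

definition hbar :: "real \<Rightarrow> real" where
  "hbar b = 1 / (b + 1 / b)\<^sup>2"

text \<open>
  The contour \<open>\<real> + i0\<^sup>+\<close> is the limit of the lines \<open>\<real> + i\<eta>\<close> as \<open>\<eta>\<close> decreases to \<open>0\<close>; the integral does
  not depend on \<open>\<eta>\<close> as long as the line stays below the poles other than \<open>0\<close>.
\<close>

definition qdilog_strip :: "real \<Rightarrow> complex \<Rightarrow> complex" where
  "qdilog_strip b z = exp (1 / 4 * Lim (at_right 0) (\<lambda>\<eta>. \<integral>x.
     (let w = Complex x \<eta>
      in exp (- 2 * \<i> * z * w) / (sinh (of_real b * w) * sinh (of_real (1 / b) * w) * w)) \<partial>lborel))"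

definition qdilog :: "real \<Rightarrow> complex \<Rightarrow> complex" where
  "qdilog b z =
     (if \<bar>Im z\<bar> < 1 / (2 * sqrt (hbar b)) then qdilog_strip b z
      else (THE g. g nicely_meromorphic_on UNIV \<and>
              (\<forall>w. \<bar>Im w\<bar> < 1 / (2 * sqrt (hbar b)) \<longrightarrow> g w = qdilog_strip b w)) z)"


section \<open>Partition function\<close>

definition schwartz :: "(real \<Rightarrow> complex) \<Rightarrow> bool" where
  "schwartz \<psi> \<longleftrightarrow> (\<exists>D :: nat \<Rightarrow> real \<Rightarrow> complex. D 0 = \<psi> \<and>
     (\<forall>m x. (D m has_vector_derivative D (Suc m) x) (at x)) \<and>
     (\<forall>k m. bounded (range (\<lambda>x. x ^ k *\<^sub>R D m x))))"

text \<open>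
  \<open>\<delta>(x) = \<integral> e\<^bsup>- 2\<pi>ixw\<^esup> dw\<close> with the cut-off \<open>\<psi>(\<epsilon>w)\<close> inserted.
\<close>

definition delta_cutoff :: "(real \<Rightarrow> complex) \<Rightarrow> real \<Rightarrow> real \<Rightarrow> complex" where
  "delta_cutoff \<psi> \<epsilon> x = (\<integral>w. exp (- 2 * of_real pi * \<i> * of_real (x * w)) * \<psi> (\<epsilon> * w) \<partial>lborel)"

text \<open>
  The kinematical kernel as a functional on Schwartz functions \<open>\<phi>\<close> of \<open>\<^bold>t\<close>. Once every delta is
  written as an integral over a dual variable \<open>w\<close>, its value on \<open>\<phi>\<close> is an oscillatory integral over
  \<open>\<^bold>t\<close>, the face variables \<open>\<^bold>x\<close> and the dual variables. This is understood in the standard way: insert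
  a cut-off \<open>\<psi>(\<epsilon>\<cdot>)\<close> in every variable \<open>x\<close> and \<open>w\<close>, where \<open>\<psi>\<close> is a Schwartz function with \<open>\<psi>(0) = 1\<close>, and
  let \<open>\<epsilon>\<close> decrease to \<open>0\<close>; the limit must be the same for all \<open>\<psi>\<close>. The cut-off in \<open>\<^bold>x\<close> matters: a face
  variable may drop out of all deltas (as \<open>m\<close> does for the tetrahedron \<open>Z\<close> below), and then its
  integral produces a further delta in \<open>\<^bold>t\<close>.
\<close>

definition kernel_cutoff ::
    "('t, 'f) triangulation \<Rightarrow> (real \<Rightarrow> complex) \<Rightarrow> real \<Rightarrow> ('t \<Rightarrow> real) \<Rightarrow> complex" where
  "kernel_cutoff X \<psi> \<epsilon> t =
     (\<integral>x. (\<Prod>f\<in>faces X. \<psi> (\<epsilon> * x f)) *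
        (\<Prod>T\<in>tets X.
           exp (2 * of_real pi * \<i> * of_int (sign X T) * of_real (x (face X T 0) * t T)) *
           delta_cutoff \<psi> \<epsilon> (x (face X T 0) - x (face X T 1) + x (face X T 2)) *
           delta_cutoff \<psi> \<epsilon> (x (face X T 2) - x (face X T 3) + t T))
      \<partial>(\<Pi>\<^sub>M f\<in>faces X. lborel))"

definition kinematical_kernel ::
    "('t, 'f) triangulation \<Rightarrow> (('t \<Rightarrow> real) \<Rightarrow> complex) \<Rightarrow> complex" where
  "kinematical_kernel X \<phi> = (THE I. \<forall>\<psi>. schwartz \<psi> \<and> \<psi> 0 = 1 \<longrightarrow>
     ((\<lambda>\<epsilon>. \<integral>t. kernel_cutoff X \<psi> \<epsilon> t * \<phi> t \<partial>(\<Pi>\<^sub>M T\<in>tets X. lborel)) \<longlongrightarrow> I) (at_right 0))"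

definition dynamical_content ::
    "real \<Rightarrow> ('t, 'f) triangulation \<Rightarrow> 't angles \<Rightarrow> ('t \<Rightarrow> real) \<Rightarrow> complex" where
  "dynamical_content b X \<alpha> t =
     (\<Prod>T\<in>tets X. of_real (exp (ang_c \<alpha> T * t T / sqrt (hbar b))) /
        qdilog b (of_real (t T) -
          \<i> / of_real (2 * pi * sqrt (hbar b)) * of_int (sign X T) * of_real (pi - ang_a \<alpha> T))
        powi sign X T)"

definition partition_function :: "real \<Rightarrow> ('t, 'f) triangulation \<Rightarrow> 't angles \<Rightarrow> complex" where
  "partition_function b X \<alpha> = kinematical_kernel X (dynamical_content b X \<alpha>)"


section \<open>Triangulations for the twist knots\<close>

datatype tet = TT nat | TU | TV | TW | TZ

datatype fc = FE nat | FF nat | Fv | Fr | Fs | Fs' | Fg | Fu | Fm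

text \<open>The face \<open>f\<^sub>k\<close>, with the convention that \<open>f\<^sub>0\<close> is \<open>e\<^sub>1\<close>.\<close>

definition face_f :: "nat \<Rightarrow> fc" where
  "face_f k = (if k = 0 then FE 1 else FF k)"

definition twist_p :: "nat \<Rightarrow> nat" where
  "twist_p n = (n - 3) div 2"

fun twist_sign :: "tet \<Rightarrow> int" where
  "twist_sign (TT k) = 1"
| "twist_sign TU = -1"
| "twist_sign TV = -1"
| "twist_sign TW = -1"
| "twist_sign TZ = 1"

fun Y_faces :: "nat \<Rightarrow> tet \<Rightarrow> fc list" where
  "Y_faces p (TT k) = [FE k, FE (k + 1), face_f k, face_f (k - 1)]"
| "Y_faces p TU = [Fr, Fv, Fs, Fg]"
| "Y_faces p TV = [Fg, Fs', face_f p, Fu]"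
| "Y_faces p TW = [Fu, Fr, Fv, FE (p + 1)]"
| "Y_faces p TZ = [Fm, Fm, Fs, Fs']"

definition twist_Y :: "nat \<Rightarrow> (tet, fc) triangulation" where
  "twist_Y n =
     \<lparr> tets = TT ` {1..twist_p n} \<union> {TU, TV, TW, TZ},
       face = (\<lambda>T k. Y_faces (twist_p n) T ! k),
       sign = twist_sign \<rparr>"

definition twist_knot_edge :: "nat \<Rightarrow> (tet \<times> nat \<times> nat) set" where
  "twist_knot_edge n = edge_class (twist_Y n) (TZ, 2, 3)"

text \<open>The faces \<open>s\<close> and \<open>s'\<close> of \<^const>\<open>twist_Y\<close> are a single face \<open>s\<close> here.\<close>

definition twist_X :: "nat \<Rightarrow> (tet, fc) triangulation" where
  "twist_X n =
     \<lparr> tets = TT ` {1..twist_p n} \<union> {TU, TV, TW},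
       face = (\<lambda>T k. ((Y_faces (twist_p n))(TV := [Fg, Fs, face_f (twist_p n), Fu])) T ! k),
       sign = twist_sign \<rparr>"

text \<open>Shape structures on all tetrahedra except \<open>Z\<close>, times the closed triples on \<open>Z\<close>.\<close>

definition Z_closed_shapes :: "nat \<Rightarrow> tet angles set" where
  "Z_closed_shapes n =
     (\<Pi>\<^sub>E T\<in>tets (twist_Y n). if T = TZ then closed_triples else open_triples)"


section \<open>The value \<open>J(\<hbar>, 0)\<close>\<close>

definition J_index :: "nat \<Rightarrow> tet set" where
  "J_index p = TT ` {1..p} \<union> {TU, TW}"

fun J_Q :: "nat \<Rightarrow> tet \<Rightarrow> tet \<Rightarrow> real" where
  "J_Q p (TT j) (TT k) = real (min j k)"
| "J_Q p (TT j) TU = - real j"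
| "J_Q p TU (TT j) = - real j"
| "J_Q p TU TU = real p"
| "J_Q p TU TW = 1 / 2"
| "J_Q p TW TU = 1 / 2"
| "J_Q p _ _ = 0"

fun J_W :: "nat \<Rightarrow> tet \<Rightarrow> real" where
  "J_W p (TT k) = - 2 * pi * (real k * real p - real k * (real k - 1) / 2)"
| "J_W p TU = (real p ^ 2 + real p + 1) * pi"
| "J_W p TW = pi"
| "J_W p _ = 0"

definition J_integrand :: "real \<Rightarrow> nat \<Rightarrow> (tet \<Rightarrow> complex) \<Rightarrow> complex" where
  "J_integrand b p y =
     exp (2 * \<i> * of_real pi * (\<Sum>j\<in>J_index p. \<Sum>k\<in>J_index p. y j * of_real (J_Q p j k) * y k)
          + of_real (1 / sqrt (hbar b)) * (\<Sum>k\<in>J_index p. y k * of_real (J_W p k))) *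
     (qdilog b (y TU) ^ 2 * qdilog b (y TW) / (\<Prod>k=1..p. qdilog b (y (TT k))))"

text \<open>
  The contour is a product of horizontal lines, parametrised by real parts: its lines are
  \<open>\<real> - i(\<pi> - a\<^sub>T)/(2\<pi>\<surd>\<hbar>)\<close> for the tetrahedra \<open>T\<^sub>k\<close> and \<open>\<real> + i(\<pi> - a\<^sub>T)/(2\<pi>\<surd>\<hbar>)\<close> for \<open>U\<close> and \<open>W\<close>.
\<close>

definition J_contour_point :: "real \<Rightarrow> tet angles \<Rightarrow> (tet \<Rightarrow> real) \<Rightarrow> tet \<Rightarrow> complex" where
  "J_contour_point b \<beta> x T =
     (let d = (pi - ang_a \<beta> T) / (2 * pi * sqrt (hbar b))
      in Complex (x T) (if T \<in> {TU, TW} then d else - d))"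

definition J_contour_integral :: "real \<Rightarrow> nat \<Rightarrow> tet angles \<Rightarrow> complex" where
  "J_contour_integral b n \<beta> =
     (\<integral>x. J_integrand b (twist_p n) (J_contour_point b \<beta> x) \<partial>(\<Pi>\<^sub>M T\<in>J_index (twist_p n). lborel))"

text \<open>The common value of the contour integrals for all admissible \<open>\<beta>\<close>.\<close>

definition J_value :: "real \<Rightarrow> nat \<Rightarrow> complex" where
  "J_value b n = (THE J. \<forall>\<beta>\<in>angle_structures (twist_X n).
     ang_a \<beta> TU = ang_a \<beta> TV \<longrightarrow> J = J_contour_integral b n \<beta>)"

end

theory Submission
  imports Defs "HOL-Probability.Probability" "HOL-Real_Asymp.Real_Asymp"
begin

text \<open>
  Write \<open>Q = b + 1/b = \<hbar>\<^sup>-\<^sup>1\<^sup>/\<^sup>2\<close>. The partition function of \<open>Y\<^sub>n\<close>, multiplied by the prefactor, turns out to be an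
  absolutely convergent integral that no longer involves the tetrahedron \<open>Z\<close>. It depends continuously on
  the other angles, and at \<open>\<tau>\<close> its integrand agrees with that of \<open>J\<close> on the contour up to a constant of
  modulus \<open>1\<close>.

  In \<open>Z : (m, m, s, s')\<close> the variable \<open>m\<close> cancels from the first delta and occurs otherwise
  only in the phase \<open>exp (2 \<pi> i m t\<^sub>Z)\<close>, so its integral is one more delta, \<open>\<delta>(t\<^sub>Z)\<close>. Now there are as many
  deltas as there are faces other than \<open>m\<close>, plus two, and they form a triangular linear system for these
  face variables together with \<open>t\<^sub>Z\<close> and \<open>t\<^sub>V\<close>, with all diagonal coefficients \<open>\<plusminus>1\<close>. Its solution is
  \<open>t\<^sub>Z = 0\<close>, \<open>t\<^sub>V = t\<^sub>U\<close> and face variables whose substitution into the phase gives exactly the quadratic form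
  of \<open>Q\<^sub>n\<close> (\<open>elim_solution\<close>). The kernel is therefore \<open>\<delta>(t\<^sub>Z) \<delta>(t\<^sub>V - t\<^sub>U) exp (2 \<pi> i t\<^sup>T Q\<^sub>n t)\<close>
  (\<open>kinematical_kernel_twist_Y\<close>). With cut-offs this argument becomes a change of variables: the argument
  of each delta, divided by \<open>\<epsilon>\<close>, is the new variable, each regularised delta becomes the Fourier transform
  of the cut-off, which has integral \<open>\<psi>(0) = 1\<close>, and dominated convergence yields the limit
  (\<open>delta_cutoff_limit\<close>, \<open>fourier_inversion_at_0\<close>).

  The tetrahedron \<open>Z\<close> contributes its factor at \<open>t\<^sub>Z = 0\<close>, which is
  \<open>1/\<Phi>\<^sub>b(- i Q (\<pi> - a\<^sub>Z)/2\<pi>)\<close>. The knot edge is the only edge in its class and has weight \<open>a\<^sub>Z\<close>, so this is the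
  inverse of the prefactor (\<open>partition_function_twist_Y\<close>). The singularity at \<open>a\<^sub>Z = 0\<close> is gone, and the
  remaining integral converges as \<open>\<alpha> \<rightarrow> \<tau>\<close> because each other factor decays exponentially at rates given
  by its angles (\<open>tet_factor_bound\<close>). This rests on \<open>\<bar>\<Phi>\<^sub>b(z)\<bar> \<approx> exp (- 2 \<pi> max(0, Re z) Im z)\<close> in the
  strip (\<open>ln_norm_qdilog_bound\<close>): for \<open>Re z \<le> 0\<close> the line of integration may be pushed above the triple
  pole at \<open>0\<close> and for \<open>Re z \<ge> 0\<close> below it, and the residue between them is \<open>- 2 z\<^sup>2\<close> plus a constant.
  All arguments stay in the open strip where the integral formula for \<open>\<Phi>\<^sub>b\<close> converges.

  Removing \<open>Z\<close> from \<open>Y\<^sub>n\<close> and identifying \<open>s\<close> with \<open>s'\<close> merges two edge classes, to each of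
  which \<open>Z\<close> contributes \<open>b\<^sub>Z + c\<^sub>Z = \<pi>\<close> at \<open>\<tau>\<close>. So \<open>\<tau>\<close> restricts to an angle structure on \<open>X\<^sub>n\<close>, and moreover
  \<open>a\<^sub>U = a\<^sub>V\<close> (\<open>balanced_twist_Y\<close>, \<open>balanced_Y_angles\<close>). The edge equations determine the
  angles \<open>c\<^sub>T\<close>, with \<open>c\<^sub>U + c\<^sub>V\<close> in place of \<open>c\<^sub>U\<close> and \<open>c\<^sub>V\<close>, as affine expressions in the \<open>a\<^sub>T\<close>, and these are the coefficients of the real linear part of the exponent of
  the integrand of \<open>J\<close> on the contour (\<open>balanced_imp_J_compatible\<close>, \<open>J_integrand_contour\<close>). Finally
  \<open>J\<close> does not depend on the angle structure: these form a convex set, a segment in it moves the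
  contour in a fixed imaginary direction, and Cauchy's theorem on a square compares the two ends
  (\<open>J_contour_integral_independent\<close>).
\<close>

section \<open>Shifting a domain of integration by averaging over a square\<close>

lemma integral_unit_interval_swap:
  fixes M :: "'a measure" and G :: "'a \<Rightarrow> real \<Rightarrow> complex" and B :: "'a \<Rightarrow> real"
  assumes M: "sigma_finite_measure M"
    and meas: "(\<lambda>(t, x). indicator {0..1} x *\<^sub>R G t x) \<in> borel_measurable (M \<Otimes>\<^sub>M lborel)"
    and bound: "\<And>t x. t \<in> space M \<Longrightarrow> x \<in> {0..1} \<Longrightarrow> norm (G t x) \<le> B t"
    and B: "integrable M B"
  shows "(\<integral>x. indicator {0..1} x *\<^sub>R (\<integral>t. G t x \<partial>M) \<partial>lborel) = (\<integral>t. (\<integral>x. indicator {0..1} x *\<^sub>R G t x \<partial>lborel) \<partial>M)"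
    and "integrable M (\<lambda>t. \<integral>x. indicator {0..1} x *\<^sub>R G t x \<partial>lborel)"
proof -
  interpret M: sigma_finite_measure M by fact
  interpret MM: pair_sigma_finite M lborel ..
  have B0: "B t \<ge> 0" if "t \<in> space M" for t
    using order_trans[OF norm_ge_zero bound[OF that, of 0]] by simp
  have int: "integrable (M \<Otimes>\<^sub>M lborel) (\<lambda>(t, x). indicator {0..1} x *\<^sub>R G t x)"
  proof (rule Bochner_Integration.integrable_bound)
    have "integrable (M \<Otimes>\<^sub>M lborel) (\<lambda>(t, x). B t * indicator {0..1::real} x)"
      by (rule MM.Fubini_integrable)
         (use B B0 in \<open>auto simp: abs_mult intro!: integrable_mult_left integrable_mult_right\<close>)
    then show "integrable (M \<Otimes>\<^sub>M lborel) (\<lambda>z. B (fst z) * indicator {0..1::real} (snd z))"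
      by (simp add: case_prod_beta')
    show "AE z in M \<Otimes>\<^sub>M lborel. norm (case z of (t, x) \<Rightarrow> indicator {0..1} x *\<^sub>R G t x)
            \<le> norm (B (fst z) * indicator {0..1} (snd z))"
    proof (rule AE_I2)
      fix z assume "z \<in> space (M \<Otimes>\<^sub>M (lborel :: real measure))"
      then have "fst z \<in> space M" by (auto simp: space_pair_measure)
      then show "norm (case z of (t, x) \<Rightarrow> indicator {0..1} x *\<^sub>R G t x)
            \<le> norm (B (fst z) * indicator {0..1} (snd z))"
        using bound[of "fst z" "snd z"] B0[of "fst z"] by (auto simp: case_prod_beta indicator_def)
    qed
  qed (fact meas)
  show "integrable M (\<lambda>t. \<integral>x. indicator {0..1} x *\<^sub>R G t x \<partial>lborel)"
    using MM.integrable_fst'[OF int] by simp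
  have "(\<integral>x. indicator {0..1} x *\<^sub>R (\<integral>t. G t x \<partial>M) \<partial>lborel) = (\<integral>x. (\<integral>t. indicator {0..1} x *\<^sub>R G t x \<partial>M) \<partial>lborel)"
    by (intro Bochner_Integration.integral_cong refl) (auto simp: indicator_def)
  also have "\<dots> = (\<integral>t. (\<integral>x. indicator {0..1} x *\<^sub>R G t x \<partial>lborel) \<partial>M)"
    by (rule MM.Fubini_integral[OF int])
  finally show "(\<integral>x. indicator {0..1} x *\<^sub>R (\<integral>t. G t x \<partial>M) \<partial>lborel) = (\<integral>t. (\<integral>x. indicator {0..1} x *\<^sub>R G t x \<partial>lborel) \<partial>M)" .
qed

text \<open>
  For a segment, Cauchy's theorem in a convex set is the fundamental theorem of calculus for a
  primitive.
\<close>

lemma segment_integral_primitive: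
  fixes P f :: "complex \<Rightarrow> complex"
  assumes S: "open S" and P: "\<And>w. w \<in> S \<Longrightarrow> (P has_field_derivative f w) (at w within S)"
    and f: "continuous_on S f"
    and seg: "\<And>x. x \<in> {0..1} \<Longrightarrow> w0 + of_real x * e \<in> S"
  shows "(\<integral>x. indicator {0..1::real} x *\<^sub>R f (w0 + of_real x * e) \<partial>lborel) * e = P (w0 + e) - P w0"
proof -
  have "(\<integral>x. indicator {0..1::real} x *\<^sub>R (e * f (w0 + of_real x * e)) \<partial>lborel) = P (w0 + of_real 1 * e) - P (w0 + of_real 0 * e)"
  proof (rule integral_FTC_Icc)
    fix x :: real assume x: "0 \<le> x" "x \<le> 1"
    have "((\<lambda>x. w0 + of_real x * e) has_vector_derivative e) (at x)"
      by (auto intro!: derivative_eq_intros)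
    moreover have "(P has_field_derivative f (w0 + of_real x * e)) (at (w0 + of_real x * e))"
      using P[OF seg[of x]] x at_within_open[OF seg[of x] S] by auto
    ultimately have "((P \<circ> (\<lambda>x. w0 + of_real x * e)) has_vector_derivative (e * f (w0 + of_real x * e))) (at x)"
      by (rule field_vector_diff_chain_at)
    then show "((\<lambda>x. P (w0 + of_real x * e)) has_vector_derivative (e * f (w0 + of_real x * e))) (at x within {0..1})"
      unfolding o_def by (rule has_vector_derivative_at_within)
  next
    show "continuous_on {0..1} (\<lambda>x. e * f (w0 + complex_of_real x * e))"
      by (intro continuous_intros continuous_on_compose2[OF f]) (use seg in auto)
  qed simp
  then have "P (w0 + e) - P w0 = (\<integral>x. (indicator {0..1::real} x *\<^sub>R f (w0 + of_real x * e)) * e \<partial>lborel)"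
    by (simp add: mult_ac)
  also have "\<dots> = (\<integral>x. indicator {0..1::real} x *\<^sub>R f (w0 + of_real x * e) \<partial>lborel) * e"
    by (rule integral_mult_left_zero)
  finally show ?thesis by simp
qed

text \<open>
  This is a contour shift in one complex direction \<open>\<zeta>\<close> for integrands on an arbitrary measure space, in
  the case that moving \<open>\<zeta>\<close> horizontally amounts to a measure-preserving translation of \<open>t\<close>. By
  Cauchy's theorem on the unit square, applied for each \<open>t\<close>, the two horizontal sides differ by the
  two vertical ones. After integration over \<open>t\<close> the vertical sides are equal and cancel, while each
  horizontal side has become the average of a constant. No truncation at infinity enters, which is
  what makes the argument work in several variables at once.
\<close>

lemma integral_shift_square:
  fixes M :: "'a measure" and F :: "'a \<Rightarrow> complex \<Rightarrow> complex" and B :: "'a \<Rightarrow> real"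
  assumes M: "sigma_finite_measure M"
    and S: "open S" "convex S" "\<And>x y. x \<in> {0..1} \<Longrightarrow> y \<in> {0..1} \<Longrightarrow> Complex x y \<in> S"
    and hol: "\<And>t. t \<in> space M \<Longrightarrow> F t holomorphic_on S"
    and meas: "\<And>w e. (w, e) \<in> {(0, 1), (\<i>, 1), (0, \<i>), (1, \<i>)} \<Longrightarrow>
       (\<lambda>(t, x). indicator {0..1} x *\<^sub>R F t (w + of_real x * e)) \<in> borel_measurable (M \<Otimes>\<^sub>M lborel)"
    and bound: "\<And>t x y. t \<in> space M \<Longrightarrow> x \<in> {0..1} \<Longrightarrow> y \<in> {0..1} \<Longrightarrow> norm (F t (Complex x y)) \<le> B t"
    and B: "integrable M B"
    and transl: "\<And>x y. x \<in> {0..1} \<Longrightarrow> y \<in> {0..1} \<Longrightarrow>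
        (\<integral>t. F t (Complex x y) \<partial>M) = (\<integral>t. F t (Complex 0 y) \<partial>M)"
  shows "(\<integral>t. F t 0 \<partial>M) = (\<integral>t. F t \<i> \<partial>M)"
proof -
  have cs: "0 + of_real x * 1 = Complex x 0" "\<i> + of_real x * 1 = Complex x 1"
      "0 + of_real x * \<i> = Complex 0 x" "1 + of_real x * \<i> = Complex 1 x" for x
    by (auto simp: complex_eq_iff)
  let ?I = "\<lambda>w e t. (\<integral>x. indicator {0..1::real} x *\<^sub>R F t (w + of_real x * e) \<partial>lborel)"
  let ?J = "\<lambda>w e. (\<integral>x. indicator {0..1::real} x *\<^sub>R (\<integral>t. F t (w + of_real x * e) \<partial>M) \<partial>lborel)"
  have sq: "norm (F t (w + of_real x * e)) \<le> B t \<and> w + of_real x * e \<in> S"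
    if we: "(w, e) \<in> {(0, 1), (\<i>, 1), (0, \<i>), (1, \<i>)}" and x: "x \<in> {0..1}" and t: "t \<in> space M" for w e t x
  proof -
    obtain p q where "w + of_real x * e = Complex p q" "p \<in> {0..1}" "q \<in> {0..1}"
    proof
      show "w + of_real x * e = Complex (Re (w + of_real x * e)) (Im (w + of_real x * e))"
        by (simp only: complex.collapse)
    qed (use we x in auto)
    then show ?thesis using bound S(3) t by simp
  qed
  have swap: "?J w e = (\<integral>t. ?I w e t \<partial>M)" "integrable M (?I w e)"
    if "(w, e) \<in> {(0, 1), (\<i>, 1), (0, \<i>), (1, \<i>)}" for w e
    using integral_unit_interval_swap[OF M, of "\<lambda>t x. F t (w + of_real x * e)" B] sq[OF that] meas[OF that] B by blast+
  have pt: "?I 0 1 t + ?I 1 \<i> t * \<i> = ?I 0 \<i> t * \<i> + ?I \<i> 1 t" if t: "t \<in> space M" for t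
  proof -
    obtain P where P: "\<And>w. w \<in> S \<Longrightarrow> (P has_field_derivative F t w) (at w within S)"
      using holomorphic_convex_primitive'[OF S(2,1) hol[OF t]] by blast
    have *: "?I w e t * e = P (w + e) - P w" if "(w, e) \<in> {(0, 1), (\<i>, 1), (0, \<i>), (1, \<i>)}" for w e
      using sq[OF that _ t] P by (intro segment_integral_primitive[OF S(1)] holomorphic_on_imp_continuous_on hol t) auto
    show ?thesis using *[of 0 1] *[of \<i> 1] *[of 0 \<i>] *[of 1 \<i>] by (simp add: add.commute[of \<i> 1])
  qed
  have "(\<integral>t. ?I 0 1 t \<partial>M) + (\<integral>t. ?I 1 \<i> t \<partial>M) * \<i> = (\<integral>t. ?I 0 1 t + ?I 1 \<i> t * \<i> \<partial>M)"
    using swap(2)[of 0 1] swap(2)[of 1 \<i>] by simp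
  also have "\<dots> = (\<integral>t. ?I 0 \<i> t * \<i> + ?I \<i> 1 t \<partial>M)"
    by (rule Bochner_Integration.integral_cong[OF refl pt])
  also have "\<dots> = (\<integral>t. ?I 0 \<i> t \<partial>M) * \<i> + (\<integral>t. ?I \<i> 1 t \<partial>M)"
    using swap(2)[of 0 \<i>] swap(2)[of \<i> 1] by simp
  finally have eq: "?J 0 1 + ?J 1 \<i> * \<i> = ?J 0 \<i> * \<i> + ?J \<i> 1"
    using swap(1)[of 0 1] swap(1)[of 1 \<i>] swap(1)[of 0 \<i>] swap(1)[of \<i> 1] by simp
  \<comment> \<open>The two vertical sides differ by a horizontal translation.\<close>
  have J1: "?J 1 \<i> = ?J 0 \<i>"
    unfolding cs by (intro Bochner_Integration.integral_cong refl) (use transl[of 1] in \<open>auto simp: indicator_def\<close>)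
  \<comment> \<open>The integral over \<open>t\<close> is constant along a horizontal side.\<close>
  have Jw: "?J w 1 = (\<integral>t. F t w \<partial>M)" if "w \<in> {0, \<i>}" for w
  proof -
    define q where "q = Im w"
    have q: "q \<in> {0..1}" "w = Complex 0 q"
      using that by (auto simp: q_def complex_eq_iff)
    have "(\<integral>t. F t (w + of_real x * 1) \<partial>M) = (\<integral>t. F t w \<partial>M)" if "x \<in> {0..1}" for x
    proof -
      have "w + of_real x * 1 = Complex x q" by (simp add: q complex_eq_iff)
      then show ?thesis using transl[OF that q(1)] q(2) by simp
    qed
    then have "?J w 1 = (\<integral>x. indicator {0..1::real} x *\<^sub>R (\<integral>t. F t w \<partial>M) \<partial>lborel)"
      by (intro Bochner_Integration.integral_cong refl) (auto simp: indicator_def)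
    also have "\<dots> = (\<integral>t. F t w \<partial>M)" by simp
    finally show ?thesis .
  qed
  have cancel: "a + c * \<i> = c * \<i> + d \<Longrightarrow> a = d" for a c d :: complex by simp
  have "(\<integral>t. F t 0 \<partial>M) = ?J 0 1" by (rule Jw[symmetric]) blast
  also have "\<dots> = ?J \<i> 1" by (rule cancel[OF eq[unfolded J1]])
  also have "\<dots> = (\<integral>t. F t \<i> \<partial>M)" by (rule Jw) blast
  finally show ?thesis .
qed

lemma integrable_exp_abs:
  fixes d :: real assumes "d > 0" shows "integrable lborel (\<lambda>u::real. exp (- d * \<bar>u\<bar>))"
proof -
  have 1: "integrable lborel (\<lambda>u::real. indicator {0<..} u *\<^sub>R exp (- (u * d)))"
    using integrable_I0i_exp_mscale[OF assms] by (simp add: set_integrable_def)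
  have 2: "integrable lborel (\<lambda>u::real. indicator {0<..} (- u) *\<^sub>R exp (- (- u * d)))"
    using lborel_integrable_real_affine[OF 1, of "-1" 0] by simp
  have 3: "integrable lborel (\<lambda>u::real. indicator {0<..} u *\<^sub>R exp (- (u * d)) + indicator {0<..} (- u) *\<^sub>R exp (- (- u * d)))"
    using 1 2 by (rule Bochner_Integration.integrable_add)
  show ?thesis
  proof (rule Bochner_Integration.integrable_bound[OF 3])
    have "AE u in lborel. u \<noteq> (0::real)" by (rule AE_lborel_singleton)
    then show "AE u in lborel. norm (exp (- d * \<bar>u\<bar>)) \<le> norm (indicator {0<..} u *\<^sub>R exp (- (u * d)) + indicator {0<..} (- u) *\<^sub>R exp (- (- u * d)))"
      by eventually_elim (auto simp: indicator_def abs_if mult.commute)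
  qed simp
qed

section \<open>The quantum dilogarithm as an integral over a horizontal line\<close>

lemma sinh_norm_sq: "(cmod (sinh w))\<^sup>2 = (sinh (Re w))\<^sup>2 + (sin (Im w))\<^sup>2"
proof -
  have "sinh w = Complex (sinh (Re w) * cos (Im w)) (cosh (Re w) * sin (Im w))"
    by (simp add: sinh_def cosh_def complex_eq_iff Re_exp Im_exp field_simps)
  then have "(cmod (sinh w))\<^sup>2 = (sinh (Re w))\<^sup>2 * (cos (Im w))\<^sup>2 + (cosh (Re w))\<^sup>2 * (sin (Im w))\<^sup>2"
    by (simp add: cmod_power2 power_mult_distrib)
  also have "\<dots> = (sinh (Re w))\<^sup>2 + (sin (Im w))\<^sup>2"
    by (simp add: cosh_square_eq cos_squared_eq algebra_simps)
  finally show ?thesis .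
qed

text \<open>
  The factor \<open>\<bar>sin (Im w)\<bar>\<close> keeps this bound uniform along a horizontal line, including the points near
  the imaginary axis; the price is that the line must avoid the zeros of the sine.
\<close>

lemma sinh_norm_ge: "cmod (sinh w) \<ge> \<bar>sin (Im w)\<bar> * exp \<bar>Re w\<bar> / 2"
proof -
  have 1: "(cosh (Re w))\<^sup>2 * (sin (Im w))\<^sup>2 \<le> (cmod (sinh w))\<^sup>2"
  proof -
    have "(sin (Im w))\<^sup>2 \<le> 1" by (simp add: abs_square_le_1)
    then have "(sinh (Re w))\<^sup>2 * (sin (Im w))\<^sup>2 \<le> (sinh (Re w))\<^sup>2"
      by (simp add: mult_left_le)
    then show ?thesis unfolding sinh_norm_sq by (simp add: cosh_square_eq algebra_simps)
  qed
  have 2: "exp \<bar>Re w\<bar> / 2 \<le> cosh (Re w)"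
    using exp_gt_zero[of "Re w"] exp_gt_zero[of "- Re w"]
    by (cases "Re w \<ge> 0") (simp_all add: cosh_def)
  have "\<bar>sin (Im w)\<bar> * exp \<bar>Re w\<bar> / 2 \<le> cosh (Re w) * \<bar>sin (Im w)\<bar>"
    using mult_left_mono[OF 2, of "\<bar>sin (Im w)\<bar>"] by (simp add: mult_ac)
  also have "\<dots> \<le> cmod (sinh w)"
  proof (rule power2_le_imp_le[OF _ norm_ge_zero])
    show "(cosh (Re w) * \<bar>sin (Im w)\<bar>)\<^sup>2 \<le> (cmod (sinh w))\<^sup>2"
      using 1 by (simp only: power_mult_distrib power2_abs)
  qed
  finally show ?thesis .
qed

definition qker :: "real \<Rightarrow> complex \<Rightarrow> complex \<Rightarrow> complex" where
  "qker b z w = exp (- 2 * \<i> * z * w) / (sinh (of_real b * w) * sinh (of_real (1 / b) * w) * w)"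

text \<open>
  For \<open>0 < \<bar>y\<bar> \<le> height b\<close> both \<open>b y\<close> and \<open>y/b\<close> have absolute value in \<open>(0, 1]\<close>, and \<open>1 < \<pi>\<close>. So the
  only pole of the kernel in the strip \<open>\<bar>Im w\<bar> \<le> height b\<close> is \<open>0\<close>.
\<close>

definition height :: "real \<Rightarrow> real" where "height b = min b (1 / b)"

lemma height_pos: "b > 0 \<Longrightarrow> height b > 0"
  by (simp add: height_def)

lemma sin_nonzero:
  assumes "0 < b" "0 < \<bar>y\<bar>" "\<bar>y\<bar> \<le> height b"
  shows "sin (b * y) \<noteq> 0" "sin (y / b) \<noteq> 0"
proof -
  have p: "1 < pi" using pi_gt3 by simp
  have *: "sin x \<noteq> 0" if "0 < \<bar>x\<bar>" "\<bar>x\<bar> \<le> 1" for x :: real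
  proof (cases "x > 0")
    case True then show ?thesis using sin_gt_zero[of x] that p by auto
  next
    case False then show ?thesis using sin_gt_zero[of "-x"] that p by auto
  qed
  have "\<bar>b * y\<bar> \<le> b * (1/b)" unfolding abs_mult using assms by (intro mult_mono) (auto simp: height_def)
  then show "sin (b * y) \<noteq> 0" using assms by (intro *) auto
  have "\<bar>y / b\<bar> \<le> b / b" unfolding abs_divide using assms by (intro divide_mono) (auto simp: height_def)
  then show "sin (y / b) \<noteq> 0" using assms by (intro *) auto
qed

lemma sinh_nonzero:
  assumes "0 < b" "w \<noteq> 0" "\<bar>Im w\<bar> \<le> height b"
  shows "sinh (of_real b * w) \<noteq> 0" "sinh (of_real (1 / b) * w) \<noteq> 0"
proof -
  have "(cmod (sinh (of_real b * w)))\<^sup>2 \<noteq> 0"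
  proof (cases "Im w = 0")
    case True then have "Re w \<noteq> 0" using assms by (auto simp: complex_eq_iff)
    then show ?thesis unfolding sinh_norm_sq using True assms by simp
  next
    case False
    with sin_nonzero[of b "Im w"] assms have "sin (b * Im w) \<noteq> 0" by auto
    then have "(sin (b * Im w))\<^sup>2 > 0" by simp
    then show ?thesis unfolding sinh_norm_sq by (simp add: sum_power2_eq_zero_iff)
  qed
  then show "sinh (of_real b * w) \<noteq> 0" by auto
  have "(cmod (sinh (of_real (1/b) * w)))\<^sup>2 \<noteq> 0"
  proof (cases "Im w = 0")
    case True then have "Re w \<noteq> 0" using assms by (auto simp: complex_eq_iff)
    then show ?thesis unfolding sinh_norm_sq using True assms by simp
  next
    case False
    with sin_nonzero[of b "Im w"] assms have "sin (Im w / b) \<noteq> 0" by auto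
    then have "(sin (Im w / b))\<^sup>2 > 0" by simp
    then show ?thesis unfolding sinh_norm_sq by (simp add: sum_power2_eq_zero_iff)
  qed
  then show "sinh (of_real (1/b) * w) \<noteq> 0" by auto
qed

lemma qker_holomorphic:
  assumes "0 < b" "\<And>w. w \<in> A \<Longrightarrow> w \<noteq> 0 \<and> \<bar>Im w\<bar> \<le> height b"
  shows "qker b z holomorphic_on A"
proof -
  have "sinh (of_real b * w) * sinh (of_real (1 / b) * w) * w \<noteq> 0" if "w \<in> A" for w
    using sinh_nonzero[of b w] assms that by simp
  moreover have sh: "(\<lambda>w. sinh (c * w)) holomorphic_on A" for c :: complex
    unfolding sinh_def by (intro holomorphic_intros)
  ultimately show ?thesis
    unfolding qker_def by (intro holomorphic_on_divide holomorphic_on_mult[OF holomorphic_on_mult[OF sh sh]] holomorphic_intros)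
qed

definition qker_const :: "real \<Rightarrow> real \<Rightarrow> real" where
  "qker_const b y = 4 / (\<bar>sin (b * y)\<bar> * \<bar>sin (y / b)\<bar> * \<bar>y\<bar>)"

text \<open>
  Along the line of height \<open>Im w\<close> the kernel decays like \<open>exp (2 Im z Re w - (b + 1/b) \<bar>Re w\<bar>)\<close>, which
  is why \<open>\<bar>Im z\<bar> < (b + 1/b)/2\<close> is the strip of absolute convergence. The factor \<open>exp (2 Re z Im w)\<close> is
  small exactly if the line lies on the side of \<open>0\<close> opposite to the sign of \<open>Re z\<close>.
\<close>

lemma qker_bound:
  assumes "0 < b" "0 < \<bar>Im w\<bar>" "\<bar>Im w\<bar> \<le> height b"
  shows "cmod (qker b z w) \<le> qker_const b (Im w) * exp (2 * Re z * Im w) *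
           exp (2 * Im z * Re w - (b + 1 / b) * \<bar>Re w\<bar>)"
proof -
  note nz = sin_nonzero[OF assms]
  have h1: "cmod (sinh (of_real b * w)) \<ge> \<bar>sin (b * Im w)\<bar> * exp (b * \<bar>Re w\<bar>) / 2"
    using sinh_norm_ge[of "of_real b * w"] assms by (simp add: abs_mult)
  have h2: "cmod (sinh (of_real (1/b) * w)) \<ge> \<bar>sin (Im w / b)\<bar> * exp (\<bar>Re w\<bar> / b) / 2"
    using sinh_norm_ge[of "of_real (1/b) * w"] assms by (simp add: abs_mult)
  have h3: "cmod w \<ge> \<bar>Im w\<bar>" by (rule abs_Im_le_cmod)
  let ?D = "(\<bar>sin (b * Im w)\<bar> * exp (b * \<bar>Re w\<bar>) / 2) * (\<bar>sin (Im w / b)\<bar> * exp (\<bar>Re w\<bar> / b) / 2) * \<bar>Im w\<bar>"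
  have D: "?D \<le> cmod (sinh (of_real b * w) * sinh (of_real (1/b) * w) * w)"
    unfolding norm_mult by (intro mult_mono h1 h2 h3) auto
  have Dp: "?D > 0" using nz assms by simp
  have "cmod (qker b z w) = exp (2 * Re z * Im w + 2 * Im z * Re w) / cmod (sinh (of_real b * w) * sinh (of_real (1/b) * w) * w)"
    by (simp add: qker_def norm_divide)
  also have "\<dots> \<le> exp (2 * Re z * Im w + 2 * Im z * Re w) / ?D"
    by (rule divide_left_mono[OF D exp_ge_zero mult_pos_pos[OF less_le_trans[OF Dp D] Dp]])
  also have "\<dots> = qker_const b (Im w) * exp (2 * Re z * Im w) *
           exp (2 * Im z * Re w - (b + 1 / b) * \<bar>Re w\<bar>)"
  proof -
    have "exp (2 * Im z * Re w - (b + 1 / b) * \<bar>Re w\<bar>) =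
        exp (2 * Im z * Re w) / (exp (b * \<bar>Re w\<bar>) * exp (\<bar>Re w\<bar> / b))"
      by (simp add: exp_diff exp_add ring_distribs)
    then show ?thesis by (simp only: qker_const_def exp_add) (simp add: mult_ac)
  qed
  finally show ?thesis .
qed

lemma exp_le_exp_abs:
  fixes y q d u :: real
  assumes "2 * \<bar>y\<bar> \<le> q - d"
  shows "exp (2 * y * u - q * \<bar>u\<bar>) \<le> exp (- d * \<bar>u\<bar>)"
proof -
  have "2 * y * u \<le> \<bar>2 * y * u\<bar>" by simp
  also have "\<dots> = (2 * \<bar>y\<bar>) * \<bar>u\<bar>" by (simp add: abs_mult)
  also have "\<dots> \<le> (q - d) * \<bar>u\<bar>" using assms by (intro mult_right_mono) auto
  finally show ?thesis by (simp add: algebra_simps)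
qed

lemma qker_bound_decay:
  assumes "0 < b" "0 < \<bar>Im w\<bar>" "\<bar>Im w\<bar> \<le> height b" "2 * \<bar>Im z\<bar> \<le> (b + 1 / b) - d"
  shows "cmod (qker b z w) \<le> qker_const b (Im w) * exp (2 * Re z * Im w) * exp (- d * \<bar>Re w\<bar>)"
  using qker_bound[OF assms(1-3), of z]
  by (rule order_trans) (intro mult_left_mono exp_le_exp_abs assms, auto simp: qker_const_def)

lemma qker_continuous_line:
  assumes "0 < b" "0 < \<bar>y\<bar>" "\<bar>y\<bar> \<le> height b"
  shows "continuous_on UNIV (\<lambda>u. qker b z (Complex u y))"
proof -
  have "continuous_on {w. Im w = y} (qker b z)"
    using assms by (intro holomorphic_on_imp_continuous_on qker_holomorphic) auto
  moreover have "continuous_on UNIV (\<lambda>u. Complex u y)"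
    unfolding Complex_eq by (intro continuous_intros)
  ultimately show ?thesis
    by (rule continuous_on_compose2) auto
qed

lemma qker_integrable:
  assumes "0 < b" "0 < \<bar>y\<bar>" "\<bar>y\<bar> \<le> height b" "\<bar>Im z\<bar> < (b + 1 / b) / 2"
  shows "integrable lborel (\<lambda>u. qker b z (Complex u y))"
proof (rule Bochner_Integration.integrable_bound)
  let ?d = "(b + 1 / b) - 2 * \<bar>Im z\<bar>"
  have "?d > 0" using assms by (simp add: field_simps)
  then show "integrable lborel (\<lambda>u. qker_const b y * exp (2 * Re z * y) * exp (- ?d * \<bar>u\<bar>))"
    by (intro integrable_mult_right integrable_exp_abs)
  show "(\<lambda>u. qker b z (Complex u y)) \<in> borel_measurable lborel"
    using qker_continuous_line[OF assms(1-3)] by (simp add: borel_measurable_continuous_onI)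
  show "AE u in lborel. norm (qker b z (Complex u y)) \<le> norm (qker_const b y * exp (2 * Re z * y) * exp (- ?d * \<bar>u\<bar>))"
    using qker_bound_decay[of b "Complex _ y" z ?d] assms by (auto simp: qker_const_def)
qed

lemma qker_const_bounded:
  assumes "0 < b" "0 < h1" "h2 \<le> height b"
  obtains C where "\<And>y. h1 \<le> y \<Longrightarrow> y \<le> h2 \<Longrightarrow> qker_const b y \<le> C" "C \<ge> 0"
proof -
  have "continuous_on {h1..h2} (qker_const b)"
    unfolding qker_const_def using assms sin_nonzero[of b] by (intro continuous_intros) auto
  then have "compact (qker_const b ` {h1..h2})" by (intro compact_continuous_image) auto
  then have "bounded (qker_const b ` {h1..h2})" by (rule compact_imp_bounded)
  then obtain C where "\<And>y. y \<in> {h1..h2} \<Longrightarrow> norm (qker_const b y) \<le> C"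
    unfolding bounded_iff by blast
  then have "\<And>y. h1 \<le> y \<Longrightarrow> y \<le> h2 \<Longrightarrow> qker_const b y \<le> max C 0" by fastforce
  then show ?thesis using that[of "max C 0"] by auto
qed

lemma borel_measurable_segment:
  fixes f :: "real \<Rightarrow> real \<Rightarrow> complex"
  assumes "continuous_on (UNIV \<times> {0..1}) (\<lambda>(t, x). f t x)"
  shows "(\<lambda>(t, x). indicator {0..1} x *\<^sub>R f t x) \<in> borel_measurable (lborel \<Otimes>\<^sub>M lborel)"
proof -
  have "closed (UNIV \<times> {0..1} :: (real \<times> real) set)" by (intro closed_Times) auto
  then have "(\<lambda>z. indicator (UNIV \<times> {0..1}) z *\<^sub>R (case z of (t, x) \<Rightarrow> f t x)) \<in> borel_measurable borel"
    by (intro borel_measurable_continuous_on_indicator assms) auto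
  also have "(\<lambda>z. indicator (UNIV \<times> {0..1}) z *\<^sub>R (case z of (t, x) \<Rightarrow> f t x)) = (\<lambda>(t, x). indicator {0..1} x *\<^sub>R f t x)"
    by (auto simp: fun_eq_iff indicator_def)
  also have "borel_measurable borel = borel_measurable (lborel \<Otimes>\<^sub>M (lborel :: real measure))"
    by (intro measurable_cong_sets) (simp_all add: borel_prod[symmetric] cong: sets_pair_measure_cong)
  finally show ?thesis .
qed

text \<open>
  The point \<open>\<zeta>\<close> of the unit square parametrises \<open>w = u + h \<zeta> + i y1\<close>, and a horizontal move of \<open>\<zeta>\<close> is a
  translation of \<open>u\<close>.
\<close>

lemma qker_shift:
  assumes b: "0 < b" and y: "0 < y1" "y1 < y2" "y2 < height b" and z: "\<bar>Im z\<bar> < (b + 1 / b) / 2"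
  shows "(\<integral>u. qker b z (Complex u y1) \<partial>lborel) = (\<integral>u. qker b z (Complex u y2) \<partial>lborel)"
proof -
  define h where "h = y2 - y1"
  have h: "h > 0" using y by (simp add: h_def)
  define S where "S = {\<zeta>. -y1 < h * Im \<zeta> \<and> y1 + h * Im \<zeta> < height b}"
  define F where "F = (\<lambda>u \<zeta>. qker b z (of_real u + of_real h * \<zeta> + \<i> * of_real y1))"
  define d where "d = (b + 1 / b) - 2 * \<bar>Im z\<bar>"
  have d: "d > 0" using z by (simp add: d_def field_simps)
  obtain C where C: "\<And>y. y1 \<le> y \<Longrightarrow> y \<le> y2 \<Longrightarrow> qker_const b y \<le> C" "C \<ge> 0"
    using qker_const_bounded[of b y1 y2] b y by auto
  \<comment> \<open>The factor \<open>exp (d h)\<close> compensates a translation of \<open>u\<close> by at most \<open>h\<close>.\<close>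
  define E where "E = C * exp (2 * \<bar>Re z\<bar> * y2) * exp (d * h)"
  have Ssq: "Complex x y \<in> S" if "y \<in> {0..1}" for x y
  proof -
    have "h * y \<le> h" "0 \<le> h * y" using that h by auto
    moreover have "y1 + h < height b" using y by (simp add: h_def)
    ultimately show ?thesis using y unfolding S_def by simp
  qed
  have holF: "F u holomorphic_on S" for u
  proof -
    have "(qker b z \<circ> (\<lambda>\<zeta>. of_real u + of_real h * \<zeta> + \<i> * of_real y1)) holomorphic_on S"
    proof (rule holomorphic_on_compose)
      show "qker b z holomorphic_on (\<lambda>\<zeta>. of_real u + of_real h * \<zeta> + \<i> * of_real y1) ` S"
        using b y by (intro qker_holomorphic) (auto simp: S_def complex_eq_iff)
    qed (intro holomorphic_intros)
    then show ?thesis by (simp add: F_def o_def)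
  qed
  have contF: "continuous_on (UNIV \<times> S) (\<lambda>(u, \<zeta>). F u \<zeta>)"
  proof -
    have "continuous_on {w. 0 < Im w \<and> Im w < height b} (qker b z)"
      using b by (intro holomorphic_on_imp_continuous_on qker_holomorphic) auto
    then show ?thesis unfolding F_def case_prod_beta
      by (rule continuous_on_compose2) (auto intro!: continuous_intros simp: S_def)
  qed
  have "(\<integral>u. F u 0 \<partial>lborel) = (\<integral>u. F u \<i> \<partial>lborel)"
  proof (rule integral_shift_square[where S = S and B = "\<lambda>u. E * exp (- d * \<bar>u\<bar>)"])
    show "sigma_finite_measure (lborel :: real measure)" by (rule lborel.sigma_finite_measure_axioms)
    show "open S" unfolding S_def by (intro open_Collect_conj open_Collect_less continuous_intros)
    show "convex S"
    proof -
      have "S = {\<zeta>. - y1 / h < Im \<zeta>} \<inter> {\<zeta>. Im \<zeta> < (height b - y1) / h}"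
        using h by (auto simp: S_def field_simps)
      then show ?thesis by (auto intro!: convex_Int convex_halfspace_Im_gt convex_halfspace_Im_lt)
    qed
    show "integrable lborel (\<lambda>u. E * exp (- d * \<bar>u\<bar>))"
      by (intro integrable_mult_right integrable_exp_abs d)
    fix w e :: complex assume we: "(w, e) \<in> {(0, 1), (\<i>, 1), (0, \<i>), (1, \<i>)}"
    show "(\<lambda>(t, x). indicator {0..1} x *\<^sub>R F t (w + of_real x * e)) \<in> borel_measurable (lborel \<Otimes>\<^sub>M lborel)"
    proof (rule borel_measurable_segment)
      show "continuous_on (UNIV \<times> {0..1::real}) (\<lambda>(t, x). F t (w + of_real x * e))"
        unfolding case_prod_beta
      proof (rule continuous_on_compose2[OF contF[unfolded case_prod_beta], of _ "\<lambda>p. (fst p, w + of_real (snd p) * e)", simplified])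
        show "(\<lambda>p. (fst p, w + of_real (snd p) * e)) ` (UNIV \<times> {0..1}) \<subseteq> UNIV \<times> S"
          using Ssq[of "Im (w + of_real _ * e)" "Re (w + of_real _ * e)"] we by (auto simp: Complex_eq add.commute mult.commute)
      qed (intro continuous_intros)
    qed
  next
    fix u x y :: real assume x: "x \<in> {0..1}" and y': "y \<in> {0..1}"
    have hy: "0 \<le> h * y" "h * y \<le> h" using y' h by auto
    have "y1 + h = y2" by (simp add: h_def)
    then have hy2: "y1 + h * y \<le> y2" "0 < y1 + h * y" using hy y by linarith+
    let ?w = "Complex (u + h * x) (y1 + h * y)"
    have F: "F u (Complex x y) = qker b z ?w"
      unfolding F_def by (rule arg_cong[of _ _ "qker b z"]) (simp add: complex_eq_iff)
    have "cmod (qker b z ?w) \<le> qker_const b (Im ?w) * exp (2 * Re z * Im ?w) * exp (- d * \<bar>Re ?w\<bar>)"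
    proof (intro qker_bound_decay)
      show "\<bar>Im ?w\<bar> \<le> height b" using hy2 y by simp
    qed (use hy2 y b in \<open>auto simp: d_def\<close>)
    also have "\<dots> \<le> C * exp (2 * \<bar>Re z\<bar> * y2) * exp (d * h + - d * \<bar>u\<bar>)"
    proof (intro mult_mono)
      show "qker_const b (Im ?w) \<le> C" using C hy hy2 by auto
      have "Re z * (y1 + h * y) \<le> \<bar>Re z\<bar> * y2"
        using hy2 by (intro mult_mono) auto
      then show "exp (2 * Re z * Im ?w) \<le> exp (2 * \<bar>Re z\<bar> * y2)" by simp
      have "0 \<le> h * x" "h * x \<le> h" using x h by auto
      then have "\<bar>u\<bar> \<le> h + \<bar>u + h * x\<bar>" by linarith
      then have "d * \<bar>u\<bar> \<le> d * (h + \<bar>u + h * x\<bar>)" using d by (intro mult_left_mono) auto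
      then show "exp (- d * \<bar>Re ?w\<bar>) \<le> exp (d * h + - d * \<bar>u\<bar>)" by (simp add: algebra_simps)
    qed (use C in auto)
    finally show "cmod (F u (Complex x y)) \<le> E * exp (- d * \<bar>u\<bar>)"
      unfolding F E_def exp_add by (simp only: mult.assoc)
  next
    fix x y :: real assume "x \<in> {0..1}" "y \<in> {0..1}"
    have "(\<integral>u. F u (Complex x y) \<partial>lborel) = (\<integral>u. F (h * x + 1 * u) (Complex 0 y) \<partial>lborel)"
      unfolding F_def by (intro Bochner_Integration.integral_cong refl arg_cong[of _ _ "qker b z"]) (simp add: complex_eq_iff)
    also have "\<dots> = (\<integral>u. F u (Complex 0 y) \<partial>lborel)"
      using lborel_integral_real_affine[of 1 "\<lambda>u. F u (Complex 0 y)" "h * x"] by simp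
    finally show "(\<integral>u. F u (Complex x y) \<partial>lborel) = (\<integral>u. F u (Complex 0 y) \<partial>lborel)" .
  qed (use Ssq holF in auto)
  moreover have "F u 0 = qker b z (Complex u y1)" "F u \<i> = qker b z (Complex u y2)" for u
    unfolding F_def h_def by (rule arg_cong[of _ _ "qker b z"]; simp add: complex_eq_iff)+
  ultimately show ?thesis by simp
qed

lemma sqrt_hbar: "b > 0 \<Longrightarrow> sqrt (hbar b) = 1 / (b + 1 / b)"
  by (simp add: hbar_def real_sqrt_divide)

text \<open>
  The integrals over low lines do not depend on the line, so their limit at the real axis is the
  integral over any one of them.
\<close>

lemma qdilog_eq_exp_line:
  assumes b: "0 < b" and y: "0 < y" "y < height b" and z: "\<bar>Im z\<bar> < (b + 1 / b) / 2"
  shows "qdilog b z = exp (1 / 4 * (\<integral>u. qker b z (Complex u y) \<partial>lborel))"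
proof -
  let ?f = "\<lambda>\<eta>. \<integral>u. qker b z (Complex u \<eta>) \<partial>lborel"
  have "eventually (\<lambda>\<eta>. ?f \<eta> = ?f y) (at_right 0)"
    unfolding eventually_at_right[OF y(1)]
  proof (intro exI conjI allI impI)
    fix \<eta> assume "0 < \<eta>" "\<eta> < y"
    then show "?f \<eta> = ?f y" using qker_shift[OF b _ _ _ z, of \<eta> y] y by auto
  qed (use y in auto)
  then have "(?f \<longlongrightarrow> ?f y) (at_right 0)"
    by (simp add: tendsto_eventually)
  then have "Lim (at_right 0) ?f = ?f y"
    by (intro tendsto_Lim) auto
  moreover have "qdilog b z = qdilog_strip b z"
    using z sqrt_hbar[OF b] by (simp add: qdilog_def)
  ultimately show ?thesis
    by (simp add: qdilog_strip_def qker_def Let_def)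
qed

section \<open>The residue between the lines above and below zero\<close>

lemma contour_integral_horizontal:
  assumes f: "continuous_on {w. Im w = y} f" and R: "R > 0"
  shows "contour_integral (linepath (Complex (- R) y) (Complex R y)) f =
           (\<integral>u. indicator {-R..R} u *\<^sub>R f (Complex u y) \<partial>lborel)"
proof -
  let ?a = "Complex (- R) y" and ?b = "Complex R y"
  have seg: "linepath ?a ?b x = Complex (- R + 2 * R * x) y" for x
    by (simp add: linepath_def complex_eq_iff algebra_simps)
  have cont: "continuous_on {0..1} (\<lambda>x. f (linepath ?a ?b x) * (?b - ?a))"
    by (intro continuous_intros continuous_on_compose2[OF f]) (auto simp: seg)
  have "contour_integral (linepath ?a ?b) f = integral {0..1} (\<lambda>x. f (linepath ?a ?b x) * (?b - ?a))"
    by (simp add: contour_integral_integral)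
  also have "\<dots> = (\<integral>x. indicator {0..1} x *\<^sub>R (f (linepath ?a ?b x) * (?b - ?a)) \<partial>lborel)"
    by (rule set_borel_integral_eq_integral(2)[OF borel_integrable_compact[OF compact_Icc cont, folded set_integrable_def],
          unfolded set_lebesgue_integral_def, symmetric])
  also have "\<dots> = (\<integral>x. (2 * R) *\<^sub>R (indicator {-R..R} (- R + 2 * R * x) *\<^sub>R f (Complex (- R + 2 * R * x) y)) \<partial>lborel)"
  proof (intro Bochner_Integration.integral_cong refl)
    fix x
    have "?b - ?a = of_real (2 * R)" by (simp add: complex_eq_iff)
    moreover have "(- R + 2 * R * x \<in> {- R..R}) = (x \<in> {0..1})"
      using R by (auto simp: zero_le_mult_iff)
    ultimately show "indicator {0..1} x *\<^sub>R (f (linepath ?a ?b x) * (?b - ?a)) =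
         (2 * R) *\<^sub>R (indicator {-R..R} (- R + 2 * R * x) *\<^sub>R f (Complex (- R + 2 * R * x) y))"
      unfolding seg by (simp add: indicator_def scaleR_conv_of_real)
  qed
  also have "\<dots> = (2 * R) *\<^sub>R (\<integral>x. indicator {-R..R} (- R + 2 * R * x) *\<^sub>R f (Complex (- R + 2 * R * x) y) \<partial>lborel)"
    by (rule integral_scaleR_right)
  also have "\<dots> = (\<integral>u. indicator {-R..R} u *\<^sub>R f (Complex u y) \<partial>lborel)"
    using lborel_integral_real_affine[of "2 * R" "\<lambda>u. indicator {-R..R} u *\<^sub>R f (Complex u y)" "- R"] R by simp
  finally show ?thesis .
qed

lemma tendsto_integral_symmetric:
  fixes f :: "real \<Rightarrow> complex"
  assumes f: "integrable lborel f"
  shows "(\<lambda>n. \<integral>u. indicator {- real n..real n} u *\<^sub>R f u \<partial>lborel) \<longlonglongrightarrow> (\<integral>u. f u \<partial>lborel)"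
proof (rule integral_dominated_convergence[where w = "\<lambda>u. norm (f u)"])
  show "AE u in lborel. (\<lambda>n. indicator {- real n..real n} u *\<^sub>R f u) \<longlonglongrightarrow> f u"
  proof (rule AE_I2)
    fix u :: real
    obtain N :: nat where "\<bar>u\<bar> \<le> N" using real_arch_simple by blast
    then have "eventually (\<lambda>n. indicator {- real n..real n} u *\<^sub>R f u = f u) sequentially"
      by (intro eventually_sequentiallyI[of N]) (auto simp: indicator_def)
    then show "(\<lambda>n. indicator {- real n..real n} u *\<^sub>R f u) \<longlonglongrightarrow> f u"
      by (simp add: tendsto_eventually)
  qed
qed (use f in \<open>auto simp: indicator_def\<close>)

text \<open>
  Dividing \<open>sinh v\<close> by \<open>v\<close> turns the triple pole of the kernel into \<open>1/w\<^sup>3\<close> times an even holomorphic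
  function with value \<open>1\<close>.
\<close>

lemma sinh_quotient:
  obtains S :: "complex \<Rightarrow> complex" where "S holomorphic_on UNIV" "\<And>v. sinh v = v * S v" "S 0 = 1" "\<And>v. S (- v) = S v"
proof
  let ?S = "\<lambda>v::complex. if v = 0 then deriv sinh 0 else (sinh v - sinh 0) / (v - 0)"
  have "sinh holomorphic_on (UNIV :: complex set)" unfolding sinh_def[abs_def] by (intro holomorphic_intros)
  then show "?S holomorphic_on UNIV" by (rule pole_lemma_open) auto
  have "(sinh has_field_derivative 1) (at (0::complex))"
    by (auto intro!: derivative_eq_intros)
  then have d: "deriv sinh (0::complex) = 1" by (rule DERIV_imp_deriv)
  then show "?S 0 = 1" by simp
  show "sinh v = v * ?S v" "?S (- v) = ?S v" for v by (auto simp: d)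
qed

text \<open>
  At \<open>0\<close> the kernel is \<open>exp (- 2 i z w) k(w) / w\<^sup>3\<close> with \<open>k\<close> even and \<open>k(0) = 1\<close>. The residue is half the
  second derivative of the numerator, where evenness removes the term linear in \<open>z\<close>.
\<close>

lemma qker_residue:
  assumes b: "0 < b"
  obtains \<kappa> where "\<And>z. residue (qker b z) 0 = - 2 * z\<^sup>2 + \<kappa>"
proof -
  obtain S where S: "S holomorphic_on UNIV" "\<And>v. sinh v = v * S v" "S 0 = 1" "\<And>v. S (- v) = S v"
    using sinh_quotient by metis
  define A where "A = {w. \<bar>Im w\<bar> < height b}"
  define k where "k = (\<lambda>w. 1 / (S (of_real b * w) * S (of_real (1 / b) * w)))"
  have A: "open A" "0 \<in> A"
    unfolding A_def by (auto intro!: open_Collect_less continuous_intros height_pos b)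
  have nz: "S (of_real b * w) * S (of_real (1 / b) * w) \<noteq> 0" if "w \<in> A" for w
    using sinh_nonzero[OF b, of w] that b S by (cases "w = 0") (auto simp: A_def)
  have Sc: "(\<lambda>w. S (c * w)) holomorphic_on A" for c
    using holomorphic_on_compose[of "\<lambda>w. c * w" A S] holomorphic_on_subset[OF S(1)]
    by (auto simp: o_def intro!: holomorphic_intros)
  have k: "k holomorphic_on A"
    unfolding k_def using nz by (intro holomorphic_on_divide holomorphic_on_mult Sc holomorphic_intros)
  have k0: "k 0 = 1" by (simp add: k_def S)
  have keven: "k (- w) = k w" for w by (simp add: k_def S)
  define k' where "k' = deriv k"
  have dk: "(k has_field_derivative k' w) (at w)" if "w \<in> A" for w
    unfolding k'_def using holomorphic_derivI[OF k A(1) that] .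
  have k'hol: "k' holomorphic_on A" unfolding k'_def by (rule holomorphic_deriv[OF k A(1)])
  have dk': "(k' has_field_derivative deriv k' w) (at w)" if "w \<in> A" for w
    using holomorphic_derivI[OF k'hol A(1) that] .
  have k'0: "k' 0 = 0"
  proof -
    have "((\<lambda>w. k (- w)) has_field_derivative (- k' 0)) (at 0)"
      using DERIV_chain2[of k "k' 0" "\<lambda>w. - w" 0 "-1" UNIV] dk[OF A(2)] DERIV_minus[OF DERIV_ident, of 0 UNIV]
      by simp
    then have "(k has_field_derivative (- k' 0)) (at 0)" by (simp add: keven)
    then have "k' 0 = - k' 0" using dk[OF A(2)] DERIV_unique by blast
    then show ?thesis by simp
  qed
  have "residue (qker b z) 0 = - 2 * z\<^sup>2 + deriv k' 0 / 2" for z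
  proof -
    define h where "h = (\<lambda>w. exp (- 2 * \<i> * z * w) * k w)"
    define h' where "h' = (\<lambda>w. exp (- 2 * \<i> * z * w) * (k' w + (- 2 * \<i> * z) * k w))"
    have dexp: "((\<lambda>w. exp (- 2 * \<i> * z * w)) has_field_derivative exp (- 2 * \<i> * z * w) * (- 2 * \<i> * z)) (at w)" for w
      using DERIV_chain2[OF DERIV_exp DERIV_cmult_Id[of "- 2 * \<i> * z" w UNIV]] .
    have hhol: "h holomorphic_on A" unfolding h_def by (intro holomorphic_intros k)
    have dh: "(h has_field_derivative h' w) (at w)" if "w \<in> A" for w
      unfolding h_def h'_def
      by (rule DERIV_cong[OF DERIV_mult[OF dexp dk[OF that]]]) (simp add: algebra_simps)
    have d2: "(h' has_field_derivative (- 4 * z\<^sup>2 + deriv k' 0)) (at 0)"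
      unfolding h'_def
      by (rule DERIV_cong[OF DERIV_mult[OF dexp DERIV_add[OF dk'[OF A(2)] DERIV_cmult[OF dk[OF A(2)]]]]])
         (simp add: k0 k'0 algebra_simps power2_eq_square)
    have "deriv (deriv h) 0 = deriv h' 0"
    proof (rule deriv_cong_ev)
      show "eventually (\<lambda>w. deriv h w = h' w) (nhds 0)"
        using eventually_nhds_in_open[OF A] by eventually_elim (rule DERIV_imp_deriv[OF dh])
    qed simp
    then have dd: "(deriv ^^ 2) h 0 = - 4 * z\<^sup>2 + deriv k' 0"
      using DERIV_imp_deriv[OF d2] by (simp add: numeral_2_eq_2)
    have "residue (qker b z) 0 = residue (\<lambda>w. h w / w ^ Suc 2) 0"
    proof (rule residue_cong)
      have "qker b z w = h w / w ^ Suc 2" if "w \<noteq> 0" for w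
        unfolding qker_def h_def k_def S(2)[of "of_real b * w"] S(2)[of "of_real (1 / b) * w"]
        using b that by (simp add: power3_eq_cube numeral_3_eq_3[symmetric] divide_simps)
      then show "eventually (\<lambda>w. qker b z w = h w / w ^ Suc 2) (at 0)"
        by (auto simp: eventually_at_filter)
    qed simp
    also have "\<dots> = (- 4 * z\<^sup>2 + deriv k' 0) / 2"
      using residue_holomorphic_over_power'[OF A hhol, of 2] dd by simp
    finally show ?thesis by (simp add: field_simps)
  qed
  then show ?thesis using that by blast
qed

text \<open>
  This bound serves for the vertical sides of a rectangle. They cross the real axis, where the bound
  by the sine degenerates, and \<open>\<bar>sinh w\<bar> \<ge> \<bar>sinh (Re w)\<bar>\<close> takes its place.
\<close>

lemma qker_bound_side:
  assumes b: "0 < b" and w: "\<bar>Re w\<bar> \<ge> 1" and z: "2 * \<bar>Im z\<bar> \<le> (b + 1 / b) - d"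
  shows "cmod (qker b z w) \<le> 4 / ((1 - exp (- 2 * b)) * (1 - exp (- 2 / b))) * exp (2 * Re z * Im w) * exp (- d * \<bar>Re w\<bar>)"
proof -
  have sh: "cmod (sinh (of_real c * w)) \<ge> (1 - exp (- 2 * c)) * exp (c * \<bar>Re w\<bar>) / 2" if c: "c > 0" for c
  proof -
    have "(sinh (c * Re w))\<^sup>2 \<le> (cmod (sinh (of_real c * w)))\<^sup>2"
      unfolding sinh_norm_sq by simp
    then have "\<bar>sinh (c * Re w)\<bar> \<le> cmod (sinh (of_real c * w))"
      using abs_le_square_iff[of "sinh (c * Re w)" "cmod (sinh (of_real c * w))"] by simp
    moreover have "\<bar>sinh (c * Re w)\<bar> = sinh (c * \<bar>Re w\<bar>)"
      using c by (simp add: sinh_real_abs[symmetric] abs_mult)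
    moreover have "sinh (c * \<bar>Re w\<bar>) \<ge> (1 - exp (- 2 * c)) * exp (c * \<bar>Re w\<bar>) / 2"
    proof -
      have "c \<le> c * \<bar>Re w\<bar>" using c w by simp
      then have "exp (- (c * \<bar>Re w\<bar>)) \<le> exp (- 2 * c + c * \<bar>Re w\<bar>)" by simp
      also have "\<dots> = exp (- 2 * c) * exp (c * \<bar>Re w\<bar>)" by (rule exp_add)
      finally show ?thesis by (simp add: sinh_field_def left_diff_distrib)
    qed
    ultimately show ?thesis by simp
  qed
  define D where "D = ((1 - exp (- 2 * b)) * exp (b * \<bar>Re w\<bar>) / 2) * ((1 - exp (- 2 / b)) * exp (\<bar>Re w\<bar> / b) / 2) * 1"
  have "D \<le> cmod (sinh (of_real b * w) * sinh (of_real (1/b) * w) * w)"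
    unfolding norm_mult D_def
  proof (intro mult_mono)
    show "1 \<le> cmod w" using w abs_Re_le_cmod[of w] by linarith
    show "(1 - exp (- 2 * b)) * exp (b * \<bar>Re w\<bar>) / 2 \<le> cmod (sinh (of_real b * w))" by (rule sh[OF b])
    show "(1 - exp (- 2 / b)) * exp (\<bar>Re w\<bar> / b) / 2 \<le> cmod (sinh (of_real (1/b) * w))" using sh[of "1/b"] b by simp
  qed (use b in auto)
  moreover have "D > 0" using b by (simp add: D_def)
  moreover have "cmod (qker b z w) = exp (2 * Re z * Im w + 2 * Im z * Re w) / cmod (sinh (of_real b * w) * sinh (of_real (1/b) * w) * w)"
    by (simp add: qker_def norm_divide)
  ultimately have "cmod (qker b z w) \<le> exp (2 * Re z * Im w + 2 * Im z * Re w) / D"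
    by (simp only:) (rule divide_left_mono[OF _ exp_ge_zero mult_pos_pos[OF less_le_trans]])
  also have "\<dots> = 4 / ((1 - exp (- 2 * b)) * (1 - exp (- 2 / b))) * exp (2 * Re z * Im w) * exp (2 * Im z * Re w - (b + 1 / b) * \<bar>Re w\<bar>)"
  proof -
    have "exp (2 * Im z * Re w - (b + 1 / b) * \<bar>Re w\<bar>) =
        exp (2 * Im z * Re w) / (exp (b * \<bar>Re w\<bar>) * exp (\<bar>Re w\<bar> / b))"
      by (simp add: exp_diff exp_add ring_distribs)
    then show ?thesis by (simp only: D_def exp_add) (simp add: mult_ac)
  qed
  also have "\<dots> \<le> 4 / ((1 - exp (- 2 * b)) * (1 - exp (- 2 / b))) * exp (2 * Re z * Im w) * exp (- d * \<bar>Re w\<bar>)"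
    using b by (intro mult_left_mono exp_le_exp_abs z) auto
  finally show ?thesis .
qed

text \<open>
  The residue theorem on the rectangle with vertices \<open>\<plusminus>n \<plusminus> i y\<close>, whose vertical sides contribute
  \<open>O(exp (- d n))\<close>.
\<close>

lemma qker_line_difference:
  assumes b: "0 < b" and y: "0 < y" "y < height b" and z: "\<bar>Im z\<bar> < (b + 1 / b) / 2"
  shows "(\<integral>u. qker b z (Complex u (- y)) \<partial>lborel) - (\<integral>u. qker b z (Complex u y) \<partial>lborel) =
           2 * pi * \<i> * residue (qker b z) 0"
proof -
  let ?f = "qker b z" and ?r = "2 * pi * \<i> * residue (qker b z) 0"
  define d where "d = (b + 1 / b) - 2 * \<bar>Im z\<bar>"
  have d: "d > 0" using z by (simp add: d_def field_simps)
  define A where "A = {w. \<bar>Im w\<bar> < height b}"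
  have A: "open A" "convex A"
  proof -
    show "open A" unfolding A_def by (auto intro!: open_Collect_less continuous_intros)
    have "A = {w. - height b < Im w} \<inter> {w. Im w < height b}" by (auto simp: A_def abs_less_iff)
    then show "convex A" by (auto intro!: convex_Int convex_halfspace_Im_gt convex_halfspace_Im_lt)
  qed
  have cont: "continuous_on {w. Im w = s} ?f" if "s \<in> {y, - y}" for s
    using that y by (intro holomorphic_on_imp_continuous_on qker_holomorphic b) auto
  have hol: "?f holomorphic_on A - {0}" by (intro qker_holomorphic b) (auto simp: A_def)
  define K where "K = 4 / ((1 - exp (- 2 * b)) * (1 - exp (- 2 / b))) * exp (2 * \<bar>Re z\<bar> * y)"
  have K0: "K \<ge> 0" using b by (simp add: K_def)
  let ?I = "\<lambda>n y. (\<integral>u. indicator {- real n..real n} u *\<^sub>R ?f (Complex u y) \<partial>lborel)"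
  have main: "norm (?I n (- y) - ?I n y - ?r) \<le> 4 * y * K * exp (- d * real n)" if n: "n \<ge> 1" for n
  proof -
    let ?R = "real n"
    let ?a = "Complex (- ?R) (- y)" and ?b = "Complex ?R (- y)" and ?c = "Complex ?R y" and ?d = "Complex (- ?R) y"
    have sub: "closed_segment ?a ?b \<subseteq> A - {0}" "closed_segment ?b ?c \<subseteq> A - {0}"
       "closed_segment ?c ?d \<subseteq> A - {0}" "closed_segment ?d ?a \<subseteq> A - {0}" "closed_segment ?d ?c \<subseteq> A - {0}"
      using y n by (auto simp: A_def closed_segment_same_Re closed_segment_same_Im closed_segment_eq_real_ivl split: if_splits)
    have int: "?f contour_integrable_on linepath p q" if "closed_segment p q \<subseteq> A - {0}" for p q
      using that by (intro contour_integrable_continuous_linepath holomorphic_on_imp_continuous_on holomorphic_on_subset[OF hol])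
    have rp: "rectpath ?a ?c = linepath ?a ?b +++ linepath ?b ?c +++ linepath ?c ?d +++ linepath ?d ?a"
      by (simp add: rectpath_def Let_def)
    have pathim: "path_image (rectpath ?a ?c) \<subseteq> A - {0}"
      unfolding rp using sub by (simp add: path_image_join)
    have "contour_integral (rectpath ?a ?c) ?f = 2 * pi * \<i> * (\<Sum>p\<in>{0}. winding_number (rectpath ?a ?c) p * residue ?f p)"
    proof (rule Residue_theorem[OF A(1) convex_connected[OF A(2)]])
      show "\<forall>w. w \<notin> A \<longrightarrow> winding_number (rectpath ?a ?c) w = 0"
        using y by (auto intro!: winding_number_rectpath_outside simp: A_def in_cbox_complex_iff)
    qed (use hol pathim in auto)
    also have "\<dots> = ?r"
      using y n by (simp add: winding_number_rectpath in_box_complex_iff)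
    finally have 1: "contour_integral (rectpath ?a ?c) ?f = ?r" .
    have "contour_integral (rectpath ?a ?c) ?f = contour_integral (linepath ?a ?b) ?f + (contour_integral (linepath ?b ?c) ?f +
        (contour_integral (linepath ?c ?d) ?f + contour_integral (linepath ?d ?a) ?f))"
      unfolding rp using sub by (simp add: int contour_integrable_joinI valid_path_join)
    moreover have "contour_integral (linepath ?c ?d) ?f = - contour_integral (linepath ?d ?c) ?f"
      using contour_integral_reverse_linepath[of ?d ?c ?f] sub(5) holomorphic_on_imp_continuous_on[OF holomorphic_on_subset[OF hol]] by simp
    moreover have "contour_integral (linepath ?a ?b) ?f = ?I n (- y)" "contour_integral (linepath ?d ?c) ?f = ?I n y"
      using n contour_integral_horizontal[OF cont, of "- y" n] contour_integral_horizontal[OF cont, of y n] by simp_all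
    moreover have side: "norm (contour_integral (linepath p q) ?f) \<le> (K * exp (- d * real n)) * norm (q - p)"
      if "(p, q) \<in> {(?b, ?c), (?d, ?a)}" for p q
    proof (rule contour_integral_bound_linepath)
      fix w assume "w \<in> closed_segment p q"
      then have w: "\<bar>Re w\<bar> = real n" "\<bar>Im w\<bar> \<le> y"
        using that y by (auto simp: closed_segment_same_Re closed_segment_eq_real_ivl split: if_splits)
      have "norm (?f w) \<le> 4 / ((1 - exp (- 2 * b)) * (1 - exp (- 2 / b))) * exp (2 * Re z * Im w) * exp (- d * \<bar>Re w\<bar>)"
        using w n by (intro qker_bound_side b) (auto simp: d_def)
      also have "\<dots> \<le> K * exp (- d * real n)"
        unfolding K_def w(1)
      proof (intro mult_right_mono mult_left_mono)
        have "Re z * Im w \<le> \<bar>Re z\<bar> * \<bar>Im w\<bar>" by (metis abs_ge_self abs_mult)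
        also have "\<dots> \<le> \<bar>Re z\<bar> * y" using w by (intro mult_left_mono) auto
        finally show "exp (2 * Re z * Im w) \<le> exp (2 * \<bar>Re z\<bar> * y)" by simp
      qed (use b in auto)
      finally show "norm (?f w) \<le> K * exp (- d * real n)" .
    qed (use that sub int K0 in auto)
    moreover have "norm (?c - ?b) = 2 * y" "norm (?a - ?d) = 2 * y"
    proof -
      have "?c - ?b = of_real (2 * y) * \<i>" "?a - ?d = of_real (- 2 * y) * \<i>" by (simp_all add: complex_eq_iff)
      then show "norm (?c - ?b) = 2 * y" "norm (?a - ?d) = 2 * y" using y by (simp_all only: norm_mult norm_of_real norm_ii)
    qed
    moreover note side[of ?b ?c] side[of ?d ?a]
    ultimately have eq: "?r = ?I n (- y) - ?I n y + (contour_integral (linepath ?b ?c) ?f + contour_integral (linepath ?d ?a) ?f)"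
      and le: "norm (contour_integral (linepath ?b ?c) ?f) \<le> K * exp (- d * real n) * (2 * y)"
      "norm (contour_integral (linepath ?d ?a) ?f) \<le> K * exp (- d * real n) * (2 * y)"
      using 1 by simp_all
    have "?I n (- y) - ?I n y - ?r = - (contour_integral (linepath ?b ?c) ?f + contour_integral (linepath ?d ?a) ?f)"
      unfolding eq by simp
    then have "norm (?I n (- y) - ?I n y - ?r) = norm (contour_integral (linepath ?b ?c) ?f + contour_integral (linepath ?d ?a) ?f)"
      by (simp only: norm_minus_cancel)
    also have "\<dots> \<le> norm (contour_integral (linepath ?b ?c) ?f) + norm (contour_integral (linepath ?d ?a) ?f)"
      by (rule norm_triangle_ineq)
    finally show ?thesis using le by (simp add: algebra_simps)
  qed
  have "(\<lambda>n. ?I n (- y) - ?I n y - ?r) \<longlonglongrightarrow> 0"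
  proof (rule Lim_null_comparison)
    show "eventually (\<lambda>n. norm (?I n (- y) - ?I n y - ?r) \<le> 4 * y * K * exp (- d * real n)) sequentially"
      using main by (intro eventually_sequentiallyI[of 1]) auto
    show "(\<lambda>n. 4 * y * K * exp (- d * real n)) \<longlonglongrightarrow> 0"
      using d by real_asymp
  qed
  moreover have "(\<lambda>n. ?I n (- y) - ?I n y - ?r) \<longlonglongrightarrow>
      (\<integral>u. ?f (Complex u (- y)) \<partial>lborel) - (\<integral>u. ?f (Complex u y) \<partial>lborel) - ?r"
    using y by (intro tendsto_intros tendsto_integral_symmetric qker_integrable b z) auto
  ultimately show ?thesis
    using LIMSEQ_unique by fastforce
qed

section \<open>Growth and holomorphy of the quantum dilogarithm in its strip\<close>

lemma norm_qker_integral_le: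
  assumes b: "0 < b" and y: "0 < \<bar>y\<bar>" "\<bar>y\<bar> \<le> height b" and z: "2 * \<bar>Im z\<bar> \<le> (b + 1 / b) - d" and d: "d > 0"
    and s: "Re z * y \<le> 0"
  shows "cmod (\<integral>u. qker b z (Complex u y) \<partial>lborel) \<le> qker_const b y * (\<integral>u. exp (- d * \<bar>u\<bar>) \<partial>lborel)"
proof -
  have zi: "\<bar>Im z\<bar> < (b + 1 / b) / 2" using z d by simp
  have "cmod (\<integral>u. qker b z (Complex u y) \<partial>lborel) \<le> (\<integral>u. cmod (qker b z (Complex u y)) \<partial>lborel)"
    by (rule integral_norm_bound)
  also have "\<dots> \<le> (\<integral>u. qker_const b y * exp (- d * \<bar>u\<bar>) \<partial>lborel)"
  proof (rule integral_mono)
    show "integrable lborel (\<lambda>u. cmod (qker b z (Complex u y)))"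
      by (intro integrable_norm qker_integrable b y zi)
    show "integrable lborel (\<lambda>u. qker_const b y * exp (- d * \<bar>u\<bar>))"
      by (intro integrable_mult_right integrable_exp_abs d)
    fix u :: real
    have "cmod (qker b z (Complex u y)) \<le> qker_const b y * exp (2 * (Re z * y)) * exp (- d * \<bar>u\<bar>)"
      using qker_bound_decay[of b "Complex u y" z d] b y z by (simp add: mult.assoc)
    also have "\<dots> \<le> qker_const b y * 1 * exp (- d * \<bar>u\<bar>)"
      using s by (intro mult_right_mono mult_left_mono) (auto simp: qker_const_def mult.commute)
    finally show "cmod (qker b z (Complex u y)) \<le> qker_const b y * exp (- d * \<bar>u\<bar>)" by simp
  qed
  also have "\<dots> = qker_const b y * (\<integral>u. exp (- d * \<bar>u\<bar>) \<partial>lborel)" by simp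
  finally show ?thesis .
qed

text \<open>
  For \<open>Re z \<le> 0\<close> the integral over a line above \<open>0\<close> is bounded, hence so is \<open>ln \<bar>\<Phi>\<^sub>b(z)\<bar>\<close>. For \<open>Re z \<ge> 0\<close> a
  line below \<open>0\<close> does the same, and the crossed residue \<open>- 2 z\<^sup>2 + \<kappa>\<close> contributes
  \<open>- 1/4 \<cdot> Re (2 \<pi> i (- 2 z\<^sup>2)) = - 2 \<pi> Re z Im z\<close>. Everything that follows about convergence rests on this
  estimate, which is uniform in every closed smaller strip.
\<close>

lemma ln_norm_qdilog_bound:
  assumes b: "0 < b" and y0: "y0 < (b + 1 / b) / 2"
  obtains K where "\<And>z. \<bar>Im z\<bar> \<le> y0 \<Longrightarrow> \<bar>ln (cmod (qdilog b z)) + 2 * pi * (max 0 (Re z) * Im z)\<bar> \<le> K"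
proof -
  define y where "y = height b / 2"
  have y: "0 < y" "y < height b" using height_pos[OF b] by (auto simp: y_def)
  define d where "d = (b + 1 / b) - 2 * y0"
  have d: "d > 0" using y0 by (simp add: d_def field_simps)
  obtain \<kappa> where \<kappa>: "\<And>z. residue (qker b z) 0 = - 2 * z\<^sup>2 + \<kappa>" using qker_residue[OF b] by metis
  define E where "E = (\<integral>u. exp (- d * \<bar>u\<bar>) \<partial>lborel)"
  define I where "I = (\<lambda>z s. \<integral>u. qker b z (Complex u s) \<partial>lborel)"
  have sym: "qker_const b (- y) = qker_const b y" by (simp add: qker_const_def)
  show ?thesis
  proof (rule that)
    fix z assume z: "\<bar>Im z\<bar> \<le> y0"
    then have z': "2 * \<bar>Im z\<bar> \<le> (b + 1 / b) - d" "\<bar>Im z\<bar> < (b + 1 / b) / 2" using y0 by (auto simp: d_def)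
    have ln: "ln (cmod (qdilog b z)) = Re (I z y) / 4"
      unfolding qdilog_eq_exp_line[OF b y z'(2)] I_def by simp
    show "\<bar>ln (cmod (qdilog b z)) + 2 * pi * (max 0 (Re z) * Im z)\<bar> \<le> qker_const b y * E + pi / 2 * \<bar>Im \<kappa>\<bar>"
    proof (cases "Re z \<le> 0")
      case True
      have "cmod (I z y) \<le> qker_const b y * E"
        unfolding I_def E_def using True y by (intro norm_qker_integral_le b z' d) (auto simp: mult_nonpos_nonneg)
      then have "\<bar>Re (I z y)\<bar> \<le> qker_const b y * E" using abs_Re_le_cmod order_trans by blast
      moreover have "0 \<le> pi / 2 * \<bar>Im \<kappa>\<bar>" by simp
      moreover have "ln (cmod (qdilog b z)) + 2 * pi * (max 0 (Re z) * Im z) = Re (I z y) / 4"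
        using True by (simp add: ln max_def)
      ultimately show ?thesis by linarith
    next
      case False
      have "cmod (I z (- y)) \<le> qker_const b y * E"
        unfolding I_def E_def sym[symmetric] using False y by (intro norm_qker_integral_le b z' d) (auto simp: mult_nonneg_nonpos)
      then have 1: "\<bar>Re (I z (- y))\<bar> \<le> qker_const b y * E" using abs_Re_le_cmod order_trans by blast
      \<comment> \<open>The formula for \<open>\<Phi>\<^sub>b\<close> uses a line above \<open>0\<close>; passing to the line below crosses the pole.\<close>
      have "I z y = I z (- y) - 2 * pi * \<i> * (- 2 * z\<^sup>2 + \<kappa>)"
        using qker_line_difference[OF b y z'(2)] \<kappa>[of z] unfolding I_def by (simp add: algebra_simps)
      moreover have "Re (2 * pi * \<i> * (- 2 * z\<^sup>2 + \<kappa>)) = 8 * pi * (Re z * Im z) - 2 * pi * Im \<kappa>"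
        by (simp add: power2_eq_square algebra_simps)
      ultimately have "Re (I z y) = Re (I z (- y)) - 8 * pi * (Re z * Im z) + 2 * pi * Im \<kappa>"
        by (simp only: minus_complex.sel)
      then have "ln (cmod (qdilog b z)) + 2 * pi * (max 0 (Re z) * Im z) = Re (I z (- y)) / 4 + pi / 2 * Im \<kappa>"
        using False unfolding ln by (simp add: field_simps)
      also have "\<bar>\<dots>\<bar> \<le> \<bar>Re (I z (- y))\<bar> + \<bar>pi / 2 * Im \<kappa>\<bar>" by linarith
      also have "\<dots> \<le> qker_const b y * E + pi / 2 * \<bar>Im \<kappa>\<bar>" using 1 by (simp add: abs_mult)
      finally show ?thesis .
    qed
  qed
qed

lemma norm_exp_minus_one_le: "norm (exp v - 1 :: complex) \<le> norm v * exp (norm v)"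
  using Taylor_exp_field[of v 0] by (simp add: mult.commute)

text \<open>
  Differentiation under the integral sign, with domination of the difference quotients for all
  increments of modulus at most \<open>r\<close>. Of the two factors \<open>exp (r \<bar>\<phi>\<bar>)\<close> in the integrability hypothesis
  one bounds the exponential of the increment and the other absorbs the derivative \<open>\<phi>\<close> itself.
\<close>

lemma has_field_derivative_integral_exp:
  fixes \<phi> \<kappa> :: "real \<Rightarrow> complex" and z0 :: complex
  assumes [measurable]: "\<phi> \<in> borel_measurable borel" "\<kappa> \<in> borel_measurable borel"
    and r: "r > 0"
    and int: "integrable lborel (\<lambda>u. exp (2 * r * norm (\<phi> u)) * norm (exp (z0 * \<phi> u) * \<kappa> u))"
  shows "((\<lambda>z. \<integral>u. exp (z * \<phi> u) * \<kappa> u \<partial>lborel) has_field_derivative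
            (\<integral>u. \<phi> u * (exp (z0 * \<phi> u) * \<kappa> u) \<partial>lborel)) (at z0)"
  unfolding has_field_derivative_iff tendsto_at_iff_sequentially comp_def
proof (intro allI impI)
  let ?g = "\<lambda>u. exp (z0 * \<phi> u) * \<kappa> u"
  let ?w = "\<lambda>u. exp (2 * r * norm (\<phi> u)) * norm (?g u)"
  let ?f = "\<lambda>z. \<integral>u. exp (z * \<phi> u) * \<kappa> u \<partial>lborel"
  fix X assume X: "\<forall>i. X i \<in> UNIV - {z0}" "X \<longlonglongrightarrow> z0"
  obtain N where N: "\<And>i. i \<ge> N \<Longrightarrow> dist (X i) z0 < r"
    using X(2) r unfolding lim_sequentially by blast
  define h where "h = (\<lambda>i. X (i + N) - z0)"
  have h: "h i \<noteq> 0" "norm (h i) \<le> r" for i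
    using X(1) N[of "i + N"] by (auto simp: h_def dist_norm less_imp_le)
  have h0: "h \<longlonglongrightarrow> 0"
    unfolding h_def using LIMSEQ_ignore_initial_segment[OF X(2), of N] by (simp add: LIM_zero)
  have split: "exp (X (i + N) * \<phi> u) * \<kappa> u = exp (h i * \<phi> u) * ?g u" for i u
    by (simp add: h_def algebra_simps exp_diff)
  have e: "norm (exp (h i * \<phi> u)) \<le> exp (2 * r * norm (\<phi> u))" for i u
  proof -
    have "norm (exp (h i * \<phi> u)) \<le> exp (norm (h i * \<phi> u))" by (rule norm_exp)
    also have "norm (h i * \<phi> u) \<le> (2 * r) * norm (\<phi> u)"
      unfolding norm_mult using h(2)[of i] r by (intro mult_right_mono) auto
    finally show ?thesis by (simp add: mult.assoc)
  qed
  have i0: "integrable lborel ?g"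
  proof (rule Bochner_Integration.integrable_bound[OF int])
    show "AE u in lborel. norm (?g u) \<le> norm (?w u)"
      using r mult_right_mono[of 1 "exp (2 * r * norm (\<phi> _))" "norm (?g _)"] by (intro AE_I2) simp
  qed measurable
  have ih: "integrable lborel (\<lambda>u. exp (h i * \<phi> u) * ?g u)" for i
  proof (rule Bochner_Integration.integrable_bound[OF int])
    show "AE u in lborel. norm (exp (h i * \<phi> u) * ?g u) \<le> norm (?w u)"
      using mult_right_mono[OF e norm_ge_zero[of "?g _"], of i] by (intro AE_I2) (simp add: norm_mult[of "exp (h i * \<phi> _)"])
  qed measurable
  have quot: "(?f (X (i + N)) - ?f z0) / (X (i + N) - z0) = (\<integral>u. (exp (h i * \<phi> u) - 1) / h i * ?g u \<partial>lborel)" for i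
  proof -
    have "(\<integral>u. (exp (h i * \<phi> u) - 1) / h i * ?g u \<partial>lborel) = (\<integral>u. (exp (h i * \<phi> u) * ?g u - ?g u) / h i \<partial>lborel)"
      by (intro Bochner_Integration.integral_cong refl) (simp add: left_diff_distrib diff_divide_distrib)
    also have "\<dots> = ((\<integral>u. exp (h i * \<phi> u) * ?g u \<partial>lborel) - ?f z0) / h i"
      using ih[of i] i0 by simp
    finally have "(\<integral>u. (exp (h i * \<phi> u) - 1) / h i * ?g u \<partial>lborel) = ((\<integral>u. exp (h i * \<phi> u) * ?g u \<partial>lborel) - ?f z0) / h i" .
    moreover have "X (i + N) - z0 = h i" by (simp add: h_def)
    ultimately show ?thesis unfolding split by (simp only:)
  qed
  have "(\<lambda>i. \<integral>u. (exp (h i * \<phi> u) - 1) / h i * ?g u \<partial>lborel) \<longlonglongrightarrow> (\<integral>u. \<phi> u * ?g u \<partial>lborel)"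
  proof (rule integral_dominated_convergence[where w = "\<lambda>u. ?w u / r"])
    show "integrable lborel (\<lambda>u. ?w u / r)" using int by simp
    show "AE u in lborel. (\<lambda>i. (exp (h i * \<phi> u) - 1) / h i * ?g u) \<longlonglongrightarrow> \<phi> u * ?g u"
    proof (intro AE_I2 tendsto_mult tendsto_const)
      fix u
      have "((\<lambda>y. exp (y * \<phi> u)) has_field_derivative exp (0 * \<phi> u) * \<phi> u) (at 0)"
        using DERIV_chain2[OF DERIV_exp DERIV_cmult_Id[of "\<phi> u" 0 UNIV]] by (simp add: mult.commute)
      then have "((\<lambda>y. (exp (y * \<phi> u) - 1) / y) \<longlongrightarrow> \<phi> u) (at 0)"
        by (simp add: has_field_derivative_iff)
      then show "(\<lambda>i. (exp (h i * \<phi> u) - 1) / h i) \<longlonglongrightarrow> \<phi> u"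
        by (rule filterlim_compose) (use h h0 in \<open>auto intro!: filterlim_atI\<close>)
    qed
    fix i
    show "AE u in lborel. norm ((exp (h i * \<phi> u) - 1) / h i * ?g u) \<le> ?w u / r"
    proof (rule AE_I2)
      fix u
      have "norm ((exp (h i * \<phi> u) - 1) / h i) \<le> norm (\<phi> u) * exp (norm (h i) * norm (\<phi> u))"
        using norm_exp_minus_one_le[of "h i * \<phi> u"] h(1)[of i] by (simp add: norm_divide norm_mult field_simps)
      also have "\<dots> \<le> norm (\<phi> u) * exp (r * norm (\<phi> u))"
        using h(2)[of i] by (intro mult_left_mono) (auto intro: mult_right_mono)
      also have "\<dots> \<le> (exp (r * norm (\<phi> u)) / r) * exp (r * norm (\<phi> u))"
      proof (intro mult_right_mono)
        have "r * norm (\<phi> u) \<le> exp (r * norm (\<phi> u))"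
          using exp_ge_add_one_self[of "r * norm (\<phi> u)"] by linarith
        then show "norm (\<phi> u) \<le> exp (r * norm (\<phi> u)) / r" using r by (simp add: field_simps)
      qed simp
      also have "\<dots> = exp (2 * r * norm (\<phi> u)) / r"
        by (simp add: exp_add[symmetric])
      finally have "norm ((exp (h i * \<phi> u) - 1) / h i) * norm (?g u) \<le> exp (2 * r * norm (\<phi> u)) / r * norm (?g u)"
        by (rule mult_right_mono) simp
      then show "norm ((exp (h i * \<phi> u) - 1) / h i * ?g u) \<le> ?w u / r"
        unfolding norm_mult[of "(exp (h i * \<phi> u) - 1) / h i"] by simp
    qed
  qed measurable
  then have "(\<lambda>i. (?f (X (i + N)) - ?f z0) / (X (i + N) - z0)) \<longlonglongrightarrow> (\<integral>u. \<phi> u * ?g u \<partial>lborel)"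
    unfolding quot .
  then show "(\<lambda>i. (?f (X i) - ?f z0) / (X i - z0)) \<longlonglongrightarrow> (\<integral>u. \<phi> u * ?g u \<partial>lborel)"
    by (rule LIMSEQ_offset)
qed

lemma qdilog_holomorphic:
  assumes b: "0 < b"
  shows "qdilog b holomorphic_on {z. \<bar>Im z\<bar> < (b + 1 / b) / 2}"
proof -
  define y where "y = height b / 2"
  have y: "0 < y" "y < height b" using height_pos[OF b] by (auto simp: y_def)
  define \<phi> where "\<phi> = (\<lambda>u. - 2 * \<i> * Complex u y)"
  define \<kappa> where "\<kappa> = (\<lambda>u. qker b 0 (Complex u y))"
  have ker: "qker b z (Complex u y) = exp (z * \<phi> u) * \<kappa> u" for z u
    by (simp add: qker_def \<phi>_def \<kappa>_def mult_ac)
  have [measurable]: "\<phi> \<in> borel_measurable borel" "\<kappa> \<in> borel_measurable borel"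
  proof -
    have "continuous_on UNIV \<phi>" unfolding \<phi>_def Complex_eq by (intro continuous_intros)
    then show "\<phi> \<in> borel_measurable borel" by (rule borel_measurable_continuous_onI)
    have "continuous_on UNIV \<kappa>" unfolding \<kappa>_def using y b by (intro qker_continuous_line) auto
    then show "\<kappa> \<in> borel_measurable borel" by (rule borel_measurable_continuous_onI)
  qed
  have "(\<lambda>z. \<integral>u. exp (z * \<phi> u) * \<kappa> u \<partial>lborel) holomorphic_on {z. \<bar>Im z\<bar> < (b + 1 / b) / 2}"
  proof (rule holomorphic_onI, rule field_differentiable_at_within, unfold field_differentiable_def, rule exI)
    fix z assume "z \<in> {z. \<bar>Im z\<bar> < (b + 1 / b) / 2}"
    then have z: "\<bar>Im z\<bar> < (b + 1 / b) / 2" by simp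
    define d where "d = (b + 1 / b) - 2 * \<bar>Im z\<bar>"
    have d: "d > 0" using z by (simp add: d_def field_simps)
    \<comment> \<open>As \<open>\<bar>\<phi> u\<bar> \<le> 2 (\<bar>u\<bar> + y)\<close>, the factor \<open>exp (2 r \<bar>\<phi> u\<bar>)\<close> costs half of the decay rate \<open>d\<close>.\<close>
    define r where "r = d / 8"
    have r: "r > 0" using d by (simp add: r_def)
    let ?C = "qker_const b y * exp (2 * Re z * y) * exp (4 * r * y)"
    show "((\<lambda>z. \<integral>u. exp (z * \<phi> u) * \<kappa> u \<partial>lborel) has_field_derivative
            (\<integral>u. \<phi> u * (exp (z * \<phi> u) * \<kappa> u) \<partial>lborel)) (at z)"
    proof (rule has_field_derivative_integral_exp[OF _ _ r])
      show "integrable lborel (\<lambda>u. exp (2 * r * norm (\<phi> u)) * norm (exp (z * \<phi> u) * \<kappa> u))"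
      proof (rule Bochner_Integration.integrable_bound)
        show "integrable lborel (\<lambda>u. ?C * exp (- (d / 2) * \<bar>u\<bar>))"
          using d by (intro integrable_mult_right integrable_exp_abs) auto
        show "AE u in lborel. norm (exp (2 * r * norm (\<phi> u)) * norm (exp (z * \<phi> u) * \<kappa> u)) \<le> norm (?C * exp (- (d / 2) * \<bar>u\<bar>))"
        proof (rule AE_I2)
          fix u :: real
          have "norm (exp (z * \<phi> u) * \<kappa> u) \<le> qker_const b y * exp (2 * Re z * y) * exp (- d * \<bar>u\<bar>)"
            using qker_bound_decay[of b "Complex u y" z d] y b unfolding ker[symmetric] by (simp add: d_def)
          moreover have "exp (2 * r * norm (\<phi> u)) \<le> exp (4 * r * y + d / 2 * \<bar>u\<bar>)"
          proof -
            have "norm (\<phi> u) \<le> 2 * (\<bar>u\<bar> + y)"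
              using cmod_le[of "Complex u y"] y by (simp add: \<phi>_def norm_mult)
            then have "(2 * r) * norm (\<phi> u) \<le> (2 * r) * (2 * (\<bar>u\<bar> + y))" using r by (intro mult_left_mono) auto
            then show ?thesis by (simp add: r_def algebra_simps)
          qed
          ultimately have "exp (2 * r * norm (\<phi> u)) * norm (exp (z * \<phi> u) * \<kappa> u) \<le>
              exp (4 * r * y + d / 2 * \<bar>u\<bar>) * (qker_const b y * exp (2 * Re z * y) * exp (- d * \<bar>u\<bar>))"
            by (intro mult_mono) auto
          also have "\<dots> = ?C * exp (d / 2 * \<bar>u\<bar> + - d * \<bar>u\<bar>)" by (simp only: exp_add mult_ac)
          also have "d / 2 * \<bar>u\<bar> + - d * \<bar>u\<bar> = - (d / 2) * \<bar>u\<bar>" by simp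
          finally show "norm (exp (2 * r * norm (\<phi> u)) * norm (exp (z * \<phi> u) * \<kappa> u)) \<le> norm (?C * exp (- (d / 2) * \<bar>u\<bar>))"
            by (simp add: abs_mult qker_const_def)
        qed
      qed measurable
    qed measurable
  qed
  then have "(\<lambda>z. exp (1 / 4 * (\<integral>u. qker b z (Complex u y) \<partial>lborel))) holomorphic_on {z. \<bar>Im z\<bar> < (b + 1 / b) / 2}"
    unfolding ker by (intro holomorphic_intros)
  then show ?thesis
    by (rule holomorphic_transform) (use qdilog_eq_exp_line[OF b y] in auto)
qed

lemma qdilog_nonzero: "0 < b \<Longrightarrow> \<bar>Im z\<bar> < (b + 1 / b) / 2 \<Longrightarrow> qdilog b z \<noteq> 0"
  using qdilog_eq_exp_line[of b "height b / 2" z] height_pos[of b] by simp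

section \<open>Fourier transforms of Schwartz functions\<close>

lemma integrable_inverse_one_plus_square: "integrable lborel (\<lambda>x::real. 1 / (1 + x\<^sup>2))"
  using integrable_inverse_1_plus_square by (simp add: set_integrable_def divide_inverse)

definition fourier :: "(real \<Rightarrow> complex) \<Rightarrow> real \<Rightarrow> complex" where
  "fourier f \<xi> = (\<integral>w. exp (- 2 * of_real pi * \<i> * of_real (\<xi> * w)) * f w \<partial>lborel)"

text \<open>
  The regularised delta is the Fourier transform of the cut-off at scale \<open>\<epsilon>\<close>. Its argument has to be
  measured in units of \<open>\<epsilon>\<close>, and then the factor \<open>1/\<epsilon>\<close> is the Jacobian of this rescaling.
\<close>

lemma delta_cutoff_scaled:
  assumes "\<epsilon> > 0"
  shows "delta_cutoff \<psi> \<epsilon> (\<epsilon> * z) = fourier \<psi> z / of_real \<epsilon>"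
proof -
  have "fourier \<psi> z = \<epsilon> *\<^sub>R delta_cutoff \<psi> \<epsilon> (\<epsilon> * z)"
    unfolding fourier_def delta_cutoff_def
    using lborel_integral_real_affine[of \<epsilon> "\<lambda>w. exp (- 2 * of_real pi * \<i> * of_real (z * w)) * \<psi> w" 0] assms
    by (simp add: mult_ac)
  then show ?thesis using assms by (simp add: scaleR_conv_of_real)
qed

lemma norm_cis_factor: "norm (exp (- 2 * of_real pi * \<i> * of_real x)) = 1"
proof -
  have "- 2 * of_real pi * \<i> * of_real x = \<i> * of_real (- 2 * pi * x)" by simp
  then show ?thesis by (simp only: norm_exp_i_times)
qed

lemma schwartz_decay:
  assumes "\<And>k m. bounded (range (\<lambda>x. x ^ k *\<^sub>R (D :: nat \<Rightarrow> real \<Rightarrow> complex) m x))"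
  obtains C where "C \<ge> 0" "\<And>x. norm (D m x) \<le> C / (1 + x\<^sup>2)"
proof -
  obtain C0 where C0: "\<And>x. norm (D m x) \<le> C0"
    using assms[of 0 m] by (auto simp: bounded_iff)
  obtain C2 where C2: "\<And>x. x\<^sup>2 * norm (D m x) \<le> C2"
    using assms[of 2 m] by (auto simp: bounded_iff)
  have pos: "1 + x\<^sup>2 > 0" for x :: real by (simp add: add_pos_nonneg)
  have "norm (D m x) \<le> (C0 + C2) / (1 + x\<^sup>2)" for x
    using C0[of x] C2[of x] pos[of x] by (simp add: pos_le_divide_eq algebra_simps)
  moreover have "C0 + C2 \<ge> 0" using order_trans[OF norm_ge_zero C0[of 0]] C2[of 0] by simp
  ultimately show ?thesis using that by blast
qed

lemma integrable_decay:
  fixes f :: "real \<Rightarrow> complex"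
  assumes "f \<in> borel_measurable borel" "\<And>x. norm (f x) \<le> C / (1 + x\<^sup>2)"
  shows "integrable lborel f"
proof (rule Bochner_Integration.integrable_bound)
  show "integrable lborel (\<lambda>x. C * (1 / (1 + x\<^sup>2)))"
    by (intro integrable_mult_right integrable_inverse_one_plus_square)
  show "AE x in lborel. norm (f x) \<le> norm (C * (1 / (1 + x\<^sup>2)))"
  proof (rule AE_I2)
    fix x
    have "norm (f x) \<le> C * (1 / (1 + x\<^sup>2))" using assms(2)[of x] by simp
    then show "norm (f x) \<le> norm (C * (1 / (1 + x\<^sup>2)))" by (simp only: real_norm_def)
  qed
qed (use assms in simp)

lemma fourier_measurable:
  assumes [measurable]: "f \<in> borel_measurable borel"
  shows "fourier f \<in> borel_measurable borel"
  unfolding fourier_def by measurable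

lemma norm_fourier_le:
  assumes "integrable lborel f"
  shows "norm (fourier f \<xi>) \<le> (\<integral>w. norm (f w) \<partial>lborel)"
proof -
  have "norm (fourier f \<xi>) \<le> (\<integral>w. norm (exp (- 2 * of_real pi * \<i> * of_real (\<xi> * w)) * f w) \<partial>lborel)"
    unfolding fourier_def by (rule integral_norm_bound)
  then show ?thesis by (simp only: norm_mult norm_cis_factor mult_1)
qed

lemma fourier_deriv:
  fixes f f' :: "real \<Rightarrow> complex"
  assumes f: "integrable lborel f" and f': "integrable lborel f'" "continuous_on UNIV f'"
    and d: "\<And>x. (f has_vector_derivative f' x) (at x)"
    and lim: "(\<lambda>n. f (real n)) \<longlonglongrightarrow> 0" "(\<lambda>n. f (- real n)) \<longlonglongrightarrow> 0"
  shows "fourier f' \<xi> = 2 * of_real pi * \<i> * of_real \<xi> * fourier f \<xi>"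
proof -
  let ?c = "- 2 * of_real pi * \<i> * of_real \<xi>"
  let ?e = "\<lambda>w. exp (- 2 * of_real pi * \<i> * of_real (\<xi> * w))"
  let ?g = "\<lambda>w. ?e w * f w" and ?g' = "\<lambda>w. ?e w * f' w + ?c * (?e w * f w)"
  have [measurable]: "?e \<in> borel_measurable borel" by measurable
  have contf: "continuous_on UNIV f"
    by (intro continuous_at_imp_continuous_on ballI) (use d has_vector_derivative_continuous in blast)
  have ie: "integrable lborel (\<lambda>w. ?e w * h w)" if "integrable lborel h" for h :: "real \<Rightarrow> complex"
  proof (rule Bochner_Integration.integrable_bound[OF that])
    show "(\<lambda>w. ?e w * h w) \<in> borel_measurable lborel" using that by measurable
    show "AE w in lborel. norm (?e w * h w) \<le> norm (h w)" by (simp only: norm_mult norm_cis_factor mult_1) simp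
  qed
  have ig': "integrable lborel ?g'" by (intro Bochner_Integration.integrable_add integrable_mult_right ie f f')
  have de: "(?e has_vector_derivative ?c * ?e w) (at w)" for w
  proof -
    have "((\<lambda>z. exp (?c * z)) has_field_derivative exp (?c * of_real w) * ?c) (at (of_real w))"
      using DERIV_chain2[OF DERIV_exp DERIV_cmult_Id[of "?c" "of_real w" UNIV]] by (simp only: mult.commute)
    from has_vector_derivative_real_field[OF this] show ?thesis
      by (simp add: mult_ac)
  qed
  have dg: "(?g has_vector_derivative ?g' w) (at w)" for w
    using has_vector_derivative_mult[OF de[of w] d[of w]] by (simp add: algebra_simps)
  have l1: "(\<lambda>n. \<integral>w. indicator {- real n..real n} w *\<^sub>R ?g' w \<partial>lborel) \<longlonglongrightarrow> (\<integral>w. ?g' w \<partial>lborel)"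
    by (rule tendsto_integral_symmetric[OF ig'])
  have ftc: "(\<integral>w. indicator {- real n..real n} w *\<^sub>R ?g' w \<partial>lborel) = ?g (real n) - ?g (- real n)" for n
  proof (rule integral_FTC_Icc)
    show "continuous_on {- real n..real n} ?g'"
      by (intro continuous_intros continuous_on_subset[OF contf] continuous_on_subset[OF f'(2)]) auto
    show "(?g has_vector_derivative ?g' w) (at w within {- real n..real n})" for w
      by (rule has_vector_derivative_at_within[OF dg])
  qed simp
  have l2: "(\<lambda>n. ?g (real n) - ?g (- real n)) \<longlonglongrightarrow> 0 - 0"
  proof (intro tendsto_diff)
    have *: "(\<lambda>n. ?e (s n) * f (s n)) \<longlonglongrightarrow> 0" if "(\<lambda>n. f (s n)) \<longlonglongrightarrow> 0" for s :: "nat \<Rightarrow> real"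
    proof (rule Lim_null_comparison)
      show "eventually (\<lambda>n. norm (?e (s n) * f (s n)) \<le> norm (f (s n))) sequentially"
        by (simp only: norm_mult norm_cis_factor mult_1) simp
      show "(\<lambda>n. norm (f (s n))) \<longlonglongrightarrow> 0" using that by (rule tendsto_norm_zero)
    qed
    show "(\<lambda>n. ?g (real n)) \<longlonglongrightarrow> 0" "(\<lambda>n. ?g (- real n)) \<longlonglongrightarrow> 0" using *[OF lim(1)] *[OF lim(2)] by auto
  qed
  have "(\<integral>w. ?g' w \<partial>lborel) = 0 - 0"
    by (rule LIMSEQ_unique[OF l1[unfolded ftc] l2])
  moreover have "(\<integral>w. ?g' w \<partial>lborel) = fourier f' \<xi> + ?c * fourier f \<xi>"
    unfolding fourier_def integral_mult_right_zero[symmetric]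
    by (rule Bochner_Integration.integral_add) (intro integrable_mult_right ie f f')+
  ultimately have "fourier f' \<xi> = - (?c * fourier f \<xi>)" by (simp only: eq_neg_iff_add_eq_0 diff_self)
  then show ?thesis by simp
qed

text \<open>
  The transform of the second derivative of \<open>\<psi>\<close> is bounded, so that of \<open>\<psi>\<close> decays like \<open>1/\<xi>\<^sup>2\<close> and is
  integrable, as is required of the dominating function in \<open>delta_cutoff_limit\<close>.
\<close>

lemma fourier_schwartz:
  assumes "schwartz \<psi>"
  shows "continuous_on UNIV \<psi>" "integrable lborel \<psi>" "bounded (range \<psi>)" "integrable lborel (fourier \<psi>)"
    "bounded (range (fourier \<psi>))"
proof -
  obtain D where D: "D 0 = \<psi>" "\<And>m x. (D m has_vector_derivative D (Suc m) x) (at x)"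
    and bd: "\<And>k m. bounded (range (\<lambda>x. x ^ k *\<^sub>R (D :: nat \<Rightarrow> real \<Rightarrow> complex) m x))"
    using assms unfolding schwartz_def by blast
  have cont: "continuous_on UNIV (D m)" for m
    by (intro continuous_at_imp_continuous_on ballI) (use D(2) has_vector_derivative_continuous in blast)
  then have [measurable]: "D m \<in> borel_measurable borel" for m by (rule borel_measurable_continuous_onI)
  have int: "integrable lborel (D m)" for m
    using schwartz_decay[of D m, OF bd] integrable_decay[of "D m"] by auto
  have lim: "(\<lambda>n. D m (s * real n)) \<longlonglongrightarrow> 0" if "s \<in> {1, -1}" for m and s :: real
  proof -
    obtain C where C: "\<And>x. norm (D m x) \<le> C / (1 + x\<^sup>2)" using schwartz_decay[of D m, OF bd] by metis
    show ?thesis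
    proof (rule Lim_null_comparison)
      show "eventually (\<lambda>n. norm (D m (s * real n)) \<le> C / (1 + (real n)\<^sup>2)) sequentially"
        using C[of "s * real _"] that by (auto simp: power_mult_distrib)
      show "(\<lambda>n. C / (1 + (real n)\<^sup>2)) \<longlonglongrightarrow> 0" by real_asymp
    qed
  qed
  have fd: "fourier (D (Suc m)) \<xi> = 2 * of_real pi * \<i> * of_real \<xi> * fourier (D m) \<xi>" for m \<xi>
    using lim[of 1 m] lim[of "-1" m] by (intro fourier_deriv int cont D) auto
  show "continuous_on UNIV \<psi>" "integrable lborel \<psi>" "bounded (range \<psi>)"
    using cont[of 0] int[of 0] bd[of 0 0] D(1) by auto
  define A0 where "A0 = (\<integral>w. norm (D 0 w) \<partial>lborel)"
  define A2 where "A2 = (\<integral>w. norm (D 2 w) \<partial>lborel)"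
  have 0: "norm (fourier \<psi> \<xi>) \<le> A0" for \<xi> unfolding A0_def D(1) using int[of 0] D(1) by (intro norm_fourier_le) auto
  then show "bounded (range (fourier \<psi>))" by (auto simp: bounded_iff)
  have 2: "\<xi>\<^sup>2 * norm (fourier \<psi> \<xi>) \<le> A2" for \<xi>
  proof -
    have "fourier (D 2) \<xi> = (2 * of_real pi * \<i> * of_real \<xi>)\<^sup>2 * fourier \<psi> \<xi>"
      using fd[of 0 \<xi>] fd[of 1 \<xi>] D(1) by (simp add: numeral_2_eq_2 power2_eq_square mult_ac)
    then have "norm (fourier (D 2) \<xi>) = (2 * pi)\<^sup>2 * (\<xi>\<^sup>2 * norm (fourier \<psi> \<xi>))"
      by (simp add: norm_mult norm_power power_mult_distrib)
    moreover have "norm (fourier (D 2) \<xi>) \<le> A2" unfolding A2_def by (intro norm_fourier_le int)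
    moreover have "1 * (\<xi>\<^sup>2 * norm (fourier \<psi> \<xi>)) \<le> (2 * pi)\<^sup>2 * (\<xi>\<^sup>2 * norm (fourier \<psi> \<xi>))"
    proof (intro mult_right_mono)
      have "(1::real) \<le> 2 * pi" using pi_gt3 by simp
      then show "1 \<le> (2 * pi)\<^sup>2" by (rule one_le_power)
    qed auto
    ultimately show ?thesis by simp
  qed
  have pos: "1 + x\<^sup>2 > 0" for x :: real by (simp add: add_pos_nonneg)
  have "norm (fourier \<psi> \<xi>) \<le> (A0 + A2) / (1 + \<xi>\<^sup>2)" for \<xi>
    using 0[of \<xi>] 2[of \<xi>] pos[of \<xi>] by (simp add: pos_le_divide_eq algebra_simps)
  moreover have "fourier \<psi> \<in> borel_measurable borel"
    by (rule fourier_measurable) (use D(1) in \<open>metis \<open>\<And>m. D m \<in> borel_measurable borel\<close>\<close>)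
  ultimately show "integrable lborel (fourier \<psi>)" by (intro integrable_decay)
qed

text \<open>
  The Gaussian is the density of a normal distribution, whose characteristic function is known.
\<close>

lemma fourier_gaussian:
  assumes n: "n > 0"
  shows "(\<integral>\<xi>. exp (- 2 * of_real pi * \<i> * of_real (\<xi> * w)) * of_real (exp (- (\<xi> / n)\<^sup>2 / 2)) \<partial>lborel) =
           of_real (n * sqrt (2 * pi) * exp (- (2 * pi * n * w)\<^sup>2 / 2))"
proof -
  \<comment> \<open>The frequency at which the characteristic function appears after \<open>\<xi> = n x\<close>.\<close>
  let ?t = "- 2 * pi * n * w"
  have "complex_of_real (exp (- (?t\<^sup>2) / 2)) = char std_normal_distribution ?t"
    by (simp add: char_std_normal_distribution)
  also have "\<dots> = (\<integral>x. std_normal_density x *\<^sub>R exp (\<i> * of_real (?t * x)) \<partial>lborel)"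
    unfolding char_def by (subst integral_density) auto
  finally have 1: "(\<integral>x. std_normal_density x *\<^sub>R exp (\<i> * of_real (?t * x)) \<partial>lborel) = complex_of_real (exp (- (?t\<^sup>2) / 2))" by simp
  have "(\<integral>\<xi>. exp (- 2 * of_real pi * \<i> * of_real (\<xi> * w)) * of_real (exp (- (\<xi> / n)\<^sup>2 / 2)) \<partial>lborel) =
        n *\<^sub>R (\<integral>x. exp (- 2 * of_real pi * \<i> * of_real (n * x * w)) * of_real (exp (- x\<^sup>2 / 2)) \<partial>lborel)"
    using lborel_integral_real_affine[of n "\<lambda>\<xi>. exp (- 2 * of_real pi * \<i> * of_real (\<xi> * w)) * complex_of_real (exp (- (\<xi> / n)\<^sup>2 / 2))" 0] n
    by simp
  also have "(\<integral>x. exp (- 2 * of_real pi * \<i> * of_real (n * x * w)) * complex_of_real (exp (- x\<^sup>2 / 2)) \<partial>lborel) =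
      (\<integral>x. sqrt (2 * pi) *\<^sub>R (std_normal_density x *\<^sub>R exp (\<i> * of_real (?t * x))) \<partial>lborel)"
    by (intro Bochner_Integration.integral_cong refl) (simp add: std_normal_density_def scaleR_conv_of_real mult_ac)
  also have "\<dots> = sqrt (2 * pi) *\<^sub>R complex_of_real (exp (- (?t\<^sup>2) / 2))"
    unfolding integral_scaleR_right 1 ..
  finally show ?thesis by (simp add: scaleR_conv_of_real mult_ac power_mult_distrib)
qed

text \<open>
  Gaussian regularisation: with the weight \<open>exp (- (\<xi>/n)\<^sup>2/2)\<close> the double integral may be swapped and
  becomes an average of \<open>\<psi>\<close> against a normal density of width \<open>1/(2 \<pi> n)\<close>.
\<close>

theorem fourier_inversion_at_0:
  assumes "schwartz \<psi>"
  shows "(\<integral>\<xi>. fourier \<psi> \<xi> \<partial>lborel) = \<psi> 0"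
proof -
  note S = fourier_schwartz[OF assms]
  have [measurable]: "\<psi> \<in> borel_measurable borel" by (rule borel_measurable_continuous_onI[OF S(1)])
  have [measurable]: "fourier \<psi> \<in> borel_measurable borel" by (rule fourier_measurable) measurable
  define N where "N = (\<lambda>n. real (Suc n))"
  have N: "N n > 0" for n by (simp add: N_def)
  let ?G = "\<lambda>n \<xi>. complex_of_real (exp (- (\<xi> / N n)\<^sup>2 / 2))"
  let ?e = "\<lambda>\<xi> w. exp (- 2 * of_real pi * \<i> * of_real (\<xi> * w))"
  let ?a = "\<lambda>n. \<integral>\<xi>. fourier \<psi> \<xi> * ?G n \<xi> \<partial>lborel"
  have l1: "?a \<longlonglongrightarrow> (\<integral>\<xi>. fourier \<psi> \<xi> \<partial>lborel)"
  proof (rule integral_dominated_convergence[where w = "\<lambda>\<xi>. norm (fourier \<psi> \<xi>)"])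
    show "AE \<xi> in lborel. (\<lambda>n. fourier \<psi> \<xi> * ?G n \<xi>) \<longlonglongrightarrow> fourier \<psi> \<xi>"
    proof (rule AE_I2)
      fix \<xi> :: real
      have "(\<lambda>n. \<xi> / N n) \<longlonglongrightarrow> 0" unfolding N_def by real_asymp
      then have "(\<lambda>n. fourier \<psi> \<xi> * ?G n \<xi>) \<longlonglongrightarrow> fourier \<psi> \<xi> * of_real (exp (- 0\<^sup>2 / 2))" by (intro tendsto_intros) auto
      then show "(\<lambda>n. fourier \<psi> \<xi> * ?G n \<xi>) \<longlonglongrightarrow> fourier \<psi> \<xi>" by simp
    qed
    show "AE \<xi> in lborel. norm (fourier \<psi> \<xi> * ?G n \<xi>) \<le> norm (fourier \<psi> \<xi>)" for n
      by (intro AE_I2) (simp add: norm_mult mult_left_le)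
  qed (use S in \<open>auto\<close>)
  have e: "?a n = (\<integral>v. of_real (std_normal_density v) * \<psi> (v / (2 * pi * N n)) \<partial>lborel)" for n
  proof -
    have Gint: "integrable lborel (\<lambda>\<xi>. exp (- (\<xi> / N n)\<^sup>2 / 2))"
    proof -
      have "integrable lborel (\<lambda>\<xi>. std_normal_density (0 + (1 / N n) * \<xi>))"
        using N[of n] by (intro lborel_integrable_real_affine) auto
      then have "integrable lborel (\<lambda>\<xi>. sqrt (2 * pi) * std_normal_density ((1 / N n) * \<xi>))"
        by (intro integrable_mult_right) simp
      then show ?thesis by (simp add: std_normal_density_def)
    qed
    have int2: "integrable (lborel \<Otimes>\<^sub>M lborel) (\<lambda>(\<xi>, w). ?e \<xi> w * \<psi> w * ?G n \<xi>)"
    proof (rule lborel_pair.Fubini_integrable)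
      have "(\<integral>w. norm (?e \<xi> w * \<psi> w * ?G n \<xi>) \<partial>lborel) = (\<integral>w. norm (\<psi> w) \<partial>lborel) * exp (- (\<xi> / N n)\<^sup>2 / 2)" for \<xi>
        by (simp only: norm_mult norm_cis_factor mult_1 norm_of_real) simp
      then show "integrable lborel (\<lambda>\<xi>. \<integral>w. norm (case (\<xi>, w) of (\<xi>, w) \<Rightarrow> ?e \<xi> w * \<psi> w * ?G n \<xi>) \<partial>lborel)"
        using Gint by simp
      show "AE \<xi> in lborel. integrable lborel (\<lambda>w. case (\<xi>, w) of (\<xi>, w) \<Rightarrow> ?e \<xi> w * \<psi> w * ?G n \<xi>)"
      proof (rule AE_I2, simp only: prod.case, rule integrable_mult_left)
        fix \<xi> show "integrable lborel (\<lambda>w. ?e \<xi> w * \<psi> w)"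
        proof (rule Bochner_Integration.integrable_bound[OF S(2)])
          show "AE w in lborel. norm (?e \<xi> w * \<psi> w) \<le> norm (\<psi> w)" by (simp only: norm_mult norm_cis_factor mult_1) simp
        qed measurable
      qed
    qed measurable
    have "?a n = (\<integral>\<xi>. (\<integral>w. ?e \<xi> w * \<psi> w * ?G n \<xi> \<partial>lborel) \<partial>lborel)"
      unfolding fourier_def by simp
    also have "\<dots> = (\<integral>w. (\<integral>\<xi>. ?e \<xi> w * \<psi> w * ?G n \<xi> \<partial>lborel) \<partial>lborel)"
      by (rule lborel_pair.Fubini_integral[OF int2, symmetric])
    also have "\<dots> = (\<integral>w. (\<integral>\<xi>. ?e \<xi> w * ?G n \<xi> \<partial>lborel) * \<psi> w \<partial>lborel)"
      by (subst integral_mult_left_zero[symmetric]) (simp add: mult_ac)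
    also have "\<dots> = (\<integral>w. of_real (N n * sqrt (2 * pi) * exp (- (2 * pi * N n * w)\<^sup>2 / 2)) * \<psi> w \<partial>lborel)"
      unfolding fourier_gaussian[OF N] ..
    also have "\<dots> = (1 / (2 * pi * N n)) *\<^sub>R (\<integral>v. of_real (N n * sqrt (2 * pi) * exp (- v\<^sup>2 / 2)) * \<psi> (v / (2 * pi * N n)) \<partial>lborel)"
      using lborel_integral_real_affine[of "1 / (2 * pi * N n)" "\<lambda>w. of_real (N n * sqrt (2 * pi) * exp (- (2 * pi * N n * w)\<^sup>2 / 2)) * \<psi> w" 0] N[of n]
      by simp
    also have "\<dots> = (\<integral>v. (1 / (2 * pi * N n)) *\<^sub>R (of_real (N n * sqrt (2 * pi) * exp (- v\<^sup>2 / 2)) * \<psi> (v / (2 * pi * N n))) \<partial>lborel)"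
      by simp
    also have "\<dots> = (\<integral>v. of_real (std_normal_density v) * \<psi> (v / (2 * pi * N n)) \<partial>lborel)"
    proof (intro Bochner_Integration.integral_cong refl)
      fix v
      have "(1 / (2 * pi * N n)) * (N n * sqrt (2 * pi) * exp (- v\<^sup>2 / 2)) = std_normal_density v"
        using N[of n] by (simp add: std_normal_density_def real_sqrt_mult field_simps)
      then show "(1 / (2 * pi * N n)) *\<^sub>R (of_real (N n * sqrt (2 * pi) * exp (- v\<^sup>2 / 2)) * \<psi> (v / (2 * pi * N n))) =
          of_real (std_normal_density v) * \<psi> (v / (2 * pi * N n))"
        unfolding scaleR_conv_of_real mult.assoc[symmetric] of_real_mult[symmetric] by simp
    qed
    finally show ?thesis .
  qed
  have l2: "(\<lambda>n. \<integral>v. of_real (std_normal_density v) * \<psi> (v / (2 * pi * N n)) \<partial>lborel) \<longlonglongrightarrow> (\<integral>v. of_real (std_normal_density v) * \<psi> 0 \<partial>lborel)"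
  proof -
    obtain C where C: "\<And>x. norm (\<psi> x) \<le> C" using S(3) by (auto simp: bounded_iff)
    show ?thesis
    proof (rule integral_dominated_convergence[where w = "\<lambda>v. std_normal_density v * C"])
      show "AE v in lborel. (\<lambda>n. of_real (std_normal_density v) * \<psi> (v / (2 * pi * N n))) \<longlonglongrightarrow> of_real (std_normal_density v) * \<psi> 0"
      proof (intro AE_I2 tendsto_mult tendsto_const)
        fix v :: real
        have "(\<lambda>n. v / (2 * pi * N n)) \<longlonglongrightarrow> 0" unfolding N_def by real_asymp
        then show "(\<lambda>n. \<psi> (v / (2 * pi * N n))) \<longlonglongrightarrow> \<psi> 0"
          using S(1) by (simp add: continuous_on_tendsto_compose[of UNIV \<psi>])
      qed
      show "AE v in lborel. norm (of_real (std_normal_density v) * \<psi> (v / (2 * pi * N n))) \<le> std_normal_density v * C" for n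
        by (intro AE_I2) (auto simp: norm_mult intro!: mult_left_mono C)
    qed auto
  qed
  have "(\<integral>\<xi>. fourier \<psi> \<xi> \<partial>lborel) = (\<integral>v. of_real (std_normal_density v) * \<psi> 0 \<partial>lborel)"
    by (rule LIMSEQ_unique[OF l1[unfolded e] l2])
  then show ?thesis by simp
qed

text \<open>
  A polynomial is bounded by \<open>C exp (N \<bar>x\<bar>)\<close>, and completing the square bounds \<open>N \<bar>x\<bar> - x\<^sup>2\<close>.
\<close>

lemma gaussian_poly_bounded:
  "bounded (range (\<lambda>x::real. complex_of_real (poly q x * exp (- x\<^sup>2))))"
proof -
  have "\<exists>C N. 0 \<le> C \<and> 0 \<le> N \<and> (\<forall>x. \<bar>poly q x\<bar> \<le> C * exp (N * \<bar>x\<bar>))"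
  proof (induction q)
    case 0 show ?case by (intro exI[of _ 0]) simp
  next
    case (pCons a q)
    then obtain C N where IH: "0 \<le> C" "0 \<le> N" "\<And>x. \<bar>poly q x\<bar> \<le> C * exp (N * \<bar>x\<bar>)" by blast
    have "\<bar>poly (pCons a q) x\<bar> \<le> (\<bar>a\<bar> + C) * exp ((N + 1) * \<bar>x\<bar>)" for x
    proof -
      have "\<bar>poly (pCons a q) x\<bar> \<le> \<bar>a\<bar> + \<bar>x\<bar> * \<bar>poly q x\<bar>"
        by (simp add: abs_mult[symmetric] abs_triangle_ineq)
      also have "\<dots> \<le> \<bar>a\<bar> * exp ((N + 1) * \<bar>x\<bar>) + exp \<bar>x\<bar> * (C * exp (N * \<bar>x\<bar>))"
      proof (intro add_mono mult_mono IH)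
        show "\<bar>a\<bar> \<le> \<bar>a\<bar> * exp ((N + 1) * \<bar>x\<bar>)" using IH by (simp add: mult_le_cancel_left1)
        show "\<bar>x\<bar> \<le> exp \<bar>x\<bar>" using exp_ge_add_one_self[of "\<bar>x\<bar>"] by linarith
      qed auto
      also have "\<dots> = (\<bar>a\<bar> + C) * exp ((N + 1) * \<bar>x\<bar>)" by (simp add: exp_add ring_distribs)
      finally show ?thesis .
    qed
    moreover have "0 \<le> \<bar>a\<bar> + C" "0 \<le> N + 1" using IH by auto
    ultimately show ?case by blast
  qed
  then obtain C N where C: "0 \<le> C" "0 \<le> N" "\<And>x. \<bar>poly q x\<bar> \<le> C * exp (N * \<bar>x\<bar>)" by blast
  have "norm (complex_of_real (poly q x * exp (- x\<^sup>2))) \<le> C * exp (N\<^sup>2 / 4)" for x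
  proof -
    have "N * \<bar>x\<bar> - x\<^sup>2 = N\<^sup>2 / 4 - (\<bar>x\<bar> - N / 2)\<^sup>2"
      by (simp add: power2_diff) (simp add: power2_eq_square)
    then have "N * \<bar>x\<bar> + - x\<^sup>2 \<le> N\<^sup>2 / 4" by simp
    then have e: "exp (N * \<bar>x\<bar>) * exp (- x\<^sup>2) \<le> exp (N\<^sup>2 / 4)" unfolding exp_add[symmetric] by simp
    have "norm (complex_of_real (poly q x * exp (- x\<^sup>2))) = \<bar>poly q x\<bar> * exp (- x\<^sup>2)"
      by (simp only: norm_of_real abs_mult abs_exp_cancel)
    also have "\<dots> \<le> (C * exp (N * \<bar>x\<bar>)) * exp (- x\<^sup>2)" by (intro mult_right_mono C) auto
    also have "\<dots> \<le> C * exp (N\<^sup>2 / 4)" using e C by (simp only: mult.assoc mult_left_mono)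
    finally show ?thesis .
  qed
  then show ?thesis by (auto simp: bounded_iff simp del: of_real_mult)
qed

text \<open>
  An admissible cut-off exists; so at most one number is the limit for all cut-offs.
\<close>

lemma schwartz_gaussian: "schwartz (\<lambda>x. of_real (exp (- x\<^sup>2)))"
proof -
  \<comment> \<open>The \<open>m\<close>-th derivative is \<open>p m x * exp (- x\<^sup>2)\<close>, with Hermite polynomials up to sign.\<close>
  define p :: "nat \<Rightarrow> real poly" where "p = rec_nat 1 (\<lambda>_ q. pderiv q - [:0, 2:] * q)"
  define D where "D = (\<lambda>m x. complex_of_real (poly (p m) x * exp (- x\<^sup>2)))"
  have p: "p 0 = 1" "p (Suc m) = pderiv (p m) - [:0, 2:] * p m" for m by (simp_all add: p_def)
  show ?thesis
    unfolding schwartz_def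
  proof (intro exI[of _ D] conjI allI)
    show "D 0 = (\<lambda>x. of_real (exp (- x\<^sup>2)))" by (simp add: D_def p)
    show "(D m has_vector_derivative D (Suc m) x) (at x)" for m x
    proof -
      have "((\<lambda>x. poly (p m) x * exp (- x\<^sup>2)) has_field_derivative poly (p (Suc m)) x * exp (- x\<^sup>2)) (at x)"
        by (auto intro!: derivative_eq_intros simp: p algebra_simps)
      then show ?thesis unfolding D_def
        by (intro has_vector_derivative_of_real) (simp add: has_real_derivative_iff_has_vector_derivative)
    qed
    show "bounded (range (\<lambda>x. x ^ k *\<^sub>R D m x))" for k m
      using gaussian_poly_bounded[of "monom 1 k * p m"] by (simp add: D_def poly_monom scaleR_conv_of_real mult.assoc)
  qed
qed

section \<open>Integrating out deltas by a triangular change of variables\<close>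

abbreviation lborel_prod :: "'i set \<Rightarrow> ('i \<Rightarrow> real) measure" where
  "lborel_prod I \<equiv> Pi\<^sub>M I (\<lambda>_. lborel)"

lemma product_sigma_finite_lborel: "product_sigma_finite (\<lambda>_. lborel :: real measure)"
  by unfold_locales

lemma measurable_shear:
  fixes I :: "'i set"
  assumes I: "i \<in> I" and g: "g \<in> borel_measurable (lborel_prod I)"
  shows "(\<lambda>x. x(i := c * x i + g x)) \<in> measurable (lborel_prod I) (lborel_prod I)"
proof -
  have [measurable]: "(\<lambda>x. x i) \<in> borel_measurable (lborel_prod I)"
    using measurable_component_singleton[OF I, of "\<lambda>_. lborel :: real measure"] by simp
  note [measurable] = g
  have "(\<lambda>(x, y). x(i := y)) \<in> measurable (lborel_prod I \<Otimes>\<^sub>M lborel) (lborel_prod I)"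
    using measurable_add_dim[of i I "\<lambda>_. lborel :: real measure"] I by (simp add: insert_absorb)
  then have "(\<lambda>x. (\<lambda>(x, y). x(i := y)) (x, c * x i + g x)) \<in> measurable (lborel_prod I) (lborel_prod I)"
    by (rule measurable_compose[rotated]) measurable
  then show ?thesis by simp
qed

text \<open>
  Integrating the shifted coordinate first, this is the affine substitution on the line, since the
  shift \<open>g\<close> does not depend on that coordinate.
\<close>

lemma nn_integral_shear:
  fixes I :: "'i set" and f :: "('i \<Rightarrow> real) \<Rightarrow> ennreal"
  assumes I: "finite I" "i \<in> I" and c: "c \<noteq> 0"
    and g: "g \<in> borel_measurable (lborel_prod I)" "\<And>x y. g (x(i := y)) = g x"
    and f: "f \<in> borel_measurable (lborel_prod I)"
  shows "ennreal \<bar>c\<bar> * (\<integral>\<^sup>+x. f (x(i := c * x i + g x)) \<partial>lborel_prod I) = (\<integral>\<^sup>+x. f x \<partial>lborel_prod I)"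
proof -
  interpret product_sigma_finite "\<lambda>_::'i. lborel :: real measure" by (rule product_sigma_finite_lborel)
  define J where "J = I - {i}"
  have J: "finite J" "i \<notin> J" "I = insert i J" using I by (auto simp: J_def)
  have mU: "(\<lambda>(x, y). x(i := y)) \<in> measurable (lborel_prod J \<Otimes>\<^sub>M lborel) (lborel_prod I)"
    unfolding J(3) by (rule measurable_add_dim)
  have mf: "(\<lambda>y. f (x(i := y))) \<in> borel_measurable borel" if "x \<in> space (lborel_prod J)" for x
    using measurable_compose[OF measurable_component_update[OF that J(2)], of f] f J(3) by simp
  have "(\<integral>\<^sup>+x. f (x(i := c * x i + g x)) \<partial>lborel_prod I) =
        (\<integral>\<^sup>+x. \<integral>\<^sup>+y. f (x(i := g x + c * y)) \<partial>lborel \<partial>lborel_prod J)"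
    unfolding J(3)
    by (subst product_nn_integral_insert[OF J(1,2)])
       (use measurable_compose[OF measurable_shear[OF I(2) g(1)] f] J(3) in \<open>simp_all add: g(2) add.commute\<close>)
  also have "ennreal \<bar>c\<bar> * \<dots> = (\<integral>\<^sup>+x. ennreal \<bar>c\<bar> * (\<integral>\<^sup>+y. f (x(i := g x + c * y)) \<partial>lborel) \<partial>lborel_prod J)"
  proof (rule nn_integral_cmult[symmetric])
    have "(\<lambda>x. g ((\<lambda>(x, y). x(i := y)) (x, 0))) \<in> borel_measurable (lborel_prod J)"
      by (rule measurable_compose[OF measurable_compose[OF _ mU] g(1)]) simp
    then have [measurable]: "g \<in> borel_measurable (lborel_prod J)" by (simp add: g(2))
    have "(\<lambda>p. f ((\<lambda>(x, y). x(i := y)) (fst p, g (fst p) + c * snd p))) \<in> borel_measurable (lborel_prod J \<Otimes>\<^sub>M lborel)"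
      by (rule measurable_compose[OF measurable_compose[OF _ mU] f]) simp
    then show "(\<lambda>x. \<integral>\<^sup>+y. f (x(i := g x + c * y)) \<partial>lborel) \<in> borel_measurable (lborel_prod J)"
      by (intro lborel.borel_measurable_nn_integral) (simp add: case_prod_beta')
  qed
  also have "\<dots> = (\<integral>\<^sup>+x. \<integral>\<^sup>+y. f (x(i := y)) \<partial>lborel \<partial>lborel_prod J)"
    by (intro nn_integral_cong nn_integral_real_affine[symmetric] mf c)
  also have "\<dots> = (\<integral>\<^sup>+x. f x \<partial>lborel_prod I)"
    unfolding J(3) by (rule product_nn_integral_insert[OF J(1,2), symmetric]) (use f J(3) in simp)
  finally show "ennreal \<bar>c\<bar> * (\<integral>\<^sup>+x. f (x(i := c * x i + g x)) \<partial>lborel_prod I) = (\<integral>\<^sup>+x. f x \<partial>lborel_prod I)" .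
qed

definition lincomb :: "(real \<times> 'i) list \<Rightarrow> ('i \<Rightarrow> real) \<Rightarrow> real" where
  "lincomb cs x = (\<Sum>(c, j)\<leftarrow>cs. c * x j)"

lemma lincomb_simps [simp]: "lincomb [] x = 0" "lincomb ((c, j) # cs) x = c * x j + lincomb cs x"
  by (simp_all add: lincomb_def)

lemma lincomb_measurable:
  "snd ` set cs \<subseteq> I \<Longrightarrow> lincomb cs \<in> borel_measurable (lborel_prod I)"
proof (induction cs)
  case Nil
  then show ?case by (simp add: lincomb_def)
next
  case (Cons a cs)
  obtain c j where a: "a = (c, j)" by force
  have "(\<lambda>x. x j) \<in> borel_measurable (lborel_prod I)"
    using measurable_component_singleton[of j I "\<lambda>_. lborel :: real measure"] Cons.prems a by simp
  with Cons show ?case unfolding a lincomb_simps(2)[abs_def] by (auto intro!: borel_measurable_add borel_measurable_times)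
qed

lemma lincomb_cong: "(\<And>j. j \<in> snd ` set cs \<Longrightarrow> x j = y j) \<Longrightarrow> lincomb cs x = lincomb cs y"
  by (induction cs) auto

lemma tendsto_lincomb:
  "(\<And>j. ((\<lambda>n. X n j) \<longlongrightarrow> x j) F) \<Longrightarrow> ((\<lambda>n. lincomb cs (X n)) \<longlongrightarrow> lincomb cs x) F"
  by (induction cs) (auto intro!: tendsto_intros)

text \<open>
  The entry \<open>(i, c, cs)\<close> stands for the equation that expresses \<open>z\<^sub>i\<close> by a linear combination of other
  variables, up to an error \<open>\<epsilon> c z\<^sub>i\<close>. For \<open>\<epsilon> > 0\<close> the composite is a change of variables to these
  errors, and for \<open>\<epsilon> = 0\<close> it solves the equations.
\<close>

primrec shears :: "real \<Rightarrow> ('i \<times> real \<times> (real \<times> 'i) list) list \<Rightarrow> ('i \<Rightarrow> real) \<Rightarrow> 'i \<Rightarrow> real" where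
  "shears \<epsilon> [] z = z"
| "shears \<epsilon> (s # l) z = (case s of (i, c, cs) \<Rightarrow> shears \<epsilon> l (z(i := \<epsilon> * c * z i + lincomb cs z)))"

text \<open>
  The rank witnesses that the system is triangular: each equation only mentions variables of smaller
  rank, and the equations are listed by increasing rank.
\<close>

definition shear_list :: "('i \<Rightarrow> nat) \<Rightarrow> 'i set \<Rightarrow> ('i \<times> real \<times> (real \<times> 'i) list) list \<Rightarrow> bool" where
  "shear_list rk I l \<longleftrightarrow> sorted_wrt (\<lambda>s s'. rk (fst s) < rk (fst s')) l \<and>
     (\<forall>(i, c, cs)\<in>set l. i \<in> I \<and> \<bar>c\<bar> = 1 \<and> (\<forall>j\<in>snd ` set cs. j \<in> I \<and> rk j < rk i))"

lemma shear_list_Cons: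
  "shear_list rk I ((i, c, cs) # l) \<longleftrightarrow> (\<forall>s\<in>set l. rk i < rk (fst s)) \<and> i \<in> I \<and> \<bar>c\<bar> = 1 \<and>
     (\<forall>j\<in>snd ` set cs. j \<in> I \<and> rk j < rk i) \<and> shear_list rk I l"
  by (auto simp: shear_list_def)

lemma shears_other: "j \<notin> fst ` set l \<Longrightarrow> shears \<epsilon> l z j = z j"
  by (induction l arbitrary: z) auto

text \<open>
  Later steps of the list change neither \<open>z\<^sub>i\<close> nor the variables on which its equation depends, so the
  equation still holds for the final values.
\<close>

lemma shears_eq:
  assumes "shear_list rk I l" "(i, c, cs) \<in> set l"
  shows "shears \<epsilon> l z i = \<epsilon> * c * z i + lincomb cs (shears \<epsilon> l z)"
  using assms
proof (induction l arbitrary: z)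
  case (Cons s l)
  obtain i' c' cs' where s: "s = (i', c', cs')" by (cases s)
  define z' where "z' = z(i' := \<epsilon> * c' * z i' + lincomb cs' z)"
  have wf: "\<And>s. s \<in> set l \<Longrightarrow> rk i' < rk (fst s)" "\<And>j. j \<in> snd ` set cs' \<Longrightarrow> rk j < rk i'" "shear_list rk I l"
    using Cons.prems(1) unfolding s shear_list_Cons by auto
  have ni: "i' \<notin> fst ` set l" using wf(1) by auto
  have sh: "shears \<epsilon> (s # l) z = shears \<epsilon> l z'" by (simp add: s z'_def)
  show ?case
  proof (cases "(i, c, cs) \<in> set l")
    case True
    then have "i \<noteq> i'" using ni by force
    then have "z' i = z i" by (simp add: z'_def)
    then show ?thesis using Cons.IH[OF wf(3) True, of z'] unfolding sh by simp
  next
    case False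
    then have i: "i = i'" "c = c'" "cs = cs'" using Cons.prems(2) s by auto
    have "lincomb cs' (shears \<epsilon> l z') = lincomb cs' z"
    proof (rule lincomb_cong)
      fix j assume "j \<in> snd ` set cs'"
      then have j: "rk j < rk i'" using wf(2) by auto
      then have "j \<notin> fst ` set l" using wf(1) by force
      then show "shears \<epsilon> l z' j = z j" using j by (subst shears_other) (auto simp: z'_def)
    qed
    then show ?thesis unfolding sh i using shears_other[OF ni, of \<epsilon> z'] by (simp add: z'_def)
  qed
qed simp

lemma shears_nn_integral:
  fixes I :: "'i set" and f :: "('i \<Rightarrow> real) \<Rightarrow> ennreal"
  assumes "finite I" "shear_list rk I l" "\<epsilon> > 0"
  shows "shears \<epsilon> l \<in> measurable (lborel_prod I) (lborel_prod I)"
    and "f \<in> borel_measurable (lborel_prod I) \<Longrightarrow>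
      ennreal (\<epsilon> ^ length l) * (\<integral>\<^sup>+x. f (shears \<epsilon> l x) \<partial>lborel_prod I) = (\<integral>\<^sup>+x. f x \<partial>lborel_prod I)"
  using assms(2)
proof (induction l arbitrary: f)
  case Nil
  { case 1 then show ?case by (simp add: id_def[symmetric] shears.simps(1)[abs_def])
  next case 2 then show ?case by simp }
next
  case (Cons s l)
  obtain i c cs where s: "s = (i, c, cs)" by (cases s)
  have wf: "i \<in> I" "\<bar>c\<bar> = 1" "snd ` set cs \<subseteq> I" "i \<notin> snd ` set cs" "shear_list rk I l"
    if "shear_list rk I (s # l)"
    using that unfolding s shear_list_Cons by auto
  have sh: "shears \<epsilon> (s # l) = (\<lambda>z. shears \<epsilon> l (z(i := \<epsilon> * c * z i + lincomb cs z)))" by (simp add: s fun_eq_iff)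
  have ind: "lincomb cs (x(i := y)) = lincomb cs x" if "i \<notin> snd ` set cs" for x y
    using that by (intro lincomb_cong) auto
  { case 1
    note wf = wf[OF this]
    show ?case unfolding sh
      by (rule measurable_compose[OF measurable_shear Cons.IH(1)[OF wf(5)]])
         (use assms wf ind in \<open>auto intro!: lincomb_measurable\<close>)
  next
    case 2
    note wf = wf[OF 2(2)]
    let ?M = "lborel_prod I"
    have m: "(\<lambda>x. f (shears \<epsilon> l x)) \<in> borel_measurable ?M" by (rule measurable_compose[OF Cons.IH(1)[OF wf(5)] 2(1)])
    have c: "\<bar>\<epsilon> * c\<bar> = \<epsilon>" "\<epsilon> * c \<noteq> 0" using assms wf by (auto simp: abs_mult)
    have "ennreal (\<epsilon> ^ length (s # l)) * (\<integral>\<^sup>+x. f (shears \<epsilon> (s # l) x) \<partial>?M) =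
          ennreal (\<epsilon> ^ length l) * (ennreal \<bar>\<epsilon> * c\<bar> * (\<integral>\<^sup>+x. f (shears \<epsilon> l (x(i := \<epsilon> * c * x i + lincomb cs x))) \<partial>?M))"
      unfolding sh c using assms(3) by (simp add: ennreal_mult mult_ac)
    also have "\<dots> = ennreal (\<epsilon> ^ length l) * (\<integral>\<^sup>+x. f (shears \<epsilon> l x) \<partial>?M)"
      by (subst nn_integral_shear[OF assms(1) wf(1) c(2) lincomb_measurable[OF wf(3)] ind[OF wf(4)] m]) simp
    also have "\<dots> = (\<integral>\<^sup>+x. f x \<partial>?M)" by (rule Cons.IH(2)[OF 2(1) wf(5)])
    finally show ?case . }
qed

lemma shears_integral:
  fixes I :: "'i set" and f :: "('i \<Rightarrow> real) \<Rightarrow> complex"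
  assumes "finite I" "shear_list rk I l" "\<epsilon> > 0" and f: "f \<in> borel_measurable (lborel_prod I)"
  shows "(\<integral>x. f x \<partial>lborel_prod I) = of_real (\<epsilon> ^ length l) * (\<integral>x. f (shears \<epsilon> l x) \<partial>lborel_prod I)"
proof -
  let ?M = "lborel_prod I" and ?S = "shears \<epsilon> l"
  note S = shears_nn_integral[OF assms(1-3)]
  let ?k = "\<epsilon> ^ length l"
  have k: "?k > 0" using assms by simp
  have "?M = density (distr ?M ?M ?S) (\<lambda>_. ennreal ?k)"
  proof (rule measure_eqI)
    fix A assume A: "A \<in> sets ?M"
    have "emeasure (density (distr ?M ?M ?S) (\<lambda>_. ennreal ?k)) A = ennreal ?k * emeasure (distr ?M ?M ?S) A"
      using A by (simp add: emeasure_density_const)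
    also have "emeasure (distr ?M ?M ?S) A = (\<integral>\<^sup>+x. indicator A x \<partial>distr ?M ?M ?S)" using A by simp
    also have "\<dots> = (\<integral>\<^sup>+x. indicator A (?S x) \<partial>?M)" using A S(1) by (intro nn_integral_distr) auto
    also have "ennreal ?k * \<dots> = (\<integral>\<^sup>+x. indicator A x \<partial>?M)" by (rule S(2)) (use A in auto)
    finally show "emeasure ?M A = emeasure (density (distr ?M ?M ?S) (\<lambda>_. ennreal ?k)) A" using A by simp
  qed simp
  then have "(\<integral>x. f x \<partial>?M) = (\<integral>x. f x \<partial>density (distr ?M ?M ?S) (\<lambda>_. ennreal ?k))" by simp
  also have "\<dots> = (\<integral>x. ?k *\<^sub>R f x \<partial>distr ?M ?M ?S)"
    using f k by (intro integral_density) auto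
  also have "\<dots> = (\<integral>x. ?k *\<^sub>R f (?S x) \<partial>?M)"
    using f S(1) by (intro integral_distr) auto
  finally show ?thesis by (simp add: scaleR_conv_of_real)
qed

text \<open>
  The shears depend continuously on \<open>\<epsilon>\<close> up to \<open>\<epsilon> = 0\<close>; there they no longer are a change of variables.
\<close>

lemma tendsto_shears:
  assumes "(e \<longlongrightarrow> \<epsilon>) F" "\<And>j. ((\<lambda>n. X n j) \<longlongrightarrow> x j) F"
  shows "((\<lambda>n. shears (e n) l (X n) j) \<longlongrightarrow> shears \<epsilon> l x j) F"
  using assms(2)
proof (induction l arbitrary: X x j)
  case (Cons s l)
  obtain i c cs where s: "s = (i, c, cs)" by (cases s)
  show ?case unfolding s shears.simps prod.case
    by (rule Cons.IH) (auto intro!: tendsto_intros tendsto_lincomb assms(1) Cons.prems)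
qed simp

text \<open>
  The face variables and the tetrahedron variables are merged into one product, so that a single
  change of variables can mix them.
\<close>

lemma PiM_sum_distr:
  fixes A :: "'a set" and B :: "'b set"
  assumes "finite A" "finite B"
  defines "comb \<equiv> \<lambda>(x, y). \<lambda>i\<in>A <+> B. case i of Inl a \<Rightarrow> x a | Inr b \<Rightarrow> (y b :: real)"
  shows "comb \<in> measurable (lborel_prod A \<Otimes>\<^sub>M lborel_prod B) (lborel_prod (A <+> B))"
    and "distr (lborel_prod A \<Otimes>\<^sub>M lborel_prod B) (lborel_prod (A <+> B)) comb = lborel_prod (A <+> B)"
proof -
  let ?MA = "lborel_prod A" and ?MB = "lborel_prod B" and ?M = "lborel_prod (A <+> B)"
  interpret A: finite_product_sigma_finite "\<lambda>_. lborel :: real measure" A by standard fact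
  interpret B: finite_product_sigma_finite "\<lambda>_. lborel :: real measure" B by standard fact
  interpret S: product_sigma_finite "\<lambda>_ :: 'a + 'b. lborel :: real measure" by (rule product_sigma_finite_lborel)
  show m: "comb \<in> measurable (?MA \<Otimes>\<^sub>M ?MB) ?M"
    unfolding comb_def case_prod_beta
  proof (rule measurable_restrict)
    fix i assume "i \<in> A <+> B"
    then show "(\<lambda>p. case i of Inl a \<Rightarrow> fst p a | Inr b \<Rightarrow> snd p b) \<in> measurable (?MA \<Otimes>\<^sub>M ?MB) lborel"
      by (auto intro!: measurable_compose[OF measurable_fst measurable_component_singleton] measurable_compose[OF measurable_snd measurable_component_singleton])
  qed
  show "distr (?MA \<Otimes>\<^sub>M ?MB) ?M comb = ?M"
  proof (rule S.PiM_eqI)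
    show "finite (A <+> B)" using assms by simp
    fix C :: "'a + 'b \<Rightarrow> real set" assume C: "\<And>i. i \<in> A <+> B \<Longrightarrow> C i \<in> sets lborel"
    have "emeasure (distr (?MA \<Otimes>\<^sub>M ?MB) ?M comb) (Pi\<^sub>E (A <+> B) C) = emeasure (?MA \<Otimes>\<^sub>M ?MB) (comb -` Pi\<^sub>E (A <+> B) C \<inter> space (?MA \<Otimes>\<^sub>M ?MB))"
      using m C assms by (intro emeasure_distr sets_PiM_I_finite) auto
    also have "comb -` Pi\<^sub>E (A <+> B) C \<inter> space (?MA \<Otimes>\<^sub>M ?MB) = Pi\<^sub>E A (C \<circ> Inl) \<times> Pi\<^sub>E B (C \<circ> Inr)"
      by (auto simp: comb_def space_pair_measure space_PiM PiE_iff Plus_def ball_Un)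
    also have "emeasure (?MA \<Otimes>\<^sub>M ?MB) \<dots> = emeasure ?MA (Pi\<^sub>E A (C \<circ> Inl)) * emeasure ?MB (Pi\<^sub>E B (C \<circ> Inr))"
      using C assms by (intro B.emeasure_pair_measure_Times sets_PiM_I_finite) auto
    also have "\<dots> = (\<Prod>i\<in>A. emeasure lborel (C (Inl i))) * (\<Prod>i\<in>B. emeasure lborel (C (Inr i)))"
      using C by (subst A.measure_times, force, subst B.measure_times, force, simp)
    also have "\<dots> = (\<Prod>i\<in>A <+> B. emeasure lborel (C i))"
      unfolding Plus_def using assms by (subst prod.union_disjoint) (auto simp: prod.reindex)
    finally show "emeasure (distr (?MA \<Otimes>\<^sub>M ?MB) ?M comb) (Pi\<^sub>E (A <+> B) C) = (\<Prod>i\<in>A <+> B. emeasure lborel (C i))" .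
  qed simp
qed

lemma integrable_PiM_bound:
  fixes f :: "('i \<Rightarrow> real) \<Rightarrow> complex" and u :: "'i \<Rightarrow> real \<Rightarrow> real"
  assumes I: "finite I" and f: "f \<in> borel_measurable (lborel_prod I)"
    and u: "\<And>i. i \<in> I \<Longrightarrow> integrable lborel (u i)"
    and bound: "\<And>z. norm (f z) \<le> C * (\<Prod>i\<in>I. u i (z i))"
  shows "integrable (lborel_prod I) f"
proof -
  interpret product_sigma_finite "\<lambda>_ :: 'i. lborel :: real measure" by (rule product_sigma_finite_lborel)
  show ?thesis
  proof (rule Bochner_Integration.integrable_bound[OF _ f])
    show "integrable (lborel_prod I) (\<lambda>z. C * (\<Prod>i\<in>I. u i (z i)))"
      by (intro integrable_mult_right product_integrable_prod I u)
    show "AE z in lborel_prod I. norm (f z) \<le> norm (C * (\<Prod>i\<in>I. u i (z i)))"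
      using bound by (intro AE_I2) (auto intro: order_trans[OF _ abs_ge_self])
  qed
qed

lemma delta_cutoff_measurable:
  assumes "schwartz \<psi>"
  shows "delta_cutoff \<psi> \<epsilon> \<in> borel_measurable borel"
proof -
  have [measurable]: "\<psi> \<in> borel_measurable borel"
    by (rule borel_measurable_continuous_onI[OF fourier_schwartz(1)[OF assms]])
  show ?thesis unfolding delta_cutoff_def by measurable
qed

lemma delta_cutoff_bounded:
  assumes "schwartz \<psi>" "\<epsilon> > 0"
  obtains D where "\<And>x. norm (delta_cutoff \<psi> \<epsilon> x) \<le> D"
proof -
  obtain D where D: "\<And>x. norm (fourier \<psi> x) \<le> D"
    using fourier_schwartz(5)[OF assms(1)] by (auto simp: bounded_iff)
  have "norm (delta_cutoff \<psi> \<epsilon> x) \<le> D / \<epsilon>" for x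
    using delta_cutoff_scaled[OF assms(2), of \<psi> "x / \<epsilon>"] D[of "x / \<epsilon>"] assms(2)
    by (simp add: norm_divide divide_right_mono)
  then show ?thesis by (rule that)
qed

lemma sorted_wrt_less_distinct:
  "sorted_wrt (\<lambda>s s'. (rk (fst s) :: nat) < rk (fst s')) l \<Longrightarrow> distinct (map fst l)"
  by (induction l) fastforce+

text \<open>
  As many deltas as eliminated variables: in the coordinates \<open>z\<close> given by the shears, the \<open>i\<close>-th
  delta has the argument \<open>\<epsilon> z\<^sub>i\<close> and equals \<open>1/\<epsilon>\<close> times the Fourier transform of the cut-off at \<open>z\<^sub>i\<close>. The
  Jacobian cancels all powers of \<open>\<epsilon>\<close>, and dominated convergence gives the limit, in which the
  amplitude \<open>A\<close> is evaluated at the solution of the linear system.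
\<close>

theorem delta_cutoff_limit:
  fixes I :: "'i set" and A :: "real \<Rightarrow> ('i \<Rightarrow> real) \<Rightarrow> complex"
  assumes I: "finite I" and l: "shear_list rk I l" and E: "E = fst ` set l"
    and \<psi>: "schwartz \<psi>"
    and argm: "\<And>i. i \<in> E \<Longrightarrow> ell i \<in> borel_measurable (lborel_prod I)"
    and arg: "\<And>\<epsilon> z i. i \<in> E \<Longrightarrow> ell i (shears \<epsilon> l z) = \<epsilon> * z i"
    and Am: "\<And>\<epsilon>. \<epsilon> > 0 \<Longrightarrow> A \<epsilon> \<in> borel_measurable (lborel_prod I)"
    and bound: "\<And>\<epsilon> z. \<epsilon> > 0 \<Longrightarrow> norm (A \<epsilon> (shears \<epsilon> l z)) \<le> B z"
    and int: "integrable (lborel_prod I) (\<lambda>z. B z * (\<Prod>i\<in>E. norm (fourier \<psi> (z i))))"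
    and A0: "A0 \<in> borel_measurable (lborel_prod I)"
    and lim: "\<And>e z. (\<And>n. e n > 0) \<Longrightarrow> e \<longlonglongrightarrow> 0 \<Longrightarrow> (\<lambda>n. A (e n) (shears (e n) l z)) \<longlonglongrightarrow> A0 z"
  shows "((\<lambda>\<epsilon>. \<integral>w. A \<epsilon> w * (\<Prod>i\<in>E. delta_cutoff \<psi> \<epsilon> (ell i w)) \<partial>lborel_prod I) \<longlongrightarrow>
           (\<integral>z. A0 z * (\<Prod>i\<in>E. fourier \<psi> (z i)) \<partial>lborel_prod I)) (at_right 0)"
  unfolding tendsto_at_iff_sequentially comp_def
proof (intro allI impI)
  let ?M = "lborel_prod I"
  fix e assume e: "\<forall>n. e n \<in> {0<..} - {0::real}" "e \<longlonglongrightarrow> 0"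
  then have epos: "e n > 0" for n by auto
  have distinct: "distinct (map fst l)" using l sorted_wrt_less_distinct unfolding shear_list_def by blast
  then have card: "card E = length l" unfolding E using distinct_card[OF distinct] by simp
  have EI: "E \<subseteq> I" using l unfolding E shear_list_def by force
  have [measurable]: "fourier \<psi> \<in> borel_measurable borel"
    by (rule fourier_measurable[OF borel_measurable_continuous_onI[OF fourier_schwartz(1)[OF \<psi>]]])
  have mi: "(\<lambda>z. z i) \<in> borel_measurable ?M" if "i \<in> E" for i
    using measurable_component_singleton[of i I "\<lambda>_. lborel :: real measure"] that EI by auto
  have mF: "(\<lambda>z. \<Prod>i\<in>E. fourier \<psi> (z i)) \<in> borel_measurable ?M"
    by (intro borel_measurable_prod measurable_compose[OF mi]) auto
  have eq: "(\<integral>w. A (e n) w * (\<Prod>i\<in>E. delta_cutoff \<psi> (e n) (ell i w)) \<partial>?M) =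
      (\<integral>z. A (e n) (shears (e n) l z) * (\<Prod>i\<in>E. fourier \<psi> (z i)) \<partial>?M)" for n
  proof -
    have m: "(\<lambda>w. A (e n) w * (\<Prod>i\<in>E. delta_cutoff \<psi> (e n) (ell i w))) \<in> borel_measurable ?M"
      by (intro borel_measurable_times borel_measurable_prod Am epos measurable_compose[OF argm] delta_cutoff_measurable \<psi>)
    have "(\<integral>w. A (e n) w * (\<Prod>i\<in>E. delta_cutoff \<psi> (e n) (ell i w)) \<partial>?M) =
      of_real (e n ^ length l) * (\<integral>z. A (e n) (shears (e n) l z) * (\<Prod>i\<in>E. delta_cutoff \<psi> (e n) (ell i (shears (e n) l z))) \<partial>?M)"
      by (rule shears_integral[OF I l epos m])
    also have "\<dots> = (\<integral>z. of_real (e n ^ length l) * (A (e n) (shears (e n) l z) * (\<Prod>i\<in>E. delta_cutoff \<psi> (e n) (ell i (shears (e n) l z)))) \<partial>?M)"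
      by simp
    also have "\<dots> = (\<integral>z. A (e n) (shears (e n) l z) * (\<Prod>i\<in>E. fourier \<psi> (z i)) \<partial>?M)"
    proof (intro Bochner_Integration.integral_cong refl)
      fix z
      have "(\<Prod>i\<in>E. delta_cutoff \<psi> (e n) (ell i (shears (e n) l z))) = (\<Prod>i\<in>E. fourier \<psi> (z i) / of_real (e n))"
        by (intro prod.cong refl) (simp add: arg delta_cutoff_scaled epos)
      also have "\<dots> = (\<Prod>i\<in>E. fourier \<psi> (z i)) / of_real (e n ^ length l)"
        by (simp add: prod_dividef card)
      finally show "of_real (e n ^ length l) * (A (e n) (shears (e n) l z) * (\<Prod>i\<in>E. delta_cutoff \<psi> (e n) (ell i (shears (e n) l z)))) =
          A (e n) (shears (e n) l z) * (\<Prod>i\<in>E. fourier \<psi> (z i))"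
        using epos[of n] by simp
    qed
    finally show ?thesis .
  qed
  show "(\<lambda>n. \<integral>w. A (e n) w * (\<Prod>i\<in>E. delta_cutoff \<psi> (e n) (ell i w)) \<partial>?M) \<longlonglongrightarrow> (\<integral>z. A0 z * (\<Prod>i\<in>E. fourier \<psi> (z i)) \<partial>?M)"
    unfolding eq
  proof (rule integral_dominated_convergence[OF _ _ int])
    show "(\<lambda>z. A0 z * (\<Prod>i\<in>E. fourier \<psi> (z i))) \<in> borel_measurable ?M"
      by (intro borel_measurable_times A0 mF)
    show "(\<lambda>z. A (e n) (shears (e n) l z) * (\<Prod>i\<in>E. fourier \<psi> (z i))) \<in> borel_measurable ?M" for n
      by (intro borel_measurable_times mF measurable_compose[OF shears_nn_integral(1)[OF I l epos] Am[OF epos]])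
    show "AE z in ?M. (\<lambda>n. A (e n) (shears (e n) l z) * (\<Prod>i\<in>E. fourier \<psi> (z i))) \<longlonglongrightarrow> A0 z * (\<Prod>i\<in>E. fourier \<psi> (z i))"
      by (intro AE_I2 tendsto_mult tendsto_const lim epos e)
    show "AE z in ?M. norm (A (e n) (shears (e n) l z) * (\<Prod>i\<in>E. fourier \<psi> (z i))) \<le> B z * (\<Prod>i\<in>E. norm (fourier \<psi> (z i)))" for n
      unfolding norm_mult prod_norm[symmetric] by (intro AE_I2 mult_right_mono bound epos prod_nonneg) auto
  qed
qed

section \<open>The linear system of the kinematical kernel\<close>

type_synonym idx = "fc + tet"

definition Y_fcs :: "nat \<Rightarrow> fc set" where
  "Y_fcs p = FE ` {1..p + 1} \<union> FF ` {1..p} \<union> {Fv, Fr, Fs, Fs', Fg, Fu}"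

definition Y_tets :: "nat \<Rightarrow> tet set" where
  "Y_tets p = insert TZ (insert TV (J_index p))"

lemma tets_twist_Y: "tets (twist_Y n) = Y_tets (twist_p n)"
  by (auto simp: twist_Y_def Y_tets_def J_index_def)

lemma face_f_in: "k \<le> p \<Longrightarrow> face_f k \<in> Y_fcs p"
  by (auto simp: face_f_def Y_fcs_def)

lemma face_twist_Y: "face (twist_Y n) T k = Y_faces (twist_p n) T ! k"
  by (simp add: twist_Y_def)

lemma le_3_image: "f ` {..3::nat} = {f 0, f 1, f 2, f 3}"
  by (auto simp: numeral_3_eq_3 numeral_2_eq_2 le_Suc_eq)

lemma Y_faces_image:
  "(\<lambda>k. Y_faces p T ! k) ` {..3} = set (Y_faces p T)"
  unfolding le_3_image by (cases T) (auto simp: numeral_3_eq_3 numeral_2_eq_2)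

lemma faces_twist_Y: "faces (twist_Y n) = insert Fm (Y_fcs (twist_p n))"
proof -
  let ?p = "twist_p n"
  have "faces (twist_Y n) = (\<Union>T\<in>Y_tets ?p. set (Y_faces ?p T))"
    unfolding faces_def tets_twist_Y face_twist_Y Y_faces_image ..
  also have "\<dots> = insert Fm (Y_fcs ?p)"
  proof (intro equalityI subsetI)
    fix f assume "f \<in> (\<Union>T\<in>Y_tets ?p. set (Y_faces ?p T))"
    then show "f \<in> insert Fm (Y_fcs ?p)"
      by (auto simp: Y_tets_def J_index_def intro!: face_f_in) (auto simp: Y_fcs_def)
  next
    fix f assume f: "f \<in> insert Fm (Y_fcs ?p)"
    have FE: "FE k \<in> (\<Union>T\<in>Y_tets ?p. set (Y_faces ?p T))" if "k \<in> {1..?p + 1}" for k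
      using that by (cases "k = ?p + 1") (auto simp: Y_tets_def J_index_def)
    have FF: "FF k \<in> (\<Union>T\<in>Y_tets ?p. set (Y_faces ?p T))" if "k \<in> {1..?p}" for k
      using that by (intro UN_I[of "TT k"]) (auto simp: Y_tets_def J_index_def face_f_def)
    show "f \<in> (\<Union>T\<in>Y_tets ?p. set (Y_faces ?p T))"
      using f FE FF by (auto simp: Y_fcs_def) (auto simp: Y_tets_def J_index_def)
  qed
  finally show ?thesis .
qed

abbreviation "xE k \<equiv> (Inl (FE k) :: idx)"
abbreviation "xF k \<equiv> (Inl (face_f k) :: idx)"
abbreviation "xT T \<equiv> (Inr T :: idx)"

text \<open>
  The linear system solved in triangular order. First \<open>t\<^sub>Z\<close>, \<open>s\<close>, \<open>s'\<close>, \<open>g\<close> and \<open>f\<^sub>p\<close>; then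
  \<open>f\<^sub>p\<^sub>-\<^sub>1, \<dots>, f\<^sub>0 = e\<^sub>1\<close> by the second deltas of \<open>T\<^sub>p, \<dots>, T\<^sub>1\<close>; then \<open>e\<^sub>2, \<dots>, e\<^sub>p\<^sub>+\<^sub>1\<close> by the first deltas of
  \<open>T\<^sub>1, \<dots>, T\<^sub>p\<close>; at last \<open>v\<close>, \<open>r\<close>, \<open>u\<close> and \<open>t\<^sub>V\<close>. What remains free are the variables \<open>t\<^sub>T\<close> with
  \<open>T\<close> in \<^term>\<open>J_index p\<close>.
\<close>

definition elim_list :: "nat \<Rightarrow> (idx \<times> real \<times> (real \<times> idx) list) list" where
  "elim_list p =
     [(xT TZ, -1, []), (Inl Fs, 1, []), (Inl Fs', -1, [(1, Inl Fs), (1, xT TZ)]),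
      (Inl Fg, -1, [(1, Inl Fs), (1, xT TU)]), (xF p, 1, [(1, Inl Fs'), (-1, Inl Fg)])] @
     map (\<lambda>j. (xF j, -1, [(1, xF (j + 1)), (1, xT (TT (j + 1)))])) (rev [0..<p]) @
     map (\<lambda>k. (xE (k + 1), -1, [(1, xE k), (1, xF k)])) [1..<p+1] @
     [(Inl Fv, 1, [(1, xE (p + 1)), (-1, xT TW)]), (Inl Fr, 1, [(1, Inl Fv), (-1, Inl Fs)]),
      (Inl Fu, 1, [(1, Inl Fr), (-1, Inl Fv)]), (xT TV, 1, [(1, Inl Fu), (-1, xF p)])]"

fun elim_rank :: "nat \<Rightarrow> idx \<Rightarrow> nat" where
  "elim_rank p (Inr TZ) = 1"
| "elim_rank p (Inl Fs) = 2"
| "elim_rank p (Inl Fs') = 3"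
| "elim_rank p (Inl Fg) = 4"
| "elim_rank p (Inl (FF k)) = 5 + p - k"
| "elim_rank p (Inl (FE k)) = 4 + p + k"
| "elim_rank p (Inl Fv) = 6 + 2 * p"
| "elim_rank p (Inl Fr) = 7 + 2 * p"
| "elim_rank p (Inl Fu) = 8 + 2 * p"
| "elim_rank p (Inr TV) = 9 + 2 * p"
| "elim_rank p _ = 0"

lemma elim_rank_face_f: "k \<le> p \<Longrightarrow> elim_rank p (xF k) = 5 + p - k"
  by (simp add: face_f_def)

definition Y_idx :: "nat \<Rightarrow> idx set" where "Y_idx p = Y_fcs p <+> Y_tets p"

lemma Y_mem:
  "Inl f \<in> Y_idx p \<longleftrightarrow> f \<in> Y_fcs p" "Inr T \<in> Y_idx p \<longleftrightarrow> T \<in> Y_tets p"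
  "TZ \<in> Y_tets p" "TV \<in> Y_tets p" "TU \<in> Y_tets p" "TW \<in> Y_tets p" "1 \<le> k \<Longrightarrow> k \<le> p \<Longrightarrow> TT k \<in> Y_tets p"
  "Fs \<in> Y_fcs p" "Fs' \<in> Y_fcs p" "Fg \<in> Y_fcs p" "Fu \<in> Y_fcs p" "Fr \<in> Y_fcs p" "Fv \<in> Y_fcs p"
  "1 \<le> k \<Longrightarrow> k \<le> p + 1 \<Longrightarrow> FE k \<in> Y_fcs p" "j \<le> p \<Longrightarrow> face_f j \<in> Y_fcs p"
  by (auto simp: Y_idx_def Y_tets_def J_index_def Y_fcs_def face_f_def)

lemma shear_list_elim: "shear_list (elim_rank p) (Y_idx p) (elim_list p)"
proof -
  have s1: "sorted_wrt (\<lambda>s s'. elim_rank p (fst s) < elim_rank p (fst s'))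
     (map (\<lambda>j. (xF j, -1 :: real, [(1 :: real, xF (j + 1)), (1, xT (TT (j + 1)))])) (rev [0..<p]))"
    unfolding sorted_wrt_map sorted_wrt_rev
    by (rule sorted_wrt_mono_rel[of _ "(<)"]) (auto simp: elim_rank_face_f)
  have s2: "sorted_wrt (\<lambda>s s'. elim_rank p (fst s) < elim_rank p (fst s'))
     (map (\<lambda>k. (xE (k + 1), -1 :: real, [(1 :: real, xE k), (1, xF k)])) [1..<p+1])"
    unfolding sorted_wrt_map
    by (rule sorted_wrt_mono_rel[OF _ sorted_wrt_upt]) auto
  have srt: "sorted_wrt (\<lambda>s s'. elim_rank p (fst s) < elim_rank p (fst s')) (elim_list p)"
    unfolding elim_list_def sorted_wrt_append using s1 s2
    by (auto simp: elim_rank_face_f)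
  have "\<forall>(i, c, cs)\<in>set (elim_list p). i \<in> Y_idx p \<and> \<bar>c\<bar> = 1 \<and> (\<forall>j\<in>snd ` set cs. j \<in> Y_idx p \<and> elim_rank p j < elim_rank p i)"
    unfolding elim_list_def set_append ball_Un set_map Ball_image_comp
  proof (intro conjI)
  qed (auto simp: Y_mem elim_rank_face_f)
  then show ?thesis
    unfolding shear_list_def using srt by blast
qed

text \<open>
  The argument of the delta that determines the variable \<open>i\<close>. The one for \<open>t\<^sub>Z\<close> is not among the deltas
  in the definition of the kernel: it comes from the integral over \<open>m\<close>. The case distinction for
  \<open>e\<^sub>1\<close> is due to \<open>f\<^sub>0 = e\<^sub>1\<close>.
\<close>

definition elim_args :: "nat \<Rightarrow> idx \<Rightarrow> (real \<times> idx) list" where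
  "elim_args p i = (case i of
     Inr T \<Rightarrow> (if T = TZ then [(-1, xT TZ)] else [(1, xF p), (-1, Inl Fu), (1, xT TV)])
   | Inl f \<Rightarrow> (case f of
       Fs \<Rightarrow> [(1, Inl Fs)]
     | Fs' \<Rightarrow> [(1, Inl Fs), (-1, Inl Fs'), (1, xT TZ)]
     | Fr \<Rightarrow> [(1, Inl Fr), (-1, Inl Fv), (1, Inl Fs)]
     | Fg \<Rightarrow> [(1, Inl Fs), (-1, Inl Fg), (1, xT TU)]
     | Fu \<Rightarrow> [(1, Inl Fu), (-1, Inl Fr), (1, Inl Fv)]
     | Fv \<Rightarrow> [(1, Inl Fv), (-1, xE (p + 1)), (1, xT TW)]
     | FE k \<Rightarrow> if k \<noteq> 1 then [(1, xE (k - 1)), (-1, xE k), (1, xF (k - 1))]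
               else if p = 0 then [(1, Inl Fg), (-1, Inl Fs'), (1, xF p)]
               else [(1, xF 1), (-1, xF 0), (1, xT (TT 1))]
     | FF k \<Rightarrow> if k = p then [(1, Inl Fg), (-1, Inl Fs'), (1, xF p)]
               else [(1, xF (k + 1)), (-1, xF k), (1, xT (TT (k + 1)))]
     | _ \<Rightarrow> []))"

lemma elim_args_face_f:
  "elim_args p (xF p) = [(1, Inl Fg), (-1, Inl Fs'), (1, xF p)]"
  "k < p \<Longrightarrow> elim_args p (xF k) = [(1, xF (k + 1)), (-1, xF k), (1, xT (TT (k + 1)))]"
  by (auto simp: elim_args_def face_f_def)

lemma elim_args_simps:
  "elim_args p (xT TZ) = [(-1, xT TZ)]"
  "elim_args p (xT TV) = [(1, xF p), (-1, Inl Fu), (1, xT TV)]"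
  "elim_args p (Inl Fs) = [(1, Inl Fs)]"
  "elim_args p (Inl Fs') = [(1, Inl Fs), (-1, Inl Fs'), (1, xT TZ)]"
  "elim_args p (Inl Fr) = [(1, Inl Fr), (-1, Inl Fv), (1, Inl Fs)]"
  "elim_args p (Inl Fg) = [(1, Inl Fs), (-1, Inl Fg), (1, xT TU)]"
  "elim_args p (Inl Fu) = [(1, Inl Fu), (-1, Inl Fr), (1, Inl Fv)]"
  "elim_args p (Inl Fv) = [(1, Inl Fv), (-1, xE (p + 1)), (1, xT TW)]"
  "1 \<le> k \<Longrightarrow> elim_args p (xE (Suc k)) = [(1, xE k), (-1, xE (Suc k)), (1, xF k)]"
  by (simp_all add: elim_args_def)

definition elim_idx :: "nat \<Rightarrow> idx set" where
  "elim_idx p = Inl ` Y_fcs p \<union> {xT TZ, xT TV}"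

lemma Y_fcs_alt: "Y_fcs p = face_f ` {..p} \<union> (\<lambda>k. FE (k + 1)) ` {1..p} \<union> {Fv, Fr, Fs, Fs', Fg, Fu}"
proof -
  have "face_f ` {..p} = insert (FE 1) (FF ` {1..p})"
    by (auto simp: face_f_def image_iff)
  moreover have "FE ` {1..p + 1} = insert (FE 1) ((\<lambda>k. FE (k + 1)) ` {1..p})"
  proof -
    have "{1..p + 1} = insert 1 ((\<lambda>k. k + 1) ` {1..p})" by auto
    then show ?thesis by (simp only: image_insert image_image)
  qed
  ultimately show ?thesis by (auto simp: Y_fcs_def)
qed

lemma elim_idx_eq: "fst ` set (elim_list p) = elim_idx p"
proof -
  have "{..p} = insert p {0..<p}" by auto
  then show ?thesis
    unfolding elim_list_def elim_idx_def Y_fcs_alt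
    by (auto simp: image_image image_Un)
qed

lemma elim_args_solve:
  "\<forall>s\<in>set (elim_list p). \<forall>w x. w (fst s) = \<epsilon> * fst (snd s) * x + lincomb (snd (snd s)) w \<longrightarrow>
     lincomb (elim_args p (fst s)) w = \<epsilon> * x"
  unfolding elim_list_def set_append ball_Un set_map Ball_image_comp
proof (intro conjI)
  show "\<forall>s\<in>set [(xT TZ, -1, []), (Inl Fs, 1, []), (Inl Fs', -1, [(1, Inl Fs), (1, xT TZ)]),
      (Inl Fg, -1, [(1, Inl Fs), (1, xT TU)]), (xF p, 1, [(1, Inl Fs'), (-1, Inl Fg)])]. \<forall>w x. w (fst s) = \<epsilon> * fst (snd s) * x + lincomb (snd (snd s)) w \<longrightarrow>
     lincomb (elim_args p (fst s)) w = \<epsilon> * x"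
    by (simp add: elim_args_simps elim_args_face_f)
  show "\<forall>s\<in>set [(Inl Fv, 1, [(1, xE (p + 1)), (-1, xT TW)]), (Inl Fr, 1, [(1, Inl Fv), (-1, Inl Fs)]),
      (Inl Fu, 1, [(1, Inl Fr), (-1, Inl Fv)]), (xT TV, 1, [(1, Inl Fu), (-1, xF p)])]. \<forall>w x. w (fst s) = \<epsilon> * fst (snd s) * x + lincomb (snd (snd s)) w \<longrightarrow>
     lincomb (elim_args p (fst s)) w = \<epsilon> * x"
    by (simp add: elim_args_simps)
qed (auto simp: elim_args_simps elim_args_face_f)

lemma elim_args_shears:
  assumes i: "i \<in> elim_idx p"
  shows "lincomb (elim_args p i) (shears \<epsilon> (elim_list p) z) = \<epsilon> * z i"
proof -
  obtain c cs where m: "(i, c, cs) \<in> set (elim_list p)"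
    using i unfolding elim_idx_eq[symmetric] by force
  from bspec[OF elim_args_solve m] shears_eq[OF shear_list_elim m, of \<epsilon> z]
  show ?thesis by simp
qed

text \<open>
  The congruence of \<open>g\<close> is required because \<^const>\<open>case_sum\<close> yields functions that are not
  extensional.
\<close>

lemma PiM_sum_integral:
  fixes A :: "'a set" and B :: "'b set" and g :: "('a + 'b \<Rightarrow> real) \<Rightarrow> complex"
  assumes AB: "finite A" "finite B" and g: "integrable (lborel_prod (A <+> B)) g"
    and cong: "\<And>w w'. (\<And>i. i \<in> A <+> B \<Longrightarrow> w i = w' i) \<Longrightarrow> g w = g w'"
  shows "(\<integral>w. g w \<partial>lborel_prod (A <+> B)) =
           (\<integral>y. (\<integral>x. g (case_sum x y) \<partial>lborel_prod A) \<partial>lborel_prod B)"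
proof -
  let ?MA = "lborel_prod A" and ?MB = "lborel_prod B"
    and ?M = "lborel_prod (A <+> B)"
  let ?comb = "\<lambda>(x, y). \<lambda>i\<in>A <+> B. case i of Inl a \<Rightarrow> x a | Inr b \<Rightarrow> (y b :: real)"
  interpret A: finite_product_sigma_finite "\<lambda>_. lborel :: real measure" A by standard fact
  interpret B: finite_product_sigma_finite "\<lambda>_. lborel :: real measure" B by standard fact
  interpret P: pair_sigma_finite ?MA ?MB ..
  note C = PiM_sum_distr[OF AB]
  have gc: "g (?comb (x, y)) = g (case_sum x y)" for x y
    by (rule cong) (auto split: sum.split)
  have int: "integrable (?MA \<Otimes>\<^sub>M ?MB) (\<lambda>p. g (?comb p))"
    by (rule integrable_distr[OF C(1)]) (subst C(2), rule g)
  have "(\<integral>w. g w \<partial>?M) = (\<integral>w. g w \<partial>distr (?MA \<Otimes>\<^sub>M ?MB) ?M ?comb)" unfolding C(2) ..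
  also have "\<dots> = (\<integral>p. g (?comb p) \<partial>(?MA \<Otimes>\<^sub>M ?MB))"
    using g by (intro integral_distr C) auto
  also have "\<dots> = (\<integral>y. (\<integral>x. g (?comb (x, y)) \<partial>?MA) \<partial>?MB)"
    using P.integral_snd[of "\<lambda>x y. g (?comb (x, y))"] int by (simp add: case_prod_beta')
  finally show ?thesis unfolding gc .
qed

lemma finite_Y [simp]: "finite (Y_fcs p)" "finite (J_index p)" "finite (Y_tets p)" "finite (elim_idx p)" "finite (Y_idx p)"
  by (auto simp: Y_fcs_def J_index_def Y_tets_def elim_idx_def Y_idx_def)

lemma Fm_notin: "Fm \<notin> Y_fcs p"
  by (auto simp: Y_fcs_def)

text \<open>
  The sum of \<open>\<epsilon>(T) x\<^sub>0(T) t\<^sub>T\<close> over all tetrahedra except \<open>Z\<close>; the term \<open>m t\<^sub>Z\<close> of \<open>Z\<close> is integrated out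
  beforehand.
\<close>

definition Y_phase :: "nat \<Rightarrow> (idx \<Rightarrow> real) \<Rightarrow> real" where
  "Y_phase p w = (\<Sum>k=1..p. w (xE k) * w (xT (TT k))) - w (Inl Fr) * w (xT TU) - w (Inl Fg) * w (xT TV) - w (Inl Fu) * w (xT TW)"

lemma prod_Y_tets:
  fixes f :: "tet \<Rightarrow> 'a :: comm_monoid_mult"
  shows "prod f (Y_tets p) = f TZ * (f TV * (f TU * (f TW * (\<Prod>k=1..p. f (TT k)))))"
proof -
  have "Y_tets p = insert TZ (insert TV (insert TU (insert TW (TT ` {1..p}))))"
    by (auto simp: Y_tets_def J_index_def)
  moreover have "prod f (TT ` {1..p}) = (\<Prod>k=1..p. f (TT k))"
    by (subst prod.reindex) (auto simp: inj_on_def)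
  ultimately show ?thesis by (auto simp: image_iff)
qed

lemma prod_elim_idx:
  fixes f :: "idx \<Rightarrow> 'a :: comm_monoid_mult"
  shows "prod f (elim_idx p) = f (xT TZ) * (f (xT TV) * (f (Inl Fv) * (f (Inl Fr) * (f (Inl Fs) * (f (Inl Fs') * (f (Inl Fg) * (f (Inl Fu) *
     (f (xF p) * ((\<Prod>k=1..p. f (xF (k - 1))) * (\<Prod>k=1..p. f (xE (k + 1))))))))))))"
proof -
  let ?A = "(\<lambda>k. xF k) ` {..p}" and ?B = "(\<lambda>k. xE (k + 1)) ` {1..p}"
  have A: "prod f ?A = f (xF p) * (\<Prod>k=1..p. f (xF (k - 1)))"
  proof -
    have "inj_on xF {..p}" by (auto simp: inj_on_def face_f_def split: if_splits)
    then have "prod f ?A = (\<Prod>k\<le>p. f (xF k))" by (simp add: prod.reindex)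
    also have "\<dots> = f (xF p) * (\<Prod>k<p. f (xF k))" by (simp add: lessThan_Suc_atMost[symmetric] mult.commute)
    also have "(\<Prod>k<p. f (xF k)) = (\<Prod>k=1..p. f (xF (k - 1)))" by (simp add: prod.atLeast1_atMost_eq)
    finally show ?thesis .
  qed
  have B: "prod f ?B = (\<Prod>k=1..p. f (xE (k + 1)))"
    by (subst prod.reindex) (auto simp: inj_on_def)
  have AB: "prod f (?A \<union> ?B) = prod f ?A * prod f ?B"
    by (rule prod.union_disjoint) (auto simp: face_f_def split: if_splits)
  have "elim_idx p = insert (xT TZ) (insert (xT TV) (insert (Inl Fv) (insert (Inl Fr) (insert (Inl Fs) (insert (Inl Fs') (insert (Inl Fg) (insert (Inl Fu) (?A \<union> ?B))))))))"
    unfolding elim_idx_def Y_fcs_alt by (auto simp: image_Un image_image)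
  moreover have "x \<notin> ?A \<union> ?B" if "x \<in> {xT TZ, xT TV, Inl Fv, Inl Fr, Inl Fs, Inl Fs', Inl Fg, Inl Fu}" for x
    using that by (auto simp: face_f_def split: if_splits)
  ultimately show ?thesis using AB A B by (simp add: mult.assoc)
qed

text \<open>
  In \<open>Z : (m, m, s, s')\<close> the variable \<open>m\<close> cancels from \<open>x\<^sub>0 - x\<^sub>1 + x\<^sub>2\<close>, and no other tetrahedron contains it.
  So it survives only in its cut-off and in the phase of \<open>Z\<close>.
\<close>

lemma kernel_integrand_split:
  fixes p :: nat and \<epsilon> :: real and x :: "fc \<Rightarrow> real" and t :: "tet \<Rightarrow> real" and \<psi> :: "real \<Rightarrow> complex"
  assumes p: "p = twist_p n"
  defines "D \<equiv> \<lambda>i. delta_cutoff \<psi> \<epsilon> (lincomb (elim_args p i) (case_sum x t))"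
  shows "(\<Prod>f\<in>faces (twist_Y n). \<psi> (\<epsilon> * x f)) *
        (\<Prod>T\<in>tets (twist_Y n).
           exp (2 * of_real pi * \<i> * of_int (sign (twist_Y n) T) * of_real (x (face (twist_Y n) T 0) * t T)) *
           delta_cutoff \<psi> \<epsilon> (x (face (twist_Y n) T 0) - x (face (twist_Y n) T 1) + x (face (twist_Y n) T 2)) *
           delta_cutoff \<psi> \<epsilon> (x (face (twist_Y n) T 2) - x (face (twist_Y n) T 3) + t T)) =
     (\<psi> (\<epsilon> * x Fm) * exp (2 * of_real pi * \<i> * of_real (x Fm * t TZ))) *
     ((\<Prod>f\<in>Y_fcs p. \<psi> (\<epsilon> * x f)) * exp (2 * of_real pi * \<i> * of_real (Y_phase p (case_sum x t))) * (\<Prod>i\<in>elim_idx p - {xT TZ}. D i))"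
proof -
  let ?E = "\<lambda>y :: real. exp (2 * of_real pi * \<i> * of_real y)"
  let ?F = "\<lambda>T. exp (2 * of_real pi * \<i> * of_int (sign (twist_Y n) T) * of_real (x (face (twist_Y n) T 0) * t T)) *
           delta_cutoff \<psi> \<epsilon> (x (face (twist_Y n) T 0) - x (face (twist_Y n) T 1) + x (face (twist_Y n) T 2)) *
           delta_cutoff \<psi> \<epsilon> (x (face (twist_Y n) T 2) - x (face (twist_Y n) T 3) + t T)"
  have sg: "sign (twist_Y n) T = twist_sign T" for T by (simp add: twist_Y_def)
  have Fs: "?F TZ = ?E (x Fm * t TZ) * (D (Inl Fs) * D (Inl Fs'))"
     "?F TU = ?E (- (x Fr * t TU)) * (D (Inl Fr) * D (Inl Fg))"
     "?F TV = ?E (- (x Fg * t TV)) * (D (xF p) * D (xT TV))"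
     "?F TW = ?E (- (x Fu * t TW)) * (D (Inl Fu) * D (Inl Fv))"
    unfolding D_def sg face_twist_Y p[symmetric]
    by (simp_all add: elim_args_simps elim_args_face_f algebra_simps)
  have Fk: "?F (TT k) = ?E (x (FE k) * t (TT k)) * (D (xE (k + 1)) * D (xF (k - 1)))" if "k \<in> {1..p}" for k
  proof -
    have "elim_args p (xF (k - 1)) = [(1, xF k), (-1, xF (k - 1)), (1, xT (TT k))]"
      using elim_args_face_f(2)[of "k - 1" p] that by (cases k) auto
    then show ?thesis
      unfolding D_def sg face_twist_Y p[symmetric] using that
      by (simp add: elim_args_simps algebra_simps)
  qed
  have ph: "?E (Y_phase p (case_sum x t)) = (\<Prod>k=1..p. ?E (x (FE k) * t (TT k))) * ?E (- (x Fr * t TU)) * ?E (- (x Fg * t TV)) * ?E (- (x Fu * t TW))"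
    unfolding Y_phase_def by (simp add: exp_diff exp_minus sum_distrib_left exp_sum ring_distribs divide_inverse)
  have 1: "(\<Prod>T\<in>tets (twist_Y n). ?F T) = ?F TZ * (?F TV * (?F TU * (?F TW * (\<Prod>k=1..p. ?F (TT k)))))"
    unfolding tets_twist_Y p[symmetric] prod_Y_tets ..
  have 2: "(\<Prod>k=1..p. ?F (TT k)) = (\<Prod>k=1..p. ?E (x (FE k) * t (TT k))) * ((\<Prod>k=1..p. D (xE (k + 1))) * (\<Prod>k=1..p. D (xF (k - 1))))"
    unfolding prod.distrib[symmetric] by (rule prod.cong[OF refl Fk])
  have 3: "(\<Prod>i\<in>elim_idx p - {xT TZ}. D i) = D (xT TV) * (D (Inl Fv) * (D (Inl Fr) * (D (Inl Fs) * (D (Inl Fs') * (D (Inl Fg) * (D (Inl Fu) *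
     (D (xF p) * ((\<Prod>k=1..p. D (xF (k - 1))) * (\<Prod>k=1..p. D (xE (k + 1)))))))))))"
  proof -
    have "(\<Prod>i\<in>elim_idx p - {xT TZ}. D i) = (\<Prod>i\<in>elim_idx p. (D(xT TZ := 1)) i)"
      by (rule prod.mono_neutral_cong_left) auto
    then show ?thesis unfolding prod_elim_idx by simp
  qed
  have 4: "(\<Prod>f\<in>faces (twist_Y n). \<psi> (\<epsilon> * x f)) = \<psi> (\<epsilon> * x Fm) * (\<Prod>f\<in>Y_fcs p. \<psi> (\<epsilon> * x f))"
    unfolding faces_twist_Y p[symmetric] using Fm_notin by simp
  show ?thesis unfolding 1 2 3 4 Fs ph by (simp only: mult_ac)
qed

section \<open>The kinematical kernel\<close>

lemma norm_exp_2pi: "norm (exp (2 * of_real pi * \<i> * of_real y)) = 1"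
proof -
  have "2 * of_real pi * \<i> * of_real y = \<i> * of_real (2 * pi * y)" by simp
  then show ?thesis by (simp only: norm_exp_i_times)
qed

lemma elim_args_idx:
  assumes "i \<in> elim_idx p"
  shows "snd ` set (elim_args p i) \<subseteq> Y_idx p"
proof -
  have "\<forall>s\<in>set (elim_list p). snd ` set (elim_args p (fst s)) \<subseteq> Y_idx p"
    unfolding elim_list_def set_append ball_Un set_map Ball_image_comp
  proof (intro conjI)
  qed (auto simp: Y_mem elim_args_simps elim_args_face_f)
  then show ?thesis using assms unfolding elim_idx_eq[symmetric] by blast
qed

lemma measurable_coord:
  "i \<in> I \<Longrightarrow> (\<lambda>w. w i) \<in> borel_measurable (lborel_prod I)"
  using measurable_component_singleton[of i I "\<lambda>_. lborel :: real measure"] by simp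

text \<open>
  A coordinate on which only a separate factor depends is integrated out. The bound on \<open>G\<close> serves for
  the integrability in the remaining coordinates.
\<close>

lemma PiM_integral_drop:
  fixes G :: "('i \<Rightarrow> real) \<Rightarrow> complex" and f :: "real \<Rightarrow> complex"
  assumes K: "finite K" "i \<notin> K" and G: "G \<in> borel_measurable (lborel_prod (insert i K))"
    and ind: "\<And>t a. G (t(i := a)) = G t"
    and u: "\<And>k. k \<in> K \<Longrightarrow> integrable lborel (u k)" and bound: "\<And>t. norm (G t) \<le> C * (\<Prod>k\<in>K. u k (t k))"
    and f: "integrable lborel f"
  shows "(\<integral>t. G t * f (t i) \<partial>lborel_prod (insert i K)) = (\<integral>t. G t \<partial>lborel_prod K) * (\<integral>y. f y \<partial>lborel)"
proof -
  interpret product_sigma_finite "\<lambda>_ :: 'i. lborel :: real measure" by (rule product_sigma_finite_lborel)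
  let ?u = "u(i := \<lambda>y. norm (f y))"
  have "integrable (lborel_prod (insert i K)) (\<lambda>t. G t * f (t i))"
  proof (rule integrable_PiM_bound)
    show "(\<lambda>t. G t * f (t i)) \<in> borel_measurable (lborel_prod (insert i K))"
      by (intro borel_measurable_times G measurable_compose[OF measurable_coord]) (use f in auto)
    show "integrable lborel (?u k)" if "k \<in> insert i K" for k using that u f by auto
    show "norm (G t * f (t i)) \<le> C * (\<Prod>k\<in>insert i K. ?u k (t k))" for t
    proof -
      have "(\<Prod>k\<in>K. ?u k (t k)) = (\<Prod>k\<in>K. u k (t k))" using K(2) by (intro prod.cong) auto
      then show ?thesis using mult_right_mono[OF bound[of t], of "norm (f (t i))"] K by (simp add: norm_mult mult_ac)
    qed
  qed (use K in simp)
  from product_integral_insert[OF K this] show ?thesis by (simp add: ind)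
qed

lemma lincomb_case_sum_measurable:
  "(\<And>f. Inl f \<in> snd ` set cs \<Longrightarrow> f \<in> A) \<Longrightarrow> (\<lambda>x. lincomb cs (case_sum x t)) \<in> borel_measurable (lborel_prod A)"
proof (induction cs)
  case (Cons a cs)
  obtain c j where a: "a = (c, j)" by force
  have "(\<lambda>x. case_sum x t j) \<in> borel_measurable (lborel_prod A)"
    using Cons.prems a by (cases j) (auto intro!: measurable_coord)
  with Cons show ?case unfolding a lincomb_simps(2) by (auto intro!: borel_measurable_add borel_measurable_times)
qed simp

text \<open>
  The integral over \<open>m\<close> is the regularised delta of \<open>- t\<^sub>Z\<close>, the additional one that matches the
  number of deltas with the number of eliminated variables.
\<close>

lemma kernel_cutoff_twist_Y:
  fixes t :: "tet \<Rightarrow> real"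
  assumes p: "p = twist_p n" and \<psi>: "schwartz \<psi>" and \<epsilon>: "\<epsilon> > 0"
  shows "kernel_cutoff (twist_Y n) \<psi> \<epsilon> t =
     (\<integral>x. (\<Prod>f\<in>Y_fcs p. \<psi> (\<epsilon> * x f)) * exp (2 * of_real pi * \<i> * of_real (Y_phase p (case_sum x t))) *
        (\<Prod>i\<in>elim_idx p. delta_cutoff \<psi> \<epsilon> (lincomb (elim_args p i) (case_sum x t))) \<partial>lborel_prod (Y_fcs p))"
proof -
  let ?D = "\<lambda>x i. delta_cutoff \<psi> \<epsilon> (lincomb (elim_args p i) (case_sum x t))"
  let ?R = "\<lambda>x. (\<Prod>f\<in>Y_fcs p. \<psi> (\<epsilon> * x f)) * exp (2 * of_real pi * \<i> * of_real (Y_phase p (case_sum x t))) * (\<Prod>i\<in>elim_idx p - {xT TZ}. ?D x i)"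
  let ?f = "\<lambda>m. \<psi> (\<epsilon> * m) * exp (2 * of_real pi * \<i> * of_real (m * t TZ))"
  let ?M = "lborel_prod (insert Fm (Y_fcs p))"
  note S = fourier_schwartz[OF \<psi>]
  have [measurable]: "\<psi> \<in> borel_measurable borel" by (rule borel_measurable_continuous_onI[OF S(1)])
  note [measurable] = delta_cutoff_measurable[OF \<psi>]
  obtain D where D: "\<And>x. norm (delta_cutoff \<psi> \<epsilon> x) \<le> D" using delta_cutoff_bounded[OF \<psi> \<epsilon>] by blast
  have mc: "(\<lambda>x. x f) \<in> borel_measurable ?M" if "f \<in> insert Fm (Y_fcs p)" for f
    using that by (rule measurable_coord)
  have arg_in: "f \<in> insert Fm (Y_fcs p)" if "i \<in> elim_idx p" "Inl f \<in> snd ` set (elim_args p i)" for f i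
    using elim_args_idx[OF that(1)] that(2) by (auto simp: Y_idx_def)
  have mD: "(\<lambda>x. ?D x i) \<in> borel_measurable ?M" if "i \<in> elim_idx p" for i
    by (rule measurable_compose[OF lincomb_case_sum_measurable delta_cutoff_measurable[OF \<psi>]]) (rule arg_in[OF that])
  have mph: "(\<lambda>x. Y_phase p (case_sum x t)) \<in> borel_measurable ?M"
    unfolding Y_phase_def old.sum.case
    by (intro borel_measurable_diff borel_measurable_sum borel_measurable_times mc borel_measurable_const) (auto simp: Y_fcs_def)
  have mpsi: "(\<lambda>x. \<psi> (\<epsilon> * x f)) \<in> borel_measurable ?M" if "f \<in> insert Fm (Y_fcs p)" for f
    using mc[OF that] by measurable
  have mph': "(\<lambda>x. complex_of_real (Y_phase p (case_sum x t))) \<in> borel_measurable ?M" using mph by simp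
  have mR: "?R \<in> borel_measurable ?M"
    by (intro borel_measurable_times borel_measurable_prod mpsi mD measurable_compose[OF _ borel_measurable_exp]
          mph' borel_measurable_const) auto
  have intpsi: "integrable lborel (\<lambda>y. norm (\<psi> (\<epsilon> * y)))"
    using lborel_integrable_real_affine[OF integrable_norm[OF S(2)], of \<epsilon> 0] \<epsilon> by simp
  have bound: "norm (?R x) \<le> (\<Prod>i\<in>elim_idx p - {xT TZ}. D) * (\<Prod>f\<in>Y_fcs p. norm (\<psi> (\<epsilon> * x f)))" for x
  proof -
    have "norm (\<Prod>i\<in>elim_idx p - {xT TZ}. ?D x i) \<le> (\<Prod>i\<in>elim_idx p - {xT TZ}. D)"
      unfolding prod_norm[symmetric] by (intro prod_mono) (auto intro: D)
    then have "norm (\<Prod>i\<in>elim_idx p - {xT TZ}. ?D x i) * (\<Prod>f\<in>Y_fcs p. norm (\<psi> (\<epsilon> * x f))) \<le>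
        (\<Prod>i\<in>elim_idx p - {xT TZ}. D) * (\<Prod>f\<in>Y_fcs p. norm (\<psi> (\<epsilon> * x f)))"
      by (rule mult_right_mono) (auto intro: prod_nonneg)
    then show ?thesis
      by (simp only: norm_mult norm_exp_2pi prod_norm[symmetric] mult_1 mult_1_right) (simp add: mult_ac)
  qed
  have R: "?R (x(Fm := m)) = ?R x" for x m
  proof -
    have "(\<Prod>f\<in>Y_fcs p. \<psi> (\<epsilon> * (x(Fm := m)) f)) = (\<Prod>f\<in>Y_fcs p. \<psi> (\<epsilon> * x f))"
      using Fm_notin[of p] by (intro prod.cong) auto
    moreover have "Y_phase p (case_sum (x(Fm := m)) t) = Y_phase p (case_sum x t)" by (simp add: Y_phase_def)
    moreover have "(\<Prod>i\<in>elim_idx p - {xT TZ}. ?D (x(Fm := m)) i) = (\<Prod>i\<in>elim_idx p - {xT TZ}. ?D x i)"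
    proof (intro prod.cong refl arg_cong[of _ _ "delta_cutoff \<psi> \<epsilon>"] lincomb_cong)
      fix i j assume "i \<in> elim_idx p - {xT TZ}" "j \<in> snd ` set (elim_args p i)"
      then have "j \<in> Y_idx p" using elim_args_idx[of i p] by auto
      then show "case_sum (x(Fm := m)) t j = case_sum x t j" using Fm_notin[of p] by (auto simp: Y_idx_def)
    qed
    ultimately show ?thesis by simp
  qed
  have intf: "integrable lborel ?f"
  proof (rule Bochner_Integration.integrable_bound[OF intpsi])
    show "AE m in lborel. norm (?f m) \<le> norm (norm (\<psi> (\<epsilon> * m)))"
      by (simp only: norm_mult norm_exp_2pi) simp
  qed measurable
  have f: "(\<integral>m. ?f m \<partial>lborel) = delta_cutoff \<psi> \<epsilon> (- t TZ)"
    unfolding delta_cutoff_def by (intro Bochner_Integration.integral_cong refl) (simp add: mult_ac)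
  have all: "(\<Prod>i\<in>elim_idx p. ?D x i) = delta_cutoff \<psi> \<epsilon> (- t TZ) * (\<Prod>i\<in>elim_idx p - {xT TZ}. ?D x i)" for x
    by (subst prod.remove[of _ "xT TZ"]) (auto simp: elim_idx_def elim_args_simps)
  have "kernel_cutoff (twist_Y n) \<psi> \<epsilon> t = (\<integral>x. ?R x * ?f (x Fm) \<partial>?M)"
    unfolding kernel_cutoff_def kernel_integrand_split[OF p] unfolding faces_twist_Y p[symmetric]
    by (intro Bochner_Integration.integral_cong refl mult.commute)
  also have "\<dots> = (\<integral>x. ?R x \<partial>lborel_prod (Y_fcs p)) * delta_cutoff \<psi> \<epsilon> (- t TZ)"
    unfolding f[symmetric]
    by (rule PiM_integral_drop[where f = ?f and G = ?R, OF _ Fm_notin mR R intpsi bound intf]) simp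
  also have "\<dots> = (\<integral>x. ?R x * delta_cutoff \<psi> \<epsilon> (- t TZ) \<partial>lborel_prod (Y_fcs p))"
    by (rule integral_mult_left_zero[symmetric])
  finally show ?thesis unfolding all by (simp only: mult_ac)
qed

definition J_quad :: "nat \<Rightarrow> (tet \<Rightarrow> real) \<Rightarrow> real" where
  "J_quad p t = (\<Sum>j\<in>J_index p. \<Sum>k\<in>J_index p. t j * J_Q p j k * t k)"

lemma sum_J_index:
  fixes f :: "tet \<Rightarrow> 'a :: comm_monoid_add"
  shows "sum f (J_index p) = (\<Sum>k=1..p. f (TT k)) + (f TU + f TW)"
proof -
  have "J_index p = insert TU (insert TW (TT ` {1..p}))" by (auto simp: J_index_def)
  moreover have "sum f (TT ` {1..p}) = (\<Sum>k=1..p. f (TT k))"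
    by (subst sum.reindex) (auto simp: inj_on_def)
  ultimately show ?thesis by (auto simp: image_iff add_ac)
qed

lemma J_quad_eq:
  "J_quad p t = (\<Sum>k=1..p. (\<Sum>j=1..p. real (min j k) * t (TT j)) * t (TT k)) - 2 * (\<Sum>k=1..p. real k * t (TT k)) * t TU
      + real p * (t TU)\<^sup>2 + t TU * t TW"
proof -
  have "J_quad p t = (\<Sum>j=1..p. \<Sum>k=1..p. t (TT j) * real (min j k) * t (TT k)) + (\<Sum>j=1..p. t (TT j) * (- real j) * t TU)
      + (\<Sum>k=1..p. t TU * (- real k) * t (TT k)) + t TU * real p * t TU + t TU * t TW"
    unfolding J_quad_def sum_J_index by (simp add: sum.distrib sum_subtractf sum_negf)
  also have "(\<Sum>j=1..p. \<Sum>k=1..p. t (TT j) * real (min j k) * t (TT k)) = (\<Sum>k=1..p. (\<Sum>j=1..p. real (min j k) * t (TT j)) * t (TT k))"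
    by (subst sum.swap) (simp add: sum_distrib_right sum_distrib_left mult_ac)
  also have "(\<Sum>j=1..p. t (TT j) * (- real j) * t TU) = - ((\<Sum>k=1..p. real k * t (TT k)) * t TU)"
    by (simp add: sum_distrib_right sum_distrib_left sum_negf mult_ac)
  also have "(\<Sum>k=1..p. t TU * (- real k) * t (TT k)) = - ((\<Sum>k=1..p. real k * t (TT k)) * t TU)"
    by (simp add: sum_distrib_right sum_distrib_left sum_negf mult_ac)
  finally show ?thesis by (simp add: power2_eq_square algebra_simps)
qed

text \<open>
  The solution at \<open>\<epsilon> = 0\<close>: \<open>s = s' = u = 0\<close>, \<open>g = t\<^sub>U = t\<^sub>V\<close>, \<open>f\<^sub>k = - t\<^sub>U + \<Sum>\<^sub>j\<^sub>>\<^sub>k t\<^sub>j\<close>, and \<open>e\<^sub>k\<close> is the sum of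
  \<open>f\<^sub>0, \<dots>, f\<^sub>k\<^sub>-\<^sub>1\<close>, that is \<open>- k t\<^sub>U + \<Sum>\<^sub>j min(j, k) t\<^sub>j\<close>. Substituted into the phase, these produce the matrix
  \<open>Q\<^sub>n\<close>.
\<close>

lemma elim_solution:
  fixes p :: nat and z :: "idx \<Rightarrow> real"
  defines "w \<equiv> shears 0 (elim_list p) z"
  shows "w (xT TZ) = 0" "w (xT TV) = z (xT TU)" "T \<in> J_index p \<Longrightarrow> w (xT T) = z (xT T)"
    "Y_phase p w = J_quad p (\<lambda>T. z (Inr T))"
proof -
  have eq: "lincomb (elim_args p i) w = 0" if "i \<in> elim_idx p" for i
    unfolding w_def using elim_args_shears[OF that, of 0 z] by simp
  have J: "w (xT T) = z (xT T)" if "T \<in> J_index p" for T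
    unfolding w_def by (rule shears_other) (use that in \<open>auto simp: elim_idx_eq elim_idx_def J_index_def\<close>)
  then show "T \<in> J_index p \<Longrightarrow> w (xT T) = z (xT T)" .
  have tU: "w (xT TU) = z (xT TU)" and tW: "w (xT TW) = z (xT TW)" and tk: "\<And>k. k \<in> {1..p} \<Longrightarrow> w (xT (TT k)) = z (xT (TT k))"
    by (auto intro!: J simp: J_index_def)
  have mem: "xT TZ \<in> elim_idx p" "xT TV \<in> elim_idx p" "Inl Fs \<in> elim_idx p" "Inl Fs' \<in> elim_idx p"
      "Inl Fg \<in> elim_idx p" "Inl Fu \<in> elim_idx p" "Inl Fr \<in> elim_idx p" "Inl Fv \<in> elim_idx p"
    by (auto simp: elim_idx_def Y_fcs_def)
  have memF: "xF k \<in> elim_idx p" if "k \<le> p" for k using face_f_in[OF that] by (auto simp: elim_idx_def)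
  have memE: "xE (Suc k) \<in> elim_idx p" if "k \<le> p" for k using that by (auto simp: elim_idx_def Y_fcs_def)
  note E = mem[THEN eq, unfolded elim_args_simps, simplified]
  show Z: "w (xT TZ) = 0" using E(1) .
  have s: "w (Inl Fs) = 0" "w (Inl Fs') = 0" using E(3,4) Z by auto
  have g: "w (Inl Fg) = z (xT TU)" using E(5) s tU by simp
  have fp: "w (xF p) = - z (xT TU)" using eq[OF memF[of p]] g s by (simp add: elim_args_face_f)
  have u: "w (Inl Fu) = 0" using E(6,7) s by simp
  show V: "w (xT TV) = z (xT TU)" using E(2) u fp by simp
  have r: "w (Inl Fr) = w (xE (p + 1)) - z (xT TW)" using E(7,8) s tW by simp
  have f: "w (xF k) = - z (xT TU) + (\<Sum>j=k+1..p. z (xT (TT j)))" if "k \<le> p" for k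
    using that
  proof (induction k rule: inc_induct)
    case base show ?case using fp by simp
  next
    case (step k)
    have "w (xF k) = w (xF (Suc k)) + w (xT (TT (Suc k)))"
      using eq[OF memF[of k]] step.hyps by (simp add: elim_args_face_f)
    moreover have "(\<Sum>j=k+1..p. z (xT (TT j))) = z (xT (TT (k + 1))) + (\<Sum>j=k+1+1..p. z (xT (TT j)))"
      using step.hyps sum.atLeast_Suc_atMost[of "k + 1" p "\<lambda>j. z (xT (TT j))"] by simp
    ultimately show ?case using step.IH tk[of "Suc k"] step.hyps by simp
  qed
  have e: "w (xE (Suc k)) = - real (Suc k) * z (xT TU) + (\<Sum>j=1..p. real (min j (Suc k)) * z (xT (TT j)))" if "k \<le> p" for k
    using that
  proof (induction k)
    case 0
    have "w (xE 1) = w (xF 0)" by (simp add: face_f_def)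
    moreover have "(\<Sum>j=1..p. real (min j (Suc 0)) * z (xT (TT j))) = (\<Sum>j=1..p. z (xT (TT j)))"
      by (intro sum.cong) (auto simp: min_def)
    ultimately show ?case using f[of 0] by simp
  next
    case (Suc k)
    have "w (xE (Suc (Suc k))) = w (xE (Suc k)) + w (xF (Suc k))"
      using eq[OF memE[of "Suc k"]] Suc.prems by (simp add: elim_args_simps)
    moreover have "(\<Sum>j=1..p. real (min j (Suc (Suc k))) * z (xT (TT j))) =
        (\<Sum>j=1..p. real (min j (Suc k)) * z (xT (TT j))) + (\<Sum>j=Suc k+1..p. z (xT (TT j)))"
    proof -
      have "(\<Sum>j=Suc k+1..p. z (xT (TT j))) = (\<Sum>j=1..p. if j \<ge> Suc k + 1 then z (xT (TT j)) else 0)"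
        by (subst sum.inter_filter[symmetric]) (auto intro!: sum.cong)
      then show ?thesis unfolding sum.distrib[symmetric]
        by (simp only: sum.distrib[symmetric]) (intro sum.cong, auto simp: min_def algebra_simps)
    qed
    ultimately show ?case using Suc f[of "Suc k"] by (simp add: algebra_simps)
  qed
  have e': "w (xE k) = - real k * z (xT TU) + (\<Sum>j=1..p. real (min j k) * z (xT (TT j)))" if "k \<in> {1..p+1}" for k
    using e[of "k - 1"] that by (cases k) auto
  have ep: "w (xE (p + 1)) = - real (p + 1) * z (xT TU) + (\<Sum>j=1..p. real j * z (xT (TT j)))"
  proof -
    have "(\<Sum>j=1..p. real (min j (p + 1)) * z (xT (TT j))) = (\<Sum>j=1..p. real j * z (xT (TT j)))"
      by (intro sum.cong) (auto simp: min_def)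
    then show ?thesis using e'[of "p + 1"] by simp
  qed
  have "(\<Sum>k=1..p. w (xE k) * w (xT (TT k))) = (\<Sum>k=1..p. (- real k * z (xT TU) + (\<Sum>j=1..p. real (min j k) * z (xT (TT j)))) * z (xT (TT k)))"
    by (intro sum.cong refl) (simp add: e' tk)
  also have "\<dots> = (\<Sum>k=1..p. (\<Sum>j=1..p. real (min j k) * z (xT (TT j))) * z (xT (TT k))) - (\<Sum>k=1..p. real k * z (xT (TT k))) * z (xT TU)"
    by (simp add: ring_distribs sum.distrib sum_negf sum_subtractf sum_distrib_right sum_distrib_left mult_ac)
  finally show "Y_phase p w = J_quad p (\<lambda>T. z (Inr T))"
    unfolding Y_phase_def J_quad_eq r g u V tU tW ep by (simp add: power2_eq_square algebra_simps)
qed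

lemma Y_idx_split: "Y_idx p = elim_idx p \<union> Inr ` J_index p" "elim_idx p \<inter> Inr ` J_index p = {}"
  by (auto simp: Y_idx_def elim_idx_def Y_tets_def Plus_def J_index_def)

lemma prod_Y_idx:
  fixes f :: "idx \<Rightarrow> 'a :: comm_monoid_mult"
  shows "prod f (Y_idx p) = prod f (elim_idx p) * (\<Prod>T\<in>J_index p. f (Inr T))"
  unfolding Y_idx_split(1) using Y_idx_split(2) by (subst prod.union_disjoint) (auto simp: prod.reindex)

lemma prod_elim_idx_sum:
  fixes f :: "idx \<Rightarrow> 'a :: comm_monoid_mult"
  shows "prod f (elim_idx p) = (\<Prod>x\<in>Y_fcs p. f (Inl x)) * (f (xT TZ) * f (xT TV))"
  unfolding elim_idx_def by (subst prod.union_disjoint) (auto simp: prod.reindex)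

text \<open>
  Faces and tetrahedra variables merged; the statement is Fubini, with the cut-offs in the face
  variables and the integrability of the test function as the source of absolute convergence.
\<close>

lemma kernel_integral_twist_Y:
  fixes h :: "tet \<Rightarrow> real \<Rightarrow> complex"
  assumes p: "p = twist_p n" and \<psi>: "schwartz \<psi>" and \<epsilon>: "\<epsilon> > 0"
    and h: "\<And>T. T \<in> Y_tets p \<Longrightarrow> continuous_on UNIV (h T)" "\<And>T. T \<in> Y_tets p \<Longrightarrow> integrable lborel (h T)"
  defines "A \<equiv> \<lambda>w :: idx \<Rightarrow> real. (\<Prod>f\<in>Y_fcs p. \<psi> (\<epsilon> * w (Inl f))) * exp (2 * of_real pi * \<i> * of_real (Y_phase p w)) * (\<Prod>T\<in>Y_tets p. h T (w (Inr T)))"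
  shows "(\<integral>t. kernel_cutoff (twist_Y n) \<psi> \<epsilon> t * (\<Prod>T\<in>Y_tets p. h T (t T)) \<partial>lborel_prod (Y_tets p)) =
     (\<integral>w. A w * (\<Prod>i\<in>elim_idx p. delta_cutoff \<psi> \<epsilon> (lincomb (elim_args p i) w)) \<partial>lborel_prod (Y_idx p))"
    and "A \<in> borel_measurable (lborel_prod (Y_idx p))"
proof -
  let ?M = "lborel_prod (Y_idx p)"
  let ?D = "\<lambda>w i. delta_cutoff \<psi> \<epsilon> (lincomb (elim_args p i) w)"
  let ?G = "\<lambda>w. A w * (\<Prod>i\<in>elim_idx p. ?D w i)"
  note S = fourier_schwartz[OF \<psi>]
  have [measurable]: "\<psi> \<in> borel_measurable borel" by (rule borel_measurable_continuous_onI[OF S(1)])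
  obtain D where D: "\<And>x. norm (delta_cutoff \<psi> \<epsilon> x) \<le> D" using delta_cutoff_bounded[OF \<psi> \<epsilon>] by blast
  have mc: "(\<lambda>w. w i) \<in> borel_measurable ?M" if "i \<in> Y_idx p" for i
    using that by (rule measurable_coord)
  have mD: "(\<lambda>w. ?D w i) \<in> borel_measurable ?M" if "i \<in> elim_idx p" for i
    by (rule measurable_compose[OF lincomb_measurable[OF elim_args_idx[OF that]] delta_cutoff_measurable[OF \<psi>]])
  have "Y_phase p \<in> borel_measurable ?M"
    unfolding Y_phase_def[abs_def]
    by (intro borel_measurable_diff borel_measurable_sum borel_measurable_times mc) (auto simp: Y_idx_def Y_fcs_def Y_tets_def J_index_def)
  then have mR: "(\<lambda>w. complex_of_real (Y_phase p w)) \<in> borel_measurable ?M" by simp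
  have mpsi: "(\<lambda>w. \<psi> (\<epsilon> * w (Inl f))) \<in> borel_measurable ?M" if "f \<in> Y_fcs p" for f
  proof -
    have "Inl f \<in> Y_idx p" using that by (auto simp: Y_idx_def)
    from mc[OF this] show ?thesis by measurable
  qed
  have mh: "(\<lambda>w. h T (w (Inr T))) \<in> borel_measurable ?M" if "T \<in> Y_tets p" for T
    by (rule measurable_compose[OF mc borel_measurable_continuous_onI[OF h(1)[OF that]]]) (use that in \<open>auto simp: Y_idx_def\<close>)
  show mA: "A \<in> borel_measurable ?M"
    unfolding A_def
    by (intro borel_measurable_times borel_measurable_prod mpsi mh measurable_compose[OF _ borel_measurable_exp]
          mR borel_measurable_const) auto
  have mG: "?G \<in> borel_measurable ?M"
    by (intro borel_measurable_times borel_measurable_prod mA mD) auto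
  let ?u = "\<lambda>i. case i of Inl f \<Rightarrow> (\<lambda>y. norm (\<psi> (\<epsilon> * y))) | Inr T \<Rightarrow> (\<lambda>y. norm (h T y))"
  have intG: "integrable ?M ?G"
  proof (rule integrable_PiM_bound[OF _ mG])
    show "integrable lborel (?u i)" if "i \<in> Y_idx p" for i
      using that lborel_integrable_real_affine[OF integrable_norm[OF S(2)], of \<epsilon> 0] \<epsilon> h(2) by (auto simp: Y_idx_def)
    show "norm (?G w) \<le> (\<Prod>i\<in>elim_idx p. D) * (\<Prod>i\<in>Y_idx p. ?u i (w i))" for w
    proof -
      have n1: "norm (\<Prod>i\<in>elim_idx p. ?D w i) \<le> (\<Prod>i\<in>elim_idx p. D)"
        unfolding prod_norm[symmetric] by (intro prod_mono) (auto intro: D)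
      have n2: "norm (A w) = (\<Prod>i\<in>Y_idx p. ?u i (w i))"
      proof -
        have "(\<Prod>i\<in>Y_idx p. ?u i (w i)) = (\<Prod>f\<in>Y_fcs p. norm (\<psi> (\<epsilon> * w (Inl f)))) * (\<Prod>T\<in>Y_tets p. norm (h T (w (Inr T))))"
          unfolding Y_idx_def Plus_def by (subst prod.union_disjoint) (auto simp: prod.reindex)
        then show ?thesis unfolding A_def norm_mult norm_exp_2pi prod_norm[symmetric] by simp
      qed
      have "norm (?G w) = norm (\<Prod>i\<in>elim_idx p. ?D w i) * norm (A w)" by (simp only: norm_mult mult.commute)
      also have "\<dots> \<le> (\<Prod>i\<in>elim_idx p. D) * norm (A w)" by (rule mult_right_mono[OF n1 norm_ge_zero])
      finally show ?thesis unfolding n2 .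
    qed
  qed simp
  have cong: "?G w = ?G w'" if eq: "\<And>i. i \<in> Y_fcs p <+> Y_tets p \<Longrightarrow> w i = w' i" for w w'
  proof -
    have eqF: "w (Inl f) = w' (Inl f)" if "f \<in> Y_fcs p" for f using eq[of "Inl f"] that by auto
    have eqT: "w (Inr T) = w' (Inr T)" if "T \<in> Y_tets p" for T using eq[of "Inr T"] that by auto
    have "Y_phase p w = Y_phase p w'"
    proof -
      have "(\<Sum>k=1..p. w (xE k) * w (xT (TT k))) = (\<Sum>k=1..p. w' (xE k) * w' (xT (TT k)))"
        by (intro sum.cong refl arg_cong2[of _ _ _ _ "(*)"] eqF eqT) (auto simp: Y_fcs_def Y_tets_def J_index_def)
      moreover have "w (Inl f) = w' (Inl f)" if "f \<in> {Fr, Fg, Fu}" for f using that by (intro eqF) (auto simp: Y_fcs_def)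
      moreover have "w (Inr T) = w' (Inr T)" if "T \<in> {TU, TV, TW}" for T using that by (intro eqT) (auto simp: Y_tets_def J_index_def)
      ultimately show ?thesis by (simp add: Y_phase_def)
    qed
    moreover have "(\<Prod>i\<in>elim_idx p. ?D w i) = (\<Prod>i\<in>elim_idx p. ?D w' i)"
      by (intro prod.cong refl arg_cong[of _ _ "delta_cutoff \<psi> \<epsilon>"] lincomb_cong eq[folded Y_idx_def])
         (use elim_args_idx in blast)
    ultimately show ?thesis unfolding A_def by (simp add: eqF eqT cong: prod.cong)
  qed
  have "(\<integral>t. kernel_cutoff (twist_Y n) \<psi> \<epsilon> t * (\<Prod>T\<in>Y_tets p. h T (t T)) \<partial>lborel_prod (Y_tets p)) =
      (\<integral>t. (\<integral>x. ?G (case_sum x t) \<partial>lborel_prod (Y_fcs p)) \<partial>lborel_prod (Y_tets p))"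
  proof (intro Bochner_Integration.integral_cong refl)
    fix t :: "tet \<Rightarrow> real"
    show "kernel_cutoff (twist_Y n) \<psi> \<epsilon> t * (\<Prod>T\<in>Y_tets p. h T (t T)) = (\<integral>x. ?G (case_sum x t) \<partial>lborel_prod (Y_fcs p))"
      unfolding kernel_cutoff_twist_Y[OF p \<psi> \<epsilon>] integral_mult_left_zero[symmetric] A_def
      by (intro Bochner_Integration.integral_cong refl) (simp add: mult_ac)
  qed
  also have "\<dots> = (\<integral>w. ?G w \<partial>?M)"
    unfolding Y_idx_def by (rule PiM_sum_integral[symmetric, OF _ _ intG[unfolded Y_idx_def] cong]) auto
  finally show "(\<integral>t. kernel_cutoff (twist_Y n) \<psi> \<epsilon> t * (\<Prod>T\<in>Y_tets p. h T (t T)) \<partial>lborel_prod (Y_tets p)) = (\<integral>w. ?G w \<partial>?M)" .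
qed

text \<open>
  The limiting amplitude depends on none of the eliminated variables, and each of them contributes
  the integral of the Fourier transform of \<open>\<psi>\<close>, which is \<open>\<psi>(0) = 1\<close>.
\<close>

lemma kernel_limit_integral:
  fixes h :: "tet \<Rightarrow> real \<Rightarrow> complex"
  assumes \<psi>: "schwartz \<psi>" "\<psi> 0 = 1"
    and h: "\<And>T. T \<in> Y_tets p \<Longrightarrow> continuous_on UNIV (h T)" "\<And>T. T \<in> Y_tets p \<Longrightarrow> integrable lborel (h T)"
      "\<And>T y. T \<in> Y_tets p \<Longrightarrow> norm (h T y) \<le> H"
  defines "A0 \<equiv> \<lambda>z :: idx \<Rightarrow> real. exp (2 * of_real pi * \<i> * of_real (J_quad p (\<lambda>T. z (Inr T)))) * (h TZ 0 * (h TV (z (Inr TU)) * (\<Prod>T\<in>J_index p. h T (z (Inr T)))))"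
  shows "A0 \<in> borel_measurable (lborel_prod (Y_idx p))"
    and "(\<integral>z. A0 z * (\<Prod>i\<in>elim_idx p. fourier \<psi> (z i)) \<partial>lborel_prod (Y_idx p)) =
      h TZ 0 * (\<integral>t. exp (2 * of_real pi * \<i> * of_real (J_quad p t)) * (h TV (t TU) * (\<Prod>T\<in>J_index p. h T (t T))) \<partial>lborel_prod (J_index p))"
proof -
  interpret F: product_sigma_finite "\<lambda>_ :: fc. lborel :: real measure" by (rule product_sigma_finite_lborel)
  let ?M = "lborel_prod (Y_idx p)"
  note S = fourier_schwartz[OF \<psi>(1)]
  have mF: "fourier \<psi> \<in> borel_measurable borel"
    by (rule fourier_measurable[OF borel_measurable_continuous_onI[OF S(1)]])
  obtain P where P: "\<And>x. norm (fourier \<psi> x) \<le> P" using S(5) by (auto simp: bounded_iff)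
  have JT: "J_index p \<subseteq> Y_tets p" "TZ \<in> Y_tets p" "TV \<in> Y_tets p" "TU \<in> J_index p" "TZ \<notin> J_index p" "TV \<notin> J_index p"
    by (auto simp: Y_tets_def J_index_def)
  let ?B = "\<lambda>t :: tet \<Rightarrow> real. exp (2 * of_real pi * \<i> * of_real (J_quad p t)) * (h TZ 0 * (h TV (t TU) * (\<Prod>T\<in>J_index p. h T (t T))))"
  have mB: "(\<lambda>w. ?B (\<lambda>T. w (g T))) \<in> borel_measurable (lborel_prod I)" if "\<And>T. T \<in> J_index p \<Longrightarrow> g T \<in> I" for g :: "tet \<Rightarrow> 'i" and I
  proof -
    have mc: "(\<lambda>w. w (g T)) \<in> borel_measurable (lborel_prod I)" if "T \<in> J_index p" for T
      by (rule measurable_coord) (use that \<open>\<And>T. T \<in> J_index p \<Longrightarrow> g T \<in> I\<close> in blast)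
    have "(\<lambda>w. J_quad p (\<lambda>T. w (g T))) \<in> borel_measurable (lborel_prod I)"
      unfolding J_quad_def by (intro borel_measurable_sum borel_measurable_times mc borel_measurable_const)
    then have mR: "(\<lambda>w. complex_of_real (J_quad p (\<lambda>T. w (g T)))) \<in> borel_measurable (lborel_prod I)" by simp
    have mh: "(\<lambda>w. h T (w (g T'))) \<in> borel_measurable (lborel_prod I)" if "T \<in> Y_tets p" "T' \<in> J_index p" for T T'
      by (rule measurable_compose[OF mc borel_measurable_continuous_onI[OF h(1)]]) (use that in auto)
    show ?thesis
      by (intro borel_measurable_times borel_measurable_prod mh measurable_compose[OF _ borel_measurable_exp] mR borel_measurable_const)
         (use JT in auto)
  qed
  have H: "0 \<le> H" using order_trans[OF norm_ge_zero h(3)[OF JT(2), of 0]] .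
  have nB: "norm (?B t) \<le> (H * H) * (\<Prod>T\<in>J_index p. norm (h T (t T)))" for t
  proof -
    have "norm (?B t) = norm (h TZ 0) * norm (h TV (t TU)) * (\<Prod>T\<in>J_index p. norm (h T (t T)))"
      unfolding norm_mult norm_exp_2pi prod_norm[symmetric] by simp
    also have "\<dots> \<le> (H * H) * (\<Prod>T\<in>J_index p. norm (h T (t T)))"
      by (intro mult_right_mono mult_mono h(3) JT prod_nonneg) (auto simp: H)
    finally show ?thesis .
  qed
  have upd: "?B (t(i := a)) = ?B t" if "i \<notin> J_index p" for i t a
  proof -
    have "J_quad p (t(i := a)) = J_quad p t" unfolding J_quad_def using that by (intro sum.cong refl) auto
    moreover have "(\<Prod>T\<in>J_index p. h T ((t(i := a)) T)) = (\<Prod>T\<in>J_index p. h T (t T))" using that by (intro prod.cong refl) auto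
    ultimately show ?thesis using that JT by auto
  qed
  show mA0: "A0 \<in> borel_measurable ?M"
    unfolding A0_def by (rule mB) (use JT in \<open>auto simp: Y_idx_def\<close>)
  have mFi: "(\<lambda>z. \<Prod>i\<in>elim_idx p. fourier \<psi> (z i)) \<in> borel_measurable ?M"
    by (intro borel_measurable_prod measurable_compose[OF measurable_coord mF]) (auto simp: Y_idx_split)
  let ?u = "\<lambda>i. case i of Inl f \<Rightarrow> (\<lambda>y. norm (fourier \<psi> y)) | Inr T \<Rightarrow> if T \<in> J_index p then (\<lambda>y. norm (h T y)) else (\<lambda>y. norm (fourier \<psi> y))"
  have int: "integrable ?M (\<lambda>z. A0 z * (\<Prod>i\<in>elim_idx p. fourier \<psi> (z i)))"
  proof (rule integrable_PiM_bound)
    show "(\<lambda>z. A0 z * (\<Prod>i\<in>elim_idx p. fourier \<psi> (z i))) \<in> borel_measurable ?M"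
      by (intro borel_measurable_times mA0 mFi)
    show "integrable lborel (?u i)" if "i \<in> Y_idx p" for i
      using that h(2) S(4) JT(1) by (auto split: sum.split)
    show "norm (A0 z * (\<Prod>i\<in>elim_idx p. fourier \<psi> (z i))) \<le> (H * H) * (\<Prod>i\<in>Y_idx p. ?u i (z i))" for z
    proof -
      have "(\<Prod>i\<in>elim_idx p. ?u i (z i)) = (\<Prod>i\<in>elim_idx p. norm (fourier \<psi> (z i)))"
        using JT by (intro prod.cong) (auto simp: elim_idx_def)
      then have "(\<Prod>i\<in>Y_idx p. ?u i (z i)) = (\<Prod>T\<in>J_index p. norm (h T (z (Inr T)))) * (\<Prod>i\<in>elim_idx p. norm (fourier \<psi> (z i)))"
        unfolding prod_Y_idx by simp
      moreover have "0 \<le> (\<Prod>i\<in>elim_idx p. norm (fourier \<psi> (z i)))" by (rule prod_nonneg) auto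
      from mult_right_mono[OF nB[of "\<lambda>T. z (Inr T)"] this]
      have "norm (A0 z) * (\<Prod>i\<in>elim_idx p. norm (fourier \<psi> (z i))) \<le>
          (H * H) * ((\<Prod>T\<in>J_index p. norm (h T (z (Inr T)))) * (\<Prod>i\<in>elim_idx p. norm (fourier \<psi> (z i))))"
        unfolding A0_def by (simp only: mult.assoc)
      ultimately show ?thesis
        unfolding norm_mult[of "A0 z"] prod_norm[symmetric] by simp
    qed
  qed simp
  have "(\<integral>z. A0 z * (\<Prod>i\<in>elim_idx p. fourier \<psi> (z i)) \<partial>?M) =
     (\<integral>t. (\<integral>x. A0 (case_sum x t) * (\<Prod>i\<in>elim_idx p. fourier \<psi> (case_sum x t i)) \<partial>lborel_prod (Y_fcs p)) \<partial>lborel_prod (Y_tets p))"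
    unfolding Y_idx_def
  proof (rule PiM_sum_integral[OF _ _ int[unfolded Y_idx_def]])
    fix w w' :: "idx \<Rightarrow> real" assume eq: "\<And>i. i \<in> Y_fcs p <+> Y_tets p \<Longrightarrow> w i = w' i"
    have eqT: "w (Inr T) = w' (Inr T)" if "T \<in> J_index p" for T using eq[of "Inr T"] that JT by auto
    have "(\<Prod>i\<in>elim_idx p. fourier \<psi> (w i)) = (\<Prod>i\<in>elim_idx p. fourier \<psi> (w' i))"
      by (intro prod.cong refl arg_cong[of _ _ "fourier \<psi>"] eq[folded Y_idx_def]) (auto simp: Y_idx_split)
    moreover have "J_quad p (\<lambda>T. w (Inr T)) = J_quad p (\<lambda>T. w' (Inr T))"
      unfolding J_quad_def by (intro sum.cong refl) (simp add: eqT)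
    ultimately show "A0 w * (\<Prod>i\<in>elim_idx p. fourier \<psi> (w i)) = A0 w' * (\<Prod>i\<in>elim_idx p. fourier \<psi> (w' i))"
      unfolding A0_def using JT by (simp add: eqT cong: prod.cong)
  qed auto
  also have "\<dots> = (\<integral>t. ?B t * (fourier \<psi> (t TZ) * fourier \<psi> (t TV)) \<partial>lborel_prod (Y_tets p))"
  proof (intro Bochner_Integration.integral_cong refl)
    fix t :: "tet \<Rightarrow> real"
    have "(\<integral>x. A0 (case_sum x t) * (\<Prod>i\<in>elim_idx p. fourier \<psi> (case_sum x t i)) \<partial>lborel_prod (Y_fcs p)) =
          (\<integral>x. (?B t * (fourier \<psi> (t TZ) * fourier \<psi> (t TV))) * (\<Prod>f\<in>Y_fcs p. fourier \<psi> (x f)) \<partial>lborel_prod (Y_fcs p))"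
      unfolding A0_def prod_elim_idx_sum by (intro Bochner_Integration.integral_cong refl) (simp add: mult_ac)
    also have "\<dots> = (?B t * (fourier \<psi> (t TZ) * fourier \<psi> (t TV))) * (\<integral>x. (\<Prod>f\<in>Y_fcs p. fourier \<psi> (x f)) \<partial>lborel_prod (Y_fcs p))"
      by (rule integral_mult_right_zero)
    also have "(\<integral>x. (\<Prod>f\<in>Y_fcs p. fourier \<psi> (x f)) \<partial>lborel_prod (Y_fcs p)) = 1"
      using F.product_integral_prod[of "Y_fcs p" "\<lambda>_. fourier \<psi>"] S(4) fourier_inversion_at_0[OF \<psi>(1)] \<psi>(2) by simp
    finally show "(\<integral>x. A0 (case_sum x t) * (\<Prod>i\<in>elim_idx p. fourier \<psi> (case_sum x t i)) \<partial>lborel_prod (Y_fcs p)) =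
        ?B t * (fourier \<psi> (t TZ) * fourier \<psi> (t TV))" by simp
  qed
  also have "\<dots> = (\<integral>t. (?B t * fourier \<psi> (t TV)) * fourier \<psi> (t TZ) \<partial>lborel_prod (insert TZ (insert TV (J_index p))))"
    unfolding Y_tets_def by (simp add: mult_ac)
  also have "\<dots> = (\<integral>t. ?B t * fourier \<psi> (t TV) \<partial>lborel_prod (insert TV (J_index p))) * (\<integral>y. fourier \<psi> y \<partial>lborel)"
  proof (rule PiM_integral_drop[where C = "H * H" and u = "\<lambda>T. if T \<in> J_index p then (\<lambda>y. norm (h T y)) else (\<lambda>y. norm (fourier \<psi> y))"])
    show "(\<lambda>t. ?B t * fourier \<psi> (t TV)) \<in> borel_measurable (lborel_prod (insert TZ (insert TV (J_index p))))"
      by (rule borel_measurable_times[OF mB[of "\<lambda>T. T"]])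
         (auto intro!: borel_measurable_times measurable_compose[OF measurable_coord mF])
    show "integrable lborel (if T \<in> J_index p then (\<lambda>y. norm (h T y)) else (\<lambda>y. norm (fourier \<psi> y)))" if "T \<in> insert TV (J_index p)" for T
      using that h(2) S(4) JT(1) by auto
    show "norm (?B t * fourier \<psi> (t TV)) \<le> (H * H) * (\<Prod>T\<in>insert TV (J_index p). (if T \<in> J_index p then (\<lambda>y. norm (h T y)) else (\<lambda>y. norm (fourier \<psi> y))) (t T))" for t
    proof -
      have "(\<Prod>T\<in>J_index p. (if T \<in> J_index p then (\<lambda>y. norm (h T y)) else (\<lambda>y. norm (fourier \<psi> y))) (t T)) = (\<Prod>T\<in>J_index p. norm (h T (t T)))"
        by (intro prod.cong) auto
      then show ?thesis
        using mult_right_mono[OF nB[of t], of "norm (fourier \<psi> (t TV))"] JT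
        unfolding norm_mult[of _ "fourier \<psi> (t TV)"] by (simp add: mult_ac)
    qed
    show "?B (t(TZ := a)) * fourier \<psi> ((t(TZ := a)) TV) = ?B t * fourier \<psi> (t TV)" for t a
      using upd[of TZ t a] JT by simp
  qed (use S JT in auto)
  also have "\<dots> = (\<integral>t. ?B t * fourier \<psi> (t TV) \<partial>lborel_prod (insert TV (J_index p)))"
    using fourier_inversion_at_0[OF \<psi>(1)] \<psi>(2) by simp
  also have "\<dots> = (\<integral>t. ?B t \<partial>lborel_prod (J_index p)) * (\<integral>y. fourier \<psi> y \<partial>lborel)"
    by (rule PiM_integral_drop[OF _ JT(6) mB[of "\<lambda>T. T"] upd[OF JT(6)] _ nB S(4)])
       (use h(2) JT(1) in auto)
  also have "\<dots> = (\<integral>t. ?B t \<partial>lborel_prod (J_index p))"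
    using fourier_inversion_at_0[OF \<psi>(1)] \<psi>(2) by simp
  also have "\<dots> = (\<integral>t. h TZ 0 * (exp (2 * of_real pi * \<i> * of_real (J_quad p t)) * (h TV (t TU) * (\<Prod>T\<in>J_index p. h T (t T)))) \<partial>lborel_prod (J_index p))"
    by (intro Bochner_Integration.integral_cong refl) (simp add: mult_ac)
  also have "\<dots> = h TZ 0 * (\<integral>t. exp (2 * of_real pi * \<i> * of_real (J_quad p t)) * (h TV (t TU) * (\<Prod>T\<in>J_index p. h T (t T))) \<partial>lborel_prod (J_index p))"
    by (rule integral_mult_right_zero)
  finally show "(\<integral>z. A0 z * (\<Prod>i\<in>elim_idx p. fourier \<psi> (z i)) \<partial>?M) = h TZ 0 * (\<integral>t. exp (2 * of_real pi * \<i> * of_real (J_quad p t)) * (h TV (t TU) * (\<Prod>T\<in>J_index p. h T (t T))) \<partial>lborel_prod (J_index p))" .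
qed

text \<open>
  The kernel is \<open>\<delta>(t\<^sub>Z) \<delta>(t\<^sub>V - t\<^sub>U) exp (2 \<pi> i t\<^sup>T Q\<^sub>n t)\<close>. The test functions here are products of bounded
  integrable continuous functions, which includes the dynamical contents.
\<close>

theorem kinematical_kernel_twist_Y:
  fixes h :: "tet \<Rightarrow> real \<Rightarrow> complex"
  assumes p: "p = twist_p n"
    and h: "\<And>T. T \<in> Y_tets p \<Longrightarrow> continuous_on UNIV (h T)" "\<And>T. T \<in> Y_tets p \<Longrightarrow> integrable lborel (h T)"
      "\<And>T y. T \<in> Y_tets p \<Longrightarrow> norm (h T y) \<le> H"
  shows "kinematical_kernel (twist_Y n) (\<lambda>t. \<Prod>T\<in>Y_tets p. h T (t T)) =
     h TZ 0 * (\<integral>t. exp (2 * of_real pi * \<i> * of_real (J_quad p t)) * (h TV (t TU) * (\<Prod>T\<in>J_index p. h T (t T))) \<partial>lborel_prod (J_index p))"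
    (is "_ = ?I")
proof -
  have JT: "J_index p \<subseteq> Y_tets p" "TZ \<in> Y_tets p" "TV \<in> Y_tets p" "TU \<in> J_index p" "TZ \<notin> J_index p" "TV \<notin> J_index p"
    by (auto simp: Y_tets_def J_index_def)
  have H: "0 \<le> H" using order_trans[OF norm_ge_zero h(3)[OF JT(2), of 0]] .
  let ?K = "\<lambda>\<psi> \<epsilon>. \<integral>t. kernel_cutoff (twist_Y n) \<psi> \<epsilon> t * (\<Prod>T\<in>Y_tets p. h T (t T)) \<partial>lborel_prod (tets (twist_Y n))"
  have main: "(?K \<psi> \<longlongrightarrow> ?I) (at_right 0)" if \<psi>: "schwartz \<psi>" "\<psi> 0 = 1" for \<psi>
  proof -
    note S = fourier_schwartz[OF \<psi>(1)]
    obtain C where C: "\<And>x. norm (\<psi> x) \<le> C" using S(3) by (auto simp: bounded_iff)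
    have C0: "0 \<le> C" using order_trans[OF norm_ge_zero C] .
    define A where "A = (\<lambda>\<epsilon> (w :: idx \<Rightarrow> real). (\<Prod>f\<in>Y_fcs p. \<psi> (\<epsilon> * w (Inl f))) * exp (2 * of_real pi * \<i> * of_real (Y_phase p w)) * (\<Prod>T\<in>Y_tets p. h T (w (Inr T))))"
    define A0 where "A0 = (\<lambda>z :: idx \<Rightarrow> real. exp (2 * of_real pi * \<i> * of_real (J_quad p (\<lambda>T. z (Inr T)))) * (h TZ 0 * (h TV (z (Inr TU)) * (\<Prod>T\<in>J_index p. h T (z (Inr T))))))"
    let ?M = "lborel_prod (Y_idx p)"
    define B where "B = (\<lambda>z :: idx \<Rightarrow> real. (\<Prod>f\<in>Y_fcs p. C) * (H * H) * (\<Prod>T\<in>J_index p. norm (h T (z (Inr T)))))"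
    interpret product_sigma_finite "\<lambda>_ :: idx. lborel :: real measure" by (rule product_sigma_finite_lborel)
    have sh_other: "shears \<epsilon> (elim_list p) z (Inr T) = z (Inr T)" if "T \<in> J_index p" for \<epsilon> z T
      by (rule shears_other) (use that in \<open>auto simp: elim_idx_eq elim_idx_def J_index_def\<close>)
    have split_tets: "(\<Prod>T\<in>Y_tets p. g T) = g TZ * (g TV * (\<Prod>T\<in>J_index p. g T))" for g :: "tet \<Rightarrow> 'a :: comm_monoid_mult"
      unfolding Y_tets_def using JT by simp
    have "((\<lambda>\<epsilon>. \<integral>w. A \<epsilon> w * (\<Prod>i\<in>elim_idx p. delta_cutoff \<psi> \<epsilon> (lincomb (elim_args p i) w)) \<partial>?M) \<longlongrightarrow>
           (\<integral>z. A0 z * (\<Prod>i\<in>elim_idx p. fourier \<psi> (z i)) \<partial>?M)) (at_right 0)"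
    proof (rule delta_cutoff_limit[OF _ shear_list_elim elim_idx_eq[symmetric] \<psi>(1), where B = B])
      show "lincomb (elim_args p i) \<in> borel_measurable ?M" if "i \<in> elim_idx p" for i
        by (rule lincomb_measurable[OF elim_args_idx[OF that]])
      show "lincomb (elim_args p i) (shears \<epsilon> (elim_list p) z) = \<epsilon> * z i" if "i \<in> elim_idx p" for i \<epsilon> z
        by (rule elim_args_shears[OF that])
      show "A \<epsilon> \<in> borel_measurable ?M" if "\<epsilon> > 0" for \<epsilon>
        unfolding A_def by (rule kernel_integral_twist_Y(2)[OF p \<psi>(1) that h(1,2)])
      \<comment> \<open>Bounded in the eliminated variables, whose integrability is left to the Fourier transforms.\<close>
      show "norm (A \<epsilon> (shears \<epsilon> (elim_list p) z)) \<le> B z" for \<epsilon> z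
      proof -
        let ?w = "shears \<epsilon> (elim_list p) z"
        have "norm (A \<epsilon> ?w) = (\<Prod>f\<in>Y_fcs p. norm (\<psi> (\<epsilon> * ?w (Inl f)))) * (norm (h TZ (?w (Inr TZ))) * norm (h TV (?w (Inr TV)))) * (\<Prod>T\<in>J_index p. norm (h T (z (Inr T))))"
          unfolding A_def norm_mult norm_exp_2pi prod_norm[symmetric] split_tets by (simp add: sh_other mult.assoc)
        also have "\<dots> \<le> B z"
          unfolding B_def by (intro mult_right_mono mult_mono prod_mono h(3) JT prod_nonneg mult_nonneg_nonneg)
             (auto simp: H C C0)
        finally show ?thesis .
      qed
      show "integrable ?M (\<lambda>z. B z * (\<Prod>i\<in>elim_idx p. norm (fourier \<psi> (z i))))"
      proof -
        let ?u = "\<lambda>i. case i of Inl f \<Rightarrow> (\<lambda>y. norm (fourier \<psi> y)) | Inr T \<Rightarrow> if T \<in> J_index p then (\<lambda>y. norm (h T y)) else (\<lambda>y. norm (fourier \<psi> y))"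
        have "integrable ?M (\<lambda>z. ((\<Prod>f\<in>Y_fcs p. C) * (H * H)) * (\<Prod>i\<in>Y_idx p. ?u i (z i)))"
          by (intro integrable_mult_right product_integrable_prod)
             (use h(2) S(4) JT(1) in \<open>auto split: sum.split\<close>)
        also have "(\<lambda>z. ((\<Prod>f\<in>Y_fcs p. C) * (H * H)) * (\<Prod>i\<in>Y_idx p. ?u i (z i))) = (\<lambda>z. B z * (\<Prod>i\<in>elim_idx p. norm (fourier \<psi> (z i))))"
        proof
          fix z
          have "(\<Prod>i\<in>elim_idx p. ?u i (z i)) = (\<Prod>i\<in>elim_idx p. norm (fourier \<psi> (z i)))"
            using JT by (intro prod.cong) (auto simp: elim_idx_def)
          then show "((\<Prod>f\<in>Y_fcs p. C) * (H * H)) * (\<Prod>i\<in>Y_idx p. ?u i (z i)) = B z * (\<Prod>i\<in>elim_idx p. norm (fourier \<psi> (z i)))"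
            unfolding prod_Y_idx B_def by (simp add: mult_ac)
        qed
        finally show ?thesis .
      qed
      show "A0 \<in> borel_measurable ?M"
        unfolding A0_def by (rule kernel_limit_integral(1)[OF \<psi> h])
      show "(\<lambda>k. A (e k) (shears (e k) (elim_list p) z)) \<longlonglongrightarrow> A0 z" if "\<And>k. 0 < e k" "e \<longlonglongrightarrow> 0" for e z
      proof -
        define w where "w = (\<lambda>k. shears (e k) (elim_list p) z)"
        define w0 where "w0 = shears 0 (elim_list p) z"
        have wl: "(\<lambda>k. w k i) \<longlonglongrightarrow> w0 i" for i
          unfolding w_def w0_def by (intro tendsto_shears that tendsto_const)
        have hl: "(\<lambda>k. h T (w k (Inr T))) \<longlonglongrightarrow> h T (w0 (Inr T))" if "T \<in> Y_tets p" for T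
          using continuous_on_tendsto_compose[OF h(1)[OF that] wl] by simp
        have psil: "(\<lambda>k. \<psi> (e k * w k (Inl f))) \<longlonglongrightarrow> 1" for f
        proof -
          have "(\<lambda>k. e k * w k (Inl f)) \<longlonglongrightarrow> 0 * w0 (Inl f)" by (intro tendsto_mult that wl)
          then show ?thesis using continuous_on_tendsto_compose[OF S(1), of _ "0 * w0 (Inl f)"] \<psi>(2) by simp
        qed
        have "(\<lambda>k. A (e k) (shears (e k) (elim_list p) z)) \<longlonglongrightarrow> (\<Prod>f\<in>Y_fcs p. 1) * exp (2 * of_real pi * \<i> * of_real (Y_phase p w0)) * (\<Prod>T\<in>Y_tets p. h T (w0 (Inr T)))"
          unfolding A_def Y_phase_def w_def[THEN fun_cong, symmetric] by (intro tendsto_intros psil hl wl)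
        also have "(\<Prod>f\<in>Y_fcs p. 1) * exp (2 * of_real pi * \<i> * of_real (Y_phase p w0)) * (\<Prod>T\<in>Y_tets p. h T (w0 (Inr T))) = A0 z"
          unfolding A0_def split_tets w0_def elim_solution(4) by (simp add: elim_solution(1-3))
        finally show ?thesis .
      qed
    qed simp
    also have "(\<integral>z. A0 z * (\<Prod>i\<in>elim_idx p. fourier \<psi> (z i)) \<partial>?M) = ?I"
      unfolding A0_def by (rule kernel_limit_integral(2)[OF \<psi> h])
    finally have lim: "((\<lambda>\<epsilon>. \<integral>w. A \<epsilon> w * (\<Prod>i\<in>elim_idx p. delta_cutoff \<psi> \<epsilon> (lincomb (elim_args p i) w)) \<partial>?M) \<longlongrightarrow> ?I) (at_right 0)" .
    show ?thesis
    proof (rule Lim_transform_eventually[OF lim])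
      show "eventually (\<lambda>\<epsilon>. (\<integral>w. A \<epsilon> w * (\<Prod>i\<in>elim_idx p. delta_cutoff \<psi> \<epsilon> (lincomb (elim_args p i) w)) \<partial>?M) = ?K \<psi> \<epsilon>) (at_right 0)"
        using eventually_at_right_less[of "0 :: real"]
      proof eventually_elim
        case (elim \<epsilon>)
        show ?case unfolding tets_twist_Y p[symmetric] A_def
          by (rule kernel_integral_twist_Y(1)[OF p \<psi>(1) elim h(1,2), symmetric])
      qed
    qed
  qed
  show ?thesis
    unfolding kinematical_kernel_def
  proof (rule the_equality)
    show "\<forall>\<psi>. schwartz \<psi> \<and> \<psi> 0 = 1 \<longrightarrow> (?K \<psi> \<longlongrightarrow> ?I) (at_right 0)" using main by blast
    fix I assume "\<forall>\<psi>. schwartz \<psi> \<and> \<psi> 0 = 1 \<longrightarrow> (?K \<psi> \<longlongrightarrow> I) (at_right 0)"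
    \<comment> \<open>Any single cut-off determines the limit.\<close>
    moreover have "schwartz (\<lambda>x. of_real (exp (- x\<^sup>2)))" by (rule schwartz_gaussian)
    ultimately have "(?K (\<lambda>x. of_real (exp (- x\<^sup>2))) \<longlongrightarrow> I) (at_right 0)" "(?K (\<lambda>x. of_real (exp (- x\<^sup>2))) \<longlongrightarrow> ?I) (at_right 0)"
      using main by auto
    then show "I = ?I" using tendsto_unique trivial_limit_at_right_real by blast
  qed
qed

section \<open>Edge classes and their weights\<close>

definition pos_pairs :: "(nat \<times> nat) set" where
  "pos_pairs = {(0, 1), (0, 2), (0, 3), (1, 2), (1, 3), (2, 3)}"

lemma pos_pairs_iff: "(i, j) \<in> pos_pairs \<longleftrightarrow> i < j \<and> j \<le> 3"
  unfolding pos_pairs_def by auto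

lemma tet_edges_alt: "tet_edges X = {(T, i, j). T \<in> tets X \<and> (i, j) \<in> pos_pairs}"
  unfolding tet_edges_def pos_pairs_iff ..

lemma edge_gluing_in_tet_edges: "(x, y) \<in> edge_gluing X \<Longrightarrow> y \<in> tet_edges X"
  by (auto simp: edge_gluing_def tet_edges_def face_vertex_def)

lemma sym_edge_gluing: "sym (edge_gluing X)"
  unfolding sym_def edge_gluing_def by force

text \<open>
  A label that is invariant under gluing, together with a representative of each label that can be
  reached from all edges with this label, determines the classes.
\<close>

lemma edge_class_eq_fibre:
  assumes lab: "\<And>x y. (x, y) \<in> edge_gluing X \<Longrightarrow> lab x = lab y"
    and conn: "\<And>x. x \<in> tet_edges X \<Longrightarrow> (x, rt (lab x)) \<in> (edge_gluing X)\<^sup>*"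
    and x: "x \<in> tet_edges X"
  shows "edge_class X x = {y \<in> tet_edges X. lab y = lab x}"
proof (intro equalityI subsetI)
  fix y assume "y \<in> edge_class X x"
  then have "(x, y) \<in> (edge_gluing X)\<^sup>*" by (simp add: edge_class_def)
  then show "y \<in> {y \<in> tet_edges X. lab y = lab x}"
    by induction (use x lab edge_gluing_in_tet_edges in fastforce)+
next
  fix y assume y: "y \<in> {y \<in> tet_edges X. lab y = lab x}"
  then have "(y, rt (lab x)) \<in> (edge_gluing X)\<^sup>*" using conn[of y] by auto
  then have "(rt (lab x), y) \<in> (edge_gluing X)\<^sup>*"
    using sym_rtrancl[OF sym_edge_gluing[of X]] by (auto dest: symD)
  then show "y \<in> edge_class X x"
    using conn[OF x] by (auto simp: edge_class_def)
qed

lemma face_label_imp_edge_label: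
  assumes "\<And>T k i j. T \<in> tets X \<Longrightarrow> k \<le> 3 \<Longrightarrow> i < j \<Longrightarrow> j \<le> 2 \<Longrightarrow> lab (T, face_vertex k i, face_vertex k j) = flab (face X T k) (i, j)"
    and "(x, y) \<in> edge_gluing X"
  shows "lab x = lab y"
proof -
  obtain T T' k l i j where *: "x = (T, face_vertex k i, face_vertex k j)" "y = (T', face_vertex l i, face_vertex l j)"
    "T \<in> tets X" "T' \<in> tets X" "k \<le> 3" "l \<le> 3" "face X T k = face X T' l" "i < j" "j \<le> 2"
    using assms(2) unfolding edge_gluing_def by blast
  show ?thesis unfolding * using assms(1)[of T k i j] assms(1)[of T' l i j] * by simp
qed

lemma edge_glue:
  assumes "T \<in> tets X" "T' \<in> tets X" "k \<le> 3" "l \<le> 3" "face X T k = face X T' l" "i < j" "j \<le> 2"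
    "x = (T, face_vertex k i, face_vertex k j)" "y = (T', face_vertex l i, face_vertex l j)"
  shows "(x, y) \<in> (edge_gluing X)\<^sup>*"
  using assms unfolding edge_gluing_def by blast

lemma edge_glue_sym: "(x, y) \<in> (edge_gluing X)\<^sup>* \<Longrightarrow> (y, x) \<in> (edge_gluing X)\<^sup>*"
  using sym_rtrancl[OF sym_edge_gluing[of X]] by (auto dest: symD)

text \<open>
  The label \<open>j + 3\<close> with \<open>0 \<le> j \<le> p + 1\<close> marks the class of the edge \<open>01\<close> of \<open>V\<close> for \<open>j = 0\<close>, of the edge
  \<open>02\<close> of \<open>T\<^sub>j\<close> for \<open>1 \<le> j \<le> p\<close>, and of the edge \<open>03\<close> of \<open>V\<close> for \<open>j = p + 1\<close>. The labels \<open>0\<close>, \<open>1\<close> and \<open>2\<close> are those of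
  the edges \<open>01\<close> and \<open>03\<close> of \<open>U\<close> and \<open>23\<close> of \<open>Z\<close>.
\<close>

fun edge_label :: "nat \<Rightarrow> tet \<times> nat \<times> nat \<Rightarrow> nat" where
  "edge_label p (TT k, e) = (if e \<in> {(0, 1), (2, 3)} then 3 else if e \<in> {(0, 2), (1, 3)} then k + 3 else if e = (0, 3) then k + 4 else k + 2)"
| "edge_label p (TU, e) = (if e \<in> {(0, 1), (2, 3)} then 0 else if e = (0, 2) then p + 3 else if e = (1, 2) then p + 4 else 1)"
| "edge_label p (TV, e) = (if e = (0, 1) then 3 else if e \<in> {(0, 2), (1, 2)} then 0 else if e = (1, 3) then p + 3 else p + 4)"
| "edge_label p (TW, e) = (if e = (0, 1) then p + 3 else if e = (0, 2) then p + 4 else if e = (0, 3) then 1 else if e = (1, 2) then 3 else 0)"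
| "edge_label p (TZ, e) = (if e = (0, 1) then 0 else if e \<in> {(0, 2), (1, 2)} then p + 4 else if e \<in> {(0, 3), (1, 3)} then 1 else 2)"

text \<open>
  The labels of the edges \<open>01\<close>, \<open>02\<close> and \<open>12\<close> of a face. That they are well defined on faces expresses
  the invariance of \<^const>\<open>edge_label\<close> under gluing.
\<close>

fun face_labels :: "nat \<Rightarrow> fc \<Rightarrow> nat \<times> nat \<times> nat" where
  "face_labels p (FE k) = (k + 2, k + 3, 3)"
| "face_labels p (FF k) = (3, k + 4, k + 3)"
| "face_labels p Fv = (p + 3, 1, 0)"
| "face_labels p Fr = (p + 4, 1, 0)"
| "face_labels p Fs = (0, 1, 1)"
| "face_labels p Fs' = (0, p + 4, p + 4)"
| "face_labels p Fg = (0, p + 3, p + 4)"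
| "face_labels p Fu = (3, 0, 0)"
| "face_labels p Fm = (p + 4, 1, 2)"

definition face_label :: "nat \<Rightarrow> fc \<Rightarrow> nat \<times> nat \<Rightarrow> nat" where
  "face_label p F e = (if e = (0, 1) then fst (face_labels p F) else if e = (0, 2) then fst (snd (face_labels p F)) else snd (snd (face_labels p F)))"

lemma face_labels_face_f: "face_labels p (face_f k) = (3, k + 4, k + 3)"
  by (simp add: face_f_def)

text \<open>
  Identifying \<open>s\<close> with \<open>s'\<close>, whose labels are \<open>(0, 1, 1)\<close> and \<open>(0, p + 4, p + 4)\<close>, merges the classes
  \<open>1\<close> and \<open>p + 4\<close>.
\<close>

definition merge_label :: "nat \<Rightarrow> nat \<Rightarrow> nat" where
  "merge_label p l = (if l = 1 then p + 4 else l)"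

lemma edge_label_face:
  assumes "T \<in> Y_tets p" "k \<le> 3" "i < j" "j \<le> 2"
  shows "edge_label p (T, face_vertex k i, face_vertex k j) = face_label p (Y_faces p T ! k) (i, j)"
proof -
  have ij: "(i, j) \<in> {(0, 1), (0, 2), (1, 2)}" and k: "k \<in> {0, 1, 2, 3}" using assms by auto
  have T: "T = TZ \<or> T = TV \<or> T = TU \<or> T = TW \<or> (\<exists>k. 1 \<le> k \<and> T = TT k)"
    using assms(1) by (auto simp: Y_tets_def J_index_def)
  then have "\<forall>k\<in>{0, 1, 2, 3}. \<forall>e\<in>{(0, 1), (0, 2), (1, 2)}.
      edge_label p (T, face_vertex k (fst e), face_vertex k (snd e)) = face_label p (Y_faces p T ! k) e"
  proof (elim disjE exE conjE)
    fix k assume "1 \<le> k" "T = TT k"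
    then show ?thesis by (simp add: face_label_def face_vertex_def face_labels_face_f numeral_2_eq_2 numeral_3_eq_3)
  qed (simp_all add: face_label_def face_vertex_def face_labels_face_f numeral_2_eq_2 numeral_3_eq_3)
  then show ?thesis using ij k by fastforce
qed

lemma tets_twist_X: "tets (twist_X n) = Y_tets (twist_p n) - {TZ}"
  by (auto simp: twist_X_def Y_tets_def J_index_def)

lemma face_twist_X: "face (twist_X n) T k = (if T = TV then [Fg, Fs, face_f (twist_p n), Fu] ! k else Y_faces (twist_p n) T ! k)"
  by (simp add: twist_X_def)

lemma edge_label_face_X:
  assumes "T \<in> tets (twist_X n)" "k \<le> 3" "i < j" "j \<le> 2" and p: "p = twist_p n"
  shows "merge_label p (edge_label p (T, face_vertex k i, face_vertex k j)) = merge_label p (face_label p (face (twist_X n) T k) (i, j))"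
proof -
  have 1: "edge_label p (T, face_vertex k i, face_vertex k j) = face_label p (Y_faces p T ! k) (i, j)"
    using assms by (intro edge_label_face) (auto simp: tets_twist_X)
  show ?thesis
  proof (cases "T = TV \<and> k = 1")
    case True
    then show ?thesis unfolding 1 face_twist_X by (simp add: face_label_def merge_label_def)
  next
    case False
    have "k \<in> {0, 1, 2, 3}" using assms by auto
    then have "face (twist_X n) T k = Y_faces p T ! k"
      using False unfolding face_twist_X p[symmetric] by auto
    then show ?thesis unfolding 1 by simp
  qed
qed

definition label_root :: "nat \<Rightarrow> nat \<Rightarrow> tet \<times> nat \<times> nat" where
  "label_root p l = (if l = 0 then (TU, 0, 1) else if l = 1 then (TU, 0, 3) else if l = 2 then (TZ, 2, 3) else if l = 3 then (TV, 0, 1)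
     else if l = p + 4 then (TV, 0, 3) else (TT (l - 3), 0, 2))"

text \<open>
  All gluings used here avoid the face \<open>1\<close> of \<open>V\<close>, the only one in which the two triangulations
  differ outside \<open>Z\<close>. For \<open>p = 0\<close> the class \<open>p + 3\<close> is the class \<open>3\<close>, which accounts for the
  separate treatment of this case.
\<close>

lemma edge_connected_common:
  assumes tets: "Y_tets p - {TZ} \<subseteq> tets X"
    and face: "\<And>T k. T \<in> Y_tets p - {TZ} \<Longrightarrow> k \<le> 3 \<Longrightarrow> (T, k) \<noteq> (TV, 1) \<Longrightarrow> face X T k = Y_faces p T ! k"
    and T: "T \<in> Y_tets p - {TZ}" and e: "e \<in> pos_pairs"
  shows "((T, e), label_root p (edge_label p (T, e))) \<in> (edge_gluing X)\<^sup>*"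
proof -
  let ?R = "\<lambda>x y. (x, y) \<in> (edge_gluing X)\<^sup>*"
  have mem: "TU \<in> Y_tets p - {TZ}" "TV \<in> Y_tets p - {TZ}" "TW \<in> Y_tets p - {TZ}" and memT: "\<And>k. 1 \<le> k \<Longrightarrow> k \<le> p \<Longrightarrow> TT k \<in> Y_tets p - {TZ}"
    by (auto simp: Y_tets_def J_index_def)
  have glue: "?R (T, face_vertex k i, face_vertex k j) (T', face_vertex l i, face_vertex l j)"
    if "T \<in> Y_tets p - {TZ}" "T' \<in> Y_tets p - {TZ}" "k \<le> 3" "l \<le> 3" "(T, k) \<noteq> (TV, 1)" "(T', l) \<noteq> (TV, 1)"
       "Y_faces p T ! k = Y_faces p T' ! l" "i < j" "j \<le> 2" for T T' k l i j
    by (rule edge_glue[of T X T' k l i j]) (use that tets face in auto)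
  note fv = face_vertex_def numeral_2_eq_2 numeral_3_eq_3
  note tr = rtrancl_trans[where r = "edge_gluing X"] and sy = edge_glue_sym
  have W12: "?R (TW, 1, 2) (TV, 0, 1)" using glue[of TW TV 0 3 0 1] mem by (simp add: fv)
  have a: "?R (TT k, 0, 1) (TV, 0, 1)" if "1 \<le> k" "k \<le> p" for k
    using that(2,1)
  proof (induction k rule: inc_induct)
    case base then show ?case using glue[of "TT p" TV 2 2 0 1] mem memT[of p] by (simp add: fv)
  next
    case (step k)
    have "?R (TT k, 0, 1) (TT (Suc k), 0, 1)" using glue[of "TT k" "TT (Suc k)" 2 3 0 1] memT step by (simp add: fv)
    from tr[OF this step.IH] show ?case by simp
  qed
  have a': "?R (TT k, 2, 3) (TV, 0, 1)" if "1 \<le> k" "k \<le> p" for k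
    using that(2,1)
  proof (induction k rule: inc_induct)
    case base
    have "?R (TT p, 2, 3) (TW, 1, 2)" using glue[of "TT p" TW 1 3 1 2] mem memT[of p] base by (simp add: fv)
    then show ?case using W12 tr by blast
  next
    case (step k)
    have "?R (TT k, 2, 3) (TT (Suc k), 2, 3)" using glue[of "TT k" "TT (Suc k)" 1 0 1 2] memT step by (simp add: fv)
    from tr[OF this step.IH] show ?case by simp
  qed
  have c1: "?R (TT 1, 1, 2) (TV, 0, 1)" if "1 \<le> p"
  proof -
    have "?R (TT 1, 1, 2) (TT 1, 0, 1)" using glue[of "TT 1" "TT 1" 0 3 0 1] memT that by (simp add: fv face_f_def)
    then show ?thesis using a[of 1] that tr by blast
  qed
  have b: "?R (TT k, 1, 3) (TT k, 0, 2)" if k: "1 \<le> k" "k \<le> p" for k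
  proof (cases "k = 1")
    case True
    then show ?thesis using glue[of "TT 1" "TT 1" 0 3 0 2] memT k by (simp add: fv face_f_def)
  next
    case False
    have "?R (TT k, 1, 3) (TT (k - 1), 0, 3)" using glue[of "TT k" "TT (k - 1)" 0 1 0 2] memT k False by (simp add: fv)
    moreover have "?R (TT (k - 1), 0, 3) (TT k, 0, 2)" using glue[of "TT (k - 1)" "TT k" 2 3 0 2] memT k False by (simp add: fv)
    ultimately show ?thesis using tr by blast
  qed
  have c3: "?R (TT k, 0, 3) (TT (k + 1), 0, 2)" if k: "1 \<le> k" "k < p" for k
    using glue[of "TT k" "TT (k + 1)" 2 3 0 2] memT k by (simp add: fv)
  have c12: "?R (TT k, 1, 2) (TT (k - 1), 0, 2)" if k: "1 < k" "k \<le> p" for k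
    using glue[of "TT k" "TT (k - 1)" 0 1 0 1] memT k by (simp add: fv)
  have V13: "?R (TV, 1, 3) (TT p, 0, 2)" if "1 \<le> p"
  proof -
    have "?R (TV, 1, 3) (TT p, 1, 3)" using glue[of TV "TT p" 2 2 1 2] mem memT that by (simp add: fv)
    then show ?thesis using b[of p] that tr by blast
  qed
  have U02: "?R (TU, 0, 2) (TV, 1, 3)" using glue[of TU TV 3 0 0 2] mem by (simp add: fv)
  have W01: "?R (TW, 0, 1) (TU, 0, 2)" using glue[of TW TU 2 1 0 1] mem by (simp add: fv)
  have W01': "?R (TW, 0, 1) (TV, 0, 1)" if "p = 0" using glue[of TW TV 3 2 0 1] mem that by (simp add: fv face_f_def)
  have pp: "?R (TV, 1, 3) (label_root p (p + 3))" "?R (TU, 0, 2) (label_root p (p + 3))" "?R (TW, 0, 1) (label_root p (p + 3))"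
  proof -
    show V: "?R (TV, 1, 3) (label_root p (p + 3))"
    proof (cases "p = 0")
      case True
      have "?R (TV, 1, 3) (TV, 0, 1)" using W01'[OF True] W01 U02 tr sy by blast
      then show ?thesis using True by (simp add: label_root_def)
    next
      case False then show ?thesis using V13 by (simp add: label_root_def)
    qed
    then show "?R (TU, 0, 2) (label_root p (p + 3))" using U02 tr by blast
    then show "?R (TW, 0, 1) (label_root p (p + 3))" using W01 tr by blast
  qed
  have q1: "?R (TT p, 0, 3) (TV, 0, 3)" if "1 \<le> p" using glue[of "TT p" TV 2 2 0 2] mem memT that by (simp add: fv)
  have q2: "?R (TW, 0, 2) (TV, 0, 3)"
  proof (cases "p = 0")
    case True
    then show ?thesis using glue[of TW TV 3 2 0 2] mem by (simp add: fv face_f_def)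
  next
    case False
    then have "?R (TW, 0, 2) (TT p, 0, 3)" using glue[of TW "TT p" 3 1 0 2] mem memT by (simp add: fv)
    from tr[OF this q1] False show ?thesis by simp
  qed
  have q3: "?R (TU, 1, 2) (TV, 0, 3)"
  proof (rule tr)
    show "?R (TU, 1, 2) (TW, 0, 2)" using glue[of TU TW 0 1 0 1] mem by (simp add: fv)
  qed (rule q2)
  have q4: "?R (TV, 2, 3) (TV, 0, 3)"
  proof (rule tr)
    show "?R (TV, 2, 3) (TU, 1, 2)" using glue[of TV TU 0 3 1 2] mem by (simp add: fv)
  qed (rule q3)
  have A1: "?R (TV, 1, 2) (TU, 0, 1)" using glue[of TV TU 0 3 0 1] mem by (simp add: fv)
  have A2: "?R (TW, 2, 3) (TU, 0, 1)"
  proof (rule tr)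
    show "?R (TW, 2, 3) (TV, 1, 2)" using glue[of TW TV 0 3 1 2] mem by (simp add: fv)
  qed (rule A1)
  have A3: "?R (TU, 2, 3) (TU, 0, 1)"
  proof (rule tr)
    show "?R (TU, 2, 3) (TW, 2, 3)" using glue[of TU TW 0 1 1 2] mem by (simp add: fv)
  qed (rule A2)
  have A4: "?R (TW, 1, 3) (TU, 0, 1)"
  proof (rule tr)
    show "?R (TW, 1, 3) (TU, 2, 3)" using glue[of TW TU 2 1 1 2] mem by (simp add: fv)
  qed (rule A3)
  have A5: "?R (TV, 0, 2) (TU, 0, 1)"
  proof (rule tr)
    show "?R (TV, 0, 2) (TW, 1, 3)" using glue[of TV TW 3 0 0 2] mem by (simp add: fv)
  qed (rule A4)
  have S1: "?R (TW, 0, 3) (TU, 0, 3)" using glue[of TW TU 2 1 0 2] mem by (simp add: fv)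
  have S2: "?R (TU, 1, 3) (TU, 0, 3)"
  proof (rule tr)
    show "?R (TU, 1, 3) (TW, 0, 3)" using glue[of TU TW 0 1 0 2] mem by (simp add: fv)
  qed (rule S1)
  have Tc: "T = TV \<or> T = TU \<or> T = TW \<or> (\<exists>k. 1 \<le> k \<and> k \<le> p \<and> T = TT k)"
    using T by (auto simp: Y_tets_def J_index_def)
  have lr: "label_root p 0 = (TU, 0, 1)" "label_root p 1 = (TU, 0, 3)" "label_root p 3 = (TV, 0, 1)" "label_root p (p + 4) = (TV, 0, 3)"
    "\<And>k. 1 \<le> k \<Longrightarrow> k \<le> p \<Longrightarrow> label_root p (k + 3) = (TT k, 0, 2)"
    by (auto simp: label_root_def)
  from Tc show ?thesis
  proof (elim disjE exE conjE)
    assume "T = TV" then show ?thesis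
      using e A1 A5 q4 pp(1) unfolding pos_pairs_def by (auto simp: lr)
  next
    assume "T = TU" then show ?thesis
      using e A3 q3 pp(2) S2 unfolding pos_pairs_def by (auto simp: lr(1-4) simp del: One_nat_def)
  next
    assume "T = TW" then show ?thesis
      using e A2 A4 q2 pp(3) S1 W12 unfolding pos_pairs_def by (auto simp: lr(1-4) simp del: One_nat_def)
  next
    fix k assume k: "1 \<le> k" "k \<le> p" "T = TT k"
    have "?R (TT k, 0, 3) (label_root p (k + 4))"
    proof (cases "k = p")
      case True then show ?thesis using q1 k lr(4) by simp
    next
      case False then show ?thesis using c3[of k] k lr(5)[of "k + 1"] by (simp add: add.commute)
    qed
    moreover have "?R (TT k, 1, 2) (label_root p (k + 2))"
    proof (cases "k = 1")
      case True
      then have "label_root p (k + 2) = (TV, 0, 1)" using lr(3) by (simp add: numeral_3_eq_3)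
      then show ?thesis using c1 k True by simp
    next
      case False
      then have "k + 2 = (k - 1) + 3" using k by simp
      then have "label_root p (k + 2) = (TT (k - 1), 0, 2)" using lr(5)[of "k - 1"] k False by simp
      then show ?thesis using c12[of k] k False by simp
    qed
    ultimately show ?thesis
      using e k a[of k] a'[of k] b[of k] lr(5)[of k] lr(3) unfolding pos_pairs_def by auto
  qed
qed

text \<open>
  The edges of \<open>Z\<close> are glued along \<open>s\<close> and \<open>s'\<close> to edges of \<open>U\<close> and \<open>V\<close>, with the exception of \<open>23\<close>, which lies only
  on the face \<open>m\<close>.
\<close>

lemma edge_class_twist_Y:
  assumes p: "p = twist_p n" and x: "x \<in> tet_edges (twist_Y n)"
  shows "edge_class (twist_Y n) x = {y \<in> tet_edges (twist_Y n). edge_label p y = edge_label p x}"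
proof (rule edge_class_eq_fibre[OF _ _ x])
  fix x y assume "(x, y) \<in> edge_gluing (twist_Y n)"
  then show "edge_label p x = edge_label p y"
    by (rule face_label_imp_edge_label[rotated, of _ _ _ _ "face_label p"])
       (use edge_label_face in \<open>auto simp: tets_twist_Y face_twist_Y p\<close>)
next
  let ?R = "\<lambda>x y. (x, y) \<in> (edge_gluing (twist_Y n))\<^sup>*"
  have common: "?R (T, e) (label_root p (edge_label p (T, e)))" if "T \<in> Y_tets p - {TZ}" "e \<in> pos_pairs" for T e
    using that by (intro edge_connected_common) (auto simp: tets_twist_Y face_twist_Y p)
  have glueZ: "?R (TZ, face_vertex k i, face_vertex k j) (T', face_vertex l i, face_vertex l j)"
    if "T' \<in> Y_tets p" "k \<le> 3" "l \<le> 3" "Y_faces p TZ ! k = Y_faces p T' ! l" "i < j" "j \<le> 2" for T' k l i j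
    by (rule edge_glue[of TZ _ T' k l i j]) (use that in \<open>auto simp: tets_twist_Y face_twist_Y p Y_tets_def\<close>)
  have mem: "TU \<in> Y_tets p" "TV \<in> Y_tets p" by (auto simp: Y_tets_def J_index_def)
  have Z01: "?R (TZ, 0, 1) (TU, 0, 1)" and Z03: "?R (TZ, 0, 3) (TU, 0, 3)" and Z13: "?R (TZ, 1, 3) (TU, 1, 3)"
    using glueZ[of TU 2 2 0 1] glueZ[of TU 2 2 0 2] glueZ[of TU 2 2 1 2] mem by (simp_all add: face_vertex_def numeral_2_eq_2 numeral_3_eq_3)
  have Z02: "?R (TZ, 0, 2) (TV, 0, 3)" and Z12: "?R (TZ, 1, 2) (TV, 2, 3)"
    using glueZ[of TV 3 1 0 2] glueZ[of TV 3 1 1 2] mem by (simp_all add: face_vertex_def numeral_2_eq_2 numeral_3_eq_3)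
  have U13: "?R (TU, 1, 3) (TU, 0, 3)" and V23: "?R (TV, 2, 3) (TV, 0, 3)"
    using common[of TU "(1, 3)"] common[of TV "(2, 3)"] mem by (simp_all add: pos_pairs_def label_root_def)
  fix x assume "x \<in> tet_edges (twist_Y n)"
  then obtain T e where x: "x = (T, e)" "T \<in> Y_tets p" "e \<in> pos_pairs"
    by (auto simp: tet_edges_alt tets_twist_Y p)
  show "?R x (label_root p (edge_label p x))"
  proof (cases "T = TZ")
    case False then show ?thesis using common x by auto
  next
    case True
    have lr: "label_root p 0 = (TU, 0, 1)" "label_root p 1 = (TU, 0, 3)" "label_root p 2 = (TZ, 2, 3)" "label_root p (p + 4) = (TV, 0, 3)"
      by (auto simp: label_root_def)
    show ?thesis unfolding x True
      using x(3) Z01 Z03 Z02 rtrancl_trans[OF Z13 U13] rtrancl_trans[OF Z12 V23]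
      unfolding pos_pairs_def by (auto simp: lr simp del: One_nat_def)
  qed
qed

lemma edge_class_twist_X:
  assumes p: "p = twist_p n" and x: "x \<in> tet_edges (twist_X n)"
  shows "edge_class (twist_X n) x = {y \<in> tet_edges (twist_X n). merge_label p (edge_label p y) = merge_label p (edge_label p x)}"
proof (rule edge_class_eq_fibre[OF _ _ x])
  fix x y assume "(x, y) \<in> edge_gluing (twist_X n)"
  then show "merge_label p (edge_label p x) = merge_label p (edge_label p y)"
    by (rule face_label_imp_edge_label[rotated, of _ _ _ _ "\<lambda>F e. merge_label p (face_label p F e)"])
       (use edge_label_face_X[OF _ _ _ _ p] in blast)
next
  let ?R = "\<lambda>x y. (x, y) \<in> (edge_gluing (twist_X n))\<^sup>*"
  have common: "?R (T, e) (label_root p (edge_label p (T, e)))" if "T \<in> Y_tets p - {TZ}" "e \<in> pos_pairs" for T e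
    using that
  proof (intro edge_connected_common)
    fix T k assume *: "k \<le> (3::nat)" "(T, k) \<noteq> (TV, 1)"
    then have "k \<in> {0, 1, 2, 3}" by auto
    then show "face (twist_X n) T k = Y_faces p T ! k" using * unfolding face_twist_X p[symmetric] by auto
  qed (auto simp: tets_twist_X p)
  have S: "?R (TU, 0, 3) (TV, 0, 3)"
    using edge_glue[of TU "twist_X n" TV 2 1 0 2] by (simp add: tets_twist_X face_twist_X Y_tets_def J_index_def face_vertex_def numeral_2_eq_2 numeral_3_eq_3)
  fix x assume "x \<in> tet_edges (twist_X n)"
  then obtain T e where x: "x = (T, e)" "T \<in> Y_tets p - {TZ}" "e \<in> pos_pairs"
    by (auto simp: tet_edges_alt tets_twist_X p)
  show "?R x (label_root p (merge_label p (edge_label p x)))"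
  proof (cases "edge_label p x = 1")
    case True
    then have "label_root p (merge_label p (edge_label p x)) = (TV, 0, 3)" by (simp add: merge_label_def label_root_def)
    moreover have "?R x (TU, 0, 3)" using common[OF x(2,3)] True x by (simp add: label_root_def)
    ultimately show ?thesis using S rtrancl_trans by metis
  next
    case False then show ?thesis using common[OF x(2,3)] x by (simp add: merge_label_def)
  qed
qed

definition tet_weight :: "tet angles \<Rightarrow> nat \<Rightarrow> nat \<Rightarrow> tet \<Rightarrow> real" where
  "tet_weight \<alpha> p l T = (\<Sum>e\<in>pos_pairs. if edge_label p (T, e) = l then dihedral \<alpha> (T, e) else 0)"

definition label_weight :: "tet angles \<Rightarrow> nat \<Rightarrow> nat \<Rightarrow> real" where
  "label_weight \<alpha> p l = (\<Sum>T\<in>Y_tets p - {TZ}. tet_weight \<alpha> p l T)"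

lemma weight_fibre:
  assumes "finite (tets X)"
  shows "weight \<alpha> {y \<in> tet_edges X. P y} = (\<Sum>T\<in>tets X. \<Sum>e\<in>pos_pairs. if P (T, e) then dihedral \<alpha> (T, e) else 0)"
proof -
  have fin: "finite (tets X \<times> pos_pairs)" using assms by (simp add: pos_pairs_def)
  have "tet_edges X = tets X \<times> pos_pairs" by (auto simp: tet_edges_alt)
  then have "weight \<alpha> {y \<in> tet_edges X. P y} = (\<Sum>y\<in>{y \<in> tets X \<times> pos_pairs. P y}. dihedral \<alpha> y)" by (simp add: weight_def)
  also have "\<dots> = (\<Sum>y\<in>tets X \<times> pos_pairs. if P y then dihedral \<alpha> y else 0)" by (rule sum.inter_filter[OF fin])
  finally show ?thesis by (auto simp: sum.cartesian_product intro!: sum.cong)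
qed

lemma weight_twist_Y:
  assumes p: "p = twist_p n" and x: "x \<in> tet_edges (twist_Y n)"
  shows "weight \<alpha> (edge_class (twist_Y n) x) = label_weight \<alpha> p (edge_label p x) + tet_weight \<alpha> p (edge_label p x) TZ"
proof -
  have "TZ \<in> Y_tets p" by (simp add: Y_tets_def)
  then show ?thesis
    unfolding edge_class_twist_Y[OF p x] weight_fibre[of "twist_Y n", unfolded tets_twist_Y, OF finite_Y(3)]
      tet_weight_def[symmetric] label_weight_def p[symmetric]
    by (simp add: sum.remove[of "Y_tets p" TZ])
qed

lemma weight_twist_X:
  assumes p: "p = twist_p n" and x: "x \<in> tet_edges (twist_X n)"
  defines "l \<equiv> merge_label p (edge_label p x)"
  shows "weight \<alpha> (edge_class (twist_X n) x) = (if l = p + 4 then label_weight \<alpha> p (p + 4) + label_weight \<alpha> p 1 else label_weight \<alpha> p l)"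
proof -
  have l1: "l \<noteq> 1" by (simp add: l_def merge_label_def)
  have "weight \<alpha> (edge_class (twist_X n) x) =
     (\<Sum>T\<in>Y_tets p - {TZ}. \<Sum>e\<in>pos_pairs. if merge_label p (edge_label p (T, e)) = l then dihedral \<alpha> (T, e) else 0)"
    unfolding edge_class_twist_X[OF p x] l_def[symmetric]
    using weight_fibre[of "twist_X n"] by (simp add: tets_twist_X p)
  also have "\<dots> = (if l = p + 4 then label_weight \<alpha> p (p + 4) + label_weight \<alpha> p 1 else label_weight \<alpha> p l)"
    unfolding label_weight_def tet_weight_def using l1
    by (auto simp: sum.distrib[symmetric] merge_label_def intro!: sum.cong)
  finally show ?thesis .
qed

lemma sum_pos_pairs:
  "sum g pos_pairs = g (0, 1) + g (2, 3) + (g (0, 2) + g (1, 3)) + (g (0, 3) + (g (1, 2) :: real))"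
  by (simp add: pos_pairs_def)

lemma dihedral_simps:
  "dihedral \<alpha> (T, 0, 1) = ang_a \<alpha> T" "dihedral \<alpha> (T, 2, 3) = ang_a \<alpha> T"
  "dihedral \<alpha> (T, 0, 2) = ang_b \<alpha> T" "dihedral \<alpha> (T, 1, 3) = ang_b \<alpha> T"
  "dihedral \<alpha> (T, 0, 3) = ang_c \<alpha> T" "dihedral \<alpha> (T, 1, 2) = ang_c \<alpha> T"
  by (simp_all add: dihedral_def)

definition if_label :: "nat \<Rightarrow> nat \<Rightarrow> real \<Rightarrow> real" where
  "if_label l m x = (if m = l then x else 0)"

lemma tet_weight_eq:
  "tet_weight \<alpha> p l (TT k) = if_label l 3 (ang_a \<alpha> (TT k)) + if_label l 3 (ang_a \<alpha> (TT k)) + (if_label l (k + 3) (ang_b \<alpha> (TT k))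
     + if_label l (k + 3) (ang_b \<alpha> (TT k))) + (if_label l (k + 4) (ang_c \<alpha> (TT k)) + if_label l (k + 2) (ang_c \<alpha> (TT k)))"
  "tet_weight \<alpha> p l TU = if_label l 0 (ang_a \<alpha> TU) + if_label l 0 (ang_a \<alpha> TU) + (if_label l (p + 3) (ang_b \<alpha> TU)
     + if_label l 1 (ang_b \<alpha> TU)) + (if_label l 1 (ang_c \<alpha> TU) + if_label l (p + 4) (ang_c \<alpha> TU))"
  "tet_weight \<alpha> p l TV = if_label l 3 (ang_a \<alpha> TV) + if_label l (p + 4) (ang_a \<alpha> TV) + (if_label l 0 (ang_b \<alpha> TV)
     + if_label l (p + 3) (ang_b \<alpha> TV)) + (if_label l (p + 4) (ang_c \<alpha> TV) + if_label l 0 (ang_c \<alpha> TV))"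
  "tet_weight \<alpha> p l TW = if_label l (p + 3) (ang_a \<alpha> TW) + if_label l 0 (ang_a \<alpha> TW) + (if_label l (p + 4) (ang_b \<alpha> TW)
     + if_label l 0 (ang_b \<alpha> TW)) + (if_label l 1 (ang_c \<alpha> TW) + if_label l 3 (ang_c \<alpha> TW))"
  "tet_weight \<alpha> p l TZ = if_label l 0 (ang_a \<alpha> TZ) + if_label l 2 (ang_a \<alpha> TZ) + (if_label l (p + 4) (ang_b \<alpha> TZ)
     + if_label l 1 (ang_b \<alpha> TZ)) + (if_label l 1 (ang_c \<alpha> TZ) + if_label l (p + 4) (ang_c \<alpha> TZ))"
  unfolding tet_weight_def sum_pos_pairs dihedral_simps if_label_def[symmetric]
  by simp_all

lemma label_weight_eq:
  "label_weight \<alpha> p l = (\<Sum>k=1..p. tet_weight \<alpha> p l (TT k)) + tet_weight \<alpha> p l TU + tet_weight \<alpha> p l TV + tet_weight \<alpha> p l TW"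
proof -
  have "Y_tets p - {TZ} = insert TV (insert TU (insert TW (TT ` {1..p})))"
    by (auto simp: Y_tets_def J_index_def)
  moreover have "sum g (TT ` {1..p}) = (\<Sum>k=1..p. g (TT k))" for g :: "tet \<Rightarrow> real"
    by (subst sum.reindex) (auto simp: inj_on_def)
  ultimately show ?thesis by (simp add: label_weight_def image_iff)
qed

text \<open>
  The edge \<open>23\<close> of \<open>Z\<close> is alone in its class.
\<close>

lemma weight_twist_knot_edge: "weight \<alpha> (twist_knot_edge n) = ang_a \<alpha> TZ"
proof -
  let ?p = "twist_p n"
  have "(TZ, 2, 3) \<in> tet_edges (twist_Y n)" by (simp add: tet_edges_alt pos_pairs_def tets_twist_Y Y_tets_def)
  from weight_twist_Y[OF refl this, of \<alpha>]
  have "weight \<alpha> (twist_knot_edge n) = label_weight \<alpha> ?p 2 + tet_weight \<alpha> ?p 2 TZ" by (simp add: twist_knot_edge_def)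
  also have "label_weight \<alpha> ?p 2 = 0"
    unfolding label_weight_eq by (simp add: tet_weight_eq if_label_def)
  also have "tet_weight \<alpha> ?p 2 TZ = ang_a \<alpha> TZ" by (simp add: tet_weight_eq if_label_def)
  finally show ?thesis by simp
qed

text \<open>
  The edge equations of \<^const>\<open>twist_X\<close>. As they are stated by labels, they make sense also for angle
  assignments on \<^const>\<open>twist_Y\<close>.
\<close>

definition balanced_X :: "nat \<Rightarrow> tet angles \<Rightarrow> bool" where
  "balanced_X p \<alpha> \<longleftrightarrow> label_weight \<alpha> p 0 = 2 * pi \<and> (\<forall>j\<le>p. label_weight \<alpha> p (j + 3) = 2 * pi) \<and>
     label_weight \<alpha> p (p + 4) + label_weight \<alpha> p 1 = 2 * pi"

text \<open>
  Every label occurs outside \<open>Z\<close>, so the equations for the edges of \<^const>\<open>twist_X\<close> and those for the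
  edges of \<^const>\<open>twist_Y\<close> can both be indexed by labels.
\<close>

lemma label_representative:
  assumes "l = 0 \<or> (\<exists>j\<le>p + 1. l = j + 3)"
  obtains T e where "T \<in> Y_tets p - {TZ}" "e \<in> pos_pairs" "edge_label p (T, e) = l"
proof -
  from assms consider "l = 0" | "l = 3" | j where "1 \<le> j" "j \<le> p" "l = j + 3" | "l = p + 4" by force
  then show ?thesis
  proof cases
    case 1 then show ?thesis by (intro that[of TU "(0, 1)"]) (auto simp: Y_tets_def J_index_def pos_pairs_def)
  next
    case 2 then show ?thesis by (intro that[of TV "(0, 1)"]) (auto simp: Y_tets_def J_index_def pos_pairs_def)
  next
    case 3 then show ?thesis by (intro that[of "TT j" "(0, 2)"]) (auto simp: Y_tets_def J_index_def pos_pairs_def)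
  next
    case 4 then show ?thesis by (intro that[of TV "(0, 3)"]) (auto simp: Y_tets_def J_index_def pos_pairs_def)
  qed
qed

lemma angle_structures_twist_X:
  assumes p: "p = twist_p n"
  shows "\<alpha> \<in> angle_structures (twist_X n) \<longleftrightarrow> \<alpha> \<in> shape_structures (twist_X n) \<and> balanced_X p \<alpha>"
proof -
  have "(\<forall>e\<in>edges (twist_X n). weight \<alpha> e = 2 * pi) \<longleftrightarrow> balanced_X p \<alpha>"
  proof
    assume w: "\<forall>e\<in>edges (twist_X n). weight \<alpha> e = 2 * pi"
    have *: "(if l = p + 4 then label_weight \<alpha> p (p + 4) + label_weight \<alpha> p 1 else label_weight \<alpha> p l) = 2 * pi"
      if l: "l = 0 \<or> (\<exists>j\<le>p + 1. l = j + 3)" for l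
    proof -
      obtain T e where Te: "T \<in> Y_tets p - {TZ}" "e \<in> pos_pairs" "edge_label p (T, e) = l" using label_representative[OF l] .
      then have x: "(T, e) \<in> tet_edges (twist_X n)" by (auto simp: tet_edges_alt tets_twist_X p)
      have "merge_label p (edge_label p (T, e)) = l" using Te(3) l by (auto simp: merge_label_def)
      moreover have "weight \<alpha> (edge_class (twist_X n) (T, e)) = 2 * pi" using w x by (auto simp: edges_def)
      ultimately show ?thesis using weight_twist_X[OF p x, of \<alpha>] by (simp only:)
    qed
    show "balanced_X p \<alpha>"
      unfolding balanced_X_def
    proof (intro conjI allI impI)
      show "label_weight \<alpha> p 0 = 2 * pi" using *[of 0] by simp
      show "label_weight \<alpha> p (j + 3) = 2 * pi" if "j \<le> p" for j using *[of "j + 3"] that by (simp split: if_splits)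
      have "\<exists>j\<le>p + 1. p + 4 = j + 3" by (rule exI[of _ "p + 1"]) simp
      then show "label_weight \<alpha> p (p + 4) + label_weight \<alpha> p 1 = 2 * pi" using *[of "p + 4"] by simp
    qed
  next
    assume b: "balanced_X p \<alpha>"
    show "\<forall>e\<in>edges (twist_X n). weight \<alpha> e = 2 * pi"
    proof
      fix c assume "c \<in> edges (twist_X n)"
      then obtain x where x: "x \<in> tet_edges (twist_X n)" "c = edge_class (twist_X n) x" by (auto simp: edges_def)
      obtain T e where Te: "x = (T, e)" "T \<in> Y_tets p - {TZ}" "e \<in> pos_pairs" using x(1) by (auto simp: tet_edges_alt tets_twist_X p)
      have label_ex: "L = j + 3 \<Longrightarrow> j \<le> p + 1 \<Longrightarrow> L = 0 \<or> L = 1 \<or> (\<exists>j\<le>p + 1. L = j + 3)" for L j by blast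
      have "edge_label p (T, e) = 0 \<or> edge_label p (T, e) = 1 \<or> (\<exists>j\<le>p + 1. edge_label p (T, e) = j + 3)"
        using Te(2)
      proof (cases T)
        case (TT k)
        then have k: "1 \<le> k" "k \<le> p" using Te(2) by (auto simp: Y_tets_def J_index_def)
        have "edge_label p (T, e) \<in> {0 + 3, k + 3, (k + 1) + 3, (k - 1) + 3}" using TT k by simp
        then show ?thesis using k by (elim insertE emptyE) (rule label_ex, assumption, simp)+
      next
        case TU
        have "edge_label p (T, e) \<in> {0, 1, p + 3, (p + 1) + 3}" using TU by simp
        then show ?thesis by (elim insertE emptyE) (simp | (rule label_ex, assumption, simp))+
      next
        case TV
        have "edge_label p (T, e) \<in> {0, 0 + 3, p + 3, (p + 1) + 3}" using TV by simp
        then show ?thesis by (elim insertE emptyE) (simp | (rule label_ex, assumption, simp))+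
      next
        case TW
        have "edge_label p (T, e) \<in> {0, 1, 0 + 3, p + 3, (p + 1) + 3}" using TW by simp
        then show ?thesis by (elim insertE emptyE) (simp | (rule label_ex, assumption, simp))+
      qed simp
      then have "edge_label p x = 0 \<or> edge_label p x = 1 \<or> (\<exists>j\<le>p + 1. edge_label p x = j + 3)"
        by (simp only: Te(1))
      then have "merge_label p (edge_label p x) = 0 \<or> (\<exists>j\<le>p. merge_label p (edge_label p x) = j + 3) \<or> merge_label p (edge_label p x) = p + 4"
        by (auto simp: merge_label_def le_Suc_eq)
      then show "weight \<alpha> c = 2 * pi"
        using b weight_twist_X[OF p x(1), of \<alpha>] unfolding x(2) balanced_X_def by (elim disjE exE conjE) auto
    qed
  qed
  then show ?thesis by (auto simp: angle_structures_def)
qed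

text \<open>
  As \<open>a\<^sub>Z = 0\<close>, the tetrahedron \<open>Z\<close> contributes \<open>b\<^sub>Z + c\<^sub>Z = \<pi>\<close> to each of the classes \<open>1\<close> and \<open>p + 4\<close>, and \<open>0\<close> to all
  others. So without \<open>Z\<close> these two classes have weight \<open>\<pi>\<close> each, and merging them gives \<open>2 \<pi>\<close>.
\<close>

lemma balanced_twist_Y:
  assumes p: "p = twist_p n" and K: "weight \<tau> (twist_knot_edge n) = 0"
    and w: "\<forall>e\<in>edges (twist_Y n) - {twist_knot_edge n}. weight \<tau> e = 2 * pi"
    and Z: "ang_a \<tau> TZ + ang_b \<tau> TZ + ang_c \<tau> TZ = pi"
  shows "balanced_X p \<tau>" "label_weight \<tau> p 1 = pi" "ang_a \<tau> TZ = 0"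
proof -
  show a: "ang_a \<tau> TZ = 0" using K by (simp add: weight_twist_knot_edge)
  have *: "label_weight \<tau> p (edge_label p (T, e)) + tet_weight \<tau> p (edge_label p (T, e)) TZ = 2 * pi"
    if Te: "T \<in> Y_tets p" "e \<in> pos_pairs" "edge_label p (T, e) \<noteq> 2" for T e
  proof -
    have x: "(T, e) \<in> tet_edges (twist_Y n)" using Te by (auto simp: tet_edges_alt tets_twist_Y p)
    have z: "(TZ, 2, 3) \<in> tet_edges (twist_Y n)" by (simp add: tet_edges_alt pos_pairs_def tets_twist_Y Y_tets_def)
    have "(T, e) \<in> edge_class (twist_Y n) (T, e)" by (simp add: edge_class_def)
    moreover have "(T, e) \<notin> twist_knot_edge n"
      unfolding twist_knot_edge_def edge_class_twist_Y[OF p z] using Te(3) by simp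
    ultimately have "edge_class (twist_Y n) (T, e) \<noteq> twist_knot_edge n" by auto
    then have "weight \<tau> (edge_class (twist_Y n) (T, e)) = 2 * pi" using w x by (auto simp: edges_def)
    then show ?thesis using weight_twist_Y[OF p x, of \<tau>] by simp
  qed
  have **: "label_weight \<tau> p l + tet_weight \<tau> p l TZ = 2 * pi" if l: "l = 0 \<or> (\<exists>j\<le>p + 1. l = j + 3)" for l
  proof -
    obtain T e where "T \<in> Y_tets p - {TZ}" "e \<in> pos_pairs" "edge_label p (T, e) = l" using label_representative[OF l] .
    then show ?thesis using *[of T e] l by auto
  qed
  have Z': "ang_b \<tau> TZ + ang_c \<tau> TZ = pi" using Z a by simp
  have "label_weight \<tau> p 1 + tet_weight \<tau> p 1 TZ = 2 * pi"
    using *[of TU "(0, 3)"] by (simp add: Y_tets_def J_index_def pos_pairs_def)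
  then show 1: "label_weight \<tau> p 1 = pi" using Z' by (simp add: tet_weight_eq if_label_def)
  show "balanced_X p \<tau>"
    unfolding balanced_X_def
  proof (intro conjI allI impI)
    show "label_weight \<tau> p 0 = 2 * pi" using **[of 0] a by (simp add: tet_weight_eq if_label_def)
    show "label_weight \<tau> p (j + 3) = 2 * pi" if "j \<le> p" for j
    proof -
      have "\<exists>i\<le>p + 1. j + 3 = i + 3" using that by (intro exI[of _ j]) auto
      then show ?thesis using **[of "j + 3"] that by (simp add: tet_weight_eq if_label_def)
    qed
    have "\<exists>j\<le>p + 1. p + 4 = j + 3" by (rule exI[of _ "p + 1"]) simp
    then have "label_weight \<tau> p (p + 4) + tet_weight \<tau> p (p + 4) TZ = 2 * pi" by (intro **) blast
    then show "label_weight \<tau> p (p + 4) + label_weight \<tau> p 1 = 2 * pi" using 1 Z' by (simp add: tet_weight_eq if_label_def)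
  qed
qed

section \<open>Consequences of the edge equations\<close>

lemma label_weight_expand:
  "label_weight \<alpha> p l = (\<Sum>k=1..p. if_label l 3 (2 * ang_a \<alpha> (TT k)) + if_label l (k + 3) (2 * ang_b \<alpha> (TT k)) + if_label l (k + 4) (ang_c \<alpha> (TT k)) + if_label l (k + 2) (ang_c \<alpha> (TT k)))
     + if_label l 0 (2 * ang_a \<alpha> TU + ang_b \<alpha> TV + ang_c \<alpha> TV + ang_a \<alpha> TW + ang_b \<alpha> TW)
     + if_label l 1 (ang_b \<alpha> TU + ang_c \<alpha> TU + ang_c \<alpha> TW)
     + if_label l 3 (ang_a \<alpha> TV + ang_c \<alpha> TW)
     + if_label l (p + 3) (ang_b \<alpha> TU + ang_b \<alpha> TV + ang_a \<alpha> TW)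
     + if_label l (p + 4) (ang_c \<alpha> TU + ang_a \<alpha> TV + ang_c \<alpha> TV + ang_b \<alpha> TW)"
proof -
  have add: "if_label l m (x + y) = if_label l m x + if_label l m y" "if_label l m (2 * x) = if_label l m x + if_label l m x" for m x y
    by (auto simp: if_label_def)
  show ?thesis unfolding label_weight_eq tet_weight_eq add by (simp add: algebra_simps)
qed

definition tet_angles_sum :: "nat \<Rightarrow> tet angles \<Rightarrow> bool" where
  "tet_angles_sum p \<alpha> \<longleftrightarrow> (\<forall>T\<in>Y_tets p - {TZ}. ang_a \<alpha> T + ang_b \<alpha> T + ang_c \<alpha> T = pi)"

text \<open>
  The right-hand sides are, in units of \<open>\<hbar>\<^sup>-\<^sup>1\<^sup>/\<^sup>2\<close>, the coefficients of the real parts of the variables in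
  the exponent of the integrand of \<open>J\<close> on the contour given by \<open>\<alpha>\<close>; see \<open>J_slope_compatible\<close>. The
  equations say that these coefficients are the ones in the dynamical content, where \<open>U\<close> and \<open>V\<close> share
  one variable.
\<close>

definition J_compatible :: "nat \<Rightarrow> tet angles \<Rightarrow> bool" where
  "J_compatible p \<alpha> \<longleftrightarrow>
     (\<forall>k\<in>{1..p}. ang_c \<alpha> (TT k) = 2 * (\<Sum>j=1..p. real (min j k) * (pi - ang_a \<alpha> (TT j))) + 2 * real k * (pi - ang_a \<alpha> TU)
         + J_W p (TT k)) \<and>
     ang_c \<alpha> TU + ang_c \<alpha> TV = - 2 * (\<Sum>j=1..p. real j * (pi - ang_a \<alpha> (TT j))) - 2 * real p * (pi - ang_a \<alpha> TU) - (pi - ang_a \<alpha> TW) + J_W p TU \<and>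
     ang_c \<alpha> TW = - (pi - ang_a \<alpha> TU) + J_W p TW"

text \<open>
  The equation of the class \<open>0\<close> gives \<open>c\<^sub>W = a\<^sub>U\<close>. With \<open>c\<^sub>0 = 0\<close>, the equations of the classes \<open>j + 3\<close>
  form a second order recurrence for \<open>c\<^sub>k\<close>, which sums up to
  \<open>c\<^sub>k\<^sub>+\<^sub>1 - c\<^sub>k = 2 (\<pi> - a\<^sub>U) - 2 \<Sum>\<^sub>j\<^sub>>\<^sub>k a\<^sub>j\<close>. The claimed right-hand sides \<open>L\<^sub>k\<close> have the same differences. The merged
  class \<open>p + 4\<close> then gives \<open>c\<^sub>U + c\<^sub>V = a\<^sub>W - c\<^sub>p\<close>, with \<open>c\<^sub>0 = 0\<close> covering the case \<open>p = 0\<close>.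
\<close>

lemma balanced_imp_J_compatible:
  assumes sum: "tet_angles_sum p \<alpha>" and bal: "balanced_X p \<alpha>" and eq: "ang_a \<alpha> TU = ang_a \<alpha> TV"
  shows "J_compatible p \<alpha>"
proof -
  define a b c where "a = ang_a \<alpha>" and "b = ang_b \<alpha>" and "c = ang_c \<alpha>"
  have s: "a T + b T + c T = pi" if "T \<in> Y_tets p - {TZ}" for T
    using sum that by (auto simp: tet_angles_sum_def a_def b_def c_def)
  have sU: "a TU + b TU + c TU = pi" and sV: "a TV + b TV + c TV = pi" and sW: "a TW + b TW + c TW = pi"
    and sk: "\<And>k. k \<in> {1..p} \<Longrightarrow> a (TT k) + b (TT k) + c (TT k) = pi"
    by (auto intro!: s simp: Y_tets_def J_index_def)
  have aUV: "a TU = a TV" using eq by (simp add: a_def)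
  note W = label_weight_expand[of \<alpha> p, folded a_def b_def c_def]
  have A: "2 * a TU + b TV + c TV + a TW + b TW = 2 * pi"
    using bal W[of 0] by (simp add: balanced_X_def if_label_def)
  have cW: "c TW = a TU" using A sV sW aUV by simp
  \<comment> \<open>With \<open>C 0 = 0\<close> the recurrence starts uniformly, and \<open>C p\<close> is correct also for \<open>p = 0\<close>.\<close>
  define C where "C = (\<lambda>k. if k \<in> {1..p} then c (TT k) else 0)"
  have E0: "2 * (\<Sum>k=1..p. a (TT k)) + C 1 + a TV + c TW = 2 * pi" if "1 \<le> p"
  proof -
    have "label_weight \<alpha> p (0 + 3) = 2 * pi" using bal unfolding balanced_X_def by blast
    then have "(\<Sum>k=1..p. 2 * a (TT k) + if_label 3 (k + 2) (c (TT k))) + a TV + c TW = 2 * pi"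
      unfolding W using that by (simp add: if_label_def)
    also have "(\<Sum>k=1..p. 2 * a (TT k) + if_label 3 (k + 2) (c (TT k))) = 2 * (\<Sum>k=1..p. a (TT k)) + (\<Sum>k=1..p. if k = 1 then c (TT k) else 0)"
      unfolding sum.distrib sum_distrib_left by (intro arg_cong2[of _ _ _ _ "(+)"] sum.cong) (auto simp: if_label_def)
    also have "(\<Sum>k=1..p. if k = 1 then c (TT k) else 0) = C 1" using that by (simp add: C_def)
    finally show ?thesis .
  qed
  have Ej: "2 * b (TT j) + C (j - 1) + C (j + 1) = 2 * pi" if j: "1 \<le> j" "j < p" for j
  proof -
    have "label_weight \<alpha> p (j + 3) = 2 * pi" using bal j unfolding balanced_X_def by auto
    then have "(\<Sum>k=1..p. if_label (j + 3) (k + 3) (2 * b (TT k)) + if_label (j + 3) (k + 4) (c (TT k)) + if_label (j + 3) (k + 2) (c (TT k))) = 2 * pi"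
      unfolding W using j by (simp add: if_label_def)
    also have "(\<Sum>k=1..p. if_label (j + 3) (k + 3) (2 * b (TT k)) + if_label (j + 3) (k + 4) (c (TT k)) + if_label (j + 3) (k + 2) (c (TT k))) =
       (\<Sum>k=1..p. if k = j then 2 * b (TT k) else 0) + (\<Sum>k=1..p. if k = j - 1 then c (TT k) else 0) + (\<Sum>k=1..p. if k = j + 1 then c (TT k) else 0)"
      unfolding sum.distrib using j by (intro arg_cong2[of _ _ _ _ "(+)"] sum.cong) (auto simp: if_label_def)
    also have "\<dots> = 2 * b (TT j) + C (j - 1) + C (j + 1)" using j by (simp add: C_def)
    finally show ?thesis .
  qed
  have Ep: "C p + c TU + a TV + c TV + b TW + (b TU + c TU + c TW) = 2 * pi"
  proof -
    have "label_weight \<alpha> p (p + 4) + label_weight \<alpha> p 1 = 2 * pi" using bal by (simp add: balanced_X_def)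
    then have "(\<Sum>k=1..p. if_label (p + 4) (k + 4) (c (TT k))) + c TU + a TV + c TV + b TW + (b TU + c TU + c TW) = 2 * pi"
      unfolding W by (simp add: if_label_def)
    also have "(\<Sum>k=1..p. if_label (p + 4) (k + 4) (c (TT k))) = (\<Sum>k=1..p. if k = p then c (TT k) else 0)"
      by (intro sum.cong) (auto simp: if_label_def)
    also have "\<dots> = C p" by (simp add: C_def)
    finally show ?thesis .
  qed
  define M where "M = (\<lambda>k. 2 * (pi - a TU) - 2 * (\<Sum>j=k+1..p. a (TT j)))"
  have step: "C (k + 1) - C k = M k" if "k < p" for k
    using that
  proof (induction k)
    case 0
    then show ?case using E0 cW aUV by (simp add: M_def C_def)
  next
    case (Suc k)
    have "M (Suc k) = M k + 2 * a (TT (Suc k))"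
      using Suc.prems sum.atLeast_Suc_atMost[of "k + 1" p "\<lambda>j. a (TT j)"] by (simp add: M_def)
    moreover have "C (Suc k) = c (TT (Suc k))" using Suc.prems by (simp add: C_def)
    ultimately show ?case using Suc Ej[of "Suc k"] sk[of "Suc k"] by simp
  qed
  have CM: "C k = (\<Sum>i<k. M i)" if "k \<le> p" for k
    using that
  proof (induction k)
    case 0 show ?case by (simp add: C_def)
  next
    case (Suc k) then show ?case using step[of k] by simp
  qed
  define L where "L = (\<lambda>k. 2 * (\<Sum>j=1..p. real (min j k) * (pi - a (TT j))) + 2 * real k * (pi - a TU) - 2 * pi * (real k * real p - real k * (real k - 1) / 2))"
  have Lstep: "L (k + 1) - L k = M k" if "k < p" for k
  proof -
    have "(\<Sum>j=1..p. real (min j (k + 1)) * (pi - a (TT j))) - (\<Sum>j=1..p. real (min j k) * (pi - a (TT j))) = (\<Sum>j=1..p. if k + 1 \<le> j then pi - a (TT j) else 0)"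
      unfolding sum_subtractf[symmetric] by (intro sum.cong) (auto simp: min_def algebra_simps)
    also have "\<dots> = (\<Sum>j=k+1..p. pi - a (TT j))"
      by (subst sum.inter_filter[symmetric]) (auto intro!: sum.cong)
    also have "\<dots> = (real p - real k) * pi - (\<Sum>j=k+1..p. a (TT j))"
      using that by (simp add: sum_subtractf of_nat_diff)
    finally have 1: "(\<Sum>j=1..p. real (min j (k + 1)) * (pi - a (TT j))) = (\<Sum>j=1..p. real (min j k) * (pi - a (TT j))) + (real p - real k) * pi - (\<Sum>j=k+1..p. a (TT j))" by simp
    show ?thesis unfolding L_def M_def 1 by (simp add: field_simps)
  qed
  have LM: "L k = (\<Sum>i<k. M i)" if "k \<le> p" for k
    using that
  proof (induction k)
    case 0 show ?case by (simp add: L_def)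
  next
    case (Suc k) then show ?case using Lstep[of k] by simp
  qed
  have CL: "C k = L k" if "k \<le> p" for k using CM LM that by simp
  have T: "c (TT k) = L k" if "k \<in> {1..p}" for k using CL[of k] that by (simp add: C_def)
  have U: "c TU + c TV = a TW - L p" using Ep CL[of p] sU sW cW aUV by simp
  have minp: "(\<Sum>j=1..p. real (min j p) * (pi - a (TT j))) = (\<Sum>j=1..p. real j * (pi - a (TT j)))"
    by (intro sum.cong) auto
  show ?thesis
    unfolding J_compatible_def a_def[symmetric] c_def[symmetric]
  proof (intro conjI ballI)
    fix k assume "k \<in> {1..p}"
    then show "c (TT k) = 2 * (\<Sum>j=1..p. real (min j k) * (pi - a (TT j))) + 2 * real k * (pi - a TU) + J_W p (TT k)"
      using T[of k] by (simp add: L_def)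
  next
    show "c TU + c TV = - 2 * (\<Sum>j=1..p. real j * (pi - a (TT j))) - 2 * real p * (pi - a TU) - (pi - a TW) + J_W p TU"
      unfolding U L_def minp by (simp add: field_simps power2_eq_square)
    show "c TW = - (pi - a TU) + J_W p TW" using cW by simp
  qed
qed

text \<open>
  The class \<open>0\<close> gives \<open>2 a\<^sub>U - a\<^sub>V = c\<^sub>W\<close> and the class \<open>1\<close> gives \<open>a\<^sub>U = c\<^sub>W\<close>.
\<close>

lemma balanced_Y_angles:
  assumes sum: "tet_angles_sum p \<alpha>" and bal: "balanced_X p \<alpha>" and S: "label_weight \<alpha> p 1 = pi"
  shows "ang_a \<alpha> TU = ang_a \<alpha> TV"
proof -
  have s: "ang_a \<alpha> TU + ang_b \<alpha> TU + ang_c \<alpha> TU = pi" "ang_a \<alpha> TV + ang_b \<alpha> TV + ang_c \<alpha> TV = pi" "ang_a \<alpha> TW + ang_b \<alpha> TW + ang_c \<alpha> TW = pi"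
    using sum by (auto simp: tet_angles_sum_def Y_tets_def J_index_def)
  have "2 * ang_a \<alpha> TU + ang_b \<alpha> TV + ang_c \<alpha> TV + ang_a \<alpha> TW + ang_b \<alpha> TW = 2 * pi"
    using bal label_weight_expand[of \<alpha> p 0] by (simp add: balanced_X_def if_label_def)
  moreover have "ang_b \<alpha> TU + ang_c \<alpha> TU + ang_c \<alpha> TW = pi"
    using S label_weight_expand[of \<alpha> p 1] by (simp add: if_label_def)
  ultimately show ?thesis using s by linarith
qed

section \<open>The factors of single tetrahedra\<close>

abbreviation Qb :: "real \<Rightarrow> real" where "Qb b \<equiv> b + 1 / b"

lemma Qb_pos: "b > 0 \<Longrightarrow> Qb b > 0" by (simp add: add_pos_pos)

definition tet_factor :: "real \<Rightarrow> int \<Rightarrow> real \<Rightarrow> real \<Rightarrow> real \<Rightarrow> complex" where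
  "tet_factor b s a c t = of_real (exp (c * t / sqrt (hbar b))) /
     qdilog b (of_real t - \<i> / of_real (2 * pi * sqrt (hbar b)) * of_int s * of_real (pi - a)) powi s"

lemma dynamical_content_twist_Y:
  "dynamical_content b (twist_Y n) \<alpha> = (\<lambda>t. \<Prod>T\<in>Y_tets (twist_p n). tet_factor b (twist_sign T) (ang_a \<alpha> T) (ang_c \<alpha> T) (t T))"
  unfolding dynamical_content_def tet_factor_def tets_twist_Y by (simp add: twist_Y_def)

lemma tet_factor_arg:
  assumes "b > 0"
  shows "of_real t - \<i> / of_real (2 * pi * sqrt (hbar b)) * of_int s * of_real (pi - a) = Complex t (- real_of_int s * ((pi - a) * Qb b / (2 * pi)))"
  using assms by (simp add: sqrt_hbar complex_eq_iff)

lemma tet_factor_alt: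
  assumes "b > 0"
  shows "tet_factor b s a c t = of_real (exp (c * t * Qb b)) / qdilog b (Complex t (- real_of_int s * ((pi - a) * Qb b / (2 * pi)))) powi s"
  unfolding tet_factor_def tet_factor_arg[OF assms] using assms by (simp add: sqrt_hbar)

lemma strip_height:
  assumes "b > 0" "0 < a" "a < 2 * pi" "s \<in> {1, -1 :: int}"
  shows "\<bar>- real_of_int s * ((pi - a) * Qb b / (2 * pi))\<bar> < Qb b / 2"
proof -
  have "\<bar>- real_of_int s * ((pi - a) * Qb b / (2 * pi))\<bar> = \<bar>pi - a\<bar> * (Qb b / (2 * pi))"
    using assms Qb_pos[OF assms(1)] by (auto simp: abs_mult)
  also have "\<dots> < pi * (Qb b / (2 * pi))" using assms Qb_pos[OF assms(1)] by (intro mult_strict_right_mono) auto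
  also have "\<dots> = Qb b / 2" by simp
  finally show ?thesis .
qed

text \<open>
  By the growth of \<open>\<Phi>\<^sub>b\<close>, the factor is of size \<open>exp (Q c t)\<close> for \<open>t \<le> 0\<close> and \<open>exp (- Q (\<pi> - a - c) t)\<close> for
  \<open>t \<ge> 0\<close>, for either sign, with \<open>Q = \<hbar>\<^sup>-\<^sup>1\<^sup>/\<^sup>2\<close>. So \<open>c\<close> and \<open>\<pi> - a - c\<close> are the decay rates
  on the two sides, while a lower bound on \<open>a\<close> keeps the argument away from the boundary of the strip.
\<close>

lemma tet_factor_bound:
  assumes b: "b > 0" and \<delta>: "\<delta> > 0" and s: "s \<in> {1, -1 :: int}"
  obtains C where "C \<ge> 0"
    "\<And>a c t. \<delta> \<le> a \<Longrightarrow> \<delta> \<le> c \<Longrightarrow> a + c \<le> pi - \<delta> \<Longrightarrow> norm (tet_factor b s a c t) \<le> C * exp (- (\<delta> * Qb b) * \<bar>t\<bar>)"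
proof -
  define y0 where "y0 = (pi - \<delta>) * Qb b / (2 * pi)"
  note Q = Qb_pos[OF b]
  have "(pi - \<delta>) * (Qb b / (2 * pi)) < pi * (Qb b / (2 * pi))" using \<delta> Q by (intro mult_strict_right_mono) auto
  then have y0: "y0 < Qb b / 2" by (simp add: y0_def)
  obtain K where K: "\<And>z. \<bar>Im z\<bar> \<le> y0 \<Longrightarrow> \<bar>ln (cmod (qdilog b z)) + 2 * pi * (max 0 (Re z) * Im z)\<bar> \<le> K"
    using ln_norm_qdilog_bound[OF b y0] by blast
  show ?thesis
  proof (rule that[of "exp K"])
    fix a c t assume ac: "\<delta> \<le> a" "\<delta> \<le> c" "a + c \<le> pi - \<delta>"
    define y where "y = - real_of_int s * ((pi - a) * Qb b / (2 * pi))"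
    let ?z = "Complex t y"
    have "\<bar>y\<bar> = (pi - a) * Qb b / (2 * pi)"
      using s ac Q \<delta> by (auto simp: y_def abs_mult)
    also have "\<dots> \<le> y0" unfolding y0_def using ac Q by (intro divide_right_mono mult_right_mono) auto
    finally have yle: "\<bar>y\<bar> \<le> y0" .
    have nz: "qdilog b ?z \<noteq> 0" by (rule qdilog_nonzero[OF b]) (use yle y0 in simp)
    let ?l = "ln (cmod (qdilog b ?z))"
    have "norm (tet_factor b s a c t) = exp (c * t * Qb b) / exp (?l) powi s"
      unfolding tet_factor_alt[OF b] y_def[symmetric] using nz by (simp add: norm_divide norm_power_int)
    also have "\<dots> = exp (c * t * Qb b - real_of_int s * ?l)"
      using s by (auto simp: exp_diff exp_minus divide_inverse exp_add)
    also have "\<dots> \<le> exp (K + - (\<delta> * Qb b) * \<bar>t\<bar>)"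
    proof -
      have "\<bar>?l + 2 * pi * (max 0 t * y)\<bar> \<le> K" using K[of ?z] yle by simp
      then have 1: "- real_of_int s * ?l \<le> K + real_of_int s * (2 * pi * (max 0 t * y))"
        using s by auto
      have "real_of_int s * (2 * pi * (max 0 t * y)) = - (max 0 t * ((pi - a) * Qb b))"
        using s by (auto simp: y_def)
      moreover have "c * t * q - max 0 t * ((pi - a) * q) \<le> - (\<delta> * q) * \<bar>t\<bar>" if Q: "q > 0" for q
      proof (cases "t \<ge> 0")
        case True
        have "\<delta> * (t * q) \<le> (pi - a - c) * (t * q)" using True ac Q by (intro mult_right_mono) auto
        then show ?thesis using True by (simp add: max_def algebra_simps)
      next
        case False
        have "\<delta> * (- t * q) \<le> c * (- t * q)" using False ac Q by (intro mult_right_mono) (auto simp: mult_nonpos_nonneg)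
        then show ?thesis using False by (simp add: max_def algebra_simps)
      qed
      from this[OF Q] calculation show ?thesis using 1 by simp
    qed
    finally show "norm (tet_factor b s a c t) \<le> exp K * exp (- (\<delta> * Qb b) * \<bar>t\<bar>)" by (simp only: exp_add)
  qed simp
qed

lemma isCont_qdilog: "b > 0 \<Longrightarrow> \<bar>Im z\<bar> < Qb b / 2 \<Longrightarrow> isCont (qdilog b) z"
proof -
  assume b: "b > 0" and z: "\<bar>Im z\<bar> < Qb b / 2"
  have "open {z. \<bar>Im z\<bar> < Qb b / 2}" by (intro open_Collect_less continuous_intros)
  then show ?thesis
    using holomorphic_on_imp_continuous_on[OF qdilog_holomorphic[OF b]] z by (simp add: continuous_on_eq_continuous_at)
qed

lemma tendsto_tet_factor:
  assumes b: "b > 0" and s: "s \<in> {1, -1 :: int}" and a: "0 < a" "a < 2 * pi"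
    and lim: "(f \<longlongrightarrow> a) F" "(g \<longlongrightarrow> c) F" "(h \<longlongrightarrow> t) F"
  shows "((\<lambda>n. tet_factor b s (f n) (g n) (h n)) \<longlongrightarrow> tet_factor b s a c t) F"
proof -
  have st: "\<bar>Im (Complex t (- real_of_int s * ((pi - a) * Qb b / (2 * pi))))\<bar> < Qb b / 2"
    using strip_height[OF b a s] by simp
  have "((\<lambda>n. qdilog b (Complex (h n) (- real_of_int s * ((pi - f n) * Qb b / (2 * pi))))) \<longlongrightarrow>
      qdilog b (Complex t (- real_of_int s * ((pi - a) * Qb b / (2 * pi))))) F"
    by (rule isCont_tendsto_compose[OF isCont_qdilog[OF b st]]) (intro tendsto_Complex tendsto_intros lim, simp)
  then show ?thesis
    unfolding tet_factor_alt[OF b] using s qdilog_nonzero[OF b st]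
    by (intro tendsto_intros lim) auto
qed

lemma tet_factor_continuous:
  assumes b: "b > 0" and s: "s \<in> {1, -1 :: int}" and a: "0 < a" "a < 2 * pi"
  shows "continuous_on UNIV (tet_factor b s a c)"
  unfolding continuous_on_def
  by (intro ballI tendsto_tet_factor b s a tendsto_const tendsto_ident_at)

lemma twist_sign_cases: "twist_sign T \<in> {1, -1}"
  by (cases T) auto

section \<open>The contour integrand on its contour\<close>

lemma J_Q_sym: "J_Q p j k = J_Q p k j"
  by (cases j; cases k) (auto simp: min.commute)

definition J_point :: "(tet \<Rightarrow> real) \<Rightarrow> (tet \<Rightarrow> real) \<Rightarrow> tet \<Rightarrow> complex" where
  "J_point x d T = Complex (x T) (d T)"

definition J_height :: "real \<Rightarrow> tet angles \<Rightarrow> tet \<Rightarrow> real" where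
  "J_height b \<alpha> T = - real_of_int (twist_sign T) * ((pi - ang_a \<alpha> T) * Qb b / (2 * pi))"

text \<open>
  The integrand that remains of the partition function after the variables \<open>t\<^sub>Z\<close> and \<open>t\<^sub>V\<close> have been
  eliminated, without the factor of \<open>Z\<close>.
\<close>

definition J_factor :: "real \<Rightarrow> nat \<Rightarrow> tet angles \<Rightarrow> (tet \<Rightarrow> real) \<Rightarrow> complex" where
  "J_factor b p \<alpha> x = exp (2 * of_real pi * \<i> * of_real (J_quad p x)) *
     (tet_factor b (twist_sign TV) (ang_a \<alpha> TV) (ang_c \<alpha> TV) (x TU) *
      (\<Prod>T\<in>J_index p. tet_factor b (twist_sign T) (ang_a \<alpha> T) (ang_c \<alpha> T) (x T)))"

lemma J_integrand_cong:
  assumes "\<And>T. T \<in> J_index p \<Longrightarrow> y T = y' T"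
  shows "J_integrand b p y = J_integrand b p y'"
proof -
  have "TU \<in> J_index p" "TW \<in> J_index p" "\<And>k. k \<in> {1..p} \<Longrightarrow> TT k \<in> J_index p" by (auto simp: J_index_def)
  then have y: "y TU = y' TU" "y TW = y' TW" "\<And>k. k \<in> {1..p} \<Longrightarrow> y (TT k) = y' (TT k)" using assms by blast+
  have "(\<Prod>k=1..p. qdilog b (y (TT k))) = (\<Prod>k=1..p. qdilog b (y' (TT k)))"
    by (intro prod.cong refl) (simp only: y)
  moreover have "(\<Sum>j\<in>J_index p. \<Sum>k\<in>J_index p. y j * of_real (J_Q p j k) * y k) = (\<Sum>j\<in>J_index p. \<Sum>k\<in>J_index p. y' j * of_real (J_Q p j k) * y' k)"
    by (intro sum.cong refl) (simp only: assms)
  moreover have "(\<Sum>k\<in>J_index p. y k * of_real (J_W p k)) = (\<Sum>k\<in>J_index p. y' k * of_real (J_W p k))"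
    by (intro sum.cong refl) (simp only: assms)
  ultimately show ?thesis unfolding J_integrand_def by (simp only: y)
qed

lemma J_contour_point_eq:
  assumes "b > 0" "T \<in> J_index p"
  shows "J_contour_point b \<beta> x T = J_point x (J_height b \<beta>) T"
  using assms by (auto simp: J_contour_point_def J_point_def J_height_def sqrt_hbar J_index_def Let_def)

lemma prod_J_index:
  fixes f :: "tet \<Rightarrow> 'a :: comm_monoid_mult"
  shows "prod f (J_index p) = f TU * (f TW * (\<Prod>k=1..p. f (TT k)))"
proof -
  have "J_index p = insert TU (insert TW (TT ` {1..p}))" by (auto simp: J_index_def)
  moreover have "prod f (TT ` {1..p}) = (\<Prod>k=1..p. f (TT k))"
    by (subst prod.reindex) (auto simp: inj_on_def)
  ultimately show ?thesis by (auto simp: image_iff)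
qed

text \<open>
  The variable of \<open>U\<close> carries the angles of both \<open>U\<close> and \<open>V\<close>, because \<open>t\<^sub>V = t\<^sub>U\<close>.
\<close>

definition J_slope :: "tet angles \<Rightarrow> tet \<Rightarrow> real" where
  "J_slope \<alpha> T = (if T = TU then ang_c \<alpha> TU + ang_c \<alpha> TV else ang_c \<alpha> T)"

text \<open>
  The left-hand side is the coefficient of \<open>x\<^sub>j\<close> in the real part of the exponent at \<open>x + i d\<close>: the
  cross term of \<open>2 \<pi> i y\<^sup>T Q\<^sub>n y\<close> is \<open>- 4 \<pi> x\<^sup>T Q\<^sub>n d\<close>.
\<close>

lemma J_slope_compatible:
  assumes b: "b > 0" and comp: "J_compatible p \<alpha>" and j: "j \<in> J_index p"
  shows "Qb b * J_W p j - 4 * pi * (\<Sum>k\<in>J_index p. J_Q p j k * J_height b \<alpha> k) = Qb b * J_slope \<alpha> j"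
proof -
  let ?h = "\<lambda>k. - 4 * pi * J_height b \<alpha> k"
  have hT: "?h (TT k) = Qb b * (2 * (pi - ang_a \<alpha> (TT k)))" for k by (simp add: J_height_def)
  have hU: "?h TU = - (Qb b * (2 * (pi - ang_a \<alpha> TU)))" "?h TW = - (Qb b * (2 * (pi - ang_a \<alpha> TW)))" by (simp_all add: J_height_def)
  have s: "- 4 * pi * (\<Sum>k\<in>J_index p. J_Q p j k * J_height b \<alpha> k) = (\<Sum>k=1..p. J_Q p j (TT k) * ?h (TT k)) + (J_Q p j TU * ?h TU + J_Q p j TW * ?h TW)"
    unfolding sum_J_index by (simp add: algebra_simps sum_distrib_left)
  have s': "(\<Sum>k=1..p. J_Q p j (TT k) * ?h (TT k)) = Qb b * (2 * (\<Sum>k=1..p. J_Q p j (TT k) * (pi - ang_a \<alpha> (TT k))))"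
    unfolding hT sum_distrib_left by (intro sum.cong refl) (simp only: mult_ac)
  have main: "J_W p j + 2 * (\<Sum>k=1..p. J_Q p j (TT k) * (pi - ang_a \<alpha> (TT k))) - 2 * J_Q p j TU * (pi - ang_a \<alpha> TU) - 2 * J_Q p j TW * (pi - ang_a \<alpha> TW) = J_slope \<alpha> j"
  proof -
    consider k where "k \<in> {1..p}" "j = TT k" | "j = TU" | "j = TW" using j by (auto simp: J_index_def)
    then show ?thesis
    proof cases
      case 1
      then have "ang_c \<alpha> (TT k) = 2 * (\<Sum>j=1..p. real (min j k) * (pi - ang_a \<alpha> (TT j))) + 2 * real k * (pi - ang_a \<alpha> TU) + J_W p (TT k)"
        using comp unfolding J_compatible_def by blast
      then show ?thesis using 1 by (simp add: J_slope_def min.commute)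
    next
      case 2
      have "ang_c \<alpha> TU + ang_c \<alpha> TV = - 2 * (\<Sum>j=1..p. real j * (pi - ang_a \<alpha> (TT j))) - 2 * real p * (pi - ang_a \<alpha> TU) - (pi - ang_a \<alpha> TW) + J_W p TU"
        using comp unfolding J_compatible_def by blast
      then show ?thesis using 2 by (simp add: J_slope_def sum_negf)
    next
      case 3
      have "ang_c \<alpha> TW = - (pi - ang_a \<alpha> TU) + J_W p TW" using comp unfolding J_compatible_def by blast
      then show ?thesis using 3 by (simp add: J_slope_def)
    qed
  qed
  have "Qb b * J_W p j - 4 * pi * (\<Sum>k\<in>J_index p. J_Q p j k * J_height b \<alpha> k) =
    Qb b * (J_W p j + 2 * (\<Sum>k=1..p. J_Q p j (TT k) * (pi - ang_a \<alpha> (TT k))) - 2 * J_Q p j TU * (pi - ang_a \<alpha> TU) - 2 * J_Q p j TW * (pi - ang_a \<alpha> TW))"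
    using s unfolding s' hU by (simp add: algebra_simps)
  then show ?thesis unfolding main .
qed

lemma J_exponent:
  assumes b: "b > 0" and comp: "J_compatible p \<alpha>"
  defines "d \<equiv> J_height b \<alpha>"
  shows "2 * \<i> * of_real pi * (\<Sum>j\<in>J_index p. \<Sum>k\<in>J_index p. J_point x d j * of_real (J_Q p j k) * J_point x d k)
      + of_real (1 / sqrt (hbar b)) * (\<Sum>k\<in>J_index p. J_point x d k * of_real (J_W p k)) =
    \<i> * of_real (Qb b * (\<Sum>k\<in>J_index p. d k * J_W p k) - 2 * pi * J_quad p d) + 2 * of_real pi * \<i> * of_real (J_quad p x)
      + of_real (Qb b * (\<Sum>j\<in>J_index p. x j * J_slope \<alpha> j))"
proof -
  let ?J = "J_index p"
  define m where "m = (\<Sum>j\<in>?J. \<Sum>k\<in>?J. x j * J_Q p j k * d k)"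
  have pt: "J_point x d j = of_real (x j) + \<i> * of_real (d j)" for j by (simp add: J_point_def complex_eq_iff)
  have m': "(\<Sum>j\<in>?J. \<Sum>k\<in>?J. d j * J_Q p j k * x k) = m"
    unfolding m_def by (subst sum.swap) (intro sum.cong refl, simp add: J_Q_sym mult_ac)
  have "(\<Sum>j\<in>?J. \<Sum>k\<in>?J. J_point x d j * of_real (J_Q p j k) * J_point x d k) =
      of_real (J_quad p x) - of_real (J_quad p d) + \<i> * (of_real m + of_real (\<Sum>j\<in>?J. \<Sum>k\<in>?J. d j * J_Q p j k * x k))"
    unfolding J_quad_def m_def of_real_sum sum_distrib_left sum.distrib[symmetric] sum_subtractf[symmetric]
    by (intro sum.cong refl) (simp add: pt algebra_simps)
  then have 1: "(\<Sum>j\<in>?J. \<Sum>k\<in>?J. J_point x d j * of_real (J_Q p j k) * J_point x d k) =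
      of_real (J_quad p x) - of_real (J_quad p d) + 2 * \<i> * of_real m" unfolding m' by simp
  have 2: "(\<Sum>k\<in>?J. J_point x d k * of_real (J_W p k)) = of_real (\<Sum>k\<in>?J. x k * J_W p k) + \<i> * of_real (\<Sum>k\<in>?J. d k * J_W p k)"
    unfolding of_real_sum sum_distrib_left sum.distrib[symmetric] by (intro sum.cong refl) (simp add: pt algebra_simps)
  have 3: "Qb b * (\<Sum>k\<in>?J. x k * J_W p k) - 4 * pi * m = Qb b * (\<Sum>j\<in>?J. x j * J_slope \<alpha> j)"
  proof -
    have "Qb b * (\<Sum>k\<in>?J. x k * J_W p k) - 4 * pi * m = (\<Sum>j\<in>?J. x j * (Qb b * J_W p j - 4 * pi * (\<Sum>k\<in>?J. J_Q p j k * d k)))"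
      unfolding m_def sum_distrib_left sum_subtractf[symmetric] right_diff_distrib by (intro sum.cong refl) (simp add: sum_distrib_left mult_ac)
    also have "\<dots> = (\<Sum>j\<in>?J. x j * (Qb b * J_slope \<alpha> j))"
      unfolding d_def by (intro sum.cong refl) (simp only: J_slope_compatible[OF b comp])
    finally show ?thesis by (simp only: sum_distrib_left mult_ac)
  qed
  have sq: "1 / sqrt (hbar b) = Qb b" using b by (simp add: sqrt_hbar)
  show ?thesis unfolding 1 2 3[symmetric] sq by (simp add: complex_eq_iff algebra_simps)
qed

text \<open>
  Where \<^const>\<open>J_compatible\<close> holds, the integrand of \<open>J\<close> on the contour and the one of the partition
  function differ by a constant of modulus \<open>1\<close>. As \<open>a\<^sub>U = a\<^sub>V\<close>, the dilogarithms of \<open>U\<close> and \<open>V\<close> coincide and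
  form the square.
\<close>

lemma J_integrand_contour:
  assumes b: "b > 0" and comp: "J_compatible p \<alpha>" and UV: "ang_a \<alpha> TU = ang_a \<alpha> TV"
  defines "d \<equiv> J_height b \<alpha>"
  shows "J_integrand b p (J_point x d) = exp (\<i> * of_real (Qb b * (\<Sum>k\<in>J_index p. d k * J_W p k) - 2 * pi * J_quad p d)) * J_factor b p \<alpha> x"
proof -
  have tf: "tet_factor b (twist_sign T) (ang_a \<alpha> T) (ang_c \<alpha> T) t = of_real (exp (Qb b * (t * ang_c \<alpha> T))) / qdilog b (Complex t (d T)) powi twist_sign T" for T t
    unfolding tet_factor_alt[OF b] d_def J_height_def by (simp add: mult_ac)
  have dV: "d TV = d TU" by (simp add: d_def J_height_def UV)
  have "exp (of_real (Qb b * (\<Sum>j\<in>J_index p. x j * J_slope \<alpha> j))) * (qdilog b (J_point x d TU) ^ 2 * qdilog b (J_point x d TW) / (\<Prod>k=1..p. qdilog b (J_point x d (TT k)))) =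
     tet_factor b (twist_sign TV) (ang_a \<alpha> TV) (ang_c \<alpha> TV) (x TU) *
      (\<Prod>T\<in>J_index p. tet_factor b (twist_sign T) (ang_a \<alpha> T) (ang_c \<alpha> T) (x T))"
  proof -
    have "Qb b * (\<Sum>j\<in>J_index p. x j * J_slope \<alpha> j) = Qb b * (x TU * ang_c \<alpha> TV) + (Qb b * (x TU * ang_c \<alpha> TU) + (Qb b * (x TW * ang_c \<alpha> TW) + (\<Sum>k=1..p. Qb b * (x (TT k) * ang_c \<alpha> (TT k)))))"
      unfolding sum_J_index by (simp add: J_slope_def sum_distrib_left algebra_simps)
    then have "exp (complex_of_real (Qb b * (\<Sum>j\<in>J_index p. x j * J_slope \<alpha> j))) =
        of_real (exp (Qb b * (x TU * ang_c \<alpha> TV))) * (of_real (exp (Qb b * (x TU * ang_c \<alpha> TU))) * (of_real (exp (Qb b * (x TW * ang_c \<alpha> TW))) * (\<Prod>k=1..p. of_real (exp (Qb b * (x (TT k) * ang_c \<alpha> (TT k)))))))"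
      by (simp only: exp_of_real exp_add exp_sum[OF finite_atLeastAtMost] of_real_mult of_real_prod)
    then show ?thesis
      unfolding prod_J_index tf dV J_point_def
      by (simp add: prod_dividef power2_eq_square power_int_minus field_simps)
  qed
  then show ?thesis
    unfolding J_integrand_def J_factor_def d_def J_exponent[OF b comp, folded d_def, unfolded d_def] exp_add
    by (simp only: mult.assoc)
qed

section \<open>Independence of the contour\<close>

lemma PiM_translate_integral:
  fixes f :: "('i \<Rightarrow> real) \<Rightarrow> complex"
  assumes I: "finite I" and f: "f \<in> borel_measurable (lborel_prod I)"
    and cong: "\<And>w w'. (\<And>i. i \<in> I \<Longrightarrow> w i = w' i) \<Longrightarrow> f w = f w'"
  shows "(\<integral>x. f (\<lambda>i. x i + u i) \<partial>lborel_prod I) = (\<integral>x. f x \<partial>lborel_prod I)"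
proof -
  interpret finite_product_sigma_finite "\<lambda>_ :: 'i. lborel :: real measure" I by standard fact
  let ?M = "lborel_prod I" and ?T = "\<lambda>x. \<lambda>i\<in>I. x i + u i"
  have T: "?T \<in> measurable ?M ?M"
  proof (rule measurable_restrict)
    fix i assume "i \<in> I"
    then have [measurable]: "(\<lambda>x. x i) \<in> borel_measurable ?M" by (rule measurable_coord)
    show "(\<lambda>x. x i + u i) \<in> measurable ?M lborel" by simp
  qed
  have "distr ?M ?M ?T = ?M"
  proof (rule PiM_eqI)
    fix A :: "'i \<Rightarrow> real set" assume A: "\<And>i. i \<in> I \<Longrightarrow> A i \<in> sets lborel"
    have "emeasure (distr ?M ?M ?T) (Pi\<^sub>E I A) = emeasure ?M (?T -` Pi\<^sub>E I A \<inter> space ?M)"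
      using T A I by (intro emeasure_distr sets_PiM_I_finite) auto
    also have "?T -` Pi\<^sub>E I A \<inter> space ?M = Pi\<^sub>E I (\<lambda>i. (\<lambda>y. y + u i) -` A i)"
      by (auto simp: space_PiM PiE_iff)
    also have "emeasure ?M \<dots> = (\<Prod>i\<in>I. emeasure lborel ((\<lambda>y. y + u i) -` A i))"
    proof (rule measure_times)
      fix i assume "i \<in> I"
      then have [measurable]: "A i \<in> sets borel" using A by simp
      have "(\<lambda>y. y + u i) -` A i \<inter> space borel \<in> sets borel" by (rule measurable_sets[of _ borel borel]) auto
      then show "(\<lambda>y. y + u i) -` A i \<in> sets lborel" by simp
    qed
    also have "\<dots> = (\<Prod>i\<in>I. emeasure lborel (A i))"
    proof (intro prod.cong refl)
      fix i assume "i \<in> I"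
      then have "A i \<in> sets borel" using A by simp
      then have "emeasure lborel (A i) = emeasure (distr lborel borel (\<lambda>y. u i + y)) (A i)"
        using lborel_distr_plus[of "u i"] by simp
      also have "\<dots> = emeasure lborel ((\<lambda>y. y + u i) -` A i)"
        using \<open>A i \<in> sets borel\<close> by (subst emeasure_distr) (simp_all add: add.commute[of _ "u i"])
      finally show "emeasure lborel ((\<lambda>y. y + u i) -` A i) = emeasure lborel (A i)" by simp
    qed
    finally show "emeasure (distr ?M ?M ?T) (Pi\<^sub>E I A) = (\<Prod>i\<in>I. emeasure lborel (A i))" .
  qed (use I in auto)
  then have "(\<integral>x. f x \<partial>?M) = (\<integral>x. f x \<partial>distr ?M ?M ?T)" by simp
  also have "\<dots> = (\<integral>x. f (?T x) \<partial>?M)" by (rule integral_distr[OF T f])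
  also have "\<dots> = (\<integral>x. f (\<lambda>i. x i + u i) \<partial>?M)" by (intro Bochner_Integration.integral_cong refl cong) simp
  finally show ?thesis by simp
qed

text \<open>
  The third condition bounds \<open>b\<^sub>T\<close> from below by \<open>\<delta>\<close> if the three angles add up to \<open>\<pi>\<close>.
\<close>

definition angle_margin :: "nat \<Rightarrow> real \<Rightarrow> tet angles \<Rightarrow> bool" where
  "angle_margin p \<delta> \<alpha> \<longleftrightarrow> (\<forall>T\<in>Y_tets p - {TZ}. \<delta> \<le> ang_a \<alpha> T \<and> \<delta> \<le> ang_c \<alpha> T \<and> ang_a \<alpha> T + ang_c \<alpha> T \<le> pi - \<delta>)"

lemma J_tets: "J_index p \<subseteq> Y_tets p - {TZ}" "TV \<in> Y_tets p - {TZ}" "TU \<in> J_index p"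
  by (auto simp: Y_tets_def J_index_def)

text \<open>
  A single dominating function for all angle assignments with the same margin. The factor of \<open>V\<close>
  shares its variable with \<open>U\<close> and needs only be bounded.
\<close>

lemma J_factor_bound:
  assumes b: "b > 0" and \<delta>: "\<delta> > 0"
  obtains C where "C \<ge> 0"
    "\<And>\<alpha> x. angle_margin p \<delta> \<alpha> \<Longrightarrow> norm (J_factor b p \<alpha> x) \<le> C * (\<Prod>T\<in>J_index p. C * exp (- (\<delta> * Qb b) * \<bar>x T\<bar>))"
proof -
  obtain C1 where C1: "C1 \<ge> 0" "\<And>a c t. \<delta> \<le> a \<Longrightarrow> \<delta> \<le> c \<Longrightarrow> a + c \<le> pi - \<delta> \<Longrightarrow> norm (tet_factor b 1 a c t) \<le> C1 * exp (- (\<delta> * Qb b) * \<bar>t\<bar>)"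
    using tet_factor_bound[OF b \<delta>, of 1] by blast
  obtain C2 where C2: "C2 \<ge> 0" "\<And>a c t. \<delta> \<le> a \<Longrightarrow> \<delta> \<le> c \<Longrightarrow> a + c \<le> pi - \<delta> \<Longrightarrow> norm (tet_factor b (-1) a c t) \<le> C2 * exp (- (\<delta> * Qb b) * \<bar>t\<bar>)"
    using tet_factor_bound[OF b \<delta>, of "-1"] by blast
  define C where "C = max C1 C2"
  have C0: "C \<ge> 0" using C1(1) by (simp add: C_def)
  have C: "norm (tet_factor b (twist_sign T) a c t) \<le> C * exp (- (\<delta> * Qb b) * \<bar>t\<bar>)"
    if "\<delta> \<le> a" "\<delta> \<le> c" "a + c \<le> pi - \<delta>" for T a c t
  proof -
    have m: "C1 * exp (- (\<delta> * Qb b) * \<bar>t\<bar>) \<le> C * exp (- (\<delta> * Qb b) * \<bar>t\<bar>)" "C2 * exp (- (\<delta> * Qb b) * \<bar>t\<bar>) \<le> C * exp (- (\<delta> * Qb b) * \<bar>t\<bar>)"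
      unfolding C_def by (rule mult_right_mono[OF max.cobounded1 exp_ge_zero], rule mult_right_mono[OF max.cobounded2 exp_ge_zero])
    consider "twist_sign T = 1" | "twist_sign T = -1" using twist_sign_cases[of T] by blast
    then show ?thesis
    proof cases
      case 1 then show ?thesis using order_trans[OF C1(2)[OF that] m(1)] by simp
    next
      case 2 then show ?thesis using order_trans[OF C2(2)[OF that] m(2)] by simp
    qed
  qed
  show ?thesis
  proof (rule that[OF C0])
    fix \<alpha> x assume m: "angle_margin p \<delta> \<alpha>"
    have V: "norm (tet_factor b (twist_sign TV) (ang_a \<alpha> TV) (ang_c \<alpha> TV) (x TU)) \<le> C"
    proof -
      have "norm (tet_factor b (twist_sign TV) (ang_a \<alpha> TV) (ang_c \<alpha> TV) (x TU)) \<le> C * exp (- (\<delta> * Qb b) * \<bar>x TU\<bar>)"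
        by (rule C) (use m J_tets in \<open>auto simp: angle_margin_def\<close>)
      also have "\<dots> \<le> C * 1" using C0 \<delta> Qb_pos[OF b] by (intro mult_left_mono) auto
      finally show ?thesis by simp
    qed
    have J: "norm (tet_factor b (twist_sign T) (ang_a \<alpha> T) (ang_c \<alpha> T) (x T)) \<le> C * exp (- (\<delta> * Qb b) * \<bar>x T\<bar>)" if "T \<in> J_index p" for T
      by (rule C) (use m J_tets that in \<open>auto simp: angle_margin_def\<close>)
    show "norm (J_factor b p \<alpha> x) \<le> C * (\<Prod>T\<in>J_index p. C * exp (- (\<delta> * Qb b) * \<bar>x T\<bar>))"
      unfolding J_factor_def norm_mult norm_exp_2pi prod_norm[symmetric] mult_1
      by (intro mult_mono prod_mono V C0 prod_nonneg conjI J) auto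
  qed
qed

definition mix_angles :: "real \<Rightarrow> tet angles \<Rightarrow> tet angles \<Rightarrow> tet angles" where
  "mix_angles y \<alpha> \<beta> T = ((1 - y) * ang_a \<alpha> T + y * ang_a \<beta> T, (1 - y) * ang_b \<alpha> T + y * ang_b \<beta> T, (1 - y) * ang_c \<alpha> T + y * ang_c \<beta> T)"

lemma ang_mix:
  "ang_a (mix_angles y \<alpha> \<beta>) T = (1 - y) * ang_a \<alpha> T + y * ang_a \<beta> T"
  "ang_c (mix_angles y \<alpha> \<beta>) T = (1 - y) * ang_c \<alpha> T + y * ang_c \<beta> T"
  by (simp_all add: ang_a_def ang_c_def mix_angles_def)

lemma J_height_mix: "J_height b (mix_angles y \<alpha> \<beta>) T = J_height b \<alpha> T + y * (J_height b \<beta> T - J_height b \<alpha> T)"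
proof -
  have "- s * ((pi - ((1 - y) * u + y * v)) * q / (2 * pi)) = - s * ((pi - u) * q / (2 * pi)) + y * (- s * ((pi - v) * q / (2 * pi)) - (- s * ((pi - u) * q / (2 * pi))))"
    for s u v q :: real by (simp add: field_simps)
  then show ?thesis unfolding J_height_def ang_mix .
qed

text \<open>
  The relations are affine in the angles.
\<close>

lemma J_compatible_mix:
  assumes "J_compatible p \<alpha>" "J_compatible p \<beta>"
  shows "J_compatible p (mix_angles y \<alpha> \<beta>)"
proof -
  let ?m = "mix_angles y \<alpha> \<beta>"
  have lin: "(\<Sum>j=1..p. r j * (pi - ang_a ?m (TT j))) = (1 - y) * (\<Sum>j=1..p. r j * (pi - ang_a \<alpha> (TT j))) + y * (\<Sum>j=1..p. r j * (pi - ang_a \<beta> (TT j)))" for r :: "nat \<Rightarrow> real"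
    unfolding sum_distrib_left sum.distrib[symmetric] ang_mix by (intro sum.cong refl) (simp add: algebra_simps)
  show ?thesis
    unfolding J_compatible_def lin
  proof (intro conjI ballI)
    fix k assume k: "k \<in> {1..p}"
    from k assms have "ang_c \<alpha> (TT k) = 2 * (\<Sum>j=1..p. real (min j k) * (pi - ang_a \<alpha> (TT j))) + 2 * real k * (pi - ang_a \<alpha> TU) + J_W p (TT k)"
      "ang_c \<beta> (TT k) = 2 * (\<Sum>j=1..p. real (min j k) * (pi - ang_a \<beta> (TT j))) + 2 * real k * (pi - ang_a \<beta> TU) + J_W p (TT k)"
      unfolding J_compatible_def by blast+
    then show "ang_c ?m (TT k) = 2 * ((1 - y) * (\<Sum>j=1..p. real (min j k) * (pi - ang_a \<alpha> (TT j))) + y * (\<Sum>j=1..p. real (min j k) * (pi - ang_a \<beta> (TT j)))) +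
         2 * real k * (pi - ang_a ?m TU) + J_W p (TT k)"
      unfolding ang_mix by (simp only:) (simp add: algebra_simps del: J_W.simps)
  next
    from assms have "ang_c \<alpha> TU + ang_c \<alpha> TV = - 2 * (\<Sum>j=1..p. real j * (pi - ang_a \<alpha> (TT j))) - 2 * real p * (pi - ang_a \<alpha> TU) - (pi - ang_a \<alpha> TW) + J_W p TU"
      "ang_c \<beta> TU + ang_c \<beta> TV = - 2 * (\<Sum>j=1..p. real j * (pi - ang_a \<beta> (TT j))) - 2 * real p * (pi - ang_a \<beta> TU) - (pi - ang_a \<beta> TW) + J_W p TU"
      unfolding J_compatible_def by blast+
    moreover have "ang_c ?m TU + ang_c ?m TV = (1 - y) * (ang_c \<alpha> TU + ang_c \<alpha> TV) + y * (ang_c \<beta> TU + ang_c \<beta> TV)"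
      unfolding ang_mix by (simp add: algebra_simps)
    ultimately show "ang_c ?m TU + ang_c ?m TV = - 2 * ((1 - y) * (\<Sum>j=1..p. real j * (pi - ang_a \<alpha> (TT j))) + y * (\<Sum>j=1..p. real j * (pi - ang_a \<beta> (TT j)))) -
         2 * real p * (pi - ang_a ?m TU) - (pi - ang_a ?m TW) + J_W p TU"
      unfolding ang_mix by (simp only:) (simp add: algebra_simps del: J_W.simps)
  next
    from assms have "ang_c \<alpha> TW = - (pi - ang_a \<alpha> TU) + J_W p TW" "ang_c \<beta> TW = - (pi - ang_a \<beta> TU) + J_W p TW"
      unfolding J_compatible_def by blast+
    then show "ang_c ?m TW = - (pi - ang_a ?m TU) + J_W p TW"
      unfolding ang_mix by (simp only:) (simp add: algebra_simps del: J_W.simps)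
  qed
qed

lemma angle_margin_mix:
  assumes "angle_margin p \<delta> \<alpha>" "angle_margin p \<delta> \<beta>" "y \<in> {0..1}"
  shows "angle_margin p \<delta> (mix_angles y \<alpha> \<beta>)"
proof -
  have ge: "r \<le> (1 - y) * u + y * v" if "r \<le> u" "r \<le> v" for r u v :: real
    using convex_bound_le[of "- u" "- r" "- v" "1 - y" y] that assms(3) by simp
  have le: "(1 - y) * u + y * v \<le> r" if "u \<le> r" "v \<le> r" for r u v :: real
    using convex_bound_le[of u r v "1 - y" y] that assms(3) by simp
  show ?thesis unfolding angle_margin_def ang_mix
  proof (intro ballI conjI)
    fix T assume T: "T \<in> Y_tets p - {TZ}"
    note A = assms(1)[unfolded angle_margin_def, rule_format, OF T] and B = assms(2)[unfolded angle_margin_def, rule_format, OF T]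
    show "\<delta> \<le> (1 - y) * ang_a \<alpha> T + y * ang_a \<beta> T" "\<delta> \<le> (1 - y) * ang_c \<alpha> T + y * ang_c \<beta> T" using A B by (auto intro: ge)
    have "(1 - y) * (ang_a \<alpha> T + ang_c \<alpha> T) + y * (ang_a \<beta> T + ang_c \<beta> T) \<le> pi - \<delta>" using A B by (intro le) auto
    then show "(1 - y) * ang_a \<alpha> T + y * ang_a \<beta> T + ((1 - y) * ang_c \<alpha> T + y * ang_c \<beta> T) \<le> pi - \<delta>" by (simp add: algebra_simps)
  qed
qed

lemma open_triples_angles:
  assumes "\<alpha> T \<in> open_triples"
  shows "0 < ang_a \<alpha> T" "0 < ang_b \<alpha> T" "0 < ang_c \<alpha> T" "ang_a \<alpha> T + ang_b \<alpha> T + ang_c \<alpha> T = pi"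
    "ang_a \<alpha> T + ang_c \<alpha> T < pi" "ang_a \<alpha> T < pi"
proof -
  obtain a b c where "\<alpha> T = (a, b, c)" by (cases "\<alpha> T")
  with assms show "0 < ang_a \<alpha> T" "0 < ang_b \<alpha> T" "0 < ang_c \<alpha> T" "ang_a \<alpha> T + ang_b \<alpha> T + ang_c \<alpha> T = pi"
    "ang_a \<alpha> T + ang_c \<alpha> T < pi" "ang_a \<alpha> T < pi"
    by (auto simp: open_triples_def ang_a_def ang_b_def ang_c_def)
qed

lemma exists_angle_margin:
  assumes "\<And>T. T \<in> Y_tets p - {TZ} \<Longrightarrow> \<alpha> T \<in> open_triples"
  obtains \<delta> where "\<delta> > 0" "\<And>\<delta>'. \<delta>' \<le> \<delta> \<Longrightarrow> angle_margin p \<delta>' \<alpha>"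
proof -
  let ?S = "(\<lambda>T. min (ang_a \<alpha> T) (min (ang_c \<alpha> T) (pi - ang_a \<alpha> T - ang_c \<alpha> T))) ` (Y_tets p - {TZ})"
  have S: "finite ?S" "?S \<noteq> {}" using J_tets(2)[of p] by (simp, blast)
  have pos: "0 < r" if r: "r \<in> ?S" for r
  proof -
    obtain T where T: "T \<in> Y_tets p - {TZ}" "r = min (ang_a \<alpha> T) (min (ang_c \<alpha> T) (pi - ang_a \<alpha> T - ang_c \<alpha> T))"
      using r by blast
    then show ?thesis using open_triples_angles[of \<alpha>, OF assms[OF T(1)]] by simp
  qed
  show ?thesis
  proof (rule that[of "Min ?S"])
    show "0 < Min ?S" using Min_in[OF S] pos by blast
    fix \<delta>' assume d: "\<delta>' \<le> Min ?S"
    show "angle_margin p \<delta>' \<alpha>" unfolding angle_margin_def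
    proof
      fix T assume "T \<in> Y_tets p - {TZ}"
      then have "Min ?S \<le> min (ang_a \<alpha> T) (min (ang_c \<alpha> T) (pi - ang_a \<alpha> T - ang_c \<alpha> T))"
        by (intro Min_le S imageI)
      then show "\<delta>' \<le> ang_a \<alpha> T \<and> \<delta>' \<le> ang_c \<alpha> T \<and> ang_a \<alpha> T + ang_c \<alpha> T \<le> pi - \<delta>'" using d by auto
    qed
  qed
qed

definition J_integrand_of :: "(complex \<Rightarrow> complex) \<Rightarrow> real \<Rightarrow> nat \<Rightarrow> (tet \<Rightarrow> complex) \<Rightarrow> complex" where
  "J_integrand_of \<Phi> b p y =
     exp (2 * \<i> * of_real pi * (\<Sum>j\<in>J_index p. \<Sum>k\<in>J_index p. y j * of_real (J_Q p j k) * y k)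
          + of_real (1 / sqrt (hbar b)) * (\<Sum>k\<in>J_index p. y k * of_real (J_W p k))) *
     (\<Phi> (y TU) ^ 2 * \<Phi> (y TW) / (\<Prod>k=1..p. \<Phi> (y (TT k))))"

text \<open>
  The quantum dilogarithm is controlled only in its strip, and its restriction by zero
  is a Borel function on the whole plane.
\<close>

definition qdilog_cut :: "real \<Rightarrow> complex \<Rightarrow> complex" where
  "qdilog_cut b z = indicator {z. \<bar>Im z\<bar> < Qb b / 2} z *\<^sub>R qdilog b z"

lemma qdilog_cut_measurable: "b > 0 \<Longrightarrow> qdilog_cut b \<in> borel_measurable borel"
  unfolding qdilog_cut_def
  by (intro borel_measurable_continuous_on_indicator holomorphic_on_imp_continuous_on qdilog_holomorphic)
     (auto intro!: borel_open open_Collect_less continuous_intros)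

lemma J_integrand_cut:
  assumes "\<And>T. T \<in> J_index p \<Longrightarrow> \<bar>Im (y T)\<bar> < Qb b / 2"
  shows "J_integrand b p y = J_integrand_of (qdilog_cut b) b p y"
proof -
  have e: "qdilog_cut b (y T) = qdilog b (y T)" if "T \<in> J_index p" for T
    using assms[OF that] by (simp add: qdilog_cut_def)
  have m: "TU \<in> J_index p" "TW \<in> J_index p" "\<And>k. k \<in> {1..p} \<Longrightarrow> TT k \<in> J_index p" by (auto simp: J_index_def)
  have "(\<Prod>k=1..p. qdilog_cut b (y (TT k))) = (\<Prod>k=1..p. qdilog b (y (TT k)))"
    by (intro prod.cong refl e m)
  then show ?thesis unfolding J_integrand_def J_integrand_of_def by (simp only: e m)
qed

lemma J_integrand_of_measurable:
  assumes \<Phi>: "\<Phi> \<in> borel_measurable borel" and Y: "\<And>T. T \<in> J_index p \<Longrightarrow> Y T \<in> borel_measurable N"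
  shows "(\<lambda>\<omega>. J_integrand_of \<Phi> b p (\<lambda>T. Y T \<omega>)) \<in> borel_measurable N"
proof -
  have m: "TU \<in> J_index p" "TW \<in> J_index p" "\<And>k. k \<in> {1..p} \<Longrightarrow> TT k \<in> J_index p" by (auto simp: J_index_def)
  show ?thesis unfolding J_integrand_of_def
    by (intro borel_measurable_times borel_measurable_divide borel_measurable_prod borel_measurable_power borel_measurable_add borel_measurable_sum
        measurable_compose[OF _ borel_measurable_exp] measurable_compose[OF Y \<Phi>] Y m borel_measurable_const)
qed

text \<open>
  Along the segment from \<open>\<alpha>\<close> to \<open>\<beta>\<close> the heights of the contour move in a fixed direction \<open>v\<close>. With the
  variables \<open>y\<^sub>T = t\<^sub>T + \<zeta> v\<^sub>T + i d\<^sub>T\<close> the contour of \<open>\<alpha>\<close> is at \<open>\<zeta> = 0\<close> and that of \<open>\<beta>\<close> at \<open>\<zeta> = i\<close>, and a real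
  increment of \<open>\<zeta>\<close> is a translation of \<open>t\<close>. Since the mixed angles satisfy the same linear relations,
  the integrand is dominated uniformly, and \<open>integral_shift_square\<close> applies.
\<close>

theorem J_contour_integral_independent:
  assumes b: "b > 0" and n: "p = twist_p n"
    and \<alpha>: "\<alpha> \<in> angle_structures (twist_X n)" "ang_a \<alpha> TU = ang_a \<alpha> TV"
    and \<beta>: "\<beta> \<in> angle_structures (twist_X n)" "ang_a \<beta> TU = ang_a \<beta> TV"
  shows "J_contour_integral b n \<alpha> = J_contour_integral b n \<beta>"
proof -
  let ?M = "lborel_prod (J_index p)"
  have ot: "\<gamma> T \<in> open_triples" if "\<gamma> \<in> angle_structures (twist_X n)" "T \<in> Y_tets p - {TZ}" for \<gamma> T
    using that by (auto simp: angle_structures_def shape_structures_def tets_twist_X n)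
  have comp: "J_compatible p \<gamma>" if g: "\<gamma> \<in> angle_structures (twist_X n)" "ang_a \<gamma> TU = ang_a \<gamma> TV" for \<gamma>
  proof (rule balanced_imp_J_compatible[OF _ _ g(2)])
    show "balanced_X p \<gamma>" using g(1) angle_structures_twist_X[OF n] by blast
    show "tet_angles_sum p \<gamma>"
      using open_triples_angles(4)[of \<gamma>, OF ot[OF g(1)]] by (simp add: tet_angles_sum_def)
  qed
  obtain \<delta>1 where \<delta>1: "\<delta>1 > 0" "\<And>\<delta>'. \<delta>' \<le> \<delta>1 \<Longrightarrow> angle_margin p \<delta>' \<alpha>" using exists_angle_margin[of p \<alpha>] ot[OF \<alpha>(1)] by blast
  obtain \<delta>2 where \<delta>2: "\<delta>2 > 0" "\<And>\<delta>'. \<delta>' \<le> \<delta>2 \<Longrightarrow> angle_margin p \<delta>' \<beta>" using exists_angle_margin[of p \<beta>] ot[OF \<beta>(1)] by blast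
  define \<delta> where "\<delta> = min \<delta>1 \<delta>2"
  have \<delta>: "\<delta> > 0" "angle_margin p \<delta> \<alpha>" "angle_margin p \<delta> \<beta>" using \<delta>1 \<delta>2 by (auto simp: \<delta>_def)
  define m where "m = (\<lambda>y. mix_angles y \<alpha> \<beta>)"
  have mix: "angle_margin p \<delta> (m y)" "J_compatible p (m y)" "ang_a (m y) TU = ang_a (m y) TV" if "y \<in> {0..1}" for y
    using angle_margin_mix[OF \<delta>(2,3) that] J_compatible_mix[OF comp[OF \<alpha>] comp[OF \<beta>]] \<alpha>(2) \<beta>(2) by (auto simp: m_def ang_mix)
  define D where "D = J_height b \<alpha>"
  define v where "v = (\<lambda>T. J_height b \<beta> T - J_height b \<alpha> T)"
  have Dv: "J_height b (m y) = (\<lambda>T. D T + y * v T)" for y by (simp add: m_def J_height_mix D_def v_def fun_eq_iff)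
  have strip: "\<bar>D T + y * v T\<bar> < Qb b / 2" if "y \<in> {0..1}" "T \<in> J_index p" for y T
  proof -
    have "\<delta> \<le> ang_a (m y) T" "ang_a (m y) T + ang_c (m y) T \<le> pi - \<delta>" "\<delta> \<le> ang_c (m y) T"
      using mix(1)[OF that(1)] that(2) J_tets by (auto simp: angle_margin_def)
    then have "\<bar>J_height b (m y) T\<bar> < Qb b / 2"
      unfolding J_height_def using \<delta>(1) pi_gt_zero by (intro strip_height b twist_sign_cases) linarith+
    then show ?thesis unfolding Dv .
  qed
  define Y where "Y = (\<lambda>(t :: tet \<Rightarrow> real) \<zeta> T. of_real (t T) + \<zeta> * of_real (v T) + \<i> * of_real (D T))"
  define F where "F = (\<lambda>t \<zeta>. J_integrand b p (Y t \<zeta>))"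
  have YP: "Y t (Complex x y) = J_point (\<lambda>T. t T + x * v T) (\<lambda>T. D T + y * v T)" for t x y
    by (simp add: Y_def J_point_def fun_eq_iff complex_eq_iff)
  define S where "S = (\<Inter>T\<in>J_index p. {\<zeta>. \<bar>D T + Im \<zeta> * v T\<bar> < Qb b / 2})"
  have memJ: "TU \<in> J_index p" "TW \<in> J_index p" "\<And>k. k \<in> {1..p} \<Longrightarrow> TT k \<in> J_index p" by (auto simp: J_index_def)
  obtain C where C: "C \<ge> 0" "\<And>\<gamma> x. angle_margin p \<delta> \<gamma> \<Longrightarrow> norm (J_factor b p \<gamma> x) \<le> C * (\<Prod>T\<in>J_index p. C * exp (- (\<delta> * Qb b) * \<bar>x T\<bar>))"
    using J_factor_bound[OF b \<delta>(1)] by blast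
  \<comment> \<open>The additional factors allow for a translation of \<open>t\<close> by at most \<open>v\<close>.\<close>
  define B where "B = (\<lambda>t :: tet \<Rightarrow> real. C * (\<Prod>T\<in>J_index p. C * exp (\<delta> * Qb b * \<bar>v T\<bar>) * exp (- (\<delta> * Qb b) * \<bar>t T\<bar>)))"
  interpret product_sigma_finite "\<lambda>_ :: tet. lborel :: real measure" by (rule product_sigma_finite_lborel)
  interpret finite_product_sigma_finite "\<lambda>_ :: tet. lborel :: real measure" "J_index p" by standard simp
  have cq: "\<delta> * Qb b > 0" using \<delta>(1) Qb_pos[OF b] by simp
  have Fcut: "F t (Complex x y) = J_integrand_of (qdilog_cut b) b p (Y t (Complex x y))" if "y \<in> {0..1}" for t x y
    unfolding F_def by (rule J_integrand_cut) (use strip[OF that] in \<open>simp add: YP J_point_def\<close>)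
  have cutm: "(\<lambda>\<omega>. J_integrand_of (qdilog_cut b) b p (\<lambda>T. Y' T \<omega>)) \<in> borel_measurable N"
    if "\<And>T. T \<in> J_index p \<Longrightarrow> Y' T \<in> borel_measurable N" for Y' :: "tet \<Rightarrow> 'x \<Rightarrow> complex" and N
    using J_integrand_of_measurable[OF qdilog_cut_measurable[OF b] that] .
  have Fm: "(\<lambda>t. F t (Complex x y)) \<in> borel_measurable ?M" if "y \<in> {0..1}" for x y
    unfolding Fcut[OF that]
  proof (rule cutm)
    fix T assume "T \<in> J_index p"
    then have [measurable]: "(\<lambda>t. t T) \<in> borel_measurable ?M" by (rule measurable_coord)
    show "(\<lambda>t. Y t (Complex x y) T) \<in> borel_measurable ?M" unfolding Y_def by measurable
  qed
  have Fcong: "F w \<zeta> = F w' \<zeta>" if "\<And>T. T \<in> J_index p \<Longrightarrow> w T = w' T" for w w' \<zeta>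
    unfolding F_def by (rule J_integrand_cong) (simp add: Y_def that)
  have shift: "(\<integral>t. F t 0 \<partial>?M) = (\<integral>t. F t \<i> \<partial>?M)"
  proof (rule integral_shift_square[where S = S and B = B])
    show "sigma_finite_measure ?M" by (rule sigma_finite_measure_axioms)
    show "open S" unfolding S_def by (intro open_INT finite_Y ballI open_Collect_less continuous_intros)
    show "convex S" unfolding S_def
    proof (rule convex_INT)
      fix T
      have eq: "{\<zeta>. \<bar>D T + Im \<zeta> * v T\<bar> < Qb b / 2} = (\<lambda>\<zeta>. Im \<zeta> * v T) -` {- (Qb b / 2) - D T<..<Qb b / 2 - D T}"
        by (intro set_eqI, simp only: mem_Collect_eq vimage_eq greaterThanLessThan_iff abs_less_iff) linarith
      show "convex {\<zeta>. \<bar>D T + Im \<zeta> * v T\<bar> < Qb b / 2}"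
        unfolding eq by (rule convex_linear_vimage) (auto intro: linearI simp: algebra_simps)
    qed
    show "Complex x y \<in> S" if "x \<in> {0..1}" "y \<in> {0..1}" for x y
      using strip[OF that(2)] by (simp add: S_def)
    show "F t holomorphic_on S" for t
    proof -
      have aff: "(\<lambda>\<zeta>. Y t \<zeta> T) holomorphic_on S" for T unfolding Y_def by (intro holomorphic_intros)
      have q: "(\<lambda>\<zeta>. qdilog b (Y t \<zeta> T)) holomorphic_on S" and nz: "\<And>\<zeta>. \<zeta> \<in> S \<Longrightarrow> qdilog b (Y t \<zeta> T) \<noteq> 0" if T: "T \<in> J_index p" for T
      proof -
        have im: "\<bar>Im (Y t \<zeta> T)\<bar> < Qb b / 2" if "\<zeta> \<in> S" for \<zeta> using that T by (auto simp: S_def Y_def add.commute)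
        have "(qdilog b \<circ> (\<lambda>\<zeta>. Y t \<zeta> T)) holomorphic_on S"
          by (rule holomorphic_on_compose[OF aff holomorphic_on_subset[OF qdilog_holomorphic[OF b]]]) (use im in auto)
        then show "(\<lambda>\<zeta>. qdilog b (Y t \<zeta> T)) holomorphic_on S" by (simp add: o_def)
        show "\<And>\<zeta>. \<zeta> \<in> S \<Longrightarrow> qdilog b (Y t \<zeta> T) \<noteq> 0" using im by (rule qdilog_nonzero[OF b])
      qed
      show ?thesis unfolding F_def J_integrand_def
        by (intro holomorphic_on_mult holomorphic_on_divide holomorphic_on_prod holomorphic_on_power holomorphic_on_exp' holomorphic_on_add
              holomorphic_on_sum holomorphic_on_const aff q memJ)
           (auto simp: nz memJ)
    qed
    show "(\<lambda>(t, x). indicator {0..1} x *\<^sub>R F t (w + of_real x * e)) \<in> borel_measurable (?M \<Otimes>\<^sub>M lborel)"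
      if we: "(w, e) \<in> {(0, 1), (\<i>, 1), (0, \<i>), (1, \<i>)}" for w e
    proof -
      have cut: "indicator {0..1} x *\<^sub>R F t (w + of_real x * e) = indicator {0..1} x *\<^sub>R J_integrand_of (qdilog_cut b) b p (Y t (w + of_real x * e))" for t and x :: real
      proof (cases "x \<in> {0..1}")
        case True
        have "w + of_real x * e = Complex (Re (w + of_real x * e)) (Im (w + of_real x * e))" by (simp only: complex.collapse)
        moreover have "Im (w + of_real x * e) \<in> {0..1}" using we True by auto
        ultimately show ?thesis using Fcut by metis
      qed simp
      have "(\<lambda>z. indicator {0..1} (snd z) *\<^sub>R J_integrand_of (qdilog_cut b) b p (Y (fst z) (w + of_real (snd z) * e))) \<in> borel_measurable (?M \<Otimes>\<^sub>M lborel)"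
      proof (intro borel_measurable_scaleR cutm)
        fix T assume "T \<in> J_index p"
        then have "(\<lambda>t. t T) \<in> borel_measurable ?M" by (rule measurable_coord)
        then have [measurable]: "(\<lambda>z. fst z T) \<in> borel_measurable (?M \<Otimes>\<^sub>M (lborel :: real measure))" by (rule measurable_compose[OF measurable_fst])
        show "(\<lambda>z. Y (fst z) (w + of_real (snd z) * e) T) \<in> borel_measurable (?M \<Otimes>\<^sub>M (lborel :: real measure))" unfolding Y_def by measurable
      qed measurable
      then show ?thesis unfolding case_prod_beta' cut .
    qed
    show "norm (F t (Complex x y)) \<le> B t" if "x \<in> {0..1}" "y \<in> {0..1}" for t x y
    proof -
      have "norm (F t (Complex x y)) = norm (J_factor b p (m y) (\<lambda>T. t T + x * v T))"
        unfolding F_def YP Dv[symmetric] J_integrand_contour[OF b mix(2,3)[OF that(2)]] by (simp only: norm_mult norm_exp_i_times mult_1)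
      also have "\<dots> \<le> C * (\<Prod>T\<in>J_index p. C * exp (- (\<delta> * Qb b) * \<bar>t T + x * v T\<bar>))" by (rule C(2)[OF mix(1)[OF that(2)]])
      also have "\<dots> \<le> B t" unfolding B_def
      proof (intro mult_left_mono prod_mono conjI C(1))
        fix T
        have "\<bar>x * v T\<bar> \<le> 1 * \<bar>v T\<bar>" unfolding abs_mult using that by (intro mult_right_mono) auto
        then have "\<bar>t T\<bar> - \<bar>v T\<bar> \<le> \<bar>t T + x * v T\<bar>" by linarith
        then have "(\<delta> * Qb b) * (\<bar>t T\<bar> - \<bar>v T\<bar>) \<le> (\<delta> * Qb b) * \<bar>t T + x * v T\<bar>" using cq by (intro mult_left_mono) auto
        then have "- (\<delta> * Qb b) * \<bar>t T + x * v T\<bar> \<le> \<delta> * Qb b * \<bar>v T\<bar> + - (\<delta> * Qb b) * \<bar>t T\<bar>" by (simp add: right_diff_distrib)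
        then have "exp (- (\<delta> * Qb b) * \<bar>t T + x * v T\<bar>) \<le> exp (\<delta> * Qb b * \<bar>v T\<bar>) * exp (- (\<delta> * Qb b) * \<bar>t T\<bar>)"
          unfolding exp_add[symmetric] by simp
        then show "C * exp (- (\<delta> * Qb b) * \<bar>t T + x * v T\<bar>) \<le> C * exp (\<delta> * Qb b * \<bar>v T\<bar>) * exp (- (\<delta> * Qb b) * \<bar>t T\<bar>)"
          unfolding mult.assoc[of C] using C(1) by (rule mult_left_mono)
      qed (use C(1) in auto)
      finally show ?thesis .
    qed
    show "integrable ?M B" unfolding B_def
      by (intro integrable_mult_right product_integrable_prod integrable_exp_abs cq) auto
    show "(\<integral>t. F t (Complex x y) \<partial>?M) = (\<integral>t. F t (Complex 0 y) \<partial>?M)" if "x \<in> {0..1}" "y \<in> {0..1}" for x y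
    proof -
      have "F t (Complex x y) = F (\<lambda>T. t T + x * v T) (Complex 0 y)" for t
        unfolding F_def YP by simp
      then have "(\<integral>t. F t (Complex x y) \<partial>?M) = (\<integral>t. F (\<lambda>T. t T + x * v T) (Complex 0 y) \<partial>?M)" by simp
      also have "\<dots> = (\<integral>t. F t (Complex 0 y) \<partial>?M)"
        by (rule PiM_translate_integral[OF _ Fm[OF that(2)] Fcong]) auto
      finally show ?thesis .
    qed
  qed
  have J: "J_contour_integral b n \<gamma> = (\<integral>t. F t \<zeta> \<partial>?M)" if "(\<gamma>, \<zeta>) \<in> {(\<alpha>, 0), (\<beta>, \<i>)}" for \<gamma> \<zeta>
    unfolding J_contour_integral_def n[symmetric]
  proof (intro Bochner_Integration.integral_cong refl)
    fix t :: "tet \<Rightarrow> real"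
    show "J_integrand b p (J_contour_point b \<gamma> t) = F t \<zeta>"
      unfolding F_def
      by (rule J_integrand_cong) (use that in \<open>auto simp: J_contour_point_eq[OF b] J_point_def Y_def D_def v_def complex_eq_iff\<close>)
  qed
  show ?thesis using J[of \<alpha> 0] J[of \<beta> \<i>] shift by simp
qed

text \<open>
  Countability makes the function space of angle assignments first countable, so that limits in it
  can be taken along sequences.
\<close>

instance tet :: countable by countable_datatype

section \<open>The limit of the partition functions\<close>

lemma tet_factor_integrable_bounded:
  assumes b: "b > 0" and s: "s \<in> {1, -1 :: int}" and ac: "0 < a" "0 < c" "a + c < pi"
  obtains H where "integrable lborel (tet_factor b s a c)" "\<And>t. norm (tet_factor b s a c t) \<le> H" "0 \<le> H"
proof -
  define \<delta> where "\<delta> = min a (min c (pi - a - c))"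
  have \<delta>: "\<delta> > 0" "\<delta> \<le> a" "\<delta> \<le> c" "a + c \<le> pi - \<delta>" using ac by (auto simp: \<delta>_def)
  obtain C where C: "C \<ge> 0" "\<And>t. norm (tet_factor b s a c t) \<le> C * exp (- (\<delta> * Qb b) * \<bar>t\<bar>)"
    using tet_factor_bound[OF b \<delta>(1) s] \<delta> by metis
  have cq: "\<delta> * Qb b > 0" using \<delta>(1) Qb_pos[OF b] by simp
  show ?thesis
  proof (rule that)
    show "integrable lborel (tet_factor b s a c)"
    proof (rule Bochner_Integration.integrable_bound)
      show "integrable lborel (\<lambda>t. C * exp (- (\<delta> * Qb b) * \<bar>t\<bar>))" by (intro integrable_mult_right integrable_exp_abs cq)
      have "continuous_on UNIV (tet_factor b s a c)" using ac by (intro tet_factor_continuous b s) auto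
      then show "tet_factor b s a c \<in> borel_measurable lborel" by (simp add: borel_measurable_continuous_onI)
      show "AE t in lborel. norm (tet_factor b s a c t) \<le> norm (C * exp (- (\<delta> * Qb b) * \<bar>t\<bar>))"
        using order_trans[OF C(2) abs_ge_self] by (intro AE_I2) (simp only: real_norm_def)
    qed
    show "norm (tet_factor b s a c t) \<le> C" for t
    proof -
      have "C * exp (- (\<delta> * Qb b) * \<bar>t\<bar>) \<le> C * 1" using C(1) cq by (intro mult_left_mono) auto
      then show ?thesis using C(2)[of t] by simp
    qed
  qed (rule C(1))
qed

lemma J_factor_measurable:
  assumes b: "b > 0" and \<alpha>: "\<And>T. T \<in> Y_tets p - {TZ} \<Longrightarrow> \<alpha> T \<in> open_triples"
  shows "J_factor b p \<alpha> \<in> borel_measurable (lborel_prod (J_index p))"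
proof -
  have mc: "(\<lambda>w. w T) \<in> borel_measurable (lborel_prod (J_index p))" if "T \<in> J_index p" for T
    using that by (rule measurable_coord)
  have "J_quad p \<in> borel_measurable (lborel_prod (J_index p))"
    unfolding J_quad_def[abs_def] by (intro borel_measurable_sum borel_measurable_times mc borel_measurable_const)
  then have mR: "(\<lambda>w. complex_of_real (J_quad p w)) \<in> borel_measurable (lborel_prod (J_index p))" by simp
  have mt: "(\<lambda>w. tet_factor b (twist_sign T) (ang_a \<alpha> T) (ang_c \<alpha> T) (w T')) \<in> borel_measurable (lborel_prod (J_index p))"
    if "T \<in> Y_tets p - {TZ}" "T' \<in> J_index p" for T T'
  proof (rule measurable_compose[OF mc[OF that(2)] borel_measurable_continuous_onI[OF tet_factor_continuous]])
    show "0 < ang_a \<alpha> T" "ang_a \<alpha> T < 2 * pi" using open_triples_angles[of \<alpha>, OF \<alpha>[OF that(1)]] by auto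
  qed (rule b, rule twist_sign_cases)
  show ?thesis unfolding J_factor_def[abs_def]
    by (intro borel_measurable_times borel_measurable_prod measurable_compose[OF _ borel_measurable_exp] mR borel_measurable_const mt)
       (use J_tets in auto)
qed

text \<open>
  The factor of \<open>Z\<close> is evaluated at \<open>t\<^sub>Z = 0\<close>, where it is the inverse of the prefactor, since the weight
  of the knot edge is \<open>a\<^sub>Z\<close>.
\<close>

lemma partition_function_twist_Y:
  assumes b: "b > 0" and p: "p = twist_p n" and \<alpha>: "\<alpha> \<in> shape_structures (twist_Y n)"
  shows "qdilog b (of_real (pi - weight \<alpha> (twist_knot_edge n)) / (2 * of_real pi * \<i> * of_real (sqrt (hbar b)))) *
            partition_function b (twist_Y n) \<alpha> = (\<integral>t. J_factor b p \<alpha> t \<partial>lborel_prod (J_index p))"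
proof -
  let ?h = "\<lambda>T. tet_factor b (twist_sign T) (ang_a \<alpha> T) (ang_c \<alpha> T)"
  have op: "\<alpha> T \<in> open_triples" if "T \<in> Y_tets p" for T
    using \<alpha> that by (auto simp: shape_structures_def tets_twist_Y p)
  note ang = open_triples_angles[of \<alpha>, OF op]
  have "\<exists>H. integrable lborel (?h T) \<and> (\<forall>t. norm (?h T t) \<le> H) \<and> 0 \<le> H" if T: "T \<in> Y_tets p" for T
    using tet_factor_integrable_bounded[OF b twist_sign_cases ang(1)[OF T] ang(3)[OF T] ang(5)[OF T]] by metis
  then obtain H where H: "\<And>T. T \<in> Y_tets p \<Longrightarrow> integrable lborel (?h T)" "\<And>T t. T \<in> Y_tets p \<Longrightarrow> norm (?h T t) \<le> H T" "\<And>T. T \<in> Y_tets p \<Longrightarrow> 0 \<le> H T"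
    by metis
  have cont: "continuous_on UNIV (?h T)" if "T \<in> Y_tets p" for T
    using ang(1)[OF that] ang(6)[OF that] by (intro tet_factor_continuous b twist_sign_cases) auto
  have bd: "norm (?h T t) \<le> (\<Sum>T\<in>Y_tets p. H T)" if "T \<in> Y_tets p" for T t
    using H(2)[OF that, of t] member_le_sum[of T "Y_tets p" H] that H(3) by force
  have "partition_function b (twist_Y n) \<alpha> = ?h TZ 0 * (\<integral>t. J_factor b p \<alpha> t \<partial>lborel_prod (J_index p))"
    unfolding partition_function_def dynamical_content_twist_Y J_factor_def p[symmetric]
    by (rule kinematical_kernel_twist_Y[OF p cont H(1) bd])
  moreover have "qdilog b (of_real (pi - weight \<alpha> (twist_knot_edge n)) / (2 * of_real pi * \<i> * of_real (sqrt (hbar b)))) * ?h TZ 0 = 1"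
  proof -
    have TZ: "TZ \<in> Y_tets p" by (simp add: Y_tets_def)
    let ?z = "Complex 0 (- real_of_int 1 * ((pi - ang_a \<alpha> TZ) * Qb b / (2 * pi)))"
    have "of_real r / (2 * of_real pi * \<i> * of_real (1 / q)) = Complex 0 (- real_of_int 1 * (r * q / (2 * pi)))" for r q :: real
      by (cases "q = 0") (simp_all add: complex_eq_iff Re_divide Im_divide power2_eq_square field_simps)
    then have "of_real (pi - weight \<alpha> (twist_knot_edge n)) / (2 * of_real pi * \<i> * of_real (sqrt (hbar b))) = ?z"
      unfolding weight_twist_knot_edge sqrt_hbar[OF b] .
    moreover have "qdilog b ?z \<noteq> 0"
      using strip_height[OF b ang(1)[OF TZ], of 1] ang(6)[OF TZ] pi_gt_zero by (intro qdilog_nonzero b) simp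
    ultimately show ?thesis by (simp add: tet_factor_alt[OF b])
  qed
  ultimately show ?thesis by (simp add: mult.assoc[symmetric])
qed

lemma tendsto_angles:
  fixes X :: "nat \<Rightarrow> tet angles"
  assumes "X \<longlonglongrightarrow> \<tau>"
  shows "(\<lambda>i. ang_a (X i) T) \<longlonglongrightarrow> ang_a \<tau> T" "(\<lambda>i. ang_c (X i) T) \<longlonglongrightarrow> ang_c \<tau> T"
proof -
  have "(\<lambda>i. X i T) \<longlonglongrightarrow> \<tau> T"
    by (rule continuous_on_tendsto_compose[OF continuous_on_product_coordinates assms]) auto
  then show "(\<lambda>i. ang_a (X i) T) \<longlonglongrightarrow> ang_a \<tau> T" "(\<lambda>i. ang_c (X i) T) \<longlonglongrightarrow> ang_c \<tau> T"
    unfolding ang_a_def ang_c_def by (auto intro: tendsto_intros)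
qed

text \<open>
  The angles of \<open>Z\<close> are absent from the integrand, so that \<open>\<tau>\<close> may be degenerate there. Half of the margin of
  \<open>\<tau>\<close> is eventually available for all \<open>X i\<close> and yields a common dominating function.
\<close>

lemma J_factor_integral_tendsto:
  assumes b: "b > 0" and X: "X \<longlonglongrightarrow> \<tau>"
    and \<tau>: "\<And>T. T \<in> Y_tets p - {TZ} \<Longrightarrow> \<tau> T \<in> open_triples"
    and Xo: "\<And>i T. T \<in> Y_tets p - {TZ} \<Longrightarrow> X i T \<in> open_triples"
  shows "(\<lambda>i. \<integral>t. J_factor b p (X i) t \<partial>lborel_prod (J_index p)) \<longlonglongrightarrow> (\<integral>t. J_factor b p \<tau> t \<partial>lborel_prod (J_index p))"
proof -
  interpret product_sigma_finite "\<lambda>_ :: tet. lborel :: real measure" by (rule product_sigma_finite_lborel)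
  let ?M = "lborel_prod (J_index p)"
  obtain d where d: "d > 0" "angle_margin p d \<tau>" using exists_angle_margin[of p \<tau>] \<tau> by blast
  define \<delta> where "\<delta> = d / 2"
  have \<delta>: "0 < \<delta>" "\<delta> < d" using d by (auto simp: \<delta>_def)
  note lim = tendsto_angles[OF X]
  have "eventually (\<lambda>i. \<forall>T\<in>Y_tets p - {TZ}. \<delta> \<le> ang_a (X i) T \<and> \<delta> \<le> ang_c (X i) T \<and> ang_a (X i) T + ang_c (X i) T \<le> pi - \<delta>) sequentially"
  proof (rule eventually_ball_finite)
    show "\<forall>T\<in>Y_tets p - {TZ}. eventually (\<lambda>i. \<delta> \<le> ang_a (X i) T \<and> \<delta> \<le> ang_c (X i) T \<and> ang_a (X i) T + ang_c (X i) T \<le> pi - \<delta>) sequentially"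
    proof
      fix T assume "T \<in> Y_tets p - {TZ}"
      then have m: "\<delta> < ang_a \<tau> T" "\<delta> < ang_c \<tau> T" "ang_a \<tau> T + ang_c \<tau> T < pi - \<delta>" using d(2) \<delta> by (force simp: angle_margin_def)+
      show "eventually (\<lambda>i. \<delta> \<le> ang_a (X i) T \<and> \<delta> \<le> ang_c (X i) T \<and> ang_a (X i) T + ang_c (X i) T \<le> pi - \<delta>) sequentially"
        using order_tendstoD(1)[OF lim(1) m(1)] order_tendstoD(1)[OF lim(2) m(2)] order_tendstoD(2)[OF tendsto_add[OF lim(1) lim(2)] m(3)]
        by eventually_elim auto
    qed
  qed simp
  then obtain N where N: "\<And>i. i \<ge> N \<Longrightarrow> angle_margin p \<delta> (X i)"
    unfolding eventually_sequentially angle_margin_def by blast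
  obtain C where C: "C \<ge> 0" "\<And>\<alpha> x. angle_margin p \<delta> \<alpha> \<Longrightarrow> norm (J_factor b p \<alpha> x) \<le> C * (\<Prod>T\<in>J_index p. C * exp (- (\<delta> * Qb b) * \<bar>x T\<bar>))"
    using J_factor_bound[OF b \<delta>(1)] by blast
  have "(\<lambda>i. \<integral>t. J_factor b p (X (i + N)) t \<partial>?M) \<longlonglongrightarrow> (\<integral>t. J_factor b p \<tau> t \<partial>?M)"
  proof (rule integral_dominated_convergence[where w = "\<lambda>x. C * (\<Prod>T\<in>J_index p. C * exp (- (\<delta> * Qb b) * \<bar>x T\<bar>))"])
    show "J_factor b p \<tau> \<in> borel_measurable ?M" by (rule J_factor_measurable[OF b \<tau>])
    show "J_factor b p (X (i + N)) \<in> borel_measurable ?M" for i by (rule J_factor_measurable[OF b Xo])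
    show "integrable ?M (\<lambda>x. C * (\<Prod>T\<in>J_index p. C * exp (- (\<delta> * Qb b) * \<bar>x T\<bar>)))"
      using \<delta>(1) Qb_pos[OF b] by (intro integrable_mult_right product_integrable_prod integrable_exp_abs) auto
    show "AE x in ?M. norm (J_factor b p (X (i + N)) x) \<le> C * (\<Prod>T\<in>J_index p. C * exp (- (\<delta> * Qb b) * \<bar>x T\<bar>))" for i
      by (intro AE_I2 C(2) N) simp
    show "AE x in ?M. (\<lambda>i. J_factor b p (X (i + N)) x) \<longlonglongrightarrow> J_factor b p \<tau> x"
    proof (rule AE_I2)
      fix x :: "tet \<Rightarrow> real"
      have t: "(\<lambda>i. tet_factor b (twist_sign T) (ang_a (X (i + N)) T) (ang_c (X (i + N)) T) y) \<longlonglongrightarrow> tet_factor b (twist_sign T) (ang_a \<tau> T) (ang_c \<tau> T) y"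
        if "T \<in> Y_tets p - {TZ}" for T y
      proof (rule tendsto_tet_factor[OF b twist_sign_cases _ _ _ _ tendsto_const])
        show "0 < ang_a \<tau> T" "ang_a \<tau> T < 2 * pi"
          using open_triples_angles(1,6)[of \<tau>, OF \<tau>[OF that]] by auto
        show "(\<lambda>i. ang_a (X (i + N)) T) \<longlonglongrightarrow> ang_a \<tau> T" by (rule LIMSEQ_ignore_initial_segment[OF lim(1)])
        show "(\<lambda>i. ang_c (X (i + N)) T) \<longlonglongrightarrow> ang_c \<tau> T" by (rule LIMSEQ_ignore_initial_segment[OF lim(2)])
      qed
      show "(\<lambda>i. J_factor b p (X (i + N)) x) \<longlonglongrightarrow> J_factor b p \<tau> x"
        unfolding J_factor_def using J_tets by (intro tendsto_mult tendsto_const tendsto_prod t) auto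
    qed
  qed
  then show ?thesis by (rule LIMSEQ_offset)
qed

theorem theorem6p1:
  fixes n :: nat and b :: real and \<tau> :: "tet angles"
  assumes "n \<ge> 3" and "odd n"
    and "b > 0"
    and "\<tau> \<in> Z_closed_shapes n"
    and "weight \<tau> (twist_knot_edge n) = 0"
    and "\<forall>e\<in>edges (twist_Y n) - {twist_knot_edge n}. weight \<tau> e = 2 * pi"
  shows "\<exists>L. ((\<lambda>\<alpha>. qdilog b (of_real (pi - weight \<alpha> (twist_knot_edge n)) /
                             (2 * of_real pi * \<i> * of_real (sqrt (hbar b)))) *
                partition_function b (twist_Y n) \<alpha>) \<longlongrightarrow> L) (at \<tau> within shape_structures (twist_Y n))
             \<and> cmod L = cmod (J_value b n)"
proof -
  define p where "p = twist_p n"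
  let ?M = "lborel_prod (J_index p)"
  let ?L = "\<integral>t. J_factor b p \<tau> t \<partial>?M"
  note b = \<open>b > 0\<close>
  have \<tau>o: "\<tau> T \<in> open_triples" if "T \<in> Y_tets p - {TZ}" for T
    using assms(4) that unfolding Z_closed_shapes_def tets_twist_Y p_def[symmetric] by (auto simp: PiE_iff)
  have \<tau>Z: "\<tau> TZ \<in> closed_triples"
    using assms(4) unfolding Z_closed_shapes_def tets_twist_Y p_def[symmetric] by (auto simp: PiE_iff Y_tets_def)
  have sumZ: "ang_a \<tau> TZ + ang_b \<tau> TZ + ang_c \<tau> TZ = pi"
    using \<tau>Z by (auto simp: closed_triples_def ang_a_def ang_b_def ang_c_def)
  note bal = balanced_twist_Y[OF p_def assms(5,6) sumZ]
  have sums: "tet_angles_sum p \<tau>"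
    using open_triples_angles(4)[of \<tau>, OF \<tau>o] by (simp add: tet_angles_sum_def)
  have UV: "ang_a \<tau> TU = ang_a \<tau> TV" by (rule balanced_Y_angles[OF sums bal(1,2)])
  \<comment> \<open>Shape structures are extensional, so the value of \<open>\<tau>\<close> at \<open>Z\<close> has to be erased.\<close>
  define \<beta> where "\<beta> = restrict \<tau> (tets (twist_X n))"
  have \<beta>: "\<beta> T = \<tau> T" if "T \<in> Y_tets p - {TZ}" for T using that by (simp add: \<beta>_def tets_twist_X p_def)
  have ang\<beta>: "ang_a \<beta> T = ang_a \<tau> T" "ang_b \<beta> T = ang_b \<tau> T" "ang_c \<beta> T = ang_c \<tau> T" if "T \<in> Y_tets p - {TZ}" for T
    using \<beta>[OF that] by (simp_all add: ang_a_def ang_b_def ang_c_def)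
  have \<beta>UV: "ang_a \<beta> TU = ang_a \<beta> TV" using UV ang\<beta> J_tets by (metis subsetD)
  have lw: "label_weight \<beta> p l = label_weight \<tau> p l" for l
    unfolding label_weight_def tet_weight_def
    by (intro sum.cong refl if_cong) (auto simp: dihedral_def ang\<beta> split: prod.splits)
  have \<beta>A: "\<beta> \<in> angle_structures (twist_X n)"
    unfolding angle_structures_twist_X[OF p_def]
  proof
    show "\<beta> \<in> shape_structures (twist_X n)"
      unfolding shape_structures_def \<beta>_def using \<tau>o by (auto simp: tets_twist_X p_def)
    show "balanced_X p \<beta>" using bal(1) by (simp add: balanced_X_def lw)
  qed
  have J_value: "J_value b n = J_contour_integral b n \<beta>"
    unfolding J_value_def
  proof (rule the_equality)
    show "\<forall>\<gamma>\<in>angle_structures (twist_X n). ang_a \<gamma> TU = ang_a \<gamma> TV \<longrightarrow> J_contour_integral b n \<beta> = J_contour_integral b n \<gamma>"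
      using J_contour_integral_independent[OF b p_def \<beta>A \<beta>UV] by blast
  qed (use \<beta>A \<beta>UV in blast)
  have comp: "J_compatible p \<beta>"
  proof (rule balanced_imp_J_compatible[OF _ _ \<beta>UV])
    show "tet_angles_sum p \<beta>" using sums ang\<beta> by (simp add: tet_angles_sum_def)
    show "balanced_X p \<beta>" using bal(1) by (simp add: balanced_X_def lw)
  qed
  have fac: "J_factor b p \<beta> x = J_factor b p \<tau> x" for x
    unfolding J_factor_def using J_tets by (intro arg_cong2[of _ _ _ _ "(*)"] refl prod.cong) (auto simp: ang\<beta> subset_iff)
  have modulus: "cmod (J_value b n) = cmod ?L"
  proof -
    let ?d = "J_height b \<beta>"
    let ?ph = "exp (\<i> * of_real (Qb b * (\<Sum>k\<in>J_index p. ?d k * J_W p k) - 2 * pi * J_quad p ?d))"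
    have "J_integrand b p (J_contour_point b \<beta> x) = ?ph * J_factor b p \<tau> x" for x
    proof -
      have "J_integrand b p (J_contour_point b \<beta> x) = J_integrand b p (J_point x ?d)"
        by (rule J_integrand_cong) (rule J_contour_point_eq[OF b])
      then show ?thesis using J_integrand_contour[OF b comp \<beta>UV, of x] fac by simp
    qed
    then have "J_contour_integral b n \<beta> = ?ph * ?L"
      unfolding J_contour_integral_def p_def[symmetric] by simp
    then show ?thesis unfolding J_value by (simp only: norm_mult norm_exp_i_times mult_1)
  qed
  have limit: "((\<lambda>\<alpha>. qdilog b (of_real (pi - weight \<alpha> (twist_knot_edge n)) / (2 * of_real pi * \<i> * of_real (sqrt (hbar b)))) *
                partition_function b (twist_Y n) \<alpha>) \<longlongrightarrow> ?L) (at \<tau> within shape_structures (twist_Y n))"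
    unfolding tendsto_at_iff_sequentially comp_def
  proof (intro allI impI)
    fix X assume X: "\<forall>i. X i \<in> shape_structures (twist_Y n) - {\<tau>}" "X \<longlonglongrightarrow> \<tau>"
    then have Xs: "X i \<in> shape_structures (twist_Y n)" for i by blast
    have Xo: "X i T \<in> open_triples" if "T \<in> Y_tets p - {TZ}" for i T
      using Xs[of i] that by (auto simp: shape_structures_def tets_twist_Y p_def)
    show "(\<lambda>i. qdilog b (of_real (pi - weight (X i) (twist_knot_edge n)) / (2 * of_real pi * \<i> * of_real (sqrt (hbar b)))) *
                partition_function b (twist_Y n) (X i)) \<longlonglongrightarrow> ?L"
      unfolding partition_function_twist_Y[OF b p_def Xs] by (rule J_factor_integral_tendsto[OF b X(2) \<tau>o Xo])
  qed
  show ?thesis by (intro exI[of _ ?L] conjI limit modulus[symmetric])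
qed

end
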